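(* Let $r=3$ and $h(V)=\frac12\|V\|_{\mathbb U}^2$. Let $(u^*,U^* )\in\mathscr A_{\mathrm{ad}}$ be a feasible pair, let $p$ be the weak solution of the adjoint system associated with $u^*$, and assume that the first order necessary condition $$U^*(t)=-D^*p(t)\quad\text{for a.e. }t\in[0,T]$$ holds. Assume also that for any $(u,U)\in\mathcal M_{u^*,U^*}$, $$\frac12\int_0^T\left(\|u(t)\|_{\mathbb H}^2+\|\nabla u(t)\|_{\mathbb H}^2+\|U(t)\|_{\mathbb U}^2\right)dt+\frac12\|u(T)\|_{\mathbb H}^2-\int_0^T\langle B(u(t),u(t)),p(t)\rangle dt$$ $$-\beta\int_0^T\left\langle2(u^*(t)\cdot u(t))u(t)+|u(t)|^2(u(t)+u^*(t)),p(t)\right\rangle dt\ \ge0.$$ Then $(u^*,U^* )$ is an optimal pair, i.e. it minimizes $\mathscr J$ over $\mathscr A_{\mathrm{ad}}$.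
   Context: Setting. $\mathcal O\subset\mathbb R^2$ is a bounded domain with smooth boundary, $T>0$, $\mu,\alpha,\beta>0$ and $r=3$. Let $\mathcal V=\{u\in C_0^\infty(\mathcal O;\mathbb R^2):\nabla\cdot u=0\}$; $\mathbb H$, $\mathbb V$, $\widetilde{\mathbb L}^4$ are the closures of $\mathcal V$ in $L^2(\mathcal O;\mathbb R^2)$, $H^1_0(\mathcal O;\mathbb R^2)$, $L^4(\mathcal O;\mathbb R^2)$, with $\|u\|_{\mathbb H}^2=\int_{\mathcal O}|u|^2dx$, $\|u\|_{\mathbb V}^2=\int_{\mathcal O}|\nabla u|^2dx$, $\|u\|_{\widetilde{\mathbb L}^4}^4=\int_{\mathcal O}|u|^4dx$. $(\cdot,\cdot)$ is the inner product of $\mathbb H$; $\mathbb H$ is identified with its dual, $\mathbb V\subset\mathbb H\subset\mathbb V'$, and $\langle\cdot,\cdot\rangle$ is the induced duality (between $\mathbb V'$ and $\mathbb V$, and between $L^{4/3}$ and $L^4$). $\mathcal P$ is the Helmholtz–Hodge projection onto divergence-free fields. $A:\mathbb V\to\mathbb V'$ is $\langle Au,v\rangle=\int_{\mathcal O}\nabla u:\nabla v\,dx$ (so $A=-\mathcal P\Delta$; for $u\in\mathbb V$, $-\Delta u\in\mathbb V'$ denotes the same functional); $B(u,v)\in\mathbb V'$ is $\langle B(u,v),w\rangle=\int_{\mathcal O}(u\cdot\nabla)v\cdot w\,dx$, $B(u)=B(u,u)$, $B'(u)w=B(u,w)+B(w,u)$, $\langle(B'(u))^*p,q\rangle=\langle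 B(u,q),p\rangle+\langle B(q,u),p\rangle$. $\mathcal C(u)=\mathcal P(|u|^2u)$, $\mathcal C'(u)v=\mathcal P(|u|^2v+2u(u\cdot v))$. Controls. $\mathbb U$ is a separable Hilbert space identified with its dual, $D\in\mathcal L(\mathbb U,\mathbb V')$ (bounded linear) with adjoint $D^*:\mathbb V\to\mathbb U$. State system, for given $u_0\in\mathbb H$, $f\in L^2(0,T;\mathbb V')$: $\partial_tu+\mu Au+B(u)+\alpha u+\beta\mathcal C(u)=f+DU$ in $\mathbb V'$ for a.e. $t\in[0,T]$, $u(0)=u_0$. A weak solution is $u\in L^\infty(0,T;\mathbb H)\cap L^2(0,T;\mathbb V)$ with $\partial_tu\in L^{4/3}(0,T;\mathbb V')$, satisfying the equation tested against every $v\in\mathbb V$, $\lim_{t\downarrow0}(u(t),v)=(u_0,v)$ for $v\in\mathbb V$, and the energy equality $\|u(t)\|_{\mathbb H}^2+2\mu\int_0^t\|u\|_{\mathbb V}^2ds+2\alpha\int_0^t\|u\|_{\mathbb H}^2ds+2\beta\int_0^t\|u\|_{\widetilde{\mathbb L}^4}^4ds=\|u_0\|_{\mathbb H}^2+2\int_0^t\langle f,u\rangle ds+2\int_0^t\langle DU,u\rangle ds$ for all $t\in[0,T]$. For each $U\in L^2(0,T;\mathbb U)$ it is known that there is a unique weak solution, and it lies in $C([0,T];\mathbb H)\cap L^2(0,T;\mathbb V)$. Admissible class: $\mathscr A_{\mathrm{ad}}$ (also written $\mathcal A_{\mathrm{ad}}$) is the set of pairs $(u,U)$ with $U\in L^2(0,T;\mathbb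 U)$ and $u$ the unique weak solution of the state system with control $U$; its elements are called feasible pairs. For a feasible pair $(\hat u,\hat U)$, $\mathcal M_{\hat u,\hat U}=\{(z-\hat u,W-\hat U):(z,W)\in\mathscr A_{\mathrm{ad}}\}$. Cost: given $u_d\in L^2(0,T;\mathbb H)$, $u^f\in\mathbb H$, $$\mathscr J(u,U)=\tfrac12\int_0^T\|u(t)-u_d(t)\|_{\mathbb H}^2dt+\tfrac12\int_0^T\|\nabla u(t)\|_{\mathbb H}^2dt+\tfrac12\int_0^T\|U(t)\|_{\mathbb U}^2dt+\tfrac12\|u(T)-u^f\|_{\mathbb H}^2.$$ Adjoint system associated with $u^*$: $-\partial_tp+\mu Ap+(B'(u^* ))^*p+\alpha p+\beta\mathcal C'(u^* )p=(u^*-u_d)-\Delta u^*$ in $\mathbb V'$ for a.e. $t\in[0,T]$, $p(T)=u^*(T)-u^f$; its weak solution $p\in C([0,T];\mathbb H)\cap L^2(0,T;\mathbb V)$, with $\partial_tp\in L^{4/3}(0,T;\mathbb V')$, is unique. *)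

theory Defs
  imports "HOL-Analysis.Analysis"
begin

text \<open>
  Conventions.  The domain \<open>\<Omega>\<close> is a parameter, so the function spaces over it are sets of
  representatives: a field is a function on the whole plane of which only the values almost everywhere
  on \<open>\<Omega>\<close> matter, and the norms below are seminorms on such representatives.  Elements of the
  dual of \<open>\<V>\<close> are real functionals on fields of which only the values on \<open>\<V>\<close> matter.
\<close>

type_synonym field = "real^2 \<Rightarrow> real^2"
type_synonym functional = "field \<Rightarrow> real"

section \<open>Smooth functions and smooth domains\<close>

primrec C_diff :: "nat \<Rightarrow> ('a::euclidean_space \<Rightarrow> 'b::real_normed_vector) \<Rightarrow> bool" where
  "C_diff 0 f \<longleftrightarrow> continuous_on UNIV f"
| "C_diff (Suc k) f \<longleftrightarrow>
     f differentiable_on UNIV \<and> (\<forall>v. C_diff k (\<lambda>x. frechet_derivative f (at x) v))"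

definition smooth :: "('a::euclidean_space \<Rightarrow> 'b::real_normed_vector) \<Rightarrow> bool" where
  "smooth f \<longleftrightarrow> (\<forall>k. C_diff k f)"

text \<open>Near each boundary point the domain is, up to an orthogonal change of coordinates, the
  region above the graph of a smooth function.\<close>

definition smooth_bounded_domain :: "(real^2) set \<Rightarrow> bool" where
  "smooth_bounded_domain \<Omega> \<longleftrightarrow>
     open \<Omega> \<and> connected \<Omega> \<and> bounded \<Omega> \<and> \<Omega> \<noteq> {} \<and>
     (\<forall>x0\<in>frontier \<Omega>. \<exists>r>0. \<exists>(R :: real^2 \<Rightarrow> real^2) (\<gamma> :: real \<Rightarrow> real).
        orthogonal_transformation R \<and> smooth \<gamma> \<and>
        \<Omega> \<inter> ball x0 r = {x \<in> ball x0 r. R x $ 2 > \<gamma> (R x $ 1)})"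

definition test_funs :: "'a::euclidean_space set \<Rightarrow> ('a \<Rightarrow> 'b::real_normed_vector) set" where
  "test_funs S = {\<phi>. smooth \<phi> \<and> compact (closure {x. \<phi> x \<noteq> 0}) \<and> closure {x. \<phi> x \<noteq> 0} \<subseteq> S}"

definition divergence :: "field \<Rightarrow> real^2 \<Rightarrow> real" where
  "divergence \<phi> x = (\<Sum>i\<in>UNIV. frechet_derivative \<phi> (at x) (axis i 1) $ i)"

definition div_free_tests :: "(real^2) set \<Rightarrow> field set" where
  "div_free_tests \<Omega> = {\<phi> \<in> test_funs \<Omega>. \<forall>x. divergence \<phi> x = 0}"

section \<open>Function spaces over the domain\<close>

definition Lspace :: "(real^2) set \<Rightarrow> nat \<Rightarrow> (real^2 \<Rightarrow> 'b::euclidean_space) set" where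
  "Lspace \<Omega> q = {g \<in> borel_measurable (lebesgue_on \<Omega>).
     integrable (lebesgue_on \<Omega>) (\<lambda>x. norm (g x) ^ q)}"

definition Lnorm :: "(real^2) set \<Rightarrow> nat \<Rightarrow> (real^2 \<Rightarrow> 'b::euclidean_space) \<Rightarrow> real" where
  "Lnorm \<Omega> q g = root q (LINT x|lebesgue_on \<Omega>. norm (g x) ^ q)"

text \<open>Also used for the pairing of \<open>L\<close>-\<open>4/3\<close> with \<open>L\<close>-\<open>4\<close>.  On matrix fields the inner product
  of \<^typ>\<open>real^2^2\<close> is the Frobenius one.\<close>

definition pairing :: "(real^2) set \<Rightarrow> (real^2 \<Rightarrow> 'b::euclidean_space) \<Rightarrow> (real^2 \<Rightarrow> 'b) \<Rightarrow> real" where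
  "pairing \<Omega> g h = (LINT x|lebesgue_on \<Omega>. g x \<bullet> h x)"

text \<open>Row \<open>i\<close>, column \<open>j\<close> of the gradient is the \<open>j\<close>-th weak partial derivative of component \<open>i\<close>.\<close>

definition is_weak_grad :: "(real^2) set \<Rightarrow> field \<Rightarrow> (real^2 \<Rightarrow> real^2^2) \<Rightarrow> bool" where
  "is_weak_grad \<Omega> u G \<longleftrightarrow> G \<in> Lspace \<Omega> 2 \<and>
     (\<forall>\<phi>\<in>test_funs \<Omega>. \<forall>i j.
        (LINT x|lebesgue_on \<Omega>. u x $ i * frechet_derivative \<phi> (at x) (axis j 1))
        = - (LINT x|lebesgue_on \<Omega>. G x $ i $ j * \<phi> x))"

definition grad :: "(real^2) set \<Rightarrow> field \<Rightarrow> real^2 \<Rightarrow> real^2^2" where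
  "grad \<Omega> u = (SOME G. is_weak_grad \<Omega> u G)"

definition H1 :: "(real^2) set \<Rightarrow> field set" where
  "H1 \<Omega> = {u \<in> Lspace \<Omega> 2. \<exists>G. is_weak_grad \<Omega> u G}"

definition H1_norm :: "(real^2) set \<Rightarrow> field \<Rightarrow> real" where
  "H1_norm \<Omega> u = sqrt (Lnorm \<Omega> 2 u ^ 2 + Lnorm \<Omega> 2 (grad \<Omega> u) ^ 2)"

definition closure_in ::
    "('c \<Rightarrow> 'd::real_vector) set \<Rightarrow> (('c \<Rightarrow> 'd) \<Rightarrow> real) \<Rightarrow> ('c \<Rightarrow> 'd) set \<Rightarrow> ('c \<Rightarrow> 'd) set" where
  "closure_in X N S = {u \<in> X. \<forall>\<epsilon>>0. \<exists>\<phi>\<in>S. N (\<lambda>x. u x - \<phi> x) < \<epsilon>}"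

definition H10 :: "(real^2) set \<Rightarrow> field set" where
  "H10 \<Omega> = closure_in (H1 \<Omega>) (H1_norm \<Omega>) (test_funs \<Omega>)"

definition \<H> :: "(real^2) set \<Rightarrow> field set" where
  "\<H> \<Omega> = closure_in (Lspace \<Omega> 2) (Lnorm \<Omega> 2) (div_free_tests \<Omega>)"

definition \<V> :: "(real^2) set \<Rightarrow> field set" where
  "\<V> \<Omega> = closure_in (H10 \<Omega>) (H1_norm \<Omega>) (div_free_tests \<Omega>)"

abbreviation H_norm :: "(real^2) set \<Rightarrow> field \<Rightarrow> real" where
  "H_norm \<Omega> \<equiv> Lnorm \<Omega> 2"

definition V_norm :: "(real^2) set \<Rightarrow> field \<Rightarrow> real" where
  "V_norm \<Omega> u = Lnorm \<Omega> 2 (grad \<Omega> u)"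

definition V_dual :: "(real^2) set \<Rightarrow> functional set" where
  "V_dual \<Omega> = {F.
     (\<forall>v\<in>\<V> \<Omega>. \<forall>w\<in>\<V> \<Omega>. F (\<lambda>x. v x + w x) = F v + F w) \<and>
     (\<forall>c. \<forall>v\<in>\<V> \<Omega>. F (\<lambda>x. c *\<^sub>R v x) = c * F v) \<and>
     (\<exists>K. \<forall>v\<in>\<V> \<Omega>. \<bar>F v\<bar> \<le> K * V_norm \<Omega> v)}"

definition V_dual_norm :: "(real^2) set \<Rightarrow> functional \<Rightarrow> real" where
  "V_dual_norm \<Omega> F = (SUP v\<in>{v \<in> \<V> \<Omega>. V_norm \<Omega> v \<le> 1}. \<bar>F v\<bar>)"

section \<open>Operators\<close>

text \<open>The Helmholtz--Hodge projection as the orthogonal projection of the square integrable fields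
  onto \<open>\<H>\<close>.  It is applied only to cubic expressions in elements of \<open>\<V>\<close>, which are square
  integrable because \<open>\<V>\<close> embeds into \<open>L\<close>-\<open>6\<close> in two dimensions.\<close>

definition helmholtz :: "(real^2) set \<Rightarrow> field \<Rightarrow> field" where
  "helmholtz \<Omega> g = (SOME w. w \<in> \<H> \<Omega> \<and> (\<forall>v\<in>\<H> \<Omega>. pairing \<Omega> (\<lambda>x. g x - w x) v = 0))"

definition A_op :: "(real^2) set \<Rightarrow> field \<Rightarrow> functional" where
  "A_op \<Omega> u = (\<lambda>v. pairing \<Omega> (grad \<Omega> u) (grad \<Omega> v))"

definition B_op :: "(real^2) set \<Rightarrow> field \<Rightarrow> field \<Rightarrow> functional" where
  "B_op \<Omega> u v = (\<lambda>w. pairing \<Omega> (\<lambda>x. grad \<Omega> v x *v u x) w)"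

definition B'_adj :: "(real^2) set \<Rightarrow> field \<Rightarrow> field \<Rightarrow> functional" where
  "B'_adj \<Omega> u p = (\<lambda>q. B_op \<Omega> u q p + B_op \<Omega> q u p)"

definition C_op :: "(real^2) set \<Rightarrow> field \<Rightarrow> field" where
  "C_op \<Omega> u = helmholtz \<Omega> (\<lambda>x. (norm (u x))\<^sup>2 *\<^sub>R u x)"

definition C'_op :: "(real^2) set \<Rightarrow> field \<Rightarrow> field \<Rightarrow> field" where
  "C'_op \<Omega> u v = helmholtz \<Omega> (\<lambda>x. (norm (u x))\<^sup>2 *\<^sub>R v x + (2 * (u x \<bullet> v x)) *\<^sub>R u x)"

section \<open>Functions of time\<close>

definition strongly_measurable ::
    "real \<Rightarrow> ('c \<Rightarrow> 'd::real_vector) set \<Rightarrow> (('c \<Rightarrow> 'd) \<Rightarrow> real) \<Rightarrow> (real \<Rightarrow> 'c \<Rightarrow> 'd) \<Rightarrow> bool" where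
  "strongly_measurable T X N u \<longleftrightarrow> (\<exists>s :: nat \<Rightarrow> real \<Rightarrow> 'c \<Rightarrow> 'd.
     (\<forall>n. finite (s n ` {0..T}) \<and> s n ` {0..T} \<subseteq> X \<and>
          (\<forall>y. {t \<in> {0..T}. s n t = y} \<in> sets lebesgue)) \<and>
     (AE t in lebesgue_on {0..T}. (\<lambda>n. N (\<lambda>x. s n t x - u t x)) \<longlonglongrightarrow> 0))"

text \<open>The Bochner spaces \<open>L^q(0,T;X)\<close>, \<open>L^\<infinity>(0,T;X)\<close> and \<open>C([0,T];X)\<close> for a space of functions
  \<open>X\<close> with seminorm \<open>N\<close>.\<close>

definition bochner_L ::
    "real \<Rightarrow> real \<Rightarrow> ('c \<Rightarrow> 'd::real_vector) set \<Rightarrow> (('c \<Rightarrow> 'd) \<Rightarrow> real) \<Rightarrow> (real \<Rightarrow> 'c \<Rightarrow> 'd) set" where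
  "bochner_L q T X N = {u. strongly_measurable T X N u \<and>
     (AE t in lebesgue_on {0..T}. u t \<in> X) \<and>
     integrable (lebesgue_on {0..T}) (\<lambda>t. N (u t) powr q)}"

definition bochner_Linf ::
    "real \<Rightarrow> ('c \<Rightarrow> 'd::real_vector) set \<Rightarrow> (('c \<Rightarrow> 'd) \<Rightarrow> real) \<Rightarrow> (real \<Rightarrow> 'c \<Rightarrow> 'd) set" where
  "bochner_Linf T X N = {u. strongly_measurable T X N u \<and>
     (AE t in lebesgue_on {0..T}. u t \<in> X) \<and>
     (\<exists>K. AE t in lebesgue_on {0..T}. N (u t) \<le> K)}"

definition cont_in_time ::
    "real \<Rightarrow> ('c \<Rightarrow> 'd::real_vector) set \<Rightarrow> (('c \<Rightarrow> 'd) \<Rightarrow> real) \<Rightarrow> (real \<Rightarrow> 'c \<Rightarrow> 'd) set" where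
  "cont_in_time T X N = {u. \<forall>t\<in>{0..T}. u t \<in> X \<and>
     ((\<lambda>s. N (\<lambda>x. u s x - u t x)) \<longlongrightarrow> 0) (at t within {0..T})}"

definition controls_L2 :: "real \<Rightarrow> (real \<Rightarrow> 'u::{real_inner,polish_space}) set" where
  "controls_L2 T = {U \<in> borel_measurable (lebesgue_on {0..T}).
     integrable (lebesgue_on {0..T}) (\<lambda>t. (norm (U t))\<^sup>2)}"

text \<open>Distributional derivative on \<open>(0,T)\<close>, an identity in the dual of \<open>\<V>\<close>.\<close>

definition is_time_deriv ::
    "(real^2) set \<Rightarrow> real \<Rightarrow> (real \<Rightarrow> field) \<Rightarrow> (real \<Rightarrow> functional) \<Rightarrow> bool" where
  "is_time_deriv \<Omega> T u g \<longleftrightarrow> (\<forall>\<psi>\<in>test_funs {0<..<T}. \<forall>v\<in>\<V> \<Omega>.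
     (LINT t|lebesgue_on {0..T}. pairing \<Omega> (u t) v * deriv \<psi> t)
     = - (LINT t|lebesgue_on {0..T}. g t v * \<psi> t))"

section \<open>Control operator, state system, cost and adjoint system\<close>

definition control_operator ::
    "(real^2) set \<Rightarrow> ('u::{real_inner,polish_space} \<Rightarrow> functional) \<Rightarrow> bool" where
  "control_operator \<Omega> D \<longleftrightarrow>
     (\<forall>a. D a \<in> V_dual \<Omega>) \<and>
     (\<forall>a b. \<forall>v\<in>\<V> \<Omega>. D (a + b) v = D a v + D b v) \<and>
     (\<forall>c a. \<forall>v\<in>\<V> \<Omega>. D (c *\<^sub>R a) v = c * D a v) \<and>
     (\<exists>K. \<forall>a. V_dual_norm \<Omega> (D a) \<le> K * norm a)"

definition control_adj :: "('u::{real_inner,polish_space} \<Rightarrow> functional) \<Rightarrow> field \<Rightarrow> 'u" where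
  "control_adj D v = (THE a. \<forall>b. a \<bullet> b = D b v)"

definition weak_solution ::
    "(real^2) set \<Rightarrow> real \<Rightarrow> real \<Rightarrow> real \<Rightarrow> real \<Rightarrow> ('u::{real_inner,polish_space} \<Rightarrow> functional) \<Rightarrow>
     field \<Rightarrow> (real \<Rightarrow> functional) \<Rightarrow> (real \<Rightarrow> 'u) \<Rightarrow> (real \<Rightarrow> field) \<Rightarrow> bool" where
  "weak_solution \<Omega> T \<mu> \<alpha> \<beta> D u0 f U u \<longleftrightarrow>
     u \<in> bochner_Linf T (\<H> \<Omega>) (H_norm \<Omega>) \<and>
     u \<in> bochner_L 2 T (\<V> \<Omega>) (V_norm \<Omega>) \<and>
     (\<exists>g. g \<in> bochner_L (4/3) T (V_dual \<Omega>) (V_dual_norm \<Omega>) \<and> is_time_deriv \<Omega> T u g \<and>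
        (AE t in lebesgue_on {0..T}. \<forall>v\<in>\<V> \<Omega>.
           g t v + \<mu> * A_op \<Omega> (u t) v + B_op \<Omega> (u t) (u t) v
             + \<alpha> * pairing \<Omega> (u t) v + \<beta> * pairing \<Omega> (C_op \<Omega> (u t)) v
           = f t v + D (U t) v)) \<and>
     (\<forall>v\<in>\<V> \<Omega>. ((\<lambda>t. pairing \<Omega> (u t) v) \<longlongrightarrow> pairing \<Omega> u0 v) (at_right 0)) \<and>
     (\<forall>t\<in>{0..T}.
        H_norm \<Omega> (u t) ^ 2
          + 2 * \<mu> * (LINT s|lebesgue_on {0..t}. V_norm \<Omega> (u s) ^ 2)
          + 2 * \<alpha> * (LINT s|lebesgue_on {0..t}. H_norm \<Omega> (u s) ^ 2)
          + 2 * \<beta> * (LINT s|lebesgue_on {0..t}. Lnorm \<Omega> 4 (u s) ^ 4)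
        = H_norm \<Omega> u0 ^ 2
          + 2 * (LINT s|lebesgue_on {0..t}. f s (u s))
          + 2 * (LINT s|lebesgue_on {0..t}. D (U s) (u s)))"

text \<open>The weak solution is taken in its representative in \<open>C([0,T];\<H>)\<close>, since the cost
  evaluates it at time \<open>T\<close>.\<close>

definition admissible ::
    "(real^2) set \<Rightarrow> real \<Rightarrow> real \<Rightarrow> real \<Rightarrow> real \<Rightarrow> ('u::{real_inner,polish_space} \<Rightarrow> functional) \<Rightarrow>
     field \<Rightarrow> (real \<Rightarrow> functional) \<Rightarrow> ((real \<Rightarrow> field) \<times> (real \<Rightarrow> 'u)) set" where
  "admissible \<Omega> T \<mu> \<alpha> \<beta> D u0 f = {(u, U). U \<in> controls_L2 T \<and>
     weak_solution \<Omega> T \<mu> \<alpha> \<beta> D u0 f U u \<and> u \<in> cont_in_time T (\<H> \<Omega>) (H_norm \<Omega>)}"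

definition admissible_differences ::
    "((real \<Rightarrow> field) \<times> (real \<Rightarrow> 'u::{real_inner,polish_space})) set \<Rightarrow> (real \<Rightarrow> field) \<Rightarrow> (real \<Rightarrow> 'u) \<Rightarrow>
     ((real \<Rightarrow> field) \<times> (real \<Rightarrow> 'u)) set" where
  "admissible_differences \<A> u' U' =
     {(\<lambda>t x. z t x - u' t x, \<lambda>t. W t - U' t) | z W. (z, W) \<in> \<A>}"

definition control_cost :: "'u::{real_inner,polish_space} \<Rightarrow> real" where
  "control_cost V = 1/2 * (norm V)\<^sup>2"

definition cost ::
    "(real^2) set \<Rightarrow> real \<Rightarrow> (real \<Rightarrow> field) \<Rightarrow> field \<Rightarrow>
     (real \<Rightarrow> field) \<Rightarrow> (real \<Rightarrow> 'u::{real_inner,polish_space}) \<Rightarrow> real" where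
  "cost \<Omega> T u\<^sub>d u\<^sub>f u U =
     1/2 * (LINT t|lebesgue_on {0..T}. H_norm \<Omega> (\<lambda>x. u t x - u\<^sub>d t x) ^ 2)
     + 1/2 * (LINT t|lebesgue_on {0..T}. Lnorm \<Omega> 2 (grad \<Omega> (u t)) ^ 2)
     + (LINT t|lebesgue_on {0..T}. control_cost (U t))
     + 1/2 * H_norm \<Omega> (\<lambda>x. u T x - u\<^sub>f x) ^ 2"

definition optimal_pair ::
    "((real \<Rightarrow> field) \<times> (real \<Rightarrow> 'u)) set \<Rightarrow> ((real \<Rightarrow> field) \<Rightarrow> (real \<Rightarrow> 'u) \<Rightarrow> real) \<Rightarrow>
     (real \<Rightarrow> field) \<Rightarrow> (real \<Rightarrow> 'u) \<Rightarrow> bool" where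
  "optimal_pair \<A> J u U \<longleftrightarrow> (u, U) \<in> \<A> \<and> (\<forall>(z, W)\<in>\<A>. J u U \<le> J z W)"

text \<open>On the right-hand side of the adjoint equation, \<open>-\<Delta>u\<close> is the functional \<open>A_op \<Omega> u\<close>.\<close>

definition adjoint_solution ::
    "(real^2) set \<Rightarrow> real \<Rightarrow> real \<Rightarrow> real \<Rightarrow> real \<Rightarrow> (real \<Rightarrow> field) \<Rightarrow> field \<Rightarrow>
     (real \<Rightarrow> field) \<Rightarrow> (real \<Rightarrow> field) \<Rightarrow> bool" where
  "adjoint_solution \<Omega> T \<mu> \<alpha> \<beta> u\<^sub>d u\<^sub>f u p \<longleftrightarrow>
     p \<in> cont_in_time T (\<H> \<Omega>) (H_norm \<Omega>) \<and>
     p \<in> bochner_L 2 T (\<V> \<Omega>) (V_norm \<Omega>) \<and>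
     (\<exists>g. g \<in> bochner_L (4/3) T (V_dual \<Omega>) (V_dual_norm \<Omega>) \<and> is_time_deriv \<Omega> T p g \<and>
        (AE t in lebesgue_on {0..T}. \<forall>q\<in>\<V> \<Omega>.
           - g t q + \<mu> * A_op \<Omega> (p t) q + B'_adj \<Omega> (u t) (p t) q
             + \<alpha> * pairing \<Omega> (p t) q + \<beta> * pairing \<Omega> (C'_op \<Omega> (u t) (p t)) q
           = pairing \<Omega> (\<lambda>x. u t x - u\<^sub>d t x) q + A_op \<Omega> (u t) q)) \<and>
     (AE x in lebesgue_on \<Omega>. p T x = u T x - u\<^sub>f x)"

end

theory Submission
  imports Defs
begin

text \<open>
  Let \<open>(z, W)\<close> be feasible and \<open>w = z - u\<^sup>*\<close>.  The equation for \<open>w\<close> tested with the adjoint state \<open>p\<close>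
  and the adjoint equation tested with \<open>w\<close> are added and integrated over \<open>(0, T)\<close>.  The time
  derivatives give \<open>(w(T), p(T)) = (w(T), u\<^sup>*(T) - u\<^sup>f)\<close>, since \<open>w(0) = 0\<close>; the linear parts of the operators
  cancel, and of the nonlinear ones only the remainders \<open>B(w, w)\<close> and
  \<open>2 (u\<^sup>* \<bullet> w) w + |w|\<^sup>2 (w + u\<^sup>*)\<close> are left.  Together with \<open>U\<^sup>* = - D\<^sup>* p\<close> this evaluates the first
  variation of the quadratic cost at \<open>(w, W - U\<^sup>*)\<close>, so that the difference of the costs of
  \<open>(z, W)\<close> and \<open>(u\<^sup>*, U\<^sup>*)\<close> is exactly the left-hand side of the second-order condition.

  The derivatives of \<open>w\<close> and \<open>p\<close> are only known to lie in \<open>L\<^sup>4\<^sup>/\<^sup>3(0,T;\<V>')\<close>, whereas \<open>w\<close> and \<open>p\<close> are only in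
  \<open>L\<^sup>2(0,T;\<V>)\<close>.  The pairings are nevertheless integrable, because by Ladyzhenskaya's inequality
  \<open>L\<^sup>\<infinity>(0,T;\<H>) \<inter> L\<^sup>2(0,T;\<V>)\<close> embeds into \<open>L\<^sup>4(0,T;L\<^sup>4)\<close>, and the equations bound the derivatives
  in the dual of that intersection.  Integration by parts in time follows by telescoping
  \<open>(w, p)\<close> along a grid that is translated so that the Riemann sums converge.
\<close>

section \<open>Smooth functions\<close>

lemma C_diff_SucI:
  assumes "\<And>x. (f has_derivative f' x) (at x)" "\<And>v. C_diff k (\<lambda>x. f' x v)"
  shows "C_diff (Suc k) f"
proof -
  have "frechet_derivative f (at x) = f' x" for x
    using frechet_derivative_at[OF assms(1)] by simp
  then show ?thesis
    using assms by (auto simp: differentiable_on_def differentiable_def)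
qed

lemma C_diff_Suc_derivative:
  assumes "C_diff (Suc k) f"
  shows "(f has_derivative frechet_derivative f (at x)) (at x)"
  using assms by (simp add: differentiable_on_def frechet_derivative_works)

lemma C_diff_SucD: "C_diff (Suc k) f \<Longrightarrow> C_diff k f"
proof (induction k arbitrary: f)
  case 0
  then show ?case by (simp add: differentiable_imp_continuous_on)
next
  case (Suc k)
  then show ?case by (metis C_diff.simps(2))
qed

lemma C_diff_const: "C_diff k (\<lambda>x. c)"
proof (induction k arbitrary: c)
  case (Suc k)
  show ?case by (rule C_diff_SucI[where f' = "\<lambda>x v. 0"]) (auto simp: Suc)
qed auto

lemma C_diff_bounded_linear:
  assumes "C_diff k f" "bounded_linear L"
  shows "C_diff k (\<lambda>x. L (f x))"
  using assms(1)
proof (induction k arbitrary: f)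
  case 0
  then show ?case using bounded_linear.continuous_on[OF assms(2)] by auto
next
  case (Suc k)
  show ?case
  proof (rule C_diff_SucI)
    show "((\<lambda>x. L (f x)) has_derivative (\<lambda>v. L (frechet_derivative f (at x) v))) (at x)" for x
      using bounded_linear.has_derivative[OF assms(2) C_diff_Suc_derivative[OF Suc.prems]] .
    show "C_diff k (\<lambda>x. L (frechet_derivative f (at x) v))" for v
      using Suc by simp
  qed
qed

lemma C_diff_add:
  assumes "C_diff k f" "C_diff k g"
  shows "C_diff k (\<lambda>x. f x + g x)"
  using assms
proof (induction k arbitrary: f g)
  case 0
  then show ?case by (auto intro: continuous_intros)
next
  case (Suc k)
  show ?case
  proof (rule C_diff_SucI)
    show "((\<lambda>x. f x + g x) has_derivative
        (\<lambda>v. frechet_derivative f (at x) v + frechet_derivative g (at x) v)) (at x)" for x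
      using has_derivative_add[OF C_diff_Suc_derivative[OF Suc.prems(1)] C_diff_Suc_derivative[OF Suc.prems(2)]] .
    show "C_diff k (\<lambda>x. frechet_derivative f (at x) v + frechet_derivative g (at x) v)" for v
      using Suc by simp
  qed
qed

lemma C_diff_mult:
  fixes f g :: "'a::euclidean_space \<Rightarrow> real"
  assumes "C_diff k f" "C_diff k g"
  shows "C_diff k (\<lambda>x. f x * g x)"
  using assms
proof (induction k arbitrary: f g)
  case 0
  then show ?case by (auto intro: continuous_intros)
next
  case (Suc k)
  show ?case
  proof (rule C_diff_SucI)
    show "((\<lambda>x. f x * g x) has_derivative
        (\<lambda>v. f x * frechet_derivative g (at x) v + frechet_derivative f (at x) v * g x)) (at x)" for x
      using has_derivative_mult[OF C_diff_Suc_derivative[OF Suc.prems(1)] C_diff_Suc_derivative[OF Suc.prems(2)]] .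
    have "C_diff k f" "C_diff k g" using Suc.prems C_diff_SucD by blast+
    then show "C_diff k (\<lambda>x. f x * frechet_derivative g (at x) v + frechet_derivative f (at x) v * g x)" for v
      using Suc by (intro C_diff_add Suc.IH) auto
  qed
qed

lemma C_diff_affine:
  fixes f :: "'b::euclidean_space \<Rightarrow> 'c::real_normed_vector" and A :: "'a::euclidean_space \<Rightarrow> 'b"
  assumes "C_diff k f" "bounded_linear A"
  shows "C_diff k (\<lambda>x. f (A x + c))"
  using assms(1)
proof (induction k arbitrary: f)
  case 0
  then have "continuous_on UNIV f" by simp
  moreover have "continuous_on UNIV (\<lambda>x. A x + c)"
    using bounded_linear.continuous_on[OF assms(2), of UNIV "\<lambda>x. x"] by (auto intro: continuous_intros)
  ultimately show ?case
    using continuous_on_compose2[of UNIV f UNIV "\<lambda>x. A x + c"] by auto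
next
  case (Suc k)
  show ?case
  proof (rule C_diff_SucI)
    have A: "((\<lambda>x. A x + c) has_derivative A) (at x)" for x
      using has_derivative_add[OF bounded_linear.has_derivative[OF assms(2) has_derivative_ident] has_derivative_const]
      by simp
    show "((\<lambda>x. f (A x + c)) has_derivative (\<lambda>v. frechet_derivative f (at (A x + c)) (A v))) (at x)" for x
      using has_derivative_compose[OF A C_diff_Suc_derivative[OF Suc.prems]] .
    show "C_diff k (\<lambda>x. frechet_derivative f (at (A x + c)) (A v))" for v
      using Suc.IH[of "\<lambda>x. frechet_derivative f (at x) (A v)"] Suc.prems by simp
  qed
qed

lemma smooth_add: "smooth f \<Longrightarrow> smooth g \<Longrightarrow> smooth (\<lambda>x. f x + g x)"
  by (simp add: smooth_def C_diff_add)

lemma smooth_mult: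
  fixes f g :: "'a::euclidean_space \<Rightarrow> real"
  shows "smooth f \<Longrightarrow> smooth g \<Longrightarrow> smooth (\<lambda>x. f x * g x)"
  by (simp add: smooth_def C_diff_mult)

lemma smooth_bounded_linear: "smooth f \<Longrightarrow> bounded_linear L \<Longrightarrow> smooth (\<lambda>x. L (f x))"
  by (simp add: smooth_def C_diff_bounded_linear)

lemma smooth_affine:
  fixes A :: "'a::euclidean_space \<Rightarrow> 'b::euclidean_space"
  shows "smooth f \<Longrightarrow> bounded_linear A \<Longrightarrow> smooth (\<lambda>x. f (A x + c))"
  unfolding smooth_def by (metis C_diff_affine)

lemma smooth_const: "smooth (\<lambda>x. c)"
  by (simp add: smooth_def C_diff_const)

lemma smooth_has_derivative: "smooth f \<Longrightarrow> (f has_derivative frechet_derivative f (at x)) (at x)"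
  unfolding smooth_def using C_diff_Suc_derivative by blast

lemma smooth_frechet_derivative: "smooth f \<Longrightarrow> smooth (\<lambda>x. frechet_derivative f (at x) v)"
  unfolding smooth_def by (metis C_diff.simps(2))

lemma smooth_continuous: "smooth f \<Longrightarrow> continuous_on S f"
  unfolding smooth_def by (metis C_diff.simps(1) continuous_on_subset subset_UNIV)

definition flat_exp :: "nat \<Rightarrow> real \<Rightarrow> real" where
  "flat_exp m x = (if x \<le> 0 then 0 else inverse x ^ m * exp (- inverse x))"

lemma flat_exp_tendsto: "(flat_exp m \<longlongrightarrow> 0) (at 0)"
proof -
  have "((\<lambda>x::real. x ^ m / exp x) \<longlongrightarrow> 0) at_top"
    by (rule tendsto_power_div_exp_0)
  then have "((\<lambda>x::real. inverse x ^ m / exp (inverse x)) \<longlongrightarrow> 0) (at_right 0)"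
    using filterlim_compose filterlim_inverse_at_top_right by blast
  then have "(flat_exp m \<longlongrightarrow> 0) (at_right 0)"
    by (rule Lim_transform_eventually)
      (auto simp: flat_exp_def eventually_at_filter exp_minus field_simps intro: always_eventually)
  moreover have "(flat_exp m \<longlongrightarrow> 0) (at_left 0)"
    by (rule tendsto_eventually) (auto simp: flat_exp_def eventually_at_filter)
  ultimately show ?thesis
    using filterlim_split_at by blast
qed

lemma flat_exp_deriv:
  "(flat_exp m has_field_derivative (flat_exp (m + 2) x - real m * flat_exp (m + 1) x)) (at x)"
proof (cases x "0::real" rule: linorder_cases)
  case less
  have "((\<lambda>x. 0::real) has_field_derivative 0) (at x)" by simp
  then have "(flat_exp m has_field_derivative 0) (at x)"
    by (rule has_field_derivative_transform_within_open[where S = "{..<0}"])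
      (use less in \<open>auto simp: flat_exp_def\<close>)
  then show ?thesis using less by (simp add: flat_exp_def)
next
  case equal
  have "((\<lambda>y. (flat_exp m y - flat_exp m 0) / (y - 0)) \<longlongrightarrow> 0) (at 0)"
  proof (rule Lim_transform_eventually[OF flat_exp_tendsto[of "m + 1"]])
    show "\<forall>\<^sub>F y in at 0. flat_exp (m + 1) y = (flat_exp m y - flat_exp m 0) / (y - 0)"
      by (auto simp: flat_exp_def eventually_at_filter field_simps intro!: always_eventually)
  qed
  then have "(flat_exp m has_field_derivative 0) (at 0)"
    by (simp add: has_field_derivative_iff)
  then show ?thesis using equal by (simp add: flat_exp_def)
next
  case greater
  have "((\<lambda>x. inverse x ^ m * exp (- inverse x)) has_field_derivative
     (flat_exp (m + 2) x - real m * flat_exp (m + 1) x)) (at x)"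
  proof -
    have 1: "((\<lambda>x::real. inverse x) has_field_derivative - (inverse x ^ 2)) (at x)"
      using DERIV_inverse[of x] greater by (simp add: numeral_2_eq_2)
    have 2: "((\<lambda>x. exp (- inverse x)) has_field_derivative exp (- inverse x) * inverse x ^ 2) (at x)"
      using DERIV_chain2[OF DERIV_exp DERIV_minus[OF 1]] by simp
    have 3: "((\<lambda>x. inverse x ^ m) has_field_derivative - (real m * inverse x ^ (m + 1))) (at x)"
      using DERIV_power[OF 1, of m] by (cases m) (simp_all add: power2_eq_square mult_ac)
    show ?thesis
      using DERIV_mult[OF 3 2] greater
      by (simp add: flat_exp_def power_add power2_eq_square algebra_simps)
  qed
  then show ?thesis
    by (rule has_field_derivative_transform_within_open[where S = "{0<..}"])
      (use greater in \<open>auto simp: flat_exp_def\<close>)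
qed

lemma C_diff_flat_exp: "C_diff k (flat_exp m)"
proof (induction k arbitrary: m)
  case 0
  show ?case
    using flat_exp_deriv by (auto intro!: continuous_at_imp_continuous_on DERIV_isCont)
next
  case (Suc k)
  show ?case
  proof (rule C_diff_SucI)
    show "(flat_exp m has_derivative (\<lambda>v. (flat_exp (m + 2) x - real m * flat_exp (m + 1) x) * v)) (at x)" for x
      using flat_exp_deriv by (simp add: has_field_derivative_def)
    show "C_diff k (\<lambda>x. (flat_exp (m + 2) x - real m * flat_exp (m + 1) x) * v)" for v
    proof -
      have "C_diff k (\<lambda>x. v * flat_exp (m + 2) x + (- v * real m) * flat_exp (m + 1) x)"
        by (intro C_diff_add C_diff_bounded_linear[OF Suc.IH] bounded_linear_intros)
      then show ?thesis by (simp add: algebra_simps)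
    qed
  qed
qed

definition bump :: "real \<Rightarrow> real" where
  "bump x = flat_exp 0 x * flat_exp 0 (1 - x)"

lemma smooth_bump: "smooth bump"
proof -
  have 1: "smooth (flat_exp 0)" by (simp add: smooth_def C_diff_flat_exp)
  have "smooth (\<lambda>x. flat_exp 0 (- x + 1))"
    using smooth_affine[OF 1 bounded_linear_minus[OF bounded_linear_ident]] .
  from smooth_mult[OF 1 this] show ?thesis by (simp add: bump_def[abs_def])
qed

lemma bump_nonneg: "bump x \<ge> 0" and bump_pos: "0 < x \<Longrightarrow> x < 1 \<Longrightarrow> bump x > 0"
  and bump_0: "x \<le> 0 \<or> x \<ge> 1 \<Longrightarrow> bump x = 0"
  by (auto simp: bump_def flat_exp_def)

definition bump_mass :: real where
  "bump_mass = integral {0..1} bump"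

lemma bump_integrable: "bump integrable_on {a..b}"
  by (intro integrable_continuous_real smooth_continuous smooth_bump)

lemma bump_mass_pos: "bump_mass > 0"
proof -
  have "integral {0..1} bump \<ge> 0" by (intro integral_nonneg bump_integrable bump_nonneg)
  moreover have "integral {0..1} bump \<noteq> 0"
  proof
    assume "integral {0..1} bump = 0"
    then have "\<And>x. x \<in> {0..1} \<Longrightarrow> bump x = 0"
      using integral_eq_0_iff[of 0 1 bump] smooth_continuous[OF smooth_bump] bump_nonneg by auto
    from this[of "1/2"] show False using bump_pos[of "1/2"] by auto
  qed
  ultimately show ?thesis by (simp add: bump_mass_def)
qed

definition step :: "real \<Rightarrow> real" where
  "step x = (if x \<le> 0 then 0 else integral {0..x} bump / bump_mass)"

lemma step_deriv: "(step has_field_derivative bump x / bump_mass) (at x)"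
proof -
  let ?a = "- \<bar>x\<bar> - 1"
  have eq: "step y = integral {?a..y} bump / bump_mass" if "y > ?a" for y
  proof (cases "y \<le> 0")
    case True
    have "integral {?a..y} bump = integral {?a..y} (\<lambda>x. 0)"
      by (rule integral_cong) (use True in \<open>auto intro: bump_0\<close>)
    then show ?thesis using True by (simp add: step_def)
  next
    case False
    have "integral {?a..y} bump = integral {?a..0} bump + integral {0..y} bump"
      using Henstock_Kurzweil_Integration.integral_combine[of ?a 0 y bump] False bump_integrable by auto
    moreover have "integral {?a..0} bump = integral {?a..0} (\<lambda>x. 0)"
      by (rule integral_cong) (auto intro: bump_0)
    ultimately show ?thesis using False by (simp add: step_def)
  qed
  have "((\<lambda>y. integral {?a..y} bump) has_field_derivative bump x) (at x within {?a..\<bar>x\<bar> + 1})"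
    by (rule integral_has_real_derivative) (auto intro: smooth_continuous smooth_bump)
  then have "((\<lambda>y. integral {?a..y} bump / bump_mass) has_field_derivative bump x / bump_mass) (at x within {?a..\<bar>x\<bar> + 1})"
    by (auto intro: DERIV_cdivide)
  then have "((\<lambda>y. integral {?a..y} bump / bump_mass) has_field_derivative bump x / bump_mass) (at x)"
    by (subst (asm) at_within_interior) auto
  then show ?thesis
    by (rule has_field_derivative_transform_within_open[where S = "{?a<..}"]) (auto simp: eq)
qed

lemma smooth_step: "smooth step"
  unfolding smooth_def
proof
  fix k
  show "C_diff k step"
  proof (cases k)
    case 0
    then show ?thesis
      using step_deriv by (auto intro!: continuous_at_imp_continuous_on DERIV_isCont)
  next
    case (Suc j)
    have "C_diff (Suc j) step"
    proof (rule C_diff_SucI)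
      show "(step has_derivative (\<lambda>v. bump x / bump_mass * v)) (at x)" for x
        using step_deriv unfolding has_field_derivative_def .
      have "C_diff j bump" using smooth_bump by (simp add: smooth_def)
      from C_diff_bounded_linear[OF this bounded_linear_mult_right]
      show "C_diff j (\<lambda>x. bump x / bump_mass * v)" for v
        by (metis (no_types, lifting) ext mult.commute times_divide_eq_left times_divide_eq_right)
    qed
    then show ?thesis using Suc by simp
  qed
qed

lemma step_0: "x \<le> 0 \<Longrightarrow> step x = 0"
  by (simp add: step_def)

lemma step_1: "x \<ge> 1 \<Longrightarrow> step x = 1"
proof -
  assume x: "x \<ge> 1"
  have "integral {0..x} bump = integral {0..1} bump + integral {1..x} bump"
    using Henstock_Kurzweil_Integration.integral_combine[of 0 1 x bump] x bump_integrable by auto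
  moreover have "integral {1..x} bump = integral {1..x} (\<lambda>x. 0)"
    by (rule integral_cong) (auto intro: bump_0)
  ultimately show ?thesis using x bump_mass_pos by (simp add: step_def bump_mass_def)
qed

lemma step_mono: "x \<le> y \<Longrightarrow> step x \<le> step y"
  by (rule DERIV_nonneg_imp_nondecreasing[of x y step])
    (use step_deriv bump_nonneg bump_mass_pos in \<open>auto intro!: exI divide_nonneg_pos\<close>)

lemma step_bounds: "0 \<le> step x" "step x \<le> 1"
  using step_mono[of 0 x] step_0 step_mono[of x 1] step_1 step_mono[of 1 x]
  by (cases "x \<le> 0"; cases "x \<le> 1"; simp)+

text \<open>For \<open>n (b - a) \<ge> 2\<close> a smooth cut-off which is supported in \<open>[a, b]\<close> and equals \<open>1\<close> on
  \<open>[a + 1/n, b - 1/n]\<close>.\<close>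

definition plateau :: "real \<Rightarrow> real \<Rightarrow> nat \<Rightarrow> real \<Rightarrow> real" where
  "plateau a b n x = step (real n * (x - a)) - step (real n * (x - b) + 1)"

lemma smooth_plateau: "smooth (plateau a b n)"
proof -
  have 1: "smooth (\<lambda>x. step (real n * x + c))" for c
    using smooth_affine[OF smooth_step bounded_linear_mult_right] .
  have "smooth (\<lambda>x. step (real n * x + - real n * a) + - 1 * step (real n * x + (- real n * b + 1)))"
    by (intro smooth_add 1 smooth_bounded_linear[OF 1] bounded_linear_mult_right)
  then show ?thesis by (simp add: plateau_def[abs_def] algebra_simps)
qed

lemma plateau_deriv:
  "(plateau a b n has_field_derivative
     (real n * bump (real n * (x - a)) - real n * bump (real n * (x - b) + 1)) / bump_mass) (at x)"
proof -
  have 1: "((\<lambda>x. step (real n * (x - a))) has_field_derivative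
     bump (real n * (x - a)) / bump_mass * real n) (at x)"
    by (rule DERIV_chain2[OF step_deriv]) (auto intro!: derivative_eq_intros)
  have 2: "((\<lambda>x. step (real n * (x - b) + 1)) has_field_derivative
     bump (real n * (x - b) + 1) / bump_mass * real n) (at x)"
    by (rule DERIV_chain2[OF step_deriv]) (auto intro!: derivative_eq_intros)
  show ?thesis
    using DERIV_diff[OF 1 2] by (simp add: plateau_def[abs_def] diff_divide_distrib mult.commute)
qed

lemma plateau_support:
  assumes "real n * (b - a) \<ge> 2" "x \<notin> {a..b}"
  shows "plateau a b n x = 0"
proof (cases "x < a")
  case True
  have "real n * (x - a) \<le> 0" using True by (simp add: mult_nonneg_nonpos)
  moreover have "real n * (x - b) + 1 \<le> 0"
    using assms(1) \<open>real n * (x - a) \<le> 0\<close> by (simp add: algebra_simps)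
  ultimately show ?thesis by (simp add: plateau_def step_0)
next
  case False
  with assms have x: "x > b" by auto
  have "real n * (x - b) \<ge> 0" using x by simp
  moreover have "real n * (x - a) \<ge> 1"
    using assms(1) \<open>real n * (x - b) \<ge> 0\<close> by (simp add: algebra_simps)
  ultimately show ?thesis by (simp add: plateau_def step_1)
qed

lemma plateau_bound: "\<bar>plateau a b n x\<bar> \<le> 1"
  unfolding plateau_def using step_bounds[of "real n * (x - a)"] step_bounds[of "real n * (x - b) + 1"] by linarith

lemma plateau_tendsto:
  assumes "a < b"
  shows "(\<lambda>n. plateau a b n x) \<longlonglongrightarrow> indicator {a<..<b} x"
proof (rule tendsto_eventually)
  have ev: "\<forall>\<^sub>F n in sequentially. real n * c \<ge> 2" if "c > 0" for c
  proof -
    obtain N where N: "2 / c \<le> real N" using real_arch_simple by blast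
    have "real n * c \<ge> 2" if "n \<ge> N" for n
    proof -
      have "2 \<le> real N * c" using N \<open>c > 0\<close> by (simp add: pos_divide_le_eq)
      also have "\<dots> \<le> real n * c" using that \<open>c > 0\<close> by simp
      finally show ?thesis .
    qed
    then show ?thesis by (auto simp: eventually_sequentially)
  qed
  have ab: "\<forall>\<^sub>F n in sequentially. real n * (b - a) \<ge> 2"
    using ev[of "b - a"] assms by simp
  consider "x \<notin> {a..b}" | "x = a" | "x = b" | "a < x" "x < b" by fastforce
  then show "\<forall>\<^sub>F n in sequentially. plateau a b n x = indicator {a<..<b} x"
  proof cases
    case 1
    show ?thesis
      using ab by eventually_elim (use 1 in \<open>auto simp: plateau_support\<close>)
  next
    case 2
    show ?thesis
      using ab by eventually_elim (use 2 in \<open>auto simp: plateau_def step_0 algebra_simps\<close>)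
  next
    case 3
    show ?thesis
      using ab by eventually_elim (use 3 in \<open>auto simp: plateau_def step_1 algebra_simps\<close>)
  next
    case 4
    have "\<forall>\<^sub>F n in sequentially. real n * (x - a) \<ge> 2" "\<forall>\<^sub>F n in sequentially. real n * (b - x) \<ge> 2"
      using ev[of "x - a"] ev[of "b - x"] 4 by auto
    then show ?thesis
    proof eventually_elim
      case (elim n)
      have "real n * (x - b) + 1 \<le> 0" using elim by (simp add: algebra_simps)
      then show ?case using elim 4 by (simp add: plateau_def step_1 step_0)
    qed
  qed
qed

section \<open>Integrals over the plane\<close>

definition pt :: "real \<Rightarrow> real \<Rightarrow> real^2" where
  "pt x y = vector [x, y]"

lemma pt_nth [simp]: "pt x y $ 1 = x" "pt x y $ 2 = y"
  by (simp_all add: pt_def)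

lemma pt_eq: "pt x y = x *\<^sub>R axis 1 1 + y *\<^sub>R axis 2 1"
  by (simp add: vec_eq_iff forall_2 axis_def)

lemma pt_measurable [measurable]: "(\<lambda>z. pt (fst z) (snd z)) \<in> borel_measurable (borel \<Otimes>\<^sub>M borel)"
  unfolding pt_eq by measurable

lemma Basis_real2: "(Basis :: (real^2) set) = {axis 1 1, axis 2 1}"
  by (auto simp: Basis_vec_def UNIV_2)

lemma axis_neq: "axis 1 (1::real) \<noteq> (axis 2 1 :: real^2)"
  by (simp add: axis_eq_axis)

lemma lborel_real2:
  "(lborel :: (real^2) measure) = distr (lborel \<Otimes>\<^sub>M lborel) borel (\<lambda>z. pt (fst z) (snd z))"
proof (rule lborel_eqI)
  fix l u :: "real^2"
  assume le: "\<And>b. b \<in> Basis \<Longrightarrow> l \<bullet> b \<le> u \<bullet> b"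
  have le': "l $ 1 \<le> u $ 1" "l $ 2 \<le> u $ 2"
    using le[of "axis 1 1"] le[of "axis 2 1"] by (auto simp: Basis_real2 inner_axis)
  have "(\<lambda>z. pt (fst z) (snd z)) -` box l u = {l$1<..<u$1} \<times> {l$2<..<u$2}"
    by (auto simp: mem_box_cart forall_2)
  then have "emeasure (distr (lborel \<Otimes>\<^sub>M lborel) borel (\<lambda>z. pt (fst z) (snd z))) (box l u)
     = emeasure (lborel \<Otimes>\<^sub>M lborel) ({l$1<..<u$1} \<times> {l$2<..<u$2})"
    by (subst emeasure_distr) (auto simp: space_pair_measure)
  also have "\<dots> = ennreal (u$1 - l$1) * ennreal (u$2 - l$2)"
    using le' by (subst lborel.emeasure_pair_measure_Times) auto
  also have "\<dots> = ennreal (\<Prod>b\<in>Basis. (u - l) \<bullet> b)"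
    using le' axis_neq by (simp add: Basis_real2 inner_axis ennreal_mult)
  finally show "emeasure (distr (lborel \<Otimes>\<^sub>M lborel) borel (\<lambda>z. pt (fst z) (snd z))) (box l u)
     = ennreal (\<Prod>b\<in>Basis. (u - l) \<bullet> b)" .
qed simp

lemma nn_integral_real2:
  assumes [measurable]: "F \<in> borel_measurable (borel :: (real^2) measure)"
  shows "(\<integral>\<^sup>+x. F x \<partial>lborel) = (\<integral>\<^sup>+x. \<integral>\<^sup>+y. F (pt x y) \<partial>lborel \<partial>lborel)"
    and "(\<integral>\<^sup>+x. F x \<partial>lborel) = (\<integral>\<^sup>+y. \<integral>\<^sup>+x. F (pt x y) \<partial>lborel \<partial>lborel)"
proof -
  have eq: "(\<integral>\<^sup>+x. F x \<partial>lborel) = (\<integral>\<^sup>+z. F (pt (fst z) (snd z)) \<partial>(lborel \<Otimes>\<^sub>M lborel))"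
    by (subst lborel_real2, subst nn_integral_distr) auto
  show "(\<integral>\<^sup>+x. F x \<partial>lborel) = (\<integral>\<^sup>+x. \<integral>\<^sup>+y. F (pt x y) \<partial>lborel \<partial>lborel)"
    unfolding eq by (subst lborel.nn_integral_fst[symmetric]) auto
  show "(\<integral>\<^sup>+x. F x \<partial>lborel) = (\<integral>\<^sup>+y. \<integral>\<^sup>+x. F (pt x y) \<partial>lborel \<partial>lborel)"
    unfolding eq by (subst lborel_pair.nn_integral_snd[symmetric]) auto
qed

lemma integral_real2:
  fixes F :: "real^2 \<Rightarrow> real"
  assumes "integrable lborel F"
  shows "(\<integral>x. F x \<partial>lborel) = (\<integral>x. \<integral>y. F (pt x y) \<partial>lborel \<partial>lborel)"
    and "(\<integral>x. F x \<partial>lborel) = (\<integral>y. \<integral>x. F (pt x y) \<partial>lborel \<partial>lborel)"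
proof -
  have [measurable]: "F \<in> borel_measurable borel"
    using borel_measurable_integrable[OF assms] by simp
  have "integrable (distr (lborel \<Otimes>\<^sub>M lborel) borel (\<lambda>z. pt (fst z) (snd z))) F"
    using assms by (subst (asm) lborel_real2)
  then have int: "integrable (lborel \<Otimes>\<^sub>M lborel) (\<lambda>z. F (pt (fst z) (snd z)))"
    by (subst (asm) integrable_distr_eq) auto
  then have int': "integrable (lborel \<Otimes>\<^sub>M lborel) (\<lambda>(x, y). F (pt x y))"
    by (simp only: case_prod_beta')
  have eq: "(\<integral>x. F x \<partial>lborel) = (\<integral>z. F (pt (fst z) (snd z)) \<partial>(lborel \<Otimes>\<^sub>M lborel))"
    by (subst lborel_real2, subst integral_distr) auto
  show "(\<integral>x. F x \<partial>lborel) = (\<integral>x. \<integral>y. F (pt x y) \<partial>lborel \<partial>lborel)"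
    unfolding eq using lborel_pair.integral_fst[OF int'] by (simp add: case_prod_beta')
  show "(\<integral>x. F x \<partial>lborel) = (\<integral>y. \<integral>x. F (pt x y) \<partial>lborel \<partial>lborel)"
    unfolding eq using lborel_pair.integral_snd[OF int'] by (simp add: case_prod_beta')
qed

lemma integrable_continuous_bounded_support:
  fixes f :: "'a::euclidean_space \<Rightarrow> real"
  assumes "continuous_on UNIV f" "\<And>x. norm x > R \<Longrightarrow> f x = 0"
  shows "integrable lborel f"
proof -
  have "integrable lborel (\<lambda>x. indicator (cball 0 R) x *\<^sub>R f x)"
    by (rule borel_integrable_compact) (auto intro: continuous_on_subset[OF assms(1)])
  moreover have "(\<lambda>x. indicator (cball 0 R) x *\<^sub>R f x) = f"
    using assms(2) by (auto simp: indicator_def fun_eq_iff)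
  ultimately show ?thesis by simp
qed

abbreviation partial :: "2 \<Rightarrow> (real^2 \<Rightarrow> real) \<Rightarrow> real^2 \<Rightarrow> real" where
  "partial j f x \<equiv> frechet_derivative f (at x) (axis j 1)"

lemma partial_eq_0:
  assumes "\<And>x. norm x > R \<Longrightarrow> f x = 0" "norm x > R"
  shows "partial j f x = 0"
proof -
  have "open {x::real^2. norm x > R}"
    by (intro open_Collect_less continuous_intros)
  then have "(f has_derivative (\<lambda>v. 0)) (at x)"
    using has_derivative_transform_within_open[of "\<lambda>x. 0" "\<lambda>v. 0" x UNIV "{x. norm x > R}" f] assms
    by auto
  then have "frechet_derivative f (at x) = (\<lambda>v. 0)"
    using frechet_derivative_at by metis
  then show ?thesis by simp
qed

lemma partial_integrable:
  assumes "smooth f" "\<And>x. norm x > R \<Longrightarrow> f x = 0"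
  shows "integrable lborel (partial j f)"
  using assms by (intro integrable_continuous_bounded_support[where R = R] smooth_continuous smooth_frechet_derivative)
    (auto intro: partial_eq_0)

lemma line_deriv:
  assumes "smooth f"
  shows "((\<lambda>s. f (pt s y)) has_real_derivative partial 1 f (pt s y)) (at s)"
    and "((\<lambda>s. f (pt y s)) has_real_derivative partial 2 f (pt y s)) (at s)"
proof -
  have D: "(f has_derivative frechet_derivative f (at x)) (at x)" for x
    using smooth_has_derivative[OF assms] .
  have lin': "frechet_derivative f (at x) (v *\<^sub>R w) = v * frechet_derivative f (at x) w" for x v w
    using linear_cmul[OF has_derivative_linear[OF D]] by simp
  have "((\<lambda>s. pt s y) has_derivative (\<lambda>v. v *\<^sub>R axis 1 1)) (at s)"
    unfolding pt_eq by (auto intro!: derivative_eq_intros)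
  from has_derivative_compose[OF this D]
  show "((\<lambda>s. f (pt s y)) has_real_derivative partial 1 f (pt s y)) (at s)"
    by (simp add: has_field_derivative_def lin' mult_commute_abs)
  have "((\<lambda>s. pt y s) has_derivative (\<lambda>v. v *\<^sub>R axis 2 1)) (at s)"
    unfolding pt_eq by (auto intro!: derivative_eq_intros)
  from has_derivative_compose[OF this D]
  show "((\<lambda>s. f (pt y s)) has_real_derivative partial 2 f (pt y s)) (at s)"
    by (simp add: has_field_derivative_def lin' mult_commute_abs)
qed

lemma pt_measurable_line [measurable]: "(\<lambda>s. pt s y) \<in> borel_measurable borel" "(\<lambda>s. pt y s) \<in> borel_measurable borel"
  unfolding pt_eq by measurable

lemma pt_continuous: "continuous_on S (\<lambda>s. pt s y)" "continuous_on S (\<lambda>s. pt y s)"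
  unfolding pt_eq by (auto intro!: continuous_intros)

lemma norm_pt: "\<bar>x\<bar> \<le> norm (pt x y)" "\<bar>y\<bar> \<le> norm (pt x y)"
  using component_le_norm_cart[of "pt x y" 1] component_le_norm_cart[of "pt x y" 2] by auto

lemma FTC_bounded_support:
  fixes h h' :: "real \<Rightarrow> real"
  assumes h: "\<And>s. (h has_real_derivative h' s) (at s)" "continuous_on UNIV h'"
    and supp: "\<And>s. \<bar>s\<bar> > R \<Longrightarrow> h s = 0" "\<And>s. \<bar>s\<bar> > R \<Longrightarrow> h' s = 0"
  shows "(\<integral>s. h' s \<partial>lborel) = 0" and "ennreal \<bar>h x\<bar> \<le> (\<integral>\<^sup>+s. ennreal \<bar>h' s\<bar> \<partial>lborel)"
proof -
  let ?a = "- \<bar>R\<bar> - \<bar>x\<bar> - 1"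
  have FTC: "(\<integral>s. h' s * indicator {?a..b} s \<partial>lborel) = h b - h ?a" if "?a \<le> b" for b
    using that h by (intro integral_FTC_Icc_real)
      (auto simp: continuous_on_eq_continuous_at)
  have "(\<lambda>s. h' s * indicator {?a..\<bar>R\<bar> + 1} s) = h'"
  proof
    fix s
    show "h' s * indicator {?a..\<bar>R\<bar> + 1} s = h' s"
      using supp(2)[of s] by (cases "\<bar>s\<bar> > R") (auto simp: indicator_def)
  qed
  then show "(\<integral>s. h' s \<partial>lborel) = 0"
    using FTC[of "\<bar>R\<bar> + 1"] supp(1)[of ?a] supp(1)[of "\<bar>R\<bar> + 1"] by simp
  have "h x = (\<integral>s. h' s * indicator {?a..x} s \<partial>lborel)"
    using FTC[of x] supp(1)[of ?a] by simp
  moreover have "integrable lborel (\<lambda>s. h' s * indicator {?a..x} s)"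
    using borel_integrable_atLeastAtMost'[of ?a x h'] continuous_on_subset[OF h(2)]
    by (simp add: set_integrable_def mult.commute)
  ultimately have "ennreal \<bar>h x\<bar> \<le> (\<integral>\<^sup>+s. norm (h' s * indicator {?a..x} s) \<partial>lborel)"
    using integral_norm_bound_ennreal[of lborel "\<lambda>s. h' s * indicator {?a..x} s"] by simp
  also have "\<dots> \<le> (\<integral>\<^sup>+s. ennreal \<bar>h' s\<bar> \<partial>lborel)"
    by (intro nn_integral_mono ennreal_leI) (auto simp: indicator_def)
  finally show "ennreal \<bar>h x\<bar> \<le> (\<integral>\<^sup>+s. ennreal \<bar>h' s\<bar> \<partial>lborel)" .
qed

lemma
  assumes "smooth f" "\<And>x. norm x > R \<Longrightarrow> f x = 0"
  shows integral_partial_line: "(\<integral>s. partial 1 f (pt s y) \<partial>lborel) = 0" "(\<integral>s. partial 2 f (pt y s) \<partial>lborel) = 0"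
    and bound_partial_line: "ennreal \<bar>f (pt x y)\<bar> \<le> (\<integral>\<^sup>+s. ennreal \<bar>partial 1 f (pt s y)\<bar> \<partial>lborel)"
      "ennreal \<bar>f (pt x y)\<bar> \<le> (\<integral>\<^sup>+s. ennreal \<bar>partial 2 f (pt x s)\<bar> \<partial>lborel)"
proof -
  have cont: "continuous_on UNIV (\<lambda>s. partial j f (pt s y))" "continuous_on UNIV (\<lambda>s. partial j f (pt y s))" for j y
  proof -
    have c: "continuous_on UNIV (partial j f)"
      by (intro smooth_continuous smooth_frechet_derivative assms(1))
    show "continuous_on UNIV (\<lambda>s. partial j f (pt s y))" "continuous_on UNIV (\<lambda>s. partial j f (pt y s))"
      by (rule continuous_on_compose2[OF c pt_continuous(1)], simp,
          rule continuous_on_compose2[OF c pt_continuous(2)], simp)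
  qed
  have s1: "\<bar>s\<bar> > R \<Longrightarrow> f (pt s y) = 0" "\<bar>s\<bar> > R \<Longrightarrow> f (pt y s) = 0" for s y
    using assms(2)[of "pt s y"] norm_pt[of s y] assms(2)[of "pt y s"] norm_pt[of y s] by auto
  have s2: "\<bar>s\<bar> > R \<Longrightarrow> partial j f (pt s y) = 0" "\<bar>s\<bar> > R \<Longrightarrow> partial j f (pt y s) = 0" for s y j
    using partial_eq_0[of R f "pt s y"] norm_pt[of s y] partial_eq_0[of R f "pt y s"] norm_pt[of y s] assms(2)
    by auto
  show "(\<integral>s. partial 1 f (pt s y) \<partial>lborel) = 0" "ennreal \<bar>f (pt x y)\<bar> \<le> (\<integral>\<^sup>+s. ennreal \<bar>partial 1 f (pt s y)\<bar> \<partial>lborel)"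
    by (rule FTC_bounded_support[where R = R, OF line_deriv(1)[OF assms(1)] cont(1) s1(1) s2(1)]; assumption)+
  show "(\<integral>s. partial 2 f (pt y s) \<partial>lborel) = 0" "ennreal \<bar>f (pt x y)\<bar> \<le> (\<integral>\<^sup>+s. ennreal \<bar>partial 2 f (pt x s)\<bar> \<partial>lborel)"
    by (rule FTC_bounded_support[where R = R, OF line_deriv(2)[OF assms(1)] cont(2) s1(2) s2(2)]; assumption)+
qed

lemma integral_partial_eq_0:
  assumes "smooth f" "\<And>x. norm x > R \<Longrightarrow> f x = 0"
  shows "(\<integral>x. partial j f x \<partial>lborel) = 0"
proof -
  have int: "integrable lborel (partial j f)" for j
    by (rule partial_integrable[OF assms])
  have line: "(\<integral>s. partial 1 f (pt s y) \<partial>lborel) = 0" "(\<integral>s. partial 2 f (pt y s) \<partial>lborel) = 0" for y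
    by (rule integral_partial_line[OF assms]; assumption)+
  have "j = 1 \<or> j = 2" using exhaust_2 by blast
  then show ?thesis
    using integral_real2(1)[OF int[of 2]] integral_real2(2)[OF int[of 1]] line by auto
qed

text \<open>Applied to powers of a function, this yields the inequalities of Poincare and Ladyzhenskaya.\<close>

lemma gagliardo_nirenberg:
  assumes "smooth f" "\<And>x. norm x > R \<Longrightarrow> f x = 0"
  shows "(\<integral>x. (f x)\<^sup>2 \<partial>lborel) \<le> (\<integral>x. \<bar>partial 1 f x\<bar> \<partial>lborel) * (\<integral>x. \<bar>partial 2 f x\<bar> \<partial>lborel)"
proof -
  have [measurable]: "f \<in> borel_measurable borel" "partial j f \<in> borel_measurable borel" for j
    by (intro borel_measurable_continuous_onI smooth_continuous smooth_frechet_derivative assms(1))+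
  define f1 where "f1 y = (\<integral>\<^sup>+s. ennreal \<bar>partial 1 f (pt s y)\<bar> \<partial>lborel)" for y
  define f2 where "f2 x = (\<integral>\<^sup>+s. ennreal \<bar>partial 2 f (pt x s)\<bar> \<partial>lborel)" for x
  have [measurable]: "f1 \<in> borel_measurable borel" "f2 \<in> borel_measurable borel"
    unfolding f1_def f2_def pt_eq by measurable
  have nn: "(\<integral>\<^sup>+x. ennreal \<bar>partial j f x\<bar> \<partial>lborel) = ennreal (\<integral>x. \<bar>partial j f x\<bar> \<partial>lborel)" for j
    by (intro nn_integral_eq_integral integrable_abs partial_integrable[OF assms]) auto
  have "(\<integral>\<^sup>+x. ennreal ((f x)\<^sup>2) \<partial>lborel) = (\<integral>\<^sup>+x. \<integral>\<^sup>+y. ennreal ((f (pt x y))\<^sup>2) \<partial>lborel \<partial>lborel)"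
    by (rule nn_integral_real2) measurable
  also have "\<dots> \<le> (\<integral>\<^sup>+x. \<integral>\<^sup>+y. f2 x * f1 y \<partial>lborel \<partial>lborel)"
  proof (intro nn_integral_mono)
    fix x y
    have "ennreal ((f (pt x y))\<^sup>2) = ennreal \<bar>f (pt x y)\<bar> * ennreal \<bar>f (pt x y)\<bar>"
      by (simp add: ennreal_mult[symmetric] power2_eq_square abs_mult[symmetric])
    also have "\<dots> \<le> f2 x * f1 y"
      unfolding f1_def f2_def by (intro mult_mono bound_partial_line[OF assms]) auto
    finally show "ennreal ((f (pt x y))\<^sup>2) \<le> f2 x * f1 y" .
  qed
  also have "\<dots> = (\<integral>\<^sup>+x. f2 x \<partial>lborel) * (\<integral>\<^sup>+y. f1 y \<partial>lborel)"
    by (simp add: nn_integral_cmult nn_integral_multc)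
  also have "(\<integral>\<^sup>+x. f2 x \<partial>lborel) = (\<integral>\<^sup>+x. ennreal \<bar>partial 2 f x\<bar> \<partial>lborel)"
    unfolding f2_def by (subst nn_integral_real2(1)) auto
  also have "(\<integral>\<^sup>+x. f1 x \<partial>lborel) = (\<integral>\<^sup>+x. ennreal \<bar>partial 1 f x\<bar> \<partial>lborel)"
    unfolding f1_def by (subst nn_integral_real2(2)) auto
  finally have le: "(\<integral>\<^sup>+x. ennreal ((f x)\<^sup>2) \<partial>lborel) \<le>
      ennreal ((\<integral>x. \<bar>partial 1 f x\<bar> \<partial>lborel) * (\<integral>x. \<bar>partial 2 f x\<bar> \<partial>lborel))"
    by (simp add: nn ennreal_mult mult.commute)
  have "integrable lborel (\<lambda>x. (f x)\<^sup>2)"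
    by (rule integrable_continuous_bounded_support[where R = R])
      (auto intro!: continuous_on_power smooth_continuous[OF assms(1)] simp: assms(2))
  then have "(\<integral>\<^sup>+x. ennreal ((f x)\<^sup>2) \<partial>lborel) = ennreal (\<integral>x. (f x)\<^sup>2 \<partial>lborel)"
    by (intro nn_integral_eq_integral) auto
  with le show ?thesis
    by (simp add: ennreal_le_iff)
qed

section \<open>Square integrable functions\<close>

lemma
  fixes f g :: "'a \<Rightarrow> real"
  assumes [measurable]: "f \<in> borel_measurable M" "g \<in> borel_measurable M"
    and int: "integrable M (\<lambda>x. (f x)\<^sup>2)" "integrable M (\<lambda>x. (g x)\<^sup>2)"
  shows integrable_mult_square: "integrable M (\<lambda>x. f x * g x)"
    and Cauchy_Schwarz_integral_abs:
      "(\<integral>x. \<bar>f x * g x\<bar> \<partial>M) \<le> sqrt (\<integral>x. (f x)\<^sup>2 \<partial>M) * sqrt (\<integral>x. (g x)\<^sup>2 \<partial>M)"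
proof -
  have bound: "\<bar>f x * g x\<bar> \<le> (f x)\<^sup>2 + (g x)\<^sup>2" for x
    using sum_squares_bound[of "\<bar>f x\<bar>" "\<bar>g x\<bar>"] zero_le_power2[of "f x"] zero_le_power2[of "g x"]
    unfolding abs_mult power2_abs by linarith
  show fg: "integrable M (\<lambda>x. f x * g x)"
    by (rule Bochner_Integration.integrable_bound[OF Bochner_Integration.integrable_add[OF int]])
      (use bound in \<open>auto intro!: AE_I2 order_trans[OF bound]\<close>)
  have "(\<integral>\<^sup>+x. ennreal \<bar>f x\<bar> * ennreal \<bar>g x\<bar> \<partial>M)\<^sup>2
      \<le> (\<integral>\<^sup>+x. (ennreal \<bar>f x\<bar>)\<^sup>2 \<partial>M) * (\<integral>\<^sup>+x. (ennreal \<bar>g x\<bar>)\<^sup>2 \<partial>M)"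
    by (rule Cauchy_Schwarz_nn_integral) auto
  also have "(\<integral>\<^sup>+x. (ennreal \<bar>f x\<bar>)\<^sup>2 \<partial>M) = ennreal (\<integral>x. (f x)\<^sup>2 \<partial>M)"
    by (subst nn_integral_eq_integral[OF int(1), symmetric]) (auto simp: ennreal_power)
  also have "(\<integral>\<^sup>+x. (ennreal \<bar>g x\<bar>)\<^sup>2 \<partial>M) = ennreal (\<integral>x. (g x)\<^sup>2 \<partial>M)"
    by (subst nn_integral_eq_integral[OF int(2), symmetric]) (auto simp: ennreal_power)
  also have "(\<integral>\<^sup>+x. ennreal \<bar>f x\<bar> * ennreal \<bar>g x\<bar> \<partial>M) = ennreal (\<integral>x. \<bar>f x * g x\<bar> \<partial>M)"
    by (subst nn_integral_eq_integral[OF integrable_abs[OF fg], symmetric])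
      (auto simp: ennreal_mult abs_mult)
  finally have "(\<integral>x. \<bar>f x * g x\<bar> \<partial>M)\<^sup>2 \<le> (\<integral>x. (f x)\<^sup>2 \<partial>M) * (\<integral>x. (g x)\<^sup>2 \<partial>M)"
    by (simp add: ennreal_power ennreal_mult[symmetric] ennreal_le_iff)
  then show "(\<integral>x. \<bar>f x * g x\<bar> \<partial>M) \<le> sqrt (\<integral>x. (f x)\<^sup>2 \<partial>M) * sqrt (\<integral>x. (g x)\<^sup>2 \<partial>M)"
    by (metis real_le_rsqrt real_sqrt_mult)
qed

lemma
  fixes f g :: "'a \<Rightarrow> 'b::euclidean_space"
  assumes [measurable]: "f \<in> borel_measurable M" "g \<in> borel_measurable M"
    and int: "integrable M (\<lambda>x. norm (f x) ^ 2)" "integrable M (\<lambda>x. norm (g x) ^ 2)"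
  shows integrable_inner_square: "integrable M (\<lambda>x. f x \<bullet> g x)"
    and Cauchy_Schwarz_integral_inner:
      "\<bar>\<integral>x. f x \<bullet> g x \<partial>M\<bar> \<le> sqrt (\<integral>x. norm (f x) ^ 2 \<partial>M) * sqrt (\<integral>x. norm (g x) ^ 2 \<partial>M)"
proof -
  have i: "integrable M (\<lambda>x. norm (f x) * norm (g x))"
    by (rule integrable_mult_square) (use int in auto)
  show fg: "integrable M (\<lambda>x. f x \<bullet> g x)"
    by (rule Bochner_Integration.integrable_bound[OF i]) (auto simp: Cauchy_Schwarz_ineq2)
  have "\<bar>\<integral>x. f x \<bullet> g x \<partial>M\<bar> \<le> (\<integral>x. \<bar>norm (f x) * norm (g x)\<bar> \<partial>M)"
    using i by (intro integral_abs_bound[THEN order_trans] integral_mono integrable_abs fg)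
      (auto simp: Cauchy_Schwarz_ineq2)
  also have "\<dots> \<le> sqrt (\<integral>x. norm (f x) ^ 2 \<partial>M) * sqrt (\<integral>x. norm (g x) ^ 2 \<partial>M)"
    by (rule Cauchy_Schwarz_integral_abs) (use int in auto)
  finally show "\<bar>\<integral>x. f x \<bullet> g x \<partial>M\<bar> \<le> sqrt (\<integral>x. norm (f x) ^ 2 \<partial>M) * sqrt (\<integral>x. norm (g x) ^ 2 \<partial>M)" .
qed

lemma integrable_square_add:
  fixes f g :: "'a \<Rightarrow> 'b::euclidean_space"
  assumes [measurable]: "f \<in> borel_measurable M" "g \<in> borel_measurable M"
    and int: "integrable M (\<lambda>x. norm (f x) ^ 2)" "integrable M (\<lambda>x. norm (g x) ^ 2)"
  shows "integrable M (\<lambda>x. norm (f x + g x) ^ 2)"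
proof -
  have "norm (f x + g x) ^ 2 = norm (f x) ^ 2 + 2 * (f x \<bullet> g x) + norm (g x) ^ 2" for x
    by (simp add: power2_norm_eq_inner inner_add_left inner_add_right inner_commute)
  then show ?thesis
    using int integrable_inner_square[OF assms] by simp
qed

lemma Fatou_norm_power:
  fixes f :: "'a \<Rightarrow> 'b::euclidean_space"
  assumes [measurable]: "\<And>n. F n \<in> borel_measurable M" "f \<in> borel_measurable M"
    and AE: "AE x in M. (\<lambda>n. F n x) \<longlonglongrightarrow> f x"
    and int: "\<And>n. integrable M (\<lambda>x. norm (F n x) ^ q)"
    and le: "\<And>n. (\<integral>x. norm (F n x) ^ q \<partial>M) \<le> K n" and K: "K \<longlonglongrightarrow> L"
  shows "integrable M (\<lambda>x. norm (f x) ^ q)" "(\<integral>x. norm (f x) ^ q \<partial>M) \<le> L"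
proof -
  have K0: "K n \<ge> 0" for n
    by (rule order_trans[OF _ le]) (auto intro!: integral_nonneg_AE)
  have L0: "L \<ge> 0" using LIMSEQ_le_const[OF K] K0 by blast
  have "(\<integral>\<^sup>+x. ennreal (norm (f x) ^ q) \<partial>M) = (\<integral>\<^sup>+x. liminf (\<lambda>n. ennreal (norm (F n x) ^ q)) \<partial>M)"
  proof (rule nn_integral_cong_AE)
    show "AE x in M. ennreal (norm (f x) ^ q) = liminf (\<lambda>n. ennreal (norm (F n x) ^ q))"
      using AE
    proof eventually_elim
      case (elim x)
      have "(\<lambda>n. ennreal (norm (F n x) ^ q)) \<longlonglongrightarrow> ennreal (norm (f x) ^ q)"
        by (intro tendsto_ennrealI tendsto_power tendsto_norm elim)
      then show ?case using lim_imp_Liminf[OF sequentially_bot] by metis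
    qed
  qed
  also have "\<dots> \<le> liminf (\<lambda>n. \<integral>\<^sup>+x. ennreal (norm (F n x) ^ q) \<partial>M)"
    by (rule nn_integral_liminf) auto
  also have "\<dots> \<le> liminf (\<lambda>n. ennreal (K n))"
  proof (rule Liminf_mono, rule always_eventually, rule allI)
    fix n
    show "(\<integral>\<^sup>+x. ennreal (norm (F n x) ^ q) \<partial>M) \<le> ennreal (K n)"
      by (subst nn_integral_eq_integral[OF int]) (auto intro: ennreal_leI le)
  qed
  also have "\<dots> = ennreal L"
    using lim_imp_Liminf[OF sequentially_bot tendsto_ennrealI[OF K]] .
  finally have le: "(\<integral>\<^sup>+x. ennreal (norm (f x) ^ q) \<partial>M) \<le> ennreal L" .
  show i: "integrable M (\<lambda>x. norm (f x) ^ q)"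
  proof (rule integrableI_bounded)
    show "(\<integral>\<^sup>+ x. ennreal (norm (norm (f x) ^ q)) \<partial>M) < \<infinity>"
      using le by (simp add: order_le_less_trans)
  qed simp
  show "(\<integral>x. norm (f x) ^ q \<partial>M) \<le> L"
    using le L0 by (subst (asm) nn_integral_eq_integral[OF i]) (auto simp: ennreal_le_iff)
qed

lemma Lspace_measurable: "u \<in> Lspace \<Omega> q \<Longrightarrow> u \<in> borel_measurable (lebesgue_on \<Omega>)"
  and Lspace_integrable: "u \<in> Lspace \<Omega> q \<Longrightarrow> integrable (lebesgue_on \<Omega>) (\<lambda>x. norm (u x) ^ q)"
  by (simp_all add: Lspace_def)

lemma Lnorm_nonneg: "Lnorm \<Omega> q u \<ge> 0"
  unfolding Lnorm_def
  by (cases "q = 0") (auto intro!: real_root_ge_zero integral_nonneg_AE)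

lemma Lnorm_power: "q > 0 \<Longrightarrow> Lnorm \<Omega> q u ^ q = (LINT x|lebesgue_on \<Omega>. norm (u x) ^ q)"
  unfolding Lnorm_def by (intro real_root_pow_pos2) (auto intro!: integral_nonneg_AE)

lemma Lnorm_2: "Lnorm \<Omega> 2 u = sqrt (LINT x|lebesgue_on \<Omega>. norm (u x) ^ 2)"
  by (simp add: Lnorm_def sqrt_def)

lemma Lspace2_add:
  assumes "u \<in> Lspace \<Omega> 2" "v \<in> Lspace \<Omega> 2"
  shows "(\<lambda>x. u x + v x) \<in> Lspace \<Omega> 2"
  using assms integrable_square_add by (auto simp: Lspace_def)

lemma Lspace_scale:
  assumes "u \<in> Lspace \<Omega> q"
  shows "(\<lambda>x. c *\<^sub>R u x) \<in> Lspace \<Omega> q"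
  using assms by (auto simp: Lspace_def power_mult_distrib)

lemma Lspace2_diff:
  assumes "u \<in> Lspace \<Omega> 2" "v \<in> Lspace \<Omega> 2"
  shows "(\<lambda>x. u x - v x) \<in> Lspace \<Omega> 2"
  using Lspace2_add[OF assms(1) Lspace_scale[OF assms(2), of "-1"]] by simp

lemma pairing_integrable:
  assumes "u \<in> Lspace \<Omega> 2" "v \<in> Lspace \<Omega> 2"
  shows "integrable (lebesgue_on \<Omega>) (\<lambda>x. u x \<bullet> v x)"
  using assms integrable_inner_square by (auto simp: Lspace_def)

lemma pairing_Cauchy_Schwarz:
  assumes "u \<in> Lspace \<Omega> 2" "v \<in> Lspace \<Omega> 2"
  shows "\<bar>pairing \<Omega> u v\<bar> \<le> Lnorm \<Omega> 2 u * Lnorm \<Omega> 2 v"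
  using assms Cauchy_Schwarz_integral_inner by (auto simp: Lspace_def pairing_def Lnorm_2)

lemma pairing_commute: "pairing \<Omega> u v = pairing \<Omega> v u"
  by (simp add: pairing_def inner_commute)

lemma pairing_self: "pairing \<Omega> u u = Lnorm \<Omega> 2 u ^ 2"
  by (simp add: pairing_def Lnorm_power power2_norm_eq_inner)

lemma pairing_add_left:
  assumes "u \<in> Lspace \<Omega> 2" "v \<in> Lspace \<Omega> 2" "w \<in> Lspace \<Omega> 2"
  shows "pairing \<Omega> (\<lambda>x. u x + v x) w = pairing \<Omega> u w + pairing \<Omega> v w"
  using pairing_integrable[OF assms(1,3)] pairing_integrable[OF assms(2,3)]
  by (simp add: pairing_def inner_add_left)

lemma pairing_diff_left:
  assumes "u \<in> Lspace \<Omega> 2" "v \<in> Lspace \<Omega> 2" "w \<in> Lspace \<Omega> 2"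
  shows "pairing \<Omega> (\<lambda>x. u x - v x) w = pairing \<Omega> u w - pairing \<Omega> v w"
  using pairing_integrable[OF assms(1,3)] pairing_integrable[OF assms(2,3)]
  by (simp add: pairing_def inner_diff_left)

lemma pairing_scale_left: "pairing \<Omega> (\<lambda>x. c *\<^sub>R u x) w = c * pairing \<Omega> u w"
  by (simp add: pairing_def)

lemma pairing_add_right:
  assumes "u \<in> Lspace \<Omega> 2" "v \<in> Lspace \<Omega> 2" "w \<in> Lspace \<Omega> 2"
  shows "pairing \<Omega> w (\<lambda>x. u x + v x) = pairing \<Omega> w u + pairing \<Omega> w v"
  using pairing_add_left[OF assms] by (simp add: pairing_commute)

lemma pairing_diff_right:
  assumes "u \<in> Lspace \<Omega> 2" "v \<in> Lspace \<Omega> 2" "w \<in> Lspace \<Omega> 2"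
  shows "pairing \<Omega> w (\<lambda>x. u x - v x) = pairing \<Omega> w u - pairing \<Omega> w v"
  using pairing_diff_left[OF assms] by (simp add: pairing_commute)

lemma pairing_cong_AE:
  assumes "u \<in> borel_measurable (lebesgue_on \<Omega>)" "u' \<in> borel_measurable (lebesgue_on \<Omega>)"
    "v \<in> borel_measurable (lebesgue_on \<Omega>)" "v' \<in> borel_measurable (lebesgue_on \<Omega>)"
    "AE x in lebesgue_on \<Omega>. u x = u' x" "AE x in lebesgue_on \<Omega>. v x = v' x"
  shows "pairing \<Omega> u v = pairing \<Omega> u' v'"
  unfolding pairing_def
  by (rule integral_cong_AE) (use assms in auto)

lemma Lnorm_cong_AE:
  assumes "u \<in> borel_measurable (lebesgue_on \<Omega>)" "v \<in> borel_measurable (lebesgue_on \<Omega>)"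
    "AE x in lebesgue_on \<Omega>. u x = v x"
  shows "Lnorm \<Omega> q u = Lnorm \<Omega> q v"
  unfolding Lnorm_def
  by (rule arg_cong[where f = "root q"], rule integral_cong_AE) (use assms in auto)

lemma Lnorm_scale: "Lnorm \<Omega> 2 (\<lambda>x. c *\<^sub>R u x) = \<bar>c\<bar> * Lnorm \<Omega> 2 u"
  by (simp add: Lnorm_2 power_mult_distrib real_sqrt_mult)

lemma Lnorm2_diff_square:
  assumes "u \<in> Lspace \<Omega> 2" "v \<in> Lspace \<Omega> 2"
  shows "Lnorm \<Omega> 2 (\<lambda>x. u x - v x) ^ 2 = Lnorm \<Omega> 2 u ^ 2 - 2 * pairing \<Omega> u v + Lnorm \<Omega> 2 v ^ 2"
  using assms Lspace2_diff[OF assms]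
  by (simp add: pairing_self[symmetric] pairing_diff_left pairing_diff_right)
    (simp add: pairing_commute)

lemma Lnorm2_add_square:
  assumes "u \<in> Lspace \<Omega> 2" "v \<in> Lspace \<Omega> 2"
  shows "Lnorm \<Omega> 2 (\<lambda>x. u x + v x) ^ 2 = Lnorm \<Omega> 2 u ^ 2 + 2 * pairing \<Omega> u v + Lnorm \<Omega> 2 v ^ 2"
  using assms Lspace2_add[OF assms]
  by (simp add: pairing_self[symmetric] pairing_add_left pairing_add_right)
    (simp add: pairing_commute)

lemma Lnorm2_triangle:
  assumes "u \<in> Lspace \<Omega> 2" "v \<in> Lspace \<Omega> 2"
  shows "Lnorm \<Omega> 2 (\<lambda>x. u x + v x) \<le> Lnorm \<Omega> 2 u + Lnorm \<Omega> 2 v"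
proof (rule power2_le_imp_le)
  show "Lnorm \<Omega> 2 (\<lambda>x. u x + v x) ^ 2 \<le> (Lnorm \<Omega> 2 u + Lnorm \<Omega> 2 v) ^ 2"
    unfolding Lnorm2_add_square[OF assms] power2_sum
    using pairing_Cauchy_Schwarz[OF assms] by (simp add: abs_le_iff)
qed (simp add: Lnorm_nonneg)

lemma Lnorm2_minus_commute: "Lnorm \<Omega> 2 (\<lambda>x. u x - v x) = Lnorm \<Omega> 2 (\<lambda>x. v x - u x)"
  by (simp add: Lnorm_2 norm_minus_commute)

lemma Lnorm2_diff_triangle:
  assumes "u \<in> Lspace \<Omega> 2" "v \<in> Lspace \<Omega> 2" "w \<in> Lspace \<Omega> 2"
  shows "Lnorm \<Omega> 2 (\<lambda>x. u x - w x) \<le> Lnorm \<Omega> 2 (\<lambda>x. u x - v x) + Lnorm \<Omega> 2 (\<lambda>x. v x - w x)"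
  using Lnorm2_triangle[OF Lspace2_diff[OF assms(1,2)] Lspace2_diff[OF assms(2,3)]] by simp

lemma Lnorm2_tendsto_AE_subseq:
  fixes v :: "nat \<Rightarrow> real^2 \<Rightarrow> 'b::euclidean_space"
  assumes "\<And>n. v n \<in> Lspace \<Omega> 2" "u \<in> Lspace \<Omega> 2"
    and lim: "(\<lambda>n. Lnorm \<Omega> 2 (\<lambda>x. u x - v n x)) \<longlonglongrightarrow> 0"
  obtains r :: "nat \<Rightarrow> nat" where "strict_mono r" "AE x in lebesgue_on \<Omega>. (\<lambda>n. v (r n) x) \<longlonglongrightarrow> u x"
proof -
  have "(\<lambda>n. Lnorm \<Omega> 2 (\<lambda>x. u x - v n x) ^ 2) \<longlonglongrightarrow> 0"
    using tendsto_power[OF lim, of 2] by simp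
  then have "(\<lambda>n. LINT x|lebesgue_on \<Omega>. norm (norm (u x - v n x) ^ 2)) \<longlonglongrightarrow> 0"
    by (simp add: Lnorm_power)
  moreover have "integrable (lebesgue_on \<Omega>) (\<lambda>x. norm (u x - v n x) ^ 2)" for n
    using Lspace_integrable[OF Lspace2_diff[OF assms(2,1)]] .
  ultimately obtain r where r: "strict_mono r" "AE x in lebesgue_on \<Omega>. (\<lambda>n. norm (u x - v (r n) x) ^ 2) \<longlonglongrightarrow> 0"
    using tendsto_L1_AE_subseq[of "lebesgue_on \<Omega>" "\<lambda>n x. norm (u x - v n x) ^ 2"] by auto
  have "AE x in lebesgue_on \<Omega>. (\<lambda>n. v (r n) x) \<longlonglongrightarrow> u x"
    using r(2)
  proof eventually_elim
    case (elim x)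
    then have "(\<lambda>n. sqrt (norm (u x - v (r n) x) ^ 2)) \<longlonglongrightarrow> sqrt 0" by (intro tendsto_real_sqrt)
    then have "(\<lambda>n. dist (v (r n) x) (u x)) \<longlonglongrightarrow> 0" by (simp add: dist_norm norm_minus_commute)
    then show ?case using tendsto_dist_iff by blast
  qed
  with r(1) show ?thesis using that by blast
qed

lemma finite_measure_lebesgue_on_bounded:
  fixes \<Omega> :: "'a::euclidean_space set"
  assumes "bounded \<Omega>" "\<Omega> \<in> sets lebesgue"
  shows "finite_measure (lebesgue_on \<Omega>)"
proof
  have "\<Omega> \<in> lmeasurable" by (rule bounded_set_imp_lmeasurable[OF assms])
  then have "emeasure lebesgue \<Omega> \<noteq> \<infinity>" by (auto simp: fmeasurable_def)
  then show "emeasure (lebesgue_on \<Omega>) (space (lebesgue_on \<Omega>)) \<noteq> \<infinity>"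
    using assms(2) by (simp add: emeasure_restrict_space)
qed

lemma Lspace2_complete:
  fixes v :: "nat \<Rightarrow> real^2 \<Rightarrow> 'b::euclidean_space"
  assumes fin: "finite_measure (lebesgue_on \<Omega>)" and v: "\<And>n. v n \<in> Lspace \<Omega> 2"
    and Cauchy: "\<And>e. e > 0 \<Longrightarrow> \<exists>N. \<forall>m\<ge>N. \<forall>n\<ge>N. Lnorm \<Omega> 2 (\<lambda>x. v m x - v n x) < e"
  obtains u where "u \<in> Lspace \<Omega> 2" "(\<lambda>n. Lnorm \<Omega> 2 (\<lambda>x. u x - v n x)) \<longlonglongrightarrow> 0"
proof -
  let ?M = "lebesgue_on \<Omega>"
  have [measurable]: "v n \<in> borel_measurable ?M" for n using v by (rule Lspace_measurable)
  have "\<exists>r. strict_mono r \<and> (\<forall>n. \<forall>m\<ge>r n. Lnorm \<Omega> 2 (\<lambda>x. v m x - v (r n) x) < (1/2) ^ n)"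
  proof -
    have ex: "\<exists>N>k. \<forall>m\<ge>N. Lnorm \<Omega> 2 (\<lambda>x. v m x - v N x) < (1/2) ^ n" for k n
    proof -
      obtain N where N: "\<forall>m\<ge>N. \<forall>n'\<ge>N. Lnorm \<Omega> 2 (\<lambda>x. v m x - v n' x) < (1/2) ^ n"
        using Cauchy[of "(1/2) ^ n"] by auto
      then show ?thesis by (intro exI[of _ "max N (Suc k)"]) auto
    qed
    define r where "r = rec_nat (SOME N. \<forall>m\<ge>N. Lnorm \<Omega> 2 (\<lambda>x. v m x - v N x) < (1/2) ^ 0)
       (\<lambda>n k. SOME N. N > k \<and> (\<forall>m\<ge>N. Lnorm \<Omega> 2 (\<lambda>x. v m x - v N x) < (1/2) ^ Suc n))"
    have r0: "\<forall>m\<ge>r 0. Lnorm \<Omega> 2 (\<lambda>x. v m x - v (r 0) x) < (1/2) ^ 0"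
      unfolding r_def using someI_ex[of "\<lambda>N. \<forall>m\<ge>N. Lnorm \<Omega> 2 (\<lambda>x. v m x - v N x) < (1/2) ^ 0"] ex[of 0 0]
      by auto
    have rS: "r (Suc n) > r n \<and> (\<forall>m\<ge>r (Suc n). Lnorm \<Omega> 2 (\<lambda>x. v m x - v (r (Suc n)) x) < (1/2) ^ Suc n)" for n
      using someI_ex[OF ex[of "r n" "Suc n"]] unfolding r_def by auto
    have "\<forall>m\<ge>r n. Lnorm \<Omega> 2 (\<lambda>x. v m x - v (r n) x) < (1/2) ^ n" for n
      using r0 rS by (cases n) blast+
    then show ?thesis using rS strict_mono_Suc_iff by blast
  qed
  then obtain r where r: "strict_mono r" "\<And>n m. m \<ge> r n \<Longrightarrow> Lnorm \<Omega> 2 (\<lambda>x. v m x - v (r n) x) < (1/2) ^ n"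
    by blast
  define d where "d n x = v (r (Suc n)) x - v (r n) x" for n x
  have d: "d n \<in> Lspace \<Omega> 2" for n unfolding d_def by (intro Lspace2_diff v)
  then have [measurable]: "d n \<in> borel_measurable ?M" for n by (rule Lspace_measurable)
  have one: "integrable ?M (\<lambda>x. 1::real)" using finite_measure.integrable_const[OF fin] by blast
  define C where "C = sqrt (\<integral>x. 1 \<partial>?M)"
  have C0: "C \<ge> 0" by (simp add: C_def)
  have d1: "integrable ?M (\<lambda>x. norm (d n x))" for n
    using integrable_mult_square[of "\<lambda>x. norm (d n x)" ?M "\<lambda>x. 1"] Lspace_integrable[OF d] one by auto
  have d2: "(\<integral>x. norm (d n x) \<partial>?M) \<le> (1/2) ^ n * C" for n
  proof -
    have "(\<integral>x. norm (d n x) \<partial>?M) \<le> Lnorm \<Omega> 2 (d n) * C"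
      using Cauchy_Schwarz_integral_abs[of "\<lambda>x. norm (d n x)" ?M "\<lambda>x. 1"] Lspace_integrable[OF d] one
      by (auto simp: Lnorm_2 C_def)
    also have "\<dots> \<le> (1/2) ^ n * C"
      using r(2)[of n "r (Suc n)"] r(1) C0 unfolding d_def
      by (intro mult_right_mono) (auto simp: strict_mono_def less_imp_le)
    finally show ?thesis .
  qed
  have "(\<integral>\<^sup>+x. (\<Sum>n. ennreal (norm (d n x))) \<partial>?M) = (\<Sum>n. \<integral>\<^sup>+x. ennreal (norm (d n x)) \<partial>?M)"
    by (rule nn_integral_suminf) measurable
  also have "\<dots> \<le> (\<Sum>n. ennreal ((1/2) ^ n * C))"
  proof (rule suminf_le)
    show "(\<integral>\<^sup>+x. ennreal (norm (d n x)) \<partial>?M) \<le> ennreal ((1/2) ^ n * C)" for n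
      by (subst nn_integral_eq_integral[OF d1]) (auto intro: ennreal_leI d2)
  qed auto
  also have "\<dots> = ennreal (\<Sum>n. (1/2) ^ n * C)"
    using C0 by (intro suminf_ennreal2) (auto intro!: summable_mult2 summable_geometric)
  also have "\<dots> < \<infinity>" by simp
  finally have "AE x in ?M. (\<Sum>n. ennreal (norm (d n x))) \<noteq> \<infinity>"
    by (intro nn_integral_PInf_AE) auto
  then have conv: "AE x in ?M. convergent (\<lambda>n. v (r n) x)"
  proof eventually_elim
    case (elim x)
    then have "summable (\<lambda>n. norm (d n x))"
      by (intro summable_suminf_not_top) auto
    then have "summable (\<lambda>n. d n x)" by (rule summable_norm_cancel)
    then have "convergent (\<lambda>n. \<Sum>i<n. d i x)" by (simp add: summable_iff_convergent)
    moreover have "(\<Sum>i<n. d i x) = v (r n) x - v (r 0) x" for n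
      unfolding d_def by (rule sum_lessThan_telescope)
    ultimately have "convergent (\<lambda>n. v (r n) x - v (r 0) x)" by simp
    from convergent_add[OF this convergent_const[of "v (r 0) x"]] show ?case by simp
  qed
  define u where "u x = lim (\<lambda>n. v (r n) x)" for x
  have [measurable]: "u \<in> borel_measurable ?M" unfolding u_def by measurable
  have u: "AE x in ?M. (\<lambda>n. v (r n) x) \<longlonglongrightarrow> u x"
    using conv unfolding u_def by eventually_elim (simp add: convergent_LIMSEQ_iff)
  have key: "integrable ?M (\<lambda>x. norm (u x - v m x) ^ 2) \<and> (\<integral>x. norm (u x - v m x) ^ 2 \<partial>?M) \<le> e ^ 2"
    if e: "\<And>n. n \<ge> N \<Longrightarrow> Lnorm \<Omega> 2 (\<lambda>x. v n x - v m x) \<le> e" for m N e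
  proof -
    have le: "(\<integral>x. norm (v (r (n + N)) x - v m x) ^ 2 \<partial>?M) \<le> e ^ 2" for n
    proof -
      have "r (n + N) \<ge> N" using seq_suble[OF r(1), of "n + N"] by linarith
      then have "Lnorm \<Omega> 2 (\<lambda>x. v (r (n + N)) x - v m x) ^ 2 \<le> e ^ 2"
        using e Lnorm_nonneg by (intro power_mono) auto
      then show ?thesis by (simp add: Lnorm_power)
    qed
    have int: "integrable ?M (\<lambda>x. norm (v (r (n + N)) x - v m x) ^ 2)" for n
      by (intro Lspace_integrable Lspace2_diff v)
    have "AE x in ?M. (\<lambda>n. v (r (n + N)) x - v m x) \<longlonglongrightarrow> u x - v m x"
      using u
    proof eventually_elim
      case (elim x)
      show ?case
        using tendsto_diff[OF LIMSEQ_ignore_initial_segment[OF elim, of N] tendsto_const] .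
    qed
    from Fatou_norm_power[OF _ _ this int le tendsto_const] show ?thesis by auto
  qed
  obtain N1 where N1: "\<forall>m\<ge>N1. \<forall>n\<ge>N1. Lnorm \<Omega> 2 (\<lambda>x. v m x - v n x) < 1" using Cauchy[of 1] by auto
  have "(\<lambda>x. u x - v N1 x) \<in> Lspace \<Omega> 2"
    using key[of N1 N1 1] N1 by (auto simp: Lspace_def less_imp_le)
  from Lspace2_add[OF this v[of N1]] have uL: "u \<in> Lspace \<Omega> 2" by simp
  have "(\<lambda>n. Lnorm \<Omega> 2 (\<lambda>x. u x - v n x)) \<longlonglongrightarrow> 0"
  proof (rule LIMSEQ_I)
    fix e :: real assume e: "e > 0"
    obtain N where N: "\<forall>m\<ge>N. \<forall>n\<ge>N. Lnorm \<Omega> 2 (\<lambda>x. v m x - v n x) < e/2" using Cauchy[of "e/2"] e by auto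
    have "norm (Lnorm \<Omega> 2 (\<lambda>x. u x - v m x) - 0) < e" if "m \<ge> N" for m
    proof -
      have "Lnorm \<Omega> 2 (\<lambda>x. u x - v m x) ^ 2 \<le> (e/2) ^ 2"
        using key[of N m "e/2"] N that by (auto simp: less_imp_le Lnorm_power)
      then have "Lnorm \<Omega> 2 (\<lambda>x. u x - v m x) \<le> e/2"
        by (rule power2_le_imp_le) (use e in simp)
      then show ?thesis using e Lnorm_nonneg[of \<Omega> 2 "\<lambda>x. u x - v m x"] by simp
    qed
    then show "\<exists>N. \<forall>n\<ge>N. norm (Lnorm \<Omega> 2 (\<lambda>x. u x - v n x) - 0) < e" by blast
  qed
  with uL show ?thesis using that by blast
qed

section \<open>Test functions and weak gradients\<close>

lemma test_funsI:
  assumes "smooth \<phi>" "compact K" "K \<subseteq> S" "\<And>x. x \<notin> K \<Longrightarrow> \<phi> x = 0"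
  shows "\<phi> \<in> test_funs S"
proof -
  have "closure {x. \<phi> x \<noteq> 0} \<subseteq> K"
    by (rule closure_minimal) (use assms compact_imp_closed in auto)
  moreover have "compact (closure {x. \<phi> x \<noteq> 0})"
    using calculation assms(2) compact_Int_closed[of K "closure {x. \<phi> x \<noteq> 0}"]
    by (simp add: Int_absorb1)
  ultimately show ?thesis using assms by (auto simp: test_funs_def)
qed

lemma test_funsE:
  assumes "\<phi> \<in> test_funs S"
  obtains K where "smooth \<phi>" "compact K" "K \<subseteq> S" "\<forall>x. x \<notin> K \<longrightarrow> \<phi> x = 0"
proof (rule that)
  show "smooth \<phi>" "compact (closure {x. \<phi> x \<noteq> 0})" "closure {x. \<phi> x \<noteq> 0} \<subseteq> S"
    using assms by (auto simp: test_funs_def)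
  show "\<forall>x. x \<notin> closure {x. \<phi> x \<noteq> 0} \<longrightarrow> \<phi> x = 0"
    using closure_subset[of "{x. \<phi> x \<noteq> 0}"] by blast
qed

lemma test_funs_smooth: "\<phi> \<in> test_funs S \<Longrightarrow> smooth \<phi>"
  by (simp add: test_funs_def)

lemma test_funs_eq_0: "\<phi> \<in> test_funs S \<Longrightarrow> x \<notin> S \<Longrightarrow> \<phi> x = 0"
  by (metis subsetD test_funsE)

lemma test_funs_bounded_support:
  assumes "\<phi> \<in> test_funs S"
  obtains R where "\<And>x. norm x > R \<Longrightarrow> \<phi> x = 0"
proof -
  obtain K where K: "compact K" "\<forall>x. x \<notin> K \<longrightarrow> \<phi> x = 0" using assms by (rule test_funsE)
  obtain R where "\<And>x. x \<in> K \<Longrightarrow> norm x \<le> R" using compact_imp_bounded[OF K(1)] by (auto simp: bounded_iff)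
  with K(2) show ?thesis using that[of R] by force
qed

lemma test_funs_add: "\<phi> \<in> test_funs S \<Longrightarrow> \<psi> \<in> test_funs S \<Longrightarrow> (\<lambda>x. \<phi> x + \<psi> x) \<in> test_funs S"
proof -
  assume "\<phi> \<in> test_funs S" "\<psi> \<in> test_funs S"
  then obtain K L where "smooth \<phi>" "compact K" "K \<subseteq> S" "\<forall>x. x \<notin> K \<longrightarrow> \<phi> x = 0"
    "smooth \<psi>" "compact L" "L \<subseteq> S" "\<forall>x. x \<notin> L \<longrightarrow> \<psi> x = 0"
    by (elim test_funsE)
  then show ?thesis by (intro test_funsI[of _ "K \<union> L"] smooth_add) auto
qed

lemma test_funs_bounded_linear:
  assumes "\<phi> \<in> test_funs S" "bounded_linear L"
  shows "(\<lambda>x. L (\<phi> x)) \<in> test_funs S"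
proof -
  obtain K where "smooth \<phi>" "compact K" "K \<subseteq> S" "\<forall>x. x \<notin> K \<longrightarrow> \<phi> x = 0" using assms(1) by (rule test_funsE)
  moreover have "L 0 = 0" using assms(2) by (simp add: bounded_linear.linear linear_0)
  ultimately show ?thesis
    by (intro test_funsI[of _ K] smooth_bounded_linear[OF _ assms(2)]) simp_all
qed

lemma test_funs_mult:
  fixes \<phi> \<psi> :: "'a::euclidean_space \<Rightarrow> real"
  assumes "\<phi> \<in> test_funs S" "smooth \<psi>"
  shows "(\<lambda>x. \<phi> x * \<psi> x) \<in> test_funs S"
proof -
  obtain K where "smooth \<phi>" "compact K" "K \<subseteq> S" "\<forall>x. x \<notin> K \<longrightarrow> \<phi> x = 0" using assms(1) by (rule test_funsE)
  then show ?thesis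
    using assms(2) by (intro test_funsI[of _ K] smooth_mult) auto
qed

lemma test_funs_frechet_derivative:
  assumes "\<phi> \<in> test_funs S"
  shows "(\<lambda>x. frechet_derivative \<phi> (at x) v) \<in> test_funs S"
proof -
  obtain K where K: "smooth \<phi>" "compact K" "K \<subseteq> S" "\<forall>x. x \<notin> K \<longrightarrow> \<phi> x = 0" using assms(1) by (rule test_funsE)
  have "frechet_derivative \<phi> (at x) v = 0" if "x \<notin> K" for x
  proof -
    have "(\<phi> has_derivative (\<lambda>v. 0)) (at x)"
      by (rule has_derivative_transform_within_open[of "\<lambda>x. 0" "\<lambda>v. 0" x UNIV "- K" \<phi>])
        (use K that in \<open>auto simp: compact_imp_closed\<close>)
    then have "frechet_derivative \<phi> (at x) = (\<lambda>v. 0)"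
      using frechet_derivative_at by metis
    then show ?thesis by simp
  qed
  with K show ?thesis by (intro test_funsI[of _ K] smooth_frechet_derivative) auto
qed

lemma frechet_derivative_bounded_linear:
  assumes "smooth \<phi>" "bounded_linear L"
  shows "frechet_derivative (\<lambda>x. L (\<phi> x)) (at x) v = L (frechet_derivative \<phi> (at x) v)"
  using frechet_derivative_at[OF bounded_linear.has_derivative[OF assms(2) smooth_has_derivative[OF assms(1)]]]
  by metis

lemma frechet_derivative_mult:
  fixes \<phi> \<psi> :: "'a::euclidean_space \<Rightarrow> real"
  assumes "smooth \<phi>" "smooth \<psi>"
  shows "frechet_derivative (\<lambda>x. \<phi> x * \<psi> x) (at x) v
    = \<phi> x * frechet_derivative \<psi> (at x) v + frechet_derivative \<phi> (at x) v * \<psi> x"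
  using frechet_derivative_at[OF has_derivative_mult[OF smooth_has_derivative[OF assms(1)] smooth_has_derivative[OF assms(2)]]]
  by metis

lemma frechet_derivative_add:
  assumes "smooth \<phi>" "smooth \<psi>"
  shows "frechet_derivative (\<lambda>x. \<phi> x + \<psi> x) (at x) v
    = frechet_derivative \<phi> (at x) v + frechet_derivative \<psi> (at x) v"
  using frechet_derivative_at[OF has_derivative_add[OF smooth_has_derivative[OF assms(1)] smooth_has_derivative[OF assms(2)]]]
  by metis

definition classical_grad :: "field \<Rightarrow> real^2 \<Rightarrow> real^2^2" where
  "classical_grad \<phi> x = (\<chi> i j. frechet_derivative \<phi> (at x) (axis j 1) $ i)"

lemma classical_grad_nth: "smooth \<phi> \<Longrightarrow> classical_grad \<phi> x $ i $ j = partial j (\<lambda>x. \<phi> x $ i) x"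
  using frechet_derivative_bounded_linear[OF _ bounded_linear_vec_nth, of \<phi> i x "axis j 1"]
  by (simp add: classical_grad_def)

locale planar_domain =
  fixes \<Omega> :: "(real^2) set"
  assumes open_\<Omega>: "open \<Omega>" and bounded_\<Omega>: "bounded \<Omega>"
begin

abbreviation L\<Omega> :: "(real^2) measure" where "L\<Omega> \<equiv> lebesgue_on \<Omega>"

lemma sets_\<Omega>: "\<Omega> \<in> sets lebesgue"
  using open_\<Omega> by (intro sets_completionI_sets) simp

lemma finite_measure_\<Omega>: "finite_measure L\<Omega>"
  by (rule finite_measure_lebesgue_on_bounded[OF bounded_\<Omega> sets_\<Omega>])

lemma borel_measurable_\<Omega>: "f \<in> borel_measurable borel \<Longrightarrow> f \<in> borel_measurable L\<Omega>"
  by (intro measurable_restrict_space1 measurable_completion) simp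

lemma continuous_measurable_\<Omega>:
  fixes f :: "real^2 \<Rightarrow> 'b::euclidean_space"
  shows "continuous_on UNIV f \<Longrightarrow> f \<in> borel_measurable L\<Omega>"
  by (intro borel_measurable_\<Omega> borel_measurable_continuous_onI)

lemma
  fixes f :: "real^2 \<Rightarrow> real"
  assumes [measurable]: "f \<in> borel_measurable borel" and supp: "\<And>x. x \<notin> \<Omega> \<Longrightarrow> f x = 0"
  shows integral_\<Omega>_eq: "(LINT x|L\<Omega>. f x) = (LINT x|lborel. f x)"
    and integrable_\<Omega>_iff: "integrable L\<Omega> f \<longleftrightarrow> integrable lborel f"
proof -
  have eq: "(\<lambda>x. indicator \<Omega> x * f x) = f" using supp by (auto simp: indicator_def fun_eq_iff)
  show "(LINT x|L\<Omega>. f x) = (LINT x|lborel. f x)"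
    using sets_\<Omega> by (simp add: integral_restrict_space eq integral_completion)
  show "integrable L\<Omega> f \<longleftrightarrow> integrable lborel f"
    using sets_\<Omega> by (simp add: integrable_restrict_space eq integrable_completion)
qed

lemma test_fun_Lspace:
  fixes \<phi> :: "real^2 \<Rightarrow> 'b::euclidean_space"
  assumes "\<phi> \<in> test_funs \<Omega>" "q > 0"
  shows "\<phi> \<in> Lspace \<Omega> q"
proof -
  obtain R where R: "\<And>x. norm x > R \<Longrightarrow> \<phi> x = 0" using test_funs_bounded_support[OF assms(1)] by blast
  have c: "continuous_on UNIV \<phi>" using smooth_continuous[OF test_funs_smooth[OF assms(1)]] .
  have 0: "\<phi> x = 0" if "x \<notin> \<Omega>" for x using that by (rule test_funs_eq_0[OF assms(1)])
  have i: "integrable lborel (\<lambda>x. norm (\<phi> x) ^ q)"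
    by (rule integrable_continuous_bounded_support[where R = R])
      (use R assms(2) in \<open>auto intro!: continuous_intros c\<close>)
  have "(\<lambda>x. norm (\<phi> x) ^ q) \<in> borel_measurable borel"
    by (intro borel_measurable_continuous_onI continuous_intros c)
  then have "integrable L\<Omega> (\<lambda>x. norm (\<phi> x) ^ q)"
    using i 0 assms(2) by (subst integrable_\<Omega>_iff) auto
  then show ?thesis using continuous_measurable_\<Omega>[OF c] by (simp add: Lspace_def)
qed

lemma Lspace2_integrable_mult:
  fixes f g :: "real^2 \<Rightarrow> real"
  assumes "f \<in> Lspace \<Omega> 2" "g \<in> Lspace \<Omega> 2"
  shows "integrable L\<Omega> (\<lambda>x. f x * g x)"
  using pairing_integrable[OF assms] by simp

lemma Lspace_component:
  assumes "u \<in> Lspace \<Omega> 2"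
  shows "(\<lambda>x. (u x :: 'b::euclidean_space^'n) $ i) \<in> Lspace \<Omega> 2"
proof -
  have [measurable]: "u \<in> borel_measurable L\<Omega>" using assms by (rule Lspace_measurable)
  have m: "(\<lambda>x. u x $ i) \<in> borel_measurable L\<Omega>"
    by (intro borel_measurable_continuous_on[where f = "\<lambda>z. z $ i"] continuous_intros) measurable
  then have [measurable]: "(\<lambda>x. u x $ i) \<in> borel_measurable L\<Omega>" .
  have "integrable L\<Omega> (\<lambda>x. norm (u x $ i) ^ 2)"
    by (rule Bochner_Integration.integrable_bound[OF Lspace_integrable[OF assms]])
      (auto intro!: AE_I2 power_mono Finite_Cartesian_Product.norm_nth_le)
  then show ?thesis using m by (simp add: Lspace_def)
qed

lemma Lspace2_integrable_mult':
  assumes "u \<in> Lspace \<Omega> 2" "g \<in> Lspace \<Omega> 2"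
  shows "integrable L\<Omega> (\<lambda>x. (u x :: real^2) $ i * g x)"
  by (rule Lspace2_integrable_mult[OF Lspace_component[OF assms(1)] assms(2)])

lemma Lspace2_integrable_mult'':
  assumes "G \<in> Lspace \<Omega> 2" "g \<in> Lspace \<Omega> 2"
  shows "integrable L\<Omega> (\<lambda>x. (G x :: real^2^2) $ i $ j * g x)"
  by (rule Lspace2_integrable_mult[OF Lspace_component[OF Lspace_component[OF assms(1)]] assms(2)])

subsection \<open>Uniqueness of weak gradients\<close>

lemma integral_box_eq_0:
  fixes g :: "real^2 \<Rightarrow> real"
  assumes g: "integrable L\<Omega> g" and tests: "\<And>\<phi>. \<phi> \<in> test_funs \<Omega> \<Longrightarrow> (LINT x|L\<Omega>. g x * \<phi> x) = 0"
    and sub: "cbox a b \<subseteq> \<Omega>"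
  shows "(LINT x|L\<Omega>. indicator (box a b) x * g x) = 0"
proof (cases "a $ 1 < b $ 1 \<and> a $ 2 < b $ 2")
  case False
  then have "box a b = {}" by (auto simp: mem_box_cart forall_2)
  then show ?thesis by simp
next
  case True
  define \<phi> where "\<phi> n x = plateau (a$1) (b$1) n (x $ 1) * plateau (a$2) (b$2) n (x $ 2)" for n and x :: "real^2"
  have sm: "smooth (\<lambda>x::real^2. plateau c d n (x $ i))" for c d n i
    using smooth_affine[OF smooth_plateau bounded_linear_vec_nth, of c d n i 0] by simp
  have smooth: "smooth (\<phi> n)" for n unfolding \<phi>_def by (intro smooth_mult sm)
  have ev: "\<forall>\<^sub>F n in sequentially. real n * c \<ge> 2" if "c > 0" for c
  proof -
    obtain N where N: "2 / c \<le> real N" using real_arch_simple by blast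
    have "real n * c \<ge> 2" if "n \<ge> N" for n
      using order_trans[OF N, of "real n"] that \<open>c > 0\<close> by (simp add: pos_divide_le_eq)
    then show ?thesis by (auto simp: eventually_sequentially)
  qed
  have "\<forall>\<^sub>F n in sequentially. real n * (b$1 - a$1) \<ge> 2" "\<forall>\<^sub>F n in sequentially. real n * (b$2 - a$2) \<ge> 2"
    using ev[of "b$1 - a$1"] ev[of "b$2 - a$2"] True by auto
  then have "\<forall>\<^sub>F n in sequentially. (LINT x|L\<Omega>. g x * \<phi> n x) = 0"
  proof eventually_elim
    case (elim n)
    have "\<phi> n x = 0" if "x \<notin> cbox a b" for x
      using plateau_support[OF elim(1), of "x $ 1"] plateau_support[OF elim(2), of "x $ 2"] that
      by (auto simp: \<phi>_def mem_box_cart forall_2)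
    then have "\<phi> n \<in> test_funs \<Omega>" using smooth sub by (intro test_funsI[of _ "cbox a b"]) auto
    then show ?case by (rule tests)
  qed
  then have 1: "(\<lambda>n. LINT x|L\<Omega>. g x * \<phi> n x) \<longlonglongrightarrow> 0" by (rule tendsto_eventually)
  have [measurable]: "g \<in> borel_measurable L\<Omega>" "\<phi> n \<in> borel_measurable L\<Omega>" for n
    using g continuous_measurable_\<Omega>[OF smooth_continuous[OF smooth]] by auto
  have [measurable]: "(indicator (box a b) :: real^2 \<Rightarrow> real) \<in> borel_measurable L\<Omega>"
    by (rule borel_measurable_\<Omega>) simp
  have "(\<lambda>n. LINT x|L\<Omega>. g x * \<phi> n x) \<longlonglongrightarrow> (LINT x|L\<Omega>. g x * indicator (box a b) x)"
  proof (rule integral_dominated_convergence[where w = "\<lambda>x. \<bar>g x\<bar>"])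
    show "(\<lambda>x. g x * indicator (box a b) x) \<in> borel_measurable L\<Omega>"
      by measurable
    show "AE x in L\<Omega>. (\<lambda>n. g x * \<phi> n x) \<longlonglongrightarrow> g x * indicator (box a b) x"
    proof (rule AE_I2, rule tendsto_mult_left)
      fix x
      have "(\<lambda>n. \<phi> n x) \<longlonglongrightarrow> indicator {a$1<..<b$1} (x$1) * indicator {a$2<..<b$2} (x$2)"
        unfolding \<phi>_def using True by (intro tendsto_mult plateau_tendsto) auto
      also have "indicator {a$1<..<b$1} (x$1) * indicator {a$2<..<b$2} (x$2) = (indicator (box a b) x :: real)"
        by (auto simp: indicator_def mem_box_cart forall_2)
      finally show "(\<lambda>n. \<phi> n x) \<longlonglongrightarrow> indicator (box a b) x" .
    qed
    have "\<bar>\<phi> n x\<bar> \<le> 1" for n x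
      unfolding \<phi>_def abs_mult by (intro mult_le_one plateau_bound) auto
    then show "AE x in L\<Omega>. norm (g x * \<phi> n x) \<le> \<bar>g x\<bar>" for n
      by (auto intro!: AE_I2 mult_left_le simp: abs_mult)
  qed (use g in auto)
  from LIMSEQ_unique[OF this 1] show ?thesis by (simp add: mult.commute)
qed

lemma AE_eq_0_box:
  fixes g :: "real^2 \<Rightarrow> real"
  assumes g: "integrable L\<Omega> g" and tests: "\<And>\<phi>. \<phi> \<in> test_funs \<Omega> \<Longrightarrow> (LINT x|L\<Omega>. g x * \<phi> x) = 0"
    and sub: "cbox a b \<subseteq> \<Omega>"
  shows "AE x in L\<Omega>. x \<in> box a b \<longrightarrow> g x = 0"
proof -
  define h where "h x = indicator \<Omega> x * (indicator (box a b) x * g x)" for x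
  have "integrable L\<Omega> (\<lambda>x. indicator (box a b) x *\<^sub>R g x)"
    by (rule integrable_mult_indicator[OF _ g]) (use subset_trans[OF box_subset_cbox sub] in \<open>simp add: sets_restrict_space_iff sets_\<Omega>\<close>)
  then have int: "integrable lebesgue h"
    using sets_\<Omega> by (simp add: h_def[abs_def] integrable_restrict_space)
  have zero: "(LINT x|lebesgue. indicator (box c d) x * h x) = 0" for c d
  proof -
    have "box c d \<inter> box a b = box (\<Sum>i\<in>Basis. max (c \<bullet> i) (a \<bullet> i) *\<^sub>R i) (\<Sum>i\<in>Basis. min (d \<bullet> i) (b \<bullet> i) *\<^sub>R i)"
      by (rule box_Int_box)
    then obtain e f where ef: "box c d \<inter> box a b = box e f" by blast
    show ?thesis
    proof (cases "box e f = {}")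
      case True
      then have "(\<lambda>x. indicator (box c d) x * h x) = (\<lambda>x. 0)"
        using ef by (auto simp: h_def indicator_def fun_eq_iff)
      then show ?thesis by simp
    next
      case False
      then have "cbox e f \<subseteq> \<Omega>"
      proof -
        have "box e f \<subseteq> cbox a b" using ef box_subset_cbox by blast
        then have "closure (box e f) \<subseteq> cbox a b" by (intro closure_minimal closed_cbox)
        then show ?thesis using closure_box[OF False] sub by auto
      qed
      then have "(LINT x|L\<Omega>. indicator (box e f) x * g x) = 0"
        using tests by (intro integral_box_eq_0[OF g])
      then have "(LINT x|lebesgue. indicator \<Omega> x * (indicator (box e f) x * g x)) = 0"
        using sets_\<Omega> by (simp add: integral_restrict_space)
      moreover have "indicator \<Omega> x * (indicator (box e f) x * g x) = indicator (box c d) x * h x" for x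
        unfolding ef[symmetric] h_def by (auto simp: indicator_def)
      ultimately show ?thesis by simp
    qed
  qed
  have borel: "(LINT x|lebesgue. indicator A x * h x) = 0" if A: "A \<in> sets borel" for A
  proof -
    have *: "Int_stable (range (\<lambda>(a, b). box a b :: (real^2) set))" "range (\<lambda>(a, b). box a b :: (real^2) set) \<subseteq> Pow UNIV"
      by (auto simp: Int_stable_def box_Int_box)
    have s: "A \<in> sigma_sets UNIV (range (\<lambda>(a, b). box a b :: (real^2) set)) \<Longrightarrow> A \<in> sets lebesgue" for A
      by (metis borel_eq_box sets_measure_of space_borel subset_UNIV sets_completionI_sets sets_lborel
          Pow_UNIV)
    have "A \<in> sigma_sets UNIV (range (\<lambda>(a, b). box a b))" using A by (simp add: borel_eq_box)
    from *(1) *(2) this show ?thesis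
    proof (induction rule: sigma_sets_induct_disjoint)
      case (basic A)
      then show ?case using zero by auto
    next
      case (compl A)
      have "(LINT x|lebesgue. indicator (UNIV - A) x * h x) = (LINT x|lebesgue. h x - indicator A x * h x)"
        by (rule Bochner_Integration.integral_cong) (auto simp: indicator_def)
      also have "\<dots> = (LINT x|lebesgue. h x)"
        using int integrable_mult_indicator[OF s[OF compl(1)] int] compl(2) by simp
      also have "h = (\<lambda>x. indicator (box a b) x * h x)" by (auto simp: h_def indicator_def fun_eq_iff)
      then have "(LINT x|lebesgue. h x) = 0" using zero[of a b] by metis
      finally show ?case .
    next
      case (union A)
      have "(LINT x:(\<Union>i. A i)|lebesgue. h x) = (\<Sum>i. LINT x:A i|lebesgue. h x)"
      proof (rule lebesgue_integral_countable_add)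
        show "A i \<in> sets lebesgue" for i using union(2) s by auto
        then have "(\<Union>i. A i) \<in> sets lebesgue" by auto
        then show "set_integrable lebesgue (\<Union>i. A i) h"
          unfolding set_integrable_def by (rule integrable_mult_indicator[OF _ int])
        show "A i \<inter> A j = {}" if "i \<noteq> j" for i j using union(1) that by (auto simp: disjoint_family_on_def)
      qed
      then show ?case using union(3) by (simp add: set_lebesgue_integral_def)
    qed simp
  qed
  have all: "(LINT x|lebesgue. indicator A x * h x) = 0" if A: "A \<in> sets lebesgue" for A
  proof -
    obtain B N N' where BN: "A = B \<union> N" "N \<subseteq> N'" "N' \<in> null_sets lborel" "B \<in> sets lborel"
      using A unfolding sets_completion by blast
    have "(LINT x|lebesgue. indicator A x * h x) = (LINT x|lebesgue. indicator B x * h x)"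
    proof (rule integral_cong_AE)
      have [measurable]: "h \<in> borel_measurable lebesgue" using int by auto
      have "B \<in> sets lebesgue" using BN(4) by simp
      then show "(\<lambda>x. indicator A x * h x) \<in> borel_measurable lebesgue" "(\<lambda>x. indicator B x * h x) \<in> borel_measurable lebesgue"
        using A by measurable
      show "AE x in lebesgue. indicator A x * h x = indicator B x * h x"
        using AE_not_in[OF null_sets_completionI[OF BN(3)]]
        by eventually_elim (use BN(2) in \<open>auto simp: BN(1) indicator_def\<close>)
    qed
    then show ?thesis using borel BN(4) by simp
  qed
  have hm [measurable]: "h \<in> borel_measurable lebesgue" using int by auto
  have pos: "{x. h x > 0} \<in> sets lebesgue" "{x. h x < 0} \<in> sets lebesgue"
    using borel_measurable_less[of "\<lambda>x. 0" lebesgue h] borel_measurable_less[of h lebesgue "\<lambda>x. 0"] hm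
    by auto
  have "AE x in lebesgue. indicator {x. h x > 0} x * h x = 0"
    using all[OF pos(1)] integrable_mult_indicator[OF pos(1) int]
    by (subst (asm) integral_nonneg_eq_0_iff_AE) (auto simp: indicator_def)
  moreover have "AE x in lebesgue. indicator {x. h x < 0} x * - h x = 0"
    using all[OF pos(2)] integrable_mult_indicator[OF pos(2) int]
    by (subst integral_nonneg_eq_0_iff_AE[symmetric]) (auto simp: indicator_def)
  ultimately have "AE x in lebesgue. h x = 0"
    by eventually_elim (auto simp: indicator_def split: if_splits)
  then have "AE x in lebesgue. x \<in> \<Omega> \<longrightarrow> x \<in> box a b \<longrightarrow> g x = 0"
    by eventually_elim (auto simp: h_def indicator_def split: if_splits)
  then show ?thesis using sets_\<Omega> by (simp add: AE_restrict_space_iff)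
qed

lemma AE_eq_0_if_tests:
  fixes g :: "real^2 \<Rightarrow> real"
  assumes g: "integrable L\<Omega> g" and tests: "\<And>\<phi>. \<phi> \<in> test_funs \<Omega> \<Longrightarrow> (LINT x|L\<Omega>. g x * \<phi> x) = 0"
  shows "AE x in L\<Omega>. g x = 0"
proof -
  have "\<exists>a b. x \<in> box a b \<and> cbox a b \<subseteq> \<Omega>" if "x \<in> \<Omega>" for x
    using open_contains_cbox[OF open_\<Omega> that] by metis
  then obtain a b where ab: "\<And>x. x \<in> \<Omega> \<Longrightarrow> x \<in> box (a x) (b x) \<and> cbox (a x) (b x) \<subseteq> \<Omega>" by metis
  obtain F where F: "F \<subseteq> (\<lambda>x. box (a x) (b x)) ` \<Omega>" "countable F" "\<Union>F = (\<Union>x\<in>\<Omega>. box (a x) (b x))"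
    using Lindelof[of "(\<lambda>x. box (a x) (b x)) ` \<Omega>"] by auto
  have "AE x in L\<Omega>. \<forall>B\<in>F. x \<in> B \<longrightarrow> g x = 0"
  proof (subst AE_ball_countable[OF F(2)], rule ballI)
    fix B assume "B \<in> F"
    then obtain y where "y \<in> \<Omega>" "B = box (a y) (b y)" using F(1) by blast
    then show "AE x in L\<Omega>. x \<in> B \<longrightarrow> g x = 0" using AE_eq_0_box[OF g tests] ab by blast
  qed
  moreover have "AE x in L\<Omega>. x \<in> \<Omega>" by (rule AE_I2) simp
  ultimately show ?thesis
  proof eventually_elim
    case (elim x)
    then have "x \<in> \<Union>F" using F(3) ab by blast
    then show ?case using elim by blast
  qed
qed

lemma weak_grad_unique:
  assumes "is_weak_grad \<Omega> u G" "is_weak_grad \<Omega> u G'"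
  shows "AE x in L\<Omega>. G x = G' x"
proof -
  have G: "G \<in> Lspace \<Omega> 2" "G' \<in> Lspace \<Omega> 2" using assms by (auto simp: is_weak_grad_def)
  have "AE x in L\<Omega>. G x $ i $ j - G' x $ i $ j = 0" for i j
  proof (rule AE_eq_0_if_tests)
    have one: "(\<lambda>x. 1::real) \<in> Lspace \<Omega> 2"
      using finite_measure.integrable_const[OF finite_measure_\<Omega>] by (simp add: Lspace_def)
    have "integrable L\<Omega> (\<lambda>x. G x $ i $ j)" "integrable L\<Omega> (\<lambda>x. G' x $ i $ j)"
      using Lspace2_integrable_mult''[OF _ one] G by simp_all
    then show "integrable L\<Omega> (\<lambda>x. G x $ i $ j - G' x $ i $ j)" by simp
    fix \<phi> :: "real^2 \<Rightarrow> real" assume \<phi>: "\<phi> \<in> test_funs \<Omega>"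
    have "(LINT x|L\<Omega>. u x $ i * partial j \<phi> x) = - (LINT x|L\<Omega>. G x $ i $ j * \<phi> x)"
      "(LINT x|L\<Omega>. u x $ i * partial j \<phi> x) = - (LINT x|L\<Omega>. G' x $ i $ j * \<phi> x)"
      using assms \<phi> unfolding is_weak_grad_def by blast+
    then show "(LINT x|L\<Omega>. (G x $ i $ j - G' x $ i $ j) * \<phi> x) = 0"
      using Lspace2_integrable_mult''[OF _ test_fun_Lspace[OF \<phi>]] G by (simp add: left_diff_distrib)
  qed
  then have "AE x in L\<Omega>. \<forall>i j. G x $ i $ j - G' x $ i $ j = 0"
    by (simp add: AE_all_countable)
  then show ?thesis by eventually_elim (simp add: vec_eq_iff)
qed

end

lemma closure_in_subset: "closure_in X N S \<subseteq> X"
  by (auto simp: closure_in_def)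

lemma closure_inD: "u \<in> closure_in X N S \<Longrightarrow> e > 0 \<Longrightarrow> \<exists>\<phi>\<in>S. N (\<lambda>x. u x - \<phi> x) < e"
  by (simp add: closure_in_def)

lemma closure_in_add:
  assumes "u \<in> closure_in X N S" "v \<in> closure_in X N S"
    and X: "\<And>a b. a \<in> X \<Longrightarrow> b \<in> X \<Longrightarrow> (\<lambda>x. a x + b x) \<in> X"
    and S: "\<And>a b. a \<in> S \<Longrightarrow> b \<in> S \<Longrightarrow> (\<lambda>x. a x + b x) \<in> S"
    and diff: "\<And>a b. a \<in> X \<Longrightarrow> b \<in> S \<Longrightarrow> (\<lambda>x. a x - b x) \<in> X"
    and tri: "\<And>a b. a \<in> X \<Longrightarrow> b \<in> X \<Longrightarrow> N (\<lambda>x. a x + b x) \<le> N a + N b"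
  shows "(\<lambda>x. u x + v x) \<in> closure_in X N S"
  unfolding closure_in_def
proof (intro CollectI conjI allI impI)
  have uv: "u \<in> X" "v \<in> X" using assms(1,2) closure_in_subset by blast+
  then show "(\<lambda>x. u x + v x) \<in> X" by (rule X)
  fix e :: real assume "e > 0"
  then obtain \<phi> \<psi> where \<phi>: "\<phi> \<in> S" "N (\<lambda>x. u x - \<phi> x) < e/2" and \<psi>: "\<psi> \<in> S" "N (\<lambda>x. v x - \<psi> x) < e/2"
    using closure_inD[OF assms(1), of "e/2"] closure_inD[OF assms(2), of "e/2"] by auto
  have "N (\<lambda>x. (u x - \<phi> x) + (v x - \<psi> x)) < e"
    using tri[OF diff[OF uv(1) \<phi>(1)] diff[OF uv(2) \<psi>(1)]] \<phi>(2) \<psi>(2) by simp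
  then have "N (\<lambda>x. (u x + v x) - (\<phi> x + \<psi> x)) < e" by (simp add: algebra_simps)
  then show "\<exists>\<phi>\<in>S. N (\<lambda>x. u x + v x - \<phi> x) < e" by (rule bexI[OF _ S[OF \<phi>(1) \<psi>(1)]])
qed

lemma closure_in_scale:
  assumes "u \<in> closure_in X N S"
    and X: "\<And>a c. a \<in> X \<Longrightarrow> (\<lambda>x. c *\<^sub>R a x) \<in> X"
    and S: "\<And>a c. a \<in> S \<Longrightarrow> (\<lambda>x. c *\<^sub>R a x) \<in> S"
    and diff: "\<And>a b. a \<in> X \<Longrightarrow> b \<in> S \<Longrightarrow> (\<lambda>x. a x - b x) \<in> X"
    and scale: "\<And>a c. a \<in> X \<Longrightarrow> N (\<lambda>x. c *\<^sub>R a x) = \<bar>c\<bar> * N a"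
  shows "(\<lambda>x. c *\<^sub>R u x) \<in> closure_in X N S"
  unfolding closure_in_def
proof (intro CollectI conjI allI impI)
  have u: "u \<in> X" using assms(1) closure_in_subset by blast
  then show "(\<lambda>x. c *\<^sub>R u x) \<in> X" by (rule X)
  fix e :: real assume e: "e > 0"
  then have "e / (\<bar>c\<bar> + 1) > 0" by simp
  then obtain \<phi> where \<phi>: "\<phi> \<in> S" "N (\<lambda>x. u x - \<phi> x) < e / (\<bar>c\<bar> + 1)"
    using closure_inD[OF assms(1)] by blast
  have "N (\<lambda>x. c *\<^sub>R (u x - \<phi> x)) = \<bar>c\<bar> * N (\<lambda>x. u x - \<phi> x)"
    by (rule scale[OF diff[OF u \<phi>(1)]])
  also have "\<dots> \<le> \<bar>c\<bar> * (e / (\<bar>c\<bar> + 1))"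
    using \<phi>(2) by (intro mult_left_mono) auto
  also have "\<dots> < e" using e by (simp add: field_simps)
  finally have "N (\<lambda>x. c *\<^sub>R u x - c *\<^sub>R \<phi> x) < e" by (simp add: scaleR_diff_right)
  then show "\<exists>\<phi>\<in>S. N (\<lambda>x. c *\<^sub>R u x - \<phi> x) < e" by (rule bexI[OF _ S[OF \<phi>(1)]])
qed

lemma closure_in_superset:
  assumes "S \<subseteq> X" "N (\<lambda>x. 0) = 0"
  shows "S \<subseteq> closure_in X N S"
  using assms by (auto simp: closure_in_def intro!: bexI)

lemma closure_in_sequence:
  assumes "u \<in> closure_in X N S" "\<And>v. N v \<ge> 0"
  obtains \<phi> where "\<And>n::nat. \<phi> n \<in> S" "(\<lambda>n. N (\<lambda>x. u x - \<phi> n x)) \<longlonglongrightarrow> 0"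
proof -
  have "\<exists>\<phi>\<in>S. N (\<lambda>x. u x - \<phi> x) < inverse (real (Suc n))" for n
    using assms(1) by (auto simp: closure_in_def)
  then obtain \<phi> where \<phi>: "\<And>n. \<phi> n \<in> S" "\<And>n. N (\<lambda>x. u x - \<phi> n x) < inverse (real (Suc n))" by metis
  have "(\<lambda>n. N (\<lambda>x. u x - \<phi> n x)) \<longlonglongrightarrow> 0"
    by (rule real_tendsto_sandwich[OF _ _ tendsto_const LIMSEQ_inverse_real_of_nat])
      (auto intro!: always_eventually assms(2) less_imp_le[OF \<phi>(2)] simp del: of_nat_Suc)
  with \<phi>(1) show ?thesis using that by blast
qed

lemma div_free_tests_subset: "div_free_tests \<Omega> \<subseteq> test_funs \<Omega>"
  by (auto simp: div_free_tests_def)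

lemma div_free_tests_add:
  assumes "\<phi> \<in> div_free_tests \<Omega>" "\<psi> \<in> div_free_tests \<Omega>"
  shows "(\<lambda>x. \<phi> x + \<psi> x) \<in> div_free_tests \<Omega>"
proof -
  have t: "\<phi> \<in> test_funs \<Omega>" "\<psi> \<in> test_funs \<Omega>" using assms by (auto simp: div_free_tests_def)
  have "divergence (\<lambda>x. \<phi> x + \<psi> x) x = divergence \<phi> x + divergence \<psi> x" for x
    using t by (simp add: divergence_def frechet_derivative_add test_funs_smooth sum.distrib)
  then show ?thesis using assms test_funs_add[OF t] by (simp add: div_free_tests_def)
qed

lemma div_free_tests_scale:
  assumes "\<phi> \<in> div_free_tests \<Omega>"
  shows "(\<lambda>x. c *\<^sub>R \<phi> x) \<in> div_free_tests \<Omega>"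
proof -
  have t: "\<phi> \<in> test_funs \<Omega>" using assms by (auto simp: div_free_tests_def)
  have "divergence (\<lambda>x. c *\<^sub>R \<phi> x) x = c * divergence \<phi> x" for x
    using frechet_derivative_bounded_linear[OF test_funs_smooth[OF t] bounded_linear_scaleR_right[of c]]
    by (simp add: divergence_def sum_distrib_left)
  then show ?thesis using assms test_funs_bounded_linear[OF t bounded_linear_scaleR_right[of c]]
    by (simp add: div_free_tests_def)
qed

lemma test_funs_scale: "\<phi> \<in> test_funs S \<Longrightarrow> (\<lambda>x. c *\<^sub>R \<phi> x) \<in> test_funs S"
  by (rule test_funs_bounded_linear[OF _ bounded_linear_scaleR_right])

lemma div_free_tests_0: "(\<lambda>x. 0) \<in> div_free_tests \<Omega>"
  using test_funsI[of "\<lambda>x. 0" "{}" \<Omega>] by (simp add: div_free_tests_def divergence_def smooth_const)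

context planar_domain
begin

section \<open>The spaces of the Navier--Stokes equations\<close>

lemma weak_grad_add:
  assumes "u \<in> Lspace \<Omega> 2" "v \<in> Lspace \<Omega> 2" "is_weak_grad \<Omega> u G" "is_weak_grad \<Omega> v G'"
  shows "is_weak_grad \<Omega> (\<lambda>x. u x + v x) (\<lambda>x. G x + G' x)"
  unfolding is_weak_grad_def
proof (intro conjI ballI allI)
  have G: "G \<in> Lspace \<Omega> 2" "G' \<in> Lspace \<Omega> 2" using assms by (auto simp: is_weak_grad_def)
  then show "(\<lambda>x. G x + G' x) \<in> Lspace \<Omega> 2" by (rule Lspace2_add)
  fix \<phi> :: "real^2 \<Rightarrow> real" and i j assume \<phi>: "\<phi> \<in> test_funs \<Omega>"
  have L: "\<phi> \<in> Lspace \<Omega> 2" "(\<lambda>x. partial j \<phi> x) \<in> Lspace \<Omega> 2"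
    by (rule test_fun_Lspace[OF \<phi>], simp, rule test_fun_Lspace[OF test_funs_frechet_derivative[OF \<phi>]], simp)
  have "(LINT x|L\<Omega>. (u x + v x) $ i * partial j \<phi> x)
      = (LINT x|L\<Omega>. u x $ i * partial j \<phi> x) + (LINT x|L\<Omega>. v x $ i * partial j \<phi> x)"
    using Lspace2_integrable_mult'[OF assms(1) L(2)] Lspace2_integrable_mult'[OF assms(2) L(2)]
    by (simp add: distrib_right)
  also have "\<dots> = - (LINT x|L\<Omega>. G x $ i $ j * \<phi> x) - (LINT x|L\<Omega>. G' x $ i $ j * \<phi> x)"
    using assms(3,4) \<phi> by (simp add: is_weak_grad_def)
  also have "\<dots> = - (LINT x|L\<Omega>. (G x + G' x) $ i $ j * \<phi> x)"
    using Lspace2_integrable_mult''[OF G(1) L(1)] Lspace2_integrable_mult''[OF G(2) L(1)]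
    by (simp add: distrib_right)
  finally show "(LINT x|L\<Omega>. (u x + v x) $ i * partial j \<phi> x) = - (LINT x|L\<Omega>. (G x + G' x) $ i $ j * \<phi> x)" .
qed

lemma weak_grad_scale:
  assumes "is_weak_grad \<Omega> u G"
  shows "is_weak_grad \<Omega> (\<lambda>x. c *\<^sub>R u x) (\<lambda>x. c *\<^sub>R G x)"
  using assms Lspace_scale[of G \<Omega> 2 c] unfolding is_weak_grad_def
  by (simp add: mult.assoc)

lemma weak_grad_classical:
  assumes "\<phi> \<in> test_funs \<Omega>"
  shows "is_weak_grad \<Omega> \<phi> (classical_grad \<phi>)"
  unfolding is_weak_grad_def
proof (intro conjI ballI allI)
  have sm: "smooth \<phi>" using assms by (rule test_funs_smooth)
  have part: "(\<lambda>x. partial j (\<lambda>x. \<phi> x $ i) x) \<in> test_funs \<Omega>" for i j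
    by (intro test_funs_frechet_derivative test_funs_bounded_linear[OF assms bounded_linear_vec_nth])
  have cont: "continuous_on UNIV (classical_grad \<phi>)"
    unfolding classical_grad_def[abs_def]
    by (intro continuous_on_vec_lambda smooth_continuous smooth_bounded_linear[OF _ bounded_linear_vec_nth]
        smooth_frechet_derivative sm)
  show "classical_grad \<phi> \<in> Lspace \<Omega> 2"
  proof -
    have eq: "norm (classical_grad \<phi> x) ^ 2 = (\<Sum>i\<in>UNIV. \<Sum>j\<in>UNIV. norm (partial j (\<lambda>x. \<phi> x $ i) x) ^ 2)" for x
      by (simp add: norm_vec_def L2_set_def sum_nonneg classical_grad_nth[OF sm])
    have "integrable L\<Omega> (\<lambda>x. norm (classical_grad \<phi> x) ^ 2)"
      unfolding eq using Lspace_integrable[OF test_fun_Lspace[OF part, of 2]] by (intro Bochner_Integration.integrable_sum) auto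
    then show ?thesis using continuous_measurable_\<Omega>[OF cont] by (simp add: Lspace_def)
  qed
  fix \<psi> :: "real^2 \<Rightarrow> real" and i j assume \<psi>: "\<psi> \<in> test_funs \<Omega>"
  let ?f = "\<lambda>x. \<psi> x * \<phi> x $ i"
  have smi: "smooth (\<lambda>x. \<phi> x $ i)" by (rule smooth_bounded_linear[OF sm bounded_linear_vec_nth])
  have f: "?f \<in> test_funs \<Omega>" by (rule test_funs_mult[OF \<psi> smi])
  obtain R where R: "\<And>x. norm x > R \<Longrightarrow> ?f x = 0" using test_funs_bounded_support[OF f] by blast
  have "0 = (LINT x|lborel. partial j ?f x)" using integral_partial_eq_0[OF test_funs_smooth[OF f] R] by simp
  also have "\<dots> = (LINT x|L\<Omega>. partial j ?f x)"
    by (rule integral_\<Omega>_eq[symmetric])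
      (auto intro!: borel_measurable_continuous_onI smooth_continuous test_funs_smooth test_funs_frechet_derivative f
        test_funs_eq_0[OF test_funs_frechet_derivative[OF f]])
  also have "\<dots> = (LINT x|L\<Omega>. \<phi> x $ i * partial j \<psi> x + classical_grad \<phi> x $ i $ j * \<psi> x)"
    by (simp add: frechet_derivative_mult[OF test_funs_smooth[OF \<psi>] smi] classical_grad_nth[OF sm] algebra_simps)
  also have "\<dots> = (LINT x|L\<Omega>. \<phi> x $ i * partial j \<psi> x) + (LINT x|L\<Omega>. classical_grad \<phi> x $ i $ j * \<psi> x)"
  proof (rule Bochner_Integration.integral_add)
    show "integrable L\<Omega> (\<lambda>x. \<phi> x $ i * partial j \<psi> x)"
      by (intro Lspace2_integrable_mult' test_fun_Lspace assms test_funs_frechet_derivative \<psi>) auto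
    show "integrable L\<Omega> (\<lambda>x. classical_grad \<phi> x $ i $ j * \<psi> x)"
      by (intro Lspace2_integrable_mult'' test_fun_Lspace \<psi> \<open>classical_grad \<phi> \<in> Lspace \<Omega> 2\<close>) auto
  qed
  finally show "(LINT x|L\<Omega>. \<phi> x $ i * partial j \<psi> x) = - (LINT x|L\<Omega>. classical_grad \<phi> x $ i $ j * \<psi> x)"
    by simp
qed

lemma weak_grad_grad: "u \<in> H1 \<Omega> \<Longrightarrow> is_weak_grad \<Omega> u (grad \<Omega> u)"
  unfolding grad_def by (rule someI_ex[of "is_weak_grad \<Omega> u"]) (auto simp: H1_def)

lemma grad_Lspace: "u \<in> H1 \<Omega> \<Longrightarrow> grad \<Omega> u \<in> Lspace \<Omega> 2"
  using weak_grad_grad by (auto simp: is_weak_grad_def)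

lemma H1_Lspace: "u \<in> H1 \<Omega> \<Longrightarrow> u \<in> Lspace \<Omega> 2"
  by (simp add: H1_def)

lemma H1_add: "u \<in> H1 \<Omega> \<Longrightarrow> v \<in> H1 \<Omega> \<Longrightarrow> (\<lambda>x. u x + v x) \<in> H1 \<Omega>"
  unfolding H1_def using Lspace2_add weak_grad_add by blast

lemma H1_scale: "u \<in> H1 \<Omega> \<Longrightarrow> (\<lambda>x. c *\<^sub>R u x) \<in> H1 \<Omega>"
  unfolding H1_def using Lspace_scale weak_grad_scale by blast

lemma H1_diff: "u \<in> H1 \<Omega> \<Longrightarrow> v \<in> H1 \<Omega> \<Longrightarrow> (\<lambda>x. u x - v x) \<in> H1 \<Omega>"
  using H1_add[OF _ H1_scale[of v "-1"], of u] by simp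

lemma test_funs_H1: "\<phi> \<in> test_funs \<Omega> \<Longrightarrow> \<phi> \<in> H1 \<Omega>"
  unfolding H1_def using test_fun_Lspace[of \<phi> 2] weak_grad_classical by auto

lemma grad_add:
  "u \<in> H1 \<Omega> \<Longrightarrow> v \<in> H1 \<Omega> \<Longrightarrow> AE x in L\<Omega>. grad \<Omega> (\<lambda>x. u x + v x) x = grad \<Omega> u x + grad \<Omega> v x"
  by (intro weak_grad_unique[of "\<lambda>x. u x + v x"] weak_grad_grad weak_grad_add H1_add H1_Lspace)

lemma grad_scale: "u \<in> H1 \<Omega> \<Longrightarrow> AE x in L\<Omega>. grad \<Omega> (\<lambda>x. c *\<^sub>R u x) x = c *\<^sub>R grad \<Omega> u x"
  by (intro weak_grad_unique[of "\<lambda>x. c *\<^sub>R u x"] weak_grad_grad weak_grad_scale H1_scale)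

lemma grad_diff:
  assumes "u \<in> H1 \<Omega>" "v \<in> H1 \<Omega>"
  shows "AE x in L\<Omega>. grad \<Omega> (\<lambda>x. u x - v x) x = grad \<Omega> u x - grad \<Omega> v x"
  using grad_add[OF assms(1) H1_scale[OF assms(2), of "-1"]] grad_scale[OF assms(2), of "-1"]
  by eventually_elim simp

lemma grad_test_fun: "\<phi> \<in> test_funs \<Omega> \<Longrightarrow> AE x in L\<Omega>. grad \<Omega> \<phi> x = classical_grad \<phi> x"
  by (intro weak_grad_unique[of \<phi>] weak_grad_grad weak_grad_classical test_funs_H1)

lemma grad_measurable: "u \<in> H1 \<Omega> \<Longrightarrow> grad \<Omega> u \<in> borel_measurable L\<Omega>"
  using grad_Lspace Lspace_measurable by blast

lemma V_norm_add: "u \<in> H1 \<Omega> \<Longrightarrow> v \<in> H1 \<Omega> \<Longrightarrow> V_norm \<Omega> (\<lambda>x. u x + v x) \<le> V_norm \<Omega> u + V_norm \<Omega> v"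
  unfolding V_norm_def
  by (subst Lnorm_cong_AE[OF _ _ grad_add])
    (auto intro!: Lnorm2_triangle grad_Lspace grad_measurable H1_add borel_measurable_add)

lemma V_norm_scale: "u \<in> H1 \<Omega> \<Longrightarrow> V_norm \<Omega> (\<lambda>x. c *\<^sub>R u x) = \<bar>c\<bar> * V_norm \<Omega> u"
  unfolding V_norm_def Lnorm_scale[symmetric]
  by (subst Lnorm_cong_AE[OF _ _ grad_scale])
    (auto intro!: grad_measurable H1_scale borel_measurable_scaleR)

lemma V_norm_nonneg: "V_norm \<Omega> u \<ge> 0"
  by (simp add: V_norm_def Lnorm_nonneg)

lemma V_norm_minus_commute: "u \<in> H1 \<Omega> \<Longrightarrow> v \<in> H1 \<Omega> \<Longrightarrow> V_norm \<Omega> (\<lambda>x. u x - v x) = V_norm \<Omega> (\<lambda>x. v x - u x)"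
  using V_norm_scale[OF H1_diff, of v u "-1"] by simp

lemma V_norm_diff_triangle:
  assumes "u \<in> H1 \<Omega>" "v \<in> H1 \<Omega>" "w \<in> H1 \<Omega>"
  shows "V_norm \<Omega> (\<lambda>x. u x - w x) \<le> V_norm \<Omega> (\<lambda>x. u x - v x) + V_norm \<Omega> (\<lambda>x. v x - w x)"
  using V_norm_add[OF H1_diff[OF assms(1,2)] H1_diff[OF assms(2,3)]] by simp

lemma H1_norm_eq: "H1_norm \<Omega> u = sqrt (Lnorm \<Omega> 2 u ^ 2 + V_norm \<Omega> u ^ 2)"
  by (simp add: H1_norm_def V_norm_def)

lemma H1_norm_nonneg: "H1_norm \<Omega> u \<ge> 0"
  by (simp add: H1_norm_eq)

lemma Lnorm_le_H1_norm: "Lnorm \<Omega> 2 u \<le> H1_norm \<Omega> u"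
  and V_norm_le_H1_norm: "V_norm \<Omega> u \<le> H1_norm \<Omega> u"
  by (auto simp: H1_norm_eq intro: real_le_rsqrt)

lemma H1_norm_add:
  assumes "u \<in> H1 \<Omega>" "v \<in> H1 \<Omega>"
  shows "H1_norm \<Omega> (\<lambda>x. u x + v x) \<le> H1_norm \<Omega> u + H1_norm \<Omega> v"
proof -
  have "H1_norm \<Omega> (\<lambda>x. u x + v x) \<le> sqrt ((Lnorm \<Omega> 2 u + Lnorm \<Omega> 2 v)\<^sup>2 + (V_norm \<Omega> u + V_norm \<Omega> v)\<^sup>2)"
    unfolding H1_norm_eq
    by (intro real_sqrt_le_mono add_mono power_mono Lnorm2_triangle V_norm_add H1_Lspace assms Lnorm_nonneg V_norm_nonneg)
  also have "\<dots> \<le> H1_norm \<Omega> u + H1_norm \<Omega> v"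
    unfolding H1_norm_eq by (rule real_sqrt_sum_squares_triangle_ineq)
  finally show ?thesis .
qed

lemma H1_norm_scale: "u \<in> H1 \<Omega> \<Longrightarrow> H1_norm \<Omega> (\<lambda>x. c *\<^sub>R u x) = \<bar>c\<bar> * H1_norm \<Omega> u"
  by (simp add: H1_norm_eq V_norm_scale Lnorm_scale power_mult_distrib distrib_left[symmetric] real_sqrt_mult)

lemma V_norm_0: "V_norm \<Omega> (\<lambda>x. 0) = 0"
  using V_norm_scale[of "\<lambda>x. 0" 0] test_funs_H1 div_free_tests_0 div_free_tests_subset by auto

lemma H1_norm_0: "H1_norm \<Omega> (\<lambda>x. 0) = 0"
  by (simp add: H1_norm_eq V_norm_0 Lnorm_2)

lemma H10_H1: "u \<in> H10 \<Omega> \<Longrightarrow> u \<in> H1 \<Omega>"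
  by (simp add: H10_def closure_in_def)

lemma test_funs_H10: "test_funs \<Omega> \<subseteq> H10 \<Omega>"
  unfolding H10_def by (rule closure_in_superset) (auto intro: test_funs_H1 H1_norm_0)

lemma H10_add: "u \<in> H10 \<Omega> \<Longrightarrow> v \<in> H10 \<Omega> \<Longrightarrow> (\<lambda>x. u x + v x) \<in> H10 \<Omega>"
  unfolding H10_def by (rule closure_in_add) (auto intro: H1_add test_funs_add H1_diff test_funs_H1 H1_norm_add)

lemma H10_scale: "u \<in> H10 \<Omega> \<Longrightarrow> (\<lambda>x. c *\<^sub>R u x) \<in> H10 \<Omega>"
  unfolding H10_def by (rule closure_in_scale) (auto intro: H1_scale test_funs_scale H1_diff test_funs_H1 H1_norm_scale)

lemma H10_diff: "u \<in> H10 \<Omega> \<Longrightarrow> v \<in> H10 \<Omega> \<Longrightarrow> (\<lambda>x. u x - v x) \<in> H10 \<Omega>"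
  using H10_add[OF _ H10_scale[of v "-1"], of u] by simp

lemma V_H1: "u \<in> \<V> \<Omega> \<Longrightarrow> u \<in> H1 \<Omega>"
  by (simp add: \<V>_def closure_in_def H10_H1)

lemma V_Lspace: "u \<in> \<V> \<Omega> \<Longrightarrow> u \<in> Lspace \<Omega> 2"
  by (intro H1_Lspace V_H1)

lemma div_free_tests_V: "div_free_tests \<Omega> \<subseteq> \<V> \<Omega>"
  unfolding \<V>_def by (rule closure_in_superset)
    (use div_free_tests_subset test_funs_H10 H1_norm_0 in auto)

lemma V_0: "(\<lambda>x. 0) \<in> \<V> \<Omega>"
  using div_free_tests_V div_free_tests_0 by auto

lemma V_add: "u \<in> \<V> \<Omega> \<Longrightarrow> v \<in> \<V> \<Omega> \<Longrightarrow> (\<lambda>x. u x + v x) \<in> \<V> \<Omega>"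
  unfolding \<V>_def using test_funs_H10 div_free_tests_subset
  by (intro closure_in_add) (auto intro!: H10_add div_free_tests_add H10_diff H1_norm_add H10_H1)

lemma V_scale: "u \<in> \<V> \<Omega> \<Longrightarrow> (\<lambda>x. c *\<^sub>R u x) \<in> \<V> \<Omega>"
  unfolding \<V>_def using test_funs_H10 div_free_tests_subset
  by (intro closure_in_scale) (auto intro!: H10_scale div_free_tests_scale H10_diff H1_norm_scale H10_H1)

lemma V_diff: "u \<in> \<V> \<Omega> \<Longrightarrow> v \<in> \<V> \<Omega> \<Longrightarrow> (\<lambda>x. u x - v x) \<in> \<V> \<Omega>"
  using V_add[OF _ V_scale[of v "-1"], of u] by simp

lemma H_Lspace: "u \<in> \<H> \<Omega> \<Longrightarrow> u \<in> Lspace \<Omega> 2"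
  by (simp add: \<H>_def closure_in_def)

lemma div_free_tests_Lspace: "\<phi> \<in> div_free_tests \<Omega> \<Longrightarrow> \<phi> \<in> Lspace \<Omega> 2"
  by (rule test_fun_Lspace[OF subsetD[OF div_free_tests_subset]]) simp_all

lemma H_add: "u \<in> \<H> \<Omega> \<Longrightarrow> v \<in> \<H> \<Omega> \<Longrightarrow> (\<lambda>x. u x + v x) \<in> \<H> \<Omega>"
  unfolding \<H>_def
  by (rule closure_in_add) (auto intro: Lspace2_add Lspace2_diff Lnorm2_triangle div_free_tests_add div_free_tests_Lspace)

lemma H_scale: "u \<in> \<H> \<Omega> \<Longrightarrow> (\<lambda>x. c *\<^sub>R u x) \<in> \<H> \<Omega>"
  unfolding \<H>_def
  by (rule closure_in_scale) (auto intro: Lspace_scale Lspace2_diff div_free_tests_scale div_free_tests_Lspace Lnorm_scale)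

lemma H_diff: "u \<in> \<H> \<Omega> \<Longrightarrow> v \<in> \<H> \<Omega> \<Longrightarrow> (\<lambda>x. u x - v x) \<in> \<H> \<Omega>"
  using H_add[OF _ H_scale[of v "-1"], of u] by simp

lemma V_H: "u \<in> \<V> \<Omega> \<Longrightarrow> u \<in> \<H> \<Omega>"
proof -
  assume u: "u \<in> \<V> \<Omega>"
  have "\<exists>\<phi>\<in>div_free_tests \<Omega>. Lnorm \<Omega> 2 (\<lambda>x. u x - \<phi> x) < e" if "e > 0" for e
    using closure_inD[OF u[unfolded \<V>_def] that] Lnorm_le_H1_norm by (meson order_le_less_trans)
  then show ?thesis using V_Lspace[OF u] by (simp add: \<H>_def closure_in_def)
qed

lemma H_closed:
  assumes "u \<in> Lspace \<Omega> 2" "\<And>e. e > 0 \<Longrightarrow> \<exists>v\<in>\<H> \<Omega>. Lnorm \<Omega> 2 (\<lambda>x. u x - v x) < e"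
  shows "u \<in> \<H> \<Omega>"
proof -
  have "\<exists>\<phi>\<in>div_free_tests \<Omega>. Lnorm \<Omega> 2 (\<lambda>x. u x - \<phi> x) < e" if e: "e > 0" for e
  proof -
    obtain v where v: "v \<in> \<H> \<Omega>" "Lnorm \<Omega> 2 (\<lambda>x. u x - v x) < e/2" using assms(2)[OF half_gt_zero[OF e]] by blast
    obtain \<phi> where \<phi>: "\<phi> \<in> div_free_tests \<Omega>" "Lnorm \<Omega> 2 (\<lambda>x. v x - \<phi> x) < e/2"
      using closure_inD[OF v(1)[unfolded \<H>_def], of "e/2"] e by auto
    have "Lnorm \<Omega> 2 (\<lambda>x. u x - \<phi> x) < e"
      using Lnorm2_diff_triangle[OF assms(1) H_Lspace[OF v(1)] div_free_tests_Lspace[OF \<phi>(1)]] v(2) \<phi>(2) by simp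
    with \<phi>(1) show ?thesis by blast
  qed
  then show ?thesis using assms(1) by (simp add: \<H>_def closure_in_def)
qed


section \<open>Sobolev inequalities\<close>

definition area :: real where "area = (LINT x|L\<Omega>. 1)"

lemma area_nonneg: "area \<ge> 0"
  by (simp add: area_def)

lemma integrable_1: "integrable L\<Omega> (\<lambda>x. 1::real)"
  using finite_measure.integrable_const[OF finite_measure_\<Omega>] .

definition dirichlet :: "(real^2 \<Rightarrow> real) \<Rightarrow> real" where
  "dirichlet c = (LINT x|L\<Omega>. (partial 1 c x)\<^sup>2) + (LINT x|L\<Omega>. (partial 2 c x)\<^sup>2)"

lemma
  assumes "c \<in> test_funs \<Omega>"
  shows test_fun_measurable: "c \<in> borel_measurable L\<Omega>" "(\<lambda>x. partial j c x) \<in> borel_measurable L\<Omega>"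
    and test_fun_power_integrable: "q > 0 \<Longrightarrow> integrable L\<Omega> (\<lambda>x. c x ^ q)"
    and partial_square_integrable: "integrable L\<Omega> (\<lambda>x. (partial j c x)\<^sup>2)"
proof -
  have t: "(\<lambda>x. partial j c x) \<in> test_funs \<Omega>" for j by (rule test_funs_frechet_derivative[OF assms])
  show m: "c \<in> borel_measurable L\<Omega>" "(\<lambda>x. partial j c x) \<in> borel_measurable L\<Omega>"
    using continuous_measurable_\<Omega>[OF smooth_continuous[OF test_funs_smooth]] assms t by auto
  show "integrable L\<Omega> (\<lambda>x. (partial j c x)\<^sup>2)"
    using Lspace_integrable[OF test_fun_Lspace[OF t, of 2]] by simp
  show "integrable L\<Omega> (\<lambda>x. c x ^ q)" if "q > 0"
    using Lspace_integrable[OF test_fun_Lspace[OF assms that]] m(1)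
    by (subst integrable_norm_iff[symmetric]) (auto simp: power_abs)
qed

lemma gagliardo_nirenberg_\<Omega>:
  assumes f: "f \<in> test_funs \<Omega>"
  shows "(LINT x|L\<Omega>. (f x)\<^sup>2) \<le> (LINT x|L\<Omega>. \<bar>partial 1 f x\<bar>) * (LINT x|L\<Omega>. \<bar>partial 2 f x\<bar>)"
proof -
  have sm: "smooth f" using f by (rule test_funs_smooth)
  obtain R where R: "\<And>x. norm x > R \<Longrightarrow> f x = 0" using test_funs_bounded_support[OF f] by blast
  have c: "continuous_on UNIV f" "continuous_on UNIV (\<lambda>x. partial j f x)" for j
    by (intro smooth_continuous sm smooth_frechet_derivative)+
  have 1: "(LINT x|L\<Omega>. (f x)\<^sup>2) = (LINT x|lborel. (f x)\<^sup>2)"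
    by (rule integral_\<Omega>_eq) (auto intro!: borel_measurable_continuous_onI continuous_intros c simp: test_funs_eq_0[OF f])
  have 2: "(LINT x|L\<Omega>. \<bar>partial j f x\<bar>) = (LINT x|lborel. \<bar>partial j f x\<bar>)" for j
    by (rule integral_\<Omega>_eq) (auto intro!: borel_measurable_continuous_onI continuous_intros c
        simp: test_funs_eq_0[OF test_funs_frechet_derivative[OF f]])
  show ?thesis unfolding 1 2 by (rule gagliardo_nirenberg[OF sm R])
qed

lemma prod_sqrt_le:
  assumes "A1 \<le> K * (sqrt a * sqrt b1)" "A2 \<le> K * (sqrt a * sqrt b2)" "0 \<le> A1" "0 \<le> A2" "0 \<le> a" "0 \<le> b1" "0 \<le> b2"
  shows "A1 * A2 \<le> K\<^sup>2 * (a * (b1 + b2))"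
proof -
  have "sqrt b1 * sqrt b2 \<le> b1 + b2"
    using sum_squares_bound[of "sqrt b1" "sqrt b2"] assms by (simp add: mult.assoc)
  have "A1 * A2 \<le> (K * (sqrt a * sqrt b1)) * (K * (sqrt a * sqrt b2))"
    using assms by (intro mult_mono) (auto intro: order_trans)
  also have "\<dots> = K\<^sup>2 * ((sqrt a * sqrt a) * (sqrt b1 * sqrt b2))"
    by (simp add: power2_eq_square mult_ac del: real_sqrt_mult_self)
  also have "sqrt a * sqrt a = a" using assms by simp
  also have "K\<^sup>2 * (a * (sqrt b1 * sqrt b2)) \<le> K\<^sup>2 * (a * (b1 + b2))"
    using assms \<open>sqrt b1 * sqrt b2 \<le> b1 + b2\<close> by (intro mult_left_mono) auto
  finally show ?thesis .
qed

text \<open>The Gagliardo--Nirenberg inequality for the power \<open>c ^ (k + 1)\<close>, whose gradient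
  \<open>(k + 1) c ^ k \<nabla>c\<close> is estimated by the Cauchy--Schwarz inequality.\<close>

lemma power_inequality:
  assumes c: "c \<in> test_funs \<Omega>"
  shows "(LINT x|L\<Omega>. c x ^ (2 * Suc k)) \<le> (real (Suc k))\<^sup>2 * ((LINT x|L\<Omega>. c x ^ (2 * k)) * dirichlet c)"
proof -
  have sm: "smooth c" using c by (rule test_funs_smooth)
  note [measurable] = test_fun_measurable[OF c]
  have pw: "smooth (\<lambda>x. c x ^ k) \<and>
      (\<forall>x v. frechet_derivative (\<lambda>x. c x ^ Suc k) (at x) v = real (Suc k) * (c x ^ k * frechet_derivative c (at x) v))" for k
  proof (induction k)
    case 0
    then show ?case by (simp add: smooth_const)
  next
    case (Suc k)
    have s: "smooth (\<lambda>x. c x ^ Suc k)" using smooth_mult[OF sm conjunct1[OF Suc]] by simp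
    have "frechet_derivative (\<lambda>x. c x * c x ^ Suc k) (at x) v
        = real (Suc (Suc k)) * (c x ^ Suc k * frechet_derivative c (at x) v)" for x v
      unfolding frechet_derivative_mult[OF sm s] using Suc by (simp add: algebra_simps)
    with s show ?case by simp
  qed
  have f: "(\<lambda>x. c x ^ Suc k) \<in> test_funs \<Omega>"
    using test_funs_mult[OF c conjunct1[OF pw[of k]]] by simp
  have int: "integrable L\<Omega> (\<lambda>x. (c x ^ k)\<^sup>2)"
    using test_fun_power_integrable[OF c, of "2 * k"] integrable_1 by (cases "k = 0") (auto simp: power_mult mult.commute power_even_eq)
  have "(LINT x|L\<Omega>. \<bar>partial j (\<lambda>x. c x ^ Suc k) x\<bar>)
     \<le> real (Suc k) * (sqrt (LINT x|L\<Omega>. (c x ^ k)\<^sup>2) * sqrt (LINT x|L\<Omega>. (partial j c x)\<^sup>2))" for j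
  proof -
    have "(LINT x|L\<Omega>. \<bar>partial j (\<lambda>x. c x ^ Suc k) x\<bar>) = (LINT x|L\<Omega>. real (Suc k) * \<bar>c x ^ k * partial j c x\<bar>)"
      unfolding conjunct2[OF pw, rule_format] by (rule Bochner_Integration.integral_cong) (auto simp: abs_mult)
    also have "\<dots> = real (Suc k) * (LINT x|L\<Omega>. \<bar>c x ^ k * partial j c x\<bar>)" by simp
    also have "\<dots> \<le> real (Suc k) * (sqrt (LINT x|L\<Omega>. (c x ^ k)\<^sup>2) * sqrt (LINT x|L\<Omega>. (partial j c x)\<^sup>2))"
      by (intro mult_left_mono Cauchy_Schwarz_integral_abs int partial_square_integrable c) auto
    finally show ?thesis .
  qed
  from prod_sqrt_le[OF this[of 1] this[of 2]]
  have "(LINT x|L\<Omega>. \<bar>partial 1 (\<lambda>x. c x ^ Suc k) x\<bar>) * (LINT x|L\<Omega>. \<bar>partial 2 (\<lambda>x. c x ^ Suc k) x\<bar>)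
     \<le> (real (Suc k))\<^sup>2 * ((LINT x|L\<Omega>. (c x ^ k)\<^sup>2) * dirichlet c)"
    by (simp add: dirichlet_def)
  moreover have "(LINT x|L\<Omega>. (c x ^ Suc k)\<^sup>2) \<le>
      (LINT x|L\<Omega>. \<bar>partial 1 (\<lambda>x. c x ^ Suc k) x\<bar>) * (LINT x|L\<Omega>. \<bar>partial 2 (\<lambda>x. c x ^ Suc k) x\<bar>)"
    by (rule gagliardo_nirenberg_\<Omega>[OF f])
  ultimately have "(LINT x|L\<Omega>. (c x ^ Suc k)\<^sup>2) \<le> (real (Suc k))\<^sup>2 * ((LINT x|L\<Omega>. (c x ^ k)\<^sup>2) * dirichlet c)"
    by linarith
  then show ?thesis unfolding power_even_eq .
qed

lemma square_sum_le: "(a + b)\<^sup>2 \<le> 2 * (a\<^sup>2 + b\<^sup>2)" for a b :: real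
  using sum_squares_bound[of a b] by (simp add: power2_sum)

lemma dirichlet_nonneg: "dirichlet c \<ge> 0"
  by (simp add: dirichlet_def)

lemma norm_real2_square: "norm (x::real^2) ^ 2 = (x$1)\<^sup>2 + (x$2)\<^sup>2"
  by (simp add: norm_vec_def L2_set_def sum_2)

lemma V_norm_test_fun:
  assumes \<phi>: "\<phi> \<in> test_funs \<Omega>"
  shows "V_norm \<Omega> \<phi> ^ 2 = dirichlet (\<lambda>x. \<phi> x $ 1) + dirichlet (\<lambda>x. \<phi> x $ 2)"
proof -
  have sm: "smooth \<phi>" using \<phi> by (rule test_funs_smooth)
  have c: "(\<lambda>x. \<phi> x $ i) \<in> test_funs \<Omega>" for i
    by (rule test_funs_bounded_linear[OF \<phi> bounded_linear_vec_nth])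
  have G: "classical_grad \<phi> \<in> Lspace \<Omega> 2" using weak_grad_classical[OF \<phi>] by (simp add: is_weak_grad_def)
  have "V_norm \<Omega> \<phi> = Lnorm \<Omega> 2 (classical_grad \<phi>)"
    unfolding V_norm_def using grad_measurable[OF test_funs_H1[OF \<phi>]] G grad_test_fun[OF \<phi>]
    by (intro Lnorm_cong_AE) (auto dest: Lspace_measurable)
  then have "V_norm \<Omega> \<phi> ^ 2 = (LINT x|L\<Omega>. norm (classical_grad \<phi> x) ^ 2)"
    by (simp add: Lnorm_power)
  also have "\<dots> = (LINT x|L\<Omega>. ((partial 1 (\<lambda>x. \<phi> x $ 1) x)\<^sup>2 + (partial 2 (\<lambda>x. \<phi> x $ 1) x)\<^sup>2)
      + ((partial 1 (\<lambda>x. \<phi> x $ 2) x)\<^sup>2 + (partial 2 (\<lambda>x. \<phi> x $ 2) x)\<^sup>2))"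
    by (rule Bochner_Integration.integral_cong)
      (simp_all add: norm_vec_def L2_set_def sum_2 classical_grad_nth[OF sm])
  also have "\<dots> = dirichlet (\<lambda>x. \<phi> x $ 1) + dirichlet (\<lambda>x. \<phi> x $ 2)"
    using partial_square_integrable[OF c] by (simp add: dirichlet_def)
  finally show ?thesis .
qed

lemma
  assumes \<phi>: "\<phi> \<in> test_funs \<Omega>"
  shows poincare_test: "Lnorm \<Omega> 2 \<phi> ^ 2 \<le> area * V_norm \<Omega> \<phi> ^ 2"
    and ladyzhenskaya_test: "(LINT x|L\<Omega>. norm (\<phi> x) ^ 4) \<le> 8 * (Lnorm \<Omega> 2 \<phi> ^ 2 * V_norm \<Omega> \<phi> ^ 2)"
    and L6_test: "(LINT x|L\<Omega>. norm (\<phi> x) ^ 6) \<le> 288 * (Lnorm \<Omega> 2 \<phi> ^ 2 * V_norm \<Omega> \<phi> ^ 4)"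
proof -
  have c: "(\<lambda>x. \<phi> x $ i) \<in> test_funs \<Omega>" for i
    by (rule test_funs_bounded_linear[OF \<phi> bounded_linear_vec_nth])
  define Q where "Q i k = (LINT x|L\<Omega>. (\<phi> x $ i) ^ k)" for i k
  define P where "P i = dirichlet (\<lambda>x. \<phi> x $ i)" for i
  have P0: "P i \<ge> 0" for i by (simp add: P_def dirichlet_nonneg)
  have Q0: "Q i (2 * k) \<ge> 0" for i k unfolding Q_def by (auto intro!: integral_nonneg_AE AE_I2 zero_le_even_power)
  have ci: "integrable L\<Omega> (\<lambda>x. (\<phi> x $ i) ^ q)" if "q > 0" for i q by (rule test_fun_power_integrable[OF c that])
  have ni: "integrable L\<Omega> (\<lambda>x. norm (\<phi> x) ^ q)" if "q > 0" for q
    by (rule Lspace_integrable[OF test_fun_Lspace[OF \<phi> that]])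
  have V: "V_norm \<Omega> \<phi> ^ 2 = P 1 + P 2" unfolding P_def by (rule V_norm_test_fun[OF \<phi>])
  have L: "Lnorm \<Omega> 2 \<phi> ^ 2 = Q 1 2 + Q 2 2"
    using ci[of 2] by (simp add: Lnorm_power norm_real2_square Q_def)
  have ineq: "Q i (2 * Suc k) \<le> (real (Suc k))\<^sup>2 * (Q i (2 * k) * P i)" for i k
    unfolding Q_def P_def by (rule power_inequality[OF c])
  have Q_0: "Q i 0 = area" for i by (simp add: Q_def area_def)
  show "Lnorm \<Omega> 2 \<phi> ^ 2 \<le> area * V_norm \<Omega> \<phi> ^ 2"
    using ineq[of 1 0] ineq[of 2 0] by (simp add: L V Q_0 algebra_simps numeral_2_eq_2[symmetric])
  have Q4: "Q i 4 \<le> 4 * (Q i 2 * P i)" for i using ineq[of i 1] by (simp add: numeral_2_eq_2 numeral_eq_Suc)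
  have Q6: "Q i 6 \<le> 9 * (Q i 4 * P i)" for i using ineq[of i 2] by (simp add: numeral_eq_Suc)
  have QP: "Q i 2 * P i \<le> (Q 1 2 + Q 2 2) * (P 1 + P 2)" for i
  proof -
    have "i = 1 \<or> i = 2" using exhaust_2 by blast
    then show ?thesis using P0 Q0[of _ 1] by (auto intro!: mult_mono)
  qed
  have "(LINT x|L\<Omega>. norm (\<phi> x) ^ 4) \<le> (LINT x|L\<Omega>. 2 * ((\<phi> x $ 1) ^ 4 + (\<phi> x $ 2) ^ 4))"
  proof (rule integral_mono)
    fix x
    have "norm (\<phi> x) ^ 4 = ((\<phi> x $ 1)\<^sup>2 + (\<phi> x $ 2)\<^sup>2)\<^sup>2"
      by (simp add: norm_real2_square[symmetric])
    also have "\<dots> \<le> 2 * (((\<phi> x $ 1)\<^sup>2)\<^sup>2 + ((\<phi> x $ 2)\<^sup>2)\<^sup>2)"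
      by (rule square_sum_le)
    finally show "norm (\<phi> x) ^ 4 \<le> 2 * ((\<phi> x $ 1) ^ 4 + (\<phi> x $ 2) ^ 4)" by simp
  qed (use ni[of 4] ci[of 4] in auto)
  also have "\<dots> = 2 * (Q 1 4 + Q 2 4)" using ci[of 4] by (simp add: Q_def)
  also have "\<dots> \<le> 8 * (Q 1 2 * P 1 + Q 2 2 * P 2)" using Q4[of 1] Q4[of 2] by simp
  also have "\<dots> \<le> 8 * ((Q 1 2 + Q 2 2) * (P 1 + P 2))"
    using P0[of 1] P0[of 2] Q0[of 1 1] Q0[of 2 1] by (simp add: algebra_simps numeral_2_eq_2[symmetric])
  finally show L4: "(LINT x|L\<Omega>. norm (\<phi> x) ^ 4) \<le> 8 * (Lnorm \<Omega> 2 \<phi> ^ 2 * V_norm \<Omega> \<phi> ^ 2)"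
    by (simp add: L V)
  have Qle: "Q i 4 \<le> (LINT x|L\<Omega>. norm (\<phi> x) ^ 4)" for i
    unfolding Q_def
  proof (rule integral_mono)
    show "(\<phi> x $ i) ^ 4 \<le> norm (\<phi> x) ^ 4" for x
      using power_mono[OF component_le_norm_cart[of "\<phi> x" i], of 4] by (simp add: power_even_abs)
  qed (use ni[of 4] ci[of 4] in auto)
  have "(LINT x|L\<Omega>. norm (\<phi> x) ^ 6) \<le> (LINT x|L\<Omega>. 4 * ((\<phi> x $ 1) ^ 6 + (\<phi> x $ 2) ^ 6))"
  proof (rule integral_mono)
    fix x
    have cube: "(a + b) ^ 3 \<le> 4 * (a ^ 3 + b ^ 3)" if "a \<ge> 0" "b \<ge> 0" for a b :: real
    proof -
      have "4 * (a ^ 3 + b ^ 3) - (a + b) ^ 3 = 3 * ((a + b) * (a - b)\<^sup>2)"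
        by (simp add: power2_eq_square power3_eq_cube algebra_simps)
      also have "\<dots> \<ge> 0" using that by simp
      finally show ?thesis by simp
    qed
    have "norm (\<phi> x) ^ 6 = ((\<phi> x $ 1)\<^sup>2 + (\<phi> x $ 2)\<^sup>2) ^ 3"
      by (simp add: norm_real2_square[symmetric])
    also have "\<dots> \<le> 4 * (((\<phi> x $ 1)\<^sup>2) ^ 3 + ((\<phi> x $ 2)\<^sup>2) ^ 3)" by (rule cube) auto
    finally show "norm (\<phi> x) ^ 6 \<le> 4 * ((\<phi> x $ 1) ^ 6 + (\<phi> x $ 2) ^ 6)" by simp
  qed (use ni[of 6] ci[of 6] in auto)
  also have "\<dots> = 4 * (Q 1 6 + Q 2 6)" using ci[of 6] by (simp add: Q_def)
  also have "\<dots> \<le> 36 * (Q 1 4 * P 1 + Q 2 4 * P 2)" using Q6[of 1] Q6[of 2] by simp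
  also have "\<dots> \<le> 36 * ((LINT x|L\<Omega>. norm (\<phi> x) ^ 4) * P 1 + (LINT x|L\<Omega>. norm (\<phi> x) ^ 4) * P 2)"
    using P0 Qle by (intro mult_left_mono add_mono mult_right_mono) auto
  also have "\<dots> = 36 * ((LINT x|L\<Omega>. norm (\<phi> x) ^ 4) * V_norm \<Omega> \<phi> ^ 2)" by (simp add: V algebra_simps)
  also have "\<dots> \<le> 36 * ((8 * (Lnorm \<Omega> 2 \<phi> ^ 2 * V_norm \<Omega> \<phi> ^ 2)) * V_norm \<Omega> \<phi> ^ 2)"
    using L4 by (intro mult_left_mono mult_right_mono) auto
  also have "\<dots> = 288 * (Lnorm \<Omega> 2 \<phi> ^ 2 * V_norm \<Omega> \<phi> ^ 4)"
    by (simp add: power_add[symmetric] mult.assoc)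
  finally show "(LINT x|L\<Omega>. norm (\<phi> x) ^ 6) \<le> 288 * (Lnorm \<Omega> 2 \<phi> ^ 2 * V_norm \<Omega> \<phi> ^ 4)" .
qed

lemma V_approx:
  assumes u: "u \<in> \<V> \<Omega>"
  obtains \<phi> where "\<And>n::nat. \<phi> n \<in> div_free_tests \<Omega>" "(\<lambda>n. Lnorm \<Omega> 2 (\<phi> n)) \<longlonglongrightarrow> Lnorm \<Omega> 2 u"
    "(\<lambda>n. V_norm \<Omega> (\<phi> n)) \<longlonglongrightarrow> V_norm \<Omega> u" "AE x in L\<Omega>. (\<lambda>n. \<phi> n x) \<longlonglongrightarrow> u x"
proof -
  obtain \<phi> where \<phi>: "\<And>n::nat. \<phi> n \<in> div_free_tests \<Omega>" and lim: "(\<lambda>n. H1_norm \<Omega> (\<lambda>x. u x - \<phi> n x)) \<longlonglongrightarrow> 0"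
    using closure_in_sequence[OF u[unfolded \<V>_def] H1_norm_nonneg] by blast
  have V: "\<phi> n \<in> \<V> \<Omega>" for n using \<phi> div_free_tests_V by blast
  have l: "(\<lambda>n. Lnorm \<Omega> 2 (\<lambda>x. u x - \<phi> n x)) \<longlonglongrightarrow> 0" "(\<lambda>n. V_norm \<Omega> (\<lambda>x. u x - \<phi> n x)) \<longlonglongrightarrow> 0"
    by (rule real_tendsto_sandwich[OF _ _ tendsto_const lim];
        auto intro!: always_eventually Lnorm_nonneg V_norm_nonneg Lnorm_le_H1_norm V_norm_le_H1_norm)+
  have b1: "\<bar>Lnorm \<Omega> 2 (\<phi> n) - Lnorm \<Omega> 2 u\<bar> \<le> Lnorm \<Omega> 2 (\<lambda>x. u x - \<phi> n x)" for n
    using Lnorm2_triangle[OF Lspace2_diff[OF V_Lspace[OF u] V_Lspace[OF V]] V_Lspace[OF V], of n n]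
      Lnorm2_triangle[OF Lspace2_diff[OF V_Lspace[OF V] V_Lspace[OF u]] V_Lspace[OF u], of n]
      Lnorm2_minus_commute[of \<Omega> u "\<phi> n"]
    by simp
  have 1: "(\<lambda>n. Lnorm \<Omega> 2 (\<phi> n)) \<longlonglongrightarrow> Lnorm \<Omega> 2 u"
    by (rule LIM_zero_cancel[OF Lim_null_comparison[OF _ l(1)]]) (simp add: b1)
  have b2: "\<bar>V_norm \<Omega> (\<phi> n) - V_norm \<Omega> u\<bar> \<le> V_norm \<Omega> (\<lambda>x. u x - \<phi> n x)" for n
    using V_norm_add[OF H1_diff[OF V_H1[OF u] V_H1[OF V]] V_H1[OF V], of n n]
      V_norm_add[OF H1_diff[OF V_H1[OF V] V_H1[OF u]] V_H1[OF u], of n]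
      V_norm_minus_commute[OF V_H1[OF u] V_H1[OF V], of n]
    by simp
  have 2: "(\<lambda>n. V_norm \<Omega> (\<phi> n)) \<longlonglongrightarrow> V_norm \<Omega> u"
    by (rule LIM_zero_cancel[OF Lim_null_comparison[OF _ l(2)]]) (simp add: b2)
  obtain r :: "nat \<Rightarrow> nat" where r: "strict_mono r" "AE x in L\<Omega>. (\<lambda>n. \<phi> (r n) x) \<longlonglongrightarrow> u x"
    using Lnorm2_tendsto_AE_subseq[OF V_Lspace[OF V] V_Lspace[OF u] l(1)] by blast
  show ?thesis
  proof (rule that[of "\<lambda>n. \<phi> (r n)"])
    show "(\<lambda>n. Lnorm \<Omega> 2 (\<phi> (r n))) \<longlonglongrightarrow> Lnorm \<Omega> 2 u" "(\<lambda>n. V_norm \<Omega> (\<phi> (r n))) \<longlonglongrightarrow> V_norm \<Omega> u"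
      using LIMSEQ_subseq_LIMSEQ[OF 1 r(1)] LIMSEQ_subseq_LIMSEQ[OF 2 r(1)] by (simp_all add: o_def)
  qed (use \<phi> r(2) in auto)
qed

lemma
  assumes u: "u \<in> \<V> \<Omega>"
  shows poincare: "Lnorm \<Omega> 2 u \<le> sqrt area * V_norm \<Omega> u"
    and V_L4: "u \<in> Lspace \<Omega> 4"
    and ladyzhenskaya: "Lnorm \<Omega> 4 u ^ 4 \<le> 8 * (Lnorm \<Omega> 2 u ^ 2 * V_norm \<Omega> u ^ 2)"
    and V_L6: "u \<in> Lspace \<Omega> 6"
proof -
  obtain \<phi> where \<phi>: "\<And>n::nat. \<phi> n \<in> div_free_tests \<Omega>"
    and L: "(\<lambda>n. Lnorm \<Omega> 2 (\<phi> n)) \<longlonglongrightarrow> Lnorm \<Omega> 2 u" and V: "(\<lambda>n. V_norm \<Omega> (\<phi> n)) \<longlonglongrightarrow> V_norm \<Omega> u"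
    and AE: "AE x in L\<Omega>. (\<lambda>n. \<phi> n x) \<longlonglongrightarrow> u x"
    using V_approx[OF u] by blast
  have t: "\<phi> n \<in> test_funs \<Omega>" for n using \<phi> div_free_tests_subset by blast
  have m: "\<phi> n \<in> borel_measurable L\<Omega>" "u \<in> borel_measurable L\<Omega>" for n
    using Lspace_measurable[OF test_fun_Lspace[OF t, of 2]] Lspace_measurable[OF V_Lspace[OF u]] by auto
  have i: "integrable L\<Omega> (\<lambda>x. norm (\<phi> n x) ^ q)" if "q > 0" for n q
    by (rule Lspace_integrable[OF test_fun_Lspace[OF t that]])
  have "Lnorm \<Omega> 2 u ^ 2 \<le> area * V_norm \<Omega> u ^ 2"
    by (rule LIMSEQ_le[OF tendsto_power[OF L] tendsto_mult[OF tendsto_const tendsto_power[OF V]]])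
      (auto intro: poincare_test t)
  then show "Lnorm \<Omega> 2 u \<le> sqrt area * V_norm \<Omega> u"
    using real_le_rsqrt[of "Lnorm \<Omega> 2 u" "area * V_norm \<Omega> u ^ 2"] by (simp add: real_sqrt_mult V_norm_nonneg)
  have K4: "(\<lambda>n. 8 * (Lnorm \<Omega> 2 (\<phi> n) ^ 2 * V_norm \<Omega> (\<phi> n) ^ 2)) \<longlonglongrightarrow> 8 * (Lnorm \<Omega> 2 u ^ 2 * V_norm \<Omega> u ^ 2)"
    by (intro tendsto_intros L V)
  note F4 = Fatou_norm_power[OF m AE i[of 4] ladyzhenskaya_test[OF t] K4]
  show "u \<in> Lspace \<Omega> 4" using F4 m by (simp add: Lspace_def)
  show "Lnorm \<Omega> 4 u ^ 4 \<le> 8 * (Lnorm \<Omega> 2 u ^ 2 * V_norm \<Omega> u ^ 2)" using F4 by (simp add: Lnorm_power)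
  have K6: "(\<lambda>n. 288 * (Lnorm \<Omega> 2 (\<phi> n) ^ 2 * V_norm \<Omega> (\<phi> n) ^ 4)) \<longlonglongrightarrow> 288 * (Lnorm \<Omega> 2 u ^ 2 * V_norm \<Omega> u ^ 4)"
    by (intro tendsto_intros L V)
  show "u \<in> Lspace \<Omega> 6" using Fatou_norm_power[OF m AE i[of 6] L6_test[OF t] K6] m by (simp add: Lspace_def)
qed

section \<open>The Helmholtz--Hodge projection\<close>

lemma helmholtz_exists:
  assumes g: "g \<in> Lspace \<Omega> 2"
  shows "\<exists>w. w \<in> \<H> \<Omega> \<and> (\<forall>v\<in>\<H> \<Omega>. pairing \<Omega> (\<lambda>x. g x - w x) v = 0)"
proof -
  let ?N = "\<lambda>v. Lnorm \<Omega> 2 (\<lambda>x. g x - v x)"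
  define d where "d = (INF v\<in>\<H> \<Omega>. ?N v ^ 2)"
  have ne: "\<H> \<Omega> \<noteq> {}" using V_H[OF V_0] by blast
  have bdd: "bdd_below ((\<lambda>v. ?N v ^ 2) ` \<H> \<Omega>)" by (rule bdd_belowI2[of _ 0]) simp
  have lower: "d \<le> ?N v ^ 2" if "v \<in> \<H> \<Omega>" for v
    unfolding d_def by (rule cINF_lower[OF bdd that])
  have "\<exists>v\<in>\<H> \<Omega>. ?N v ^ 2 < d + inverse (real (Suc n))" for n
    unfolding d_def by (rule cINF_less_iff[OF ne bdd, THEN iffD1]) simp
  then obtain v where v: "\<And>n. v n \<in> \<H> \<Omega>" "\<And>n. ?N (v n) ^ 2 < d + inverse (real (Suc n))" by metis
  have vL: "v n \<in> Lspace \<Omega> 2" for n using v(1) H_Lspace by blast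
  have par: "Lnorm \<Omega> 2 (\<lambda>x. v m x - v n x) ^ 2 \<le> 2 * inverse (real (Suc m)) + 2 * inverse (real (Suc n))" for m n
  proof -
    let ?a = "\<lambda>x. g x - v m x" and ?b = "\<lambda>x. g x - v n x"
    have ab: "?a \<in> Lspace \<Omega> 2" "?b \<in> Lspace \<Omega> 2" by (intro Lspace2_diff g vL)+
    have "(\<lambda>x. (1/2) *\<^sub>R (v m x + v n x)) \<in> \<H> \<Omega>" by (intro H_scale H_add v)
    from lower[OF this] have "4 * d \<le> 4 * Lnorm \<Omega> 2 (\<lambda>x. g x - (1/2) *\<^sub>R (v m x + v n x)) ^ 2" by simp
    also have "\<dots> = Lnorm \<Omega> 2 (\<lambda>x. 2 *\<^sub>R (g x - (1/2) *\<^sub>R (v m x + v n x))) ^ 2"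
      unfolding Lnorm_scale by (simp add: power_mult_distrib)
    also have "(\<lambda>x. 2 *\<^sub>R (g x - (1/2) *\<^sub>R (v m x + v n x))) = (\<lambda>x. ?a x + ?b x)"
      by (simp add: scaleR_2 algebra_simps)
    finally have "4 * d \<le> Lnorm \<Omega> 2 (\<lambda>x. ?a x + ?b x) ^ 2" .
    moreover have "Lnorm \<Omega> 2 (\<lambda>x. ?b x - ?a x) ^ 2 + Lnorm \<Omega> 2 (\<lambda>x. ?a x + ?b x) ^ 2
        = 2 * Lnorm \<Omega> 2 ?a ^ 2 + 2 * Lnorm \<Omega> 2 ?b ^ 2"
      unfolding Lnorm2_add_square[OF ab] Lnorm2_diff_square[OF ab(2,1)] by (simp add: pairing_commute)
    moreover have "(\<lambda>x. ?b x - ?a x) = (\<lambda>x. v m x - v n x)" by auto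
    ultimately show ?thesis using v(2)[of m] v(2)[of n] by simp
  qed
  have "\<exists>N. \<forall>m\<ge>N. \<forall>n\<ge>N. Lnorm \<Omega> 2 (\<lambda>x. v m x - v n x) < e" if e: "e > 0" for e
  proof -
    have "e\<^sup>2 / 4 > 0" using e by simp
    then obtain N where N: "inverse (real (Suc N)) < e\<^sup>2 / 4" using reals_Archimedean by blast
    have le: "inverse (real (Suc m)) < e\<^sup>2 / 4" if "m \<ge> N" for m
      using N that by (smt (verit) inverse_le_imp_le le_imp_inverse_le of_nat_0_less_iff of_nat_mono Suc_le_mono zero_less_Suc)
    have "Lnorm \<Omega> 2 (\<lambda>x. v m x - v n x) < e" if "m \<ge> N" "n \<ge> N" for m n
    proof (rule power2_less_imp_less)
      show "Lnorm \<Omega> 2 (\<lambda>x. v m x - v n x) ^ 2 < e\<^sup>2" using par[of m n] le[OF that(1)] le[OF that(2)] by linarith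
    qed (use e in simp)
    then show ?thesis by blast
  qed
  from Lspace2_complete[OF finite_measure_\<Omega> vL this]
  obtain w where w: "w \<in> Lspace \<Omega> 2" "(\<lambda>n. Lnorm \<Omega> 2 (\<lambda>x. w x - v n x)) \<longlonglongrightarrow> 0" by blast
  have wH: "w \<in> \<H> \<Omega>"
  proof (rule H_closed[OF w(1)])
    fix e :: real assume "e > 0"
    then have "\<forall>\<^sub>F n in sequentially. Lnorm \<Omega> 2 (\<lambda>x. w x - v n x) < e" using order_tendstoD(2)[OF w(2)] by blast
    then obtain n where "Lnorm \<Omega> 2 (\<lambda>x. w x - v n x) < e" using eventually_happens'[OF sequentially_bot] by blast
    then show "\<exists>v\<in>\<H> \<Omega>. Lnorm \<Omega> 2 (\<lambda>x. w x - v x) < e" using v(1) by blast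
  qed
  have "?N w \<le> sqrt d"
  proof (rule LIMSEQ_le_const)
    have "(\<lambda>n. sqrt (d + inverse (real (Suc n))) + Lnorm \<Omega> 2 (\<lambda>x. w x - v n x)) \<longlonglongrightarrow> sqrt (d + 0) + 0"
      by (intro tendsto_add tendsto_real_sqrt tendsto_const LIMSEQ_inverse_real_of_nat w(2))
    then show "(\<lambda>n. sqrt (d + inverse (real (Suc n))) + Lnorm \<Omega> 2 (\<lambda>x. w x - v n x)) \<longlonglongrightarrow> sqrt d" by simp
    have "?N w \<le> sqrt (d + inverse (real (Suc n))) + Lnorm \<Omega> 2 (\<lambda>x. w x - v n x)" for n
      using Lnorm2_diff_triangle[OF g vL w(1), of n] real_le_rsqrt[OF less_imp_le[OF v(2)[of n]]]
        Lnorm2_minus_commute[of \<Omega> w "v n"] by simp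
    then show "\<exists>N. \<forall>n\<ge>N. ?N w \<le> sqrt (d + inverse (real (Suc n))) + Lnorm \<Omega> 2 (\<lambda>x. w x - v n x)" by blast
  qed
  moreover have "d \<ge> 0" unfolding d_def by (rule cINF_greatest[OF ne]) simp
  ultimately have Nw: "?N w ^ 2 \<le> d"
    using power_mono[of "?N w" "sqrt d" 2] Lnorm_nonneg[of \<Omega> 2 "\<lambda>x. g x - w x"] by simp
  have "pairing \<Omega> (\<lambda>x. g x - w x) z = 0" if z: "z \<in> \<H> \<Omega>" for z
  proof -
    define b where "b = pairing \<Omega> (\<lambda>x. g x - w x) z"
    define n where "n = Lnorm \<Omega> 2 z ^ 2"
    define t where "t = b / (n + 1)"
    have n0: "n \<ge> 0" by (simp add: n_def)
    have L: "(\<lambda>x. g x - w x) \<in> Lspace \<Omega> 2" "z \<in> Lspace \<Omega> 2" using Lspace2_diff[OF g w(1)] H_Lspace[OF z] by auto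
    have "d \<le> ?N (\<lambda>x. w x + t *\<^sub>R z x) ^ 2" by (intro lower H_add wH H_scale z)
    also have "(\<lambda>x. g x - (w x + t *\<^sub>R z x)) = (\<lambda>x. (g x - w x) - t *\<^sub>R z x)" by (simp add: algebra_simps)
    also have "Lnorm \<Omega> 2 (\<lambda>x. (g x - w x) - t *\<^sub>R z x) ^ 2 = ?N w ^ 2 - 2 * (t * b) + t\<^sup>2 * n"
      unfolding Lnorm2_diff_square[OF L(1) Lspace_scale[OF L(2)]] b_def n_def
      by (simp add: Lnorm_scale power_mult_distrib pairing_commute[of \<Omega> _ "\<lambda>x. t *\<^sub>R z x"] pairing_scale_left pairing_commute[of \<Omega> z])
    finally have "2 * (t * b) \<le> t\<^sup>2 * n" using Nw by simp
    moreover have tb: "b = t * (n + 1)" using n0 by (simp add: t_def)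
    ultimately have "t\<^sup>2 * (n + 2) \<le> 0" by (simp add: power2_eq_square algebra_simps)
    then have "t = 0" using n0 by (simp add: mult_le_0_iff)
    then show ?thesis using tb by (simp add: b_def)
  qed
  with wH show ?thesis by blast
qed

lemma pairing_helmholtz:
  assumes g: "g \<in> Lspace \<Omega> 2" and v: "v \<in> \<H> \<Omega>"
  shows "pairing \<Omega> (helmholtz \<Omega> g) v = pairing \<Omega> g v"
proof -
  have w: "helmholtz \<Omega> g \<in> \<H> \<Omega> \<and> (\<forall>v\<in>\<H> \<Omega>. pairing \<Omega> (\<lambda>x. g x - helmholtz \<Omega> g x) v = 0)"
    unfolding helmholtz_def by (rule someI_ex[OF helmholtz_exists[OF g]])
  then have "pairing \<Omega> (\<lambda>x. g x - helmholtz \<Omega> g x) v = 0" using v by blast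
  then show ?thesis using pairing_diff_left[OF g H_Lspace H_Lspace[OF v]] w by simp
qed

end

section \<open>Measurability in time\<close>

lemma tendsto_null_bound:
  fixes a e :: "nat \<Rightarrow> real"
  assumes "\<And>n. \<bar>a n - L\<bar> \<le> e n" "e \<longlonglongrightarrow> 0"
  shows "a \<longlonglongrightarrow> L"
  by (rule LIM_zero_cancel[OF Lim_null_comparison[OF _ assms(2)]]) (simp add: assms(1))

abbreviation L\<^sub>T :: "real \<Rightarrow> real measure" where "L\<^sub>T T \<equiv> lebesgue_on {0..T}"

definition simple_in_time :: "real \<Rightarrow> (real \<Rightarrow> 'a) \<Rightarrow> bool" where
  "simple_in_time T s \<longleftrightarrow> finite (s ` {0..T}) \<and> (\<forall>y. {t \<in> {0..T}. s t = y} \<in> sets lebesgue)"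

lemma simple_in_time_sets:
  assumes "simple_in_time T s" "simple_in_time T r"
  shows "{t \<in> {0..T}. P (s t) (r t)} \<in> sets lebesgue"
proof -
  let ?I = "{z \<in> s ` {0..T} \<times> r ` {0..T}. P (fst z) (snd z)}"
  have "{t \<in> {0..T}. P (s t) (r t)} = (\<Union>z\<in>?I. {t \<in> {0..T}. s t = fst z} \<inter> {t \<in> {0..T}. r t = snd z})"
    (is "?L = ?R")
  proof (rule set_eqI, rule iffI)
    fix t assume t: "t \<in> ?L"
    show "t \<in> ?R" by (rule UN_I[of "(s t, r t)"]) (use t in auto)
  qed auto
  also have "\<dots> \<in> sets lebesgue"
  proof -
    have fin: "finite ?I"
      by (rule finite_subset[of _ "s ` {0..T} \<times> r ` {0..T}"]) (use assms in \<open>auto simp: simple_in_time_def\<close>)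
    have m: "{t \<in> {0..T}. s t = y} \<in> sets lebesgue" "{t \<in> {0..T}. r t = z} \<in> sets lebesgue" for y z
      using assms by (simp_all add: simple_in_time_def)
    show ?thesis by (intro sets.finite_UN[OF fin] sets.Int m)
  qed
  finally show ?thesis .
qed

lemma simple_in_time_comp:
  assumes "simple_in_time T s" "simple_in_time T r"
  shows "simple_in_time T (\<lambda>t. h (s t) (r t))"
proof -
  have "(\<lambda>t. (s t, r t)) ` {0..T} \<subseteq> s ` {0..T} \<times> r ` {0..T}" by auto
  then have "finite ((\<lambda>t. (s t, r t)) ` {0..T})"
    by (rule finite_subset) (use assms in \<open>auto simp: simple_in_time_def\<close>)
  then have "finite ((\<lambda>(a, b). h a b) ` (\<lambda>t. (s t, r t)) ` {0..T})" by (rule finite_imageI)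
  then have "finite ((\<lambda>t. h (s t) (r t)) ` {0..T})" by (simp add: image_image)
  then show ?thesis using simple_in_time_sets[OF assms, of "\<lambda>a b. h a b = _"] by (simp add: simple_in_time_def)
qed

lemma simple_in_time_measurable:
  fixes s :: "real \<Rightarrow> real"
  assumes "simple_in_time T s"
  shows "s \<in> borel_measurable (L\<^sub>T T)"
proof (rule measurableI)
  fix A :: "real set"
  have "s -` A \<inter> space (L\<^sub>T T) = {t \<in> {0..T}. s t \<in> A}" by auto
  then show "s -` A \<inter> space (L\<^sub>T T) \<in> sets (L\<^sub>T T)"
    using simple_in_time_sets[OF assms assms, of "\<lambda>a b. a \<in> A"]
    by (auto simp: sets_restrict_space_iff)
qed simp

lemma borel_measurable_lebesgue_on_AE:
  fixes f g :: "'a::euclidean_space \<Rightarrow> real"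
  assumes f: "f \<in> borel_measurable (lebesgue_on S)" and S: "S \<in> sets lebesgue"
    and eq: "AE x in lebesgue_on S. f x = g x"
  shows "g \<in> borel_measurable (lebesgue_on S)"
proof -
  have "(\<lambda>x. if x \<in> S then f x else 0) \<in> borel_measurable lebesgue"
    using f S by (simp add: borel_measurable_if)
  moreover have "AE x in lebesgue. x \<in> S \<longrightarrow> f x = g x"
    using eq S by (simp add: AE_restrict_space_iff)
  then have "AE x in lebesgue. (if x \<in> S then f x else 0) = (if x \<in> S then g x else 0)"
    by eventually_elim simp
  ultimately have "(\<lambda>x. if x \<in> S then g x else 0) \<in> borel_measurable lebesgue"
    by (rule borel_measurable_AE)
  then show ?thesis using S by (simp add: borel_measurable_if)
qed

lemma borel_measurable_AE_LIMSEQ: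
  fixes f :: "'a::euclidean_space \<Rightarrow> real"
  assumes F: "\<And>n. F n \<in> borel_measurable (lebesgue_on S)" and S: "S \<in> sets lebesgue"
    and lim: "AE x in lebesgue_on S. (\<lambda>n. F n x) \<longlonglongrightarrow> f x"
  shows "f \<in> borel_measurable (lebesgue_on S)"
proof (rule borel_measurable_lebesgue_on_AE[OF _ S])
  show "(\<lambda>x. lim (\<lambda>n. F n x)) \<in> borel_measurable (lebesgue_on S)"
    using F by measurable
  show "AE x in lebesgue_on S. lim (\<lambda>n. F n x) = f x"
    using lim by eventually_elim (rule limI)
qed

lemma strongly_measurableE:
  assumes "strongly_measurable T X N u"
  obtains s where "\<forall>n::nat. simple_in_time T (s n)" "\<forall>n. \<forall>t\<in>{0..T}. s n t \<in> X"
    "AE t in L\<^sub>T T. (\<lambda>n. N (\<lambda>x. s n t x - u t x)) \<longlonglongrightarrow> 0"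
proof -
  obtain s :: "nat \<Rightarrow> real \<Rightarrow> 'a \<Rightarrow> 'b" where s: "\<forall>n. finite (s n ` {0..T}) \<and> s n ` {0..T} \<subseteq> X \<and>
          (\<forall>y. {t \<in> {0..T}. s n t = y} \<in> sets lebesgue)"
     "AE t in L\<^sub>T T. (\<lambda>n. N (\<lambda>x. s n t x - u t x)) \<longlonglongrightarrow> 0"
    using assms unfolding strongly_measurable_def by (elim exE conjE)
  show ?thesis
  proof (rule that[of s])
    show "\<forall>n. simple_in_time T (s n)" using s(1) by (simp add: simple_in_time_def)
    show "\<forall>n. \<forall>t\<in>{0..T}. s n t \<in> X" using s(1) by (meson imageI subsetD)
  qed (rule s(2))
qed

lemma strongly_measurable_apply2:
  fixes \<Phi> :: "('a \<Rightarrow> 'b::real_vector) \<Rightarrow> ('c \<Rightarrow> 'd::real_vector) \<Rightarrow> real"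
  assumes u: "strongly_measurable T X N u" "AE t in L\<^sub>T T. u t \<in> X"
    and v: "strongly_measurable T Y N' v" "AE t in L\<^sub>T T. v t \<in> Y"
    and cont: "\<And>a b an bn. a \<in> X \<Longrightarrow> b \<in> Y \<Longrightarrow> (\<And>n::nat. an n \<in> X) \<Longrightarrow> (\<And>n. bn n \<in> Y) \<Longrightarrow>
      (\<lambda>n. N (\<lambda>x. an n x - a x)) \<longlonglongrightarrow> 0 \<Longrightarrow> (\<lambda>n. N' (\<lambda>x. bn n x - b x)) \<longlonglongrightarrow> 0 \<Longrightarrow>
      (\<lambda>n. \<Phi> (an n) (bn n)) \<longlonglongrightarrow> \<Phi> a b"
  shows "(\<lambda>t. \<Phi> (u t) (v t)) \<in> borel_measurable (L\<^sub>T T)"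
proof -
  obtain s where "\<forall>n::nat. simple_in_time T (s n)" "\<forall>n. \<forall>t\<in>{0..T}. s n t \<in> X"
    "AE t in L\<^sub>T T. (\<lambda>n. N (\<lambda>x. s n t x - u t x)) \<longlonglongrightarrow> 0" using u(1) by (rule strongly_measurableE)
  note s = this(1)[rule_format] this(2)[rule_format] this(3)
  obtain r where "\<forall>n::nat. simple_in_time T (r n)" "\<forall>n. \<forall>t\<in>{0..T}. r n t \<in> Y"
    "AE t in L\<^sub>T T. (\<lambda>n. N' (\<lambda>x. r n t x - v t x)) \<longlonglongrightarrow> 0" using v(1) by (rule strongly_measurableE)
  note r = this(1)[rule_format] this(2)[rule_format] this(3)
  have I: "AE t in L\<^sub>T T. t \<in> {0..T}" by (rule AE_I2) simp
  show ?thesis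
  proof (rule borel_measurable_AE_LIMSEQ)
    show "(\<lambda>t. \<Phi> (s n t) (r n t)) \<in> borel_measurable (L\<^sub>T T)" for n
      by (rule simple_in_time_measurable[OF simple_in_time_comp[OF s(1) r(1)]])
    show "AE t in L\<^sub>T T. (\<lambda>n. \<Phi> (s n t) (r n t)) \<longlonglongrightarrow> \<Phi> (u t) (v t)"
      using I u(2) v(2) s(3) r(3)
    proof eventually_elim
      case (elim t)
      show ?case by (rule cont) (use elim s(2) r(2) in auto)
    qed
  qed simp
qed

lemma strongly_measurable_diff:
  assumes u: "strongly_measurable T X N u" "AE t in L\<^sub>T T. u t \<in> X"
    and v: "strongly_measurable T X N v" "AE t in L\<^sub>T T. v t \<in> X"
    and diff: "\<And>a b. a \<in> X \<Longrightarrow> b \<in> X \<Longrightarrow> (\<lambda>x. a x - b x) \<in> X"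
    and N: "\<And>a b. a \<in> X \<Longrightarrow> b \<in> X \<Longrightarrow> N (\<lambda>x. a x - b x) \<le> N a + N b" "\<And>a. a \<in> X \<Longrightarrow> N a \<ge> 0"
  shows "strongly_measurable T X N (\<lambda>t x. u t x - v t x)"
proof -
  obtain s where "\<forall>n::nat. simple_in_time T (s n)" "\<forall>n. \<forall>t\<in>{0..T}. s n t \<in> X"
    "AE t in L\<^sub>T T. (\<lambda>n. N (\<lambda>x. s n t x - u t x)) \<longlonglongrightarrow> 0" using u(1) by (rule strongly_measurableE)
  note s = this(1)[rule_format] this(2)[rule_format] this(3)
  obtain r where "\<forall>n::nat. simple_in_time T (r n)" "\<forall>n. \<forall>t\<in>{0..T}. r n t \<in> X"
    "AE t in L\<^sub>T T. (\<lambda>n. N (\<lambda>x. r n t x - v t x)) \<longlonglongrightarrow> 0" using v(1) by (rule strongly_measurableE)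
  note r = this(1)[rule_format] this(2)[rule_format] this(3)
  have I: "AE t in L\<^sub>T T. t \<in> {0..T}" by (rule AE_I2) simp
  have "simple_in_time T (\<lambda>t x. s n t x - r n t x)" for n
    using simple_in_time_comp[OF s(1) r(1), of "\<lambda>a b x. a x - b x" n n] .
  moreover have "AE t in L\<^sub>T T. (\<lambda>n. N (\<lambda>x. (s n t x - r n t x) - (u t x - v t x))) \<longlonglongrightarrow> 0"
    using I u(2) v(2) s(3) r(3)
  proof eventually_elim
    case (elim t)
    have "N (\<lambda>x. (s n t x - r n t x) - (u t x - v t x)) \<le> N (\<lambda>x. s n t x - u t x) + N (\<lambda>x. r n t x - v t x)" for n
      using N(1)[OF diff[OF s(2)[OF elim(1), of n] elim(2)] diff[OF r(2)[OF elim(1), of n] elim(3)]]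
      by (simp add: algebra_simps)
    then have b: "\<bar>N (\<lambda>x. (s n t x - r n t x) - (u t x - v t x)) - 0\<bar> \<le> N (\<lambda>x. s n t x - u t x) + N (\<lambda>x. r n t x - v t x)" for n
      using N(2)[OF diff[OF diff[OF s(2)[OF elim(1), of n] r(2)[OF elim(1), of n]] diff[OF elim(2,3)]]] by simp
    have "(\<lambda>n. N (\<lambda>x. s n t x - u t x) + N (\<lambda>x. r n t x - v t x)) \<longlonglongrightarrow> 0"
      using tendsto_add[OF elim(4,5)] by simp
    then show ?case by (rule tendsto_null_bound[rotated]) (rule b)
  qed
  ultimately show ?thesis
    unfolding strongly_measurable_def simple_in_time_def
    by (intro exI[of _ "\<lambda>n t x. s n t x - r n t x"]) (auto intro!: diff s(2) r(2))
qed

lemma bochner_L_D: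
  assumes "u \<in> bochner_L q T X N"
  shows "strongly_measurable T X N u" "AE t in L\<^sub>T T. u t \<in> X" "integrable (L\<^sub>T T) (\<lambda>t. N (u t) powr q)"
  using assms by (auto simp: bochner_L_def)

lemma bochner_L2_integrable:
  assumes "u \<in> bochner_L 2 T X N" "\<And>a. N a \<ge> 0"
  shows "integrable (L\<^sub>T T) (\<lambda>t. N (u t) ^ 2)"
  using bochner_L_D(3)[OF assms(1)] assms(2) by simp

lemma time_measure: "finite_measure (L\<^sub>T T)" "{0..T} \<in> sets lebesgue"
  by (auto intro: finite_measure_lebesgue_on_bounded)

lemma integrable_bound_AE:
  fixes f g :: "'a \<Rightarrow> real"
  assumes "integrable M g" "f \<in> borel_measurable M" "AE x in M. \<bar>f x\<bar> \<le> g x"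
  shows "integrable M f"
  by (rule Bochner_Integration.integrable_bound[OF assms(1,2)]) (use assms(3) in \<open>eventually_elim, auto\<close>)

context planar_domain
begin

lemma V_norm_diff_le: "u \<in> \<V> \<Omega> \<Longrightarrow> v \<in> \<V> \<Omega> \<Longrightarrow> V_norm \<Omega> (\<lambda>x. u x - v x) \<le> V_norm \<Omega> u + V_norm \<Omega> v"
  using V_norm_add[OF V_H1 H1_scale[OF V_H1, of v "-1"], of u] V_norm_scale[OF V_H1, of v "-1"] by simp

lemma V_dual_add: "F \<in> V_dual \<Omega> \<Longrightarrow> u \<in> \<V> \<Omega> \<Longrightarrow> v \<in> \<V> \<Omega> \<Longrightarrow> F (\<lambda>x. u x + v x) = F u + F v"
  by (simp add: V_dual_def)

lemma V_dual_scale: "F \<in> V_dual \<Omega> \<Longrightarrow> v \<in> \<V> \<Omega> \<Longrightarrow> F (\<lambda>x. c *\<^sub>R v x) = c * F v"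
  by (simp add: V_dual_def)

lemma V_dual_minus: "F \<in> V_dual \<Omega> \<Longrightarrow> u \<in> \<V> \<Omega> \<Longrightarrow> v \<in> \<V> \<Omega> \<Longrightarrow> F (\<lambda>x. u x - v x) = F u - F v"
  using V_dual_add[OF _ _ V_scale[of v "-1"], of F u] V_dual_scale[of F v "-1"] by simp

lemma V_dual_bounded: "F \<in> V_dual \<Omega> \<Longrightarrow> \<exists>K\<ge>0. \<forall>v\<in>\<V> \<Omega>. \<bar>F v\<bar> \<le> K * V_norm \<Omega> v"
proof -
  assume "F \<in> V_dual \<Omega>"
  then obtain K where K: "\<forall>v\<in>\<V> \<Omega>. \<bar>F v\<bar> \<le> K * V_norm \<Omega> v" by (auto simp: V_dual_def)
  then have "\<forall>v\<in>\<V> \<Omega>. \<bar>F v\<bar> \<le> \<bar>K\<bar> * V_norm \<Omega> v"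
    by (meson V_norm_nonneg abs_ge_self mult_right_mono order_trans)
  then show ?thesis by (intro exI[of _ "\<bar>K\<bar>"]) auto
qed

lemma V_dual_norm_bound:
  assumes F: "F \<in> V_dual \<Omega>" and v: "v \<in> \<V> \<Omega>"
  shows "\<bar>F v\<bar> \<le> V_dual_norm \<Omega> F * V_norm \<Omega> v"
proof -
  obtain K where K: "K \<ge> 0" "\<And>v. v \<in> \<V> \<Omega> \<Longrightarrow> \<bar>F v\<bar> \<le> K * V_norm \<Omega> v" using V_dual_bounded[OF F] by blast
  show ?thesis
  proof (cases "V_norm \<Omega> v = 0")
    case True
    then show ?thesis using K(2)[OF v] by simp
  next
    case False
    then have pos: "V_norm \<Omega> v > 0" using V_norm_nonneg[of v] by simp
    let ?w = "\<lambda>x. (1 / V_norm \<Omega> v) *\<^sub>R v x"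
    have w: "?w \<in> {v \<in> \<V> \<Omega>. V_norm \<Omega> v \<le> 1}"
      using V_scale[OF v] V_norm_scale[OF V_H1[OF v]] pos by simp
    have "bdd_above ((\<lambda>v. \<bar>F v\<bar>) ` {v \<in> \<V> \<Omega>. V_norm \<Omega> v \<le> 1})"
    proof (rule bdd_aboveI2)
      fix v assume "v \<in> {v \<in> \<V> \<Omega>. V_norm \<Omega> v \<le> 1}"
      then show "\<bar>F v\<bar> \<le> K" using K(2)[of v] mult_left_mono[of "V_norm \<Omega> v" 1 K] K(1) by auto
    qed
    from cSUP_upper[OF w this] have "\<bar>F ?w\<bar> \<le> V_dual_norm \<Omega> F" by (simp add: V_dual_norm_def)
    then show ?thesis using pos V_dual_scale[OF F v, of "1 / V_norm \<Omega> v"] by (simp add: abs_mult field_simps)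
  qed
qed

lemma V_dual_norm_le:
  assumes "\<And>v. v \<in> \<V> \<Omega> \<Longrightarrow> \<bar>F v\<bar> \<le> K * V_norm \<Omega> v" "K \<ge> 0"
  shows "V_dual_norm \<Omega> F \<le> K"
  unfolding V_dual_norm_def
proof (rule cSUP_least)
  show "{v \<in> \<V> \<Omega>. V_norm \<Omega> v \<le> 1} \<noteq> {}" using V_0 V_norm_0 by (auto intro!: exI[of _ "\<lambda>x. 0"])
  fix v assume "v \<in> {v \<in> \<V> \<Omega>. V_norm \<Omega> v \<le> 1}"
  then show "\<bar>F v\<bar> \<le> K" using assms(1)[of v] mult_left_mono[of "V_norm \<Omega> v" 1 K] assms(2) by auto
qed

lemma V_dual_norm_nonneg: "V_dual_norm \<Omega> F \<ge> 0" if F: "F \<in> V_dual \<Omega>"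
proof -
  obtain K where K: "K \<ge> 0" "\<And>v. v \<in> \<V> \<Omega> \<Longrightarrow> \<bar>F v\<bar> \<le> K * V_norm \<Omega> v" using V_dual_bounded[OF F] by blast
  have "bdd_above ((\<lambda>v. \<bar>F v\<bar>) ` {v \<in> \<V> \<Omega>. V_norm \<Omega> v \<le> 1})"
  proof (rule bdd_aboveI2)
    fix v assume "v \<in> {v \<in> \<V> \<Omega>. V_norm \<Omega> v \<le> 1}"
    then show "\<bar>F v\<bar> \<le> K" using K(2)[of v] mult_left_mono[of "V_norm \<Omega> v" 1 K] K(1) by auto
  qed
  from cSUP_upper[OF _ this, of "\<lambda>x. 0"] have "\<bar>F (\<lambda>x. 0)\<bar> \<le> V_dual_norm \<Omega> F"
    using V_0 V_norm_0 by (simp add: V_dual_norm_def)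
  then show ?thesis by linarith
qed

lemma V_dual_diff:
  assumes "F \<in> V_dual \<Omega>" "G \<in> V_dual \<Omega>"
  shows "(\<lambda>v. F v - G v) \<in> V_dual \<Omega>"
proof -
  obtain K L where "\<forall>v\<in>\<V> \<Omega>. \<bar>F v\<bar> \<le> K * V_norm \<Omega> v" "\<forall>v\<in>\<V> \<Omega>. \<bar>G v\<bar> \<le> L * V_norm \<Omega> v"
    using V_dual_bounded assms by meson
  then have "\<bar>F v - G v\<bar> \<le> (K + L) * V_norm \<Omega> v" if "v \<in> \<V> \<Omega>" for v
    using that by (smt (verit) distrib_right)
  then have "\<exists>K. \<forall>v\<in>\<V> \<Omega>. \<bar>F v - G v\<bar> \<le> K * V_norm \<Omega> v" by blast
  moreover have "\<forall>v\<in>\<V> \<Omega>. \<forall>w\<in>\<V> \<Omega>. F (\<lambda>x. v x + w x) - G (\<lambda>x. v x + w x) = (F v - G v) + (F w - G w)"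
    using assms by (simp add: V_dual_add)
  moreover have "\<forall>c. \<forall>v\<in>\<V> \<Omega>. F (\<lambda>x. c *\<^sub>R v x) - G (\<lambda>x. c *\<^sub>R v x) = c * (F v - G v)"
    using assms by (simp add: V_dual_scale right_diff_distrib)
  ultimately show ?thesis unfolding V_dual_def by blast
qed

lemma dual_pairing_continuous:
  assumes F: "F \<in> V_dual \<Omega>" and v: "v \<in> \<V> \<Omega>" and Fn: "\<And>n::nat. Fn n \<in> V_dual \<Omega>" and vn: "\<And>n. vn n \<in> \<V> \<Omega>"
    and limF: "(\<lambda>n. V_dual_norm \<Omega> (\<lambda>x. Fn n x - F x)) \<longlonglongrightarrow> 0"
    and limv: "(\<lambda>n. V_norm \<Omega> (\<lambda>x. vn n x - v x)) \<longlonglongrightarrow> 0"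
  shows "(\<lambda>n. Fn n (vn n)) \<longlonglongrightarrow> F v"
proof -
  have bound: "\<bar>Fn n (vn n) - F v\<bar> \<le> V_dual_norm \<Omega> (\<lambda>x. Fn n x - F x) * (V_norm \<Omega> (\<lambda>x. vn n x - v x) + V_norm \<Omega> v)
      + V_dual_norm \<Omega> F * V_norm \<Omega> (\<lambda>x. vn n x - v x)" for n
  proof -
    let ?G = "\<lambda>x. Fn n x - F x"
    have "V_norm \<Omega> (vn n) \<le> V_norm \<Omega> (\<lambda>x. vn n x - v x) + V_norm \<Omega> v"
      using V_norm_add[OF H1_diff[OF V_H1[OF vn] V_H1[OF v]] V_H1[OF v], of n] by simp
    then have "\<bar>?G (vn n)\<bar> \<le> V_dual_norm \<Omega> ?G * (V_norm \<Omega> (\<lambda>x. vn n x - v x) + V_norm \<Omega> v)"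
      using V_dual_norm_bound[OF V_dual_diff[OF Fn F] vn, of n n] V_dual_norm_nonneg[OF V_dual_diff[OF Fn F], of n]
      by (meson mult_left_mono order_trans)
    moreover have "\<bar>F (vn n) - F v\<bar> \<le> V_dual_norm \<Omega> F * V_norm \<Omega> (\<lambda>x. vn n x - v x)"
      using V_dual_norm_bound[OF F V_diff[OF vn v], of n] V_dual_minus[OF F vn v, of n] by simp
    ultimately show ?thesis by linarith
  qed
  have "(\<lambda>n. V_dual_norm \<Omega> (\<lambda>x. Fn n x - F x) * (V_norm \<Omega> (\<lambda>x. vn n x - v x) + V_norm \<Omega> v)
      + V_dual_norm \<Omega> F * V_norm \<Omega> (\<lambda>x. vn n x - v x)) \<longlonglongrightarrow> 0 * (0 + V_norm \<Omega> v) + V_dual_norm \<Omega> F * 0"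
    by (intro tendsto_intros limF limv)
  then have lim: "(\<lambda>n. V_dual_norm \<Omega> (\<lambda>x. Fn n x - F x) * (V_norm \<Omega> (\<lambda>x. vn n x - v x) + V_norm \<Omega> v)
      + V_dual_norm \<Omega> F * V_norm \<Omega> (\<lambda>x. vn n x - v x)) \<longlonglongrightarrow> 0"
    by (simp only: mult_zero_left mult_zero_right add_0)
  show ?thesis
    by (rule tendsto_null_bound[where a = "\<lambda>n. Fn n (vn n)" and L = "F v", OF _ lim]) (simp only: bound)
qed

lemma dual_pairing_measurable:
  assumes g: "strongly_measurable T (V_dual \<Omega>) (V_dual_norm \<Omega>) g" "AE t in L\<^sub>T T. g t \<in> V_dual \<Omega>"
    and v: "strongly_measurable T (\<V> \<Omega>) (V_norm \<Omega>) v" "AE t in L\<^sub>T T. v t \<in> \<V> \<Omega>"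
  shows "(\<lambda>t. g t (v t)) \<in> borel_measurable (L\<^sub>T T)"
  apply (rule strongly_measurable_apply2[where \<Phi> = "\<lambda>F v. F v", OF g v])
  subgoal for F v Fn vn by (rule dual_pairing_continuous[of F v Fn vn])
  done

lemma strongly_measurable_const: "v \<in> X \<Longrightarrow> N (\<lambda>x. 0) = 0 \<Longrightarrow> strongly_measurable T X N (\<lambda>t. v)"
proof -
  assume "v \<in> X" "N (\<lambda>x. 0) = 0"
  moreover have "{t \<in> {0..T}. v = y} \<in> sets lebesgue" for y by (cases "v = y") auto
  moreover have "finite ((\<lambda>t. v) ` {0..T})" by (rule finite_subset[of _ "{v}"]) auto
  ultimately have "\<forall>n::nat. finite ((\<lambda>t. v) ` {0..T}) \<and> (\<lambda>t. v) ` {0..T} \<subseteq> X \<and> (\<forall>y. {t \<in> {0..T}. v = y} \<in> sets lebesgue)"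
    "AE t in L\<^sub>T T. (\<lambda>n::nat. N (\<lambda>x. v x - v x)) \<longlonglongrightarrow> 0"
    by (simp_all add: image_subset_iff)
  then show ?thesis unfolding strongly_measurable_def by (intro exI[of _ "\<lambda>n t. v"] conjI)
qed

end

section \<open>Distributional derivatives in time\<close>

lemma lebesgue_on_Icc:
  fixes f :: "real \<Rightarrow> real"
  assumes "integrable (L\<^sub>T T) f"
  shows "f integrable_on {0..T}" "(LINT t|L\<^sub>T T. f t) = integral {0..T} f"
  using assms by (auto intro: integrable_on_lebesgue_on lebesgue_integral_eq_integral)

lemma AE_negligible:
  assumes "AE t in L\<^sub>T T. P t"
  obtains N where "negligible N" "\<forall>t\<in>{0..T} - N. P t"
proof -
  have "AE t in lebesgue. t \<in> {0..T} \<longrightarrow> P t" using assms by (simp add: AE_restrict_space_iff)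
  then obtain N where N: "{t \<in> space lebesgue. \<not> (t \<in> {0..T} \<longrightarrow> P t)} \<subseteq> N" "N \<in> null_sets lebesgue"
    by (rule AE_E3) blast
  from N(1) have "\<forall>t\<in>{0..T} - N. P t" by (auto simp: subset_eq)
  with N(2) show ?thesis using that[of N] by (simp add: negligible_iff_null_sets)
qed

lemma continuous_integrable_time:
  fixes f :: "real \<Rightarrow> real"
  assumes "continuous_on {0..T} f"
  shows "integrable (L\<^sub>T T) f"
  using continuous_imp_integrable_real[OF assms] .

lemma kernel_integral:
  assumes n: "n > 0" and a: "0 \<le> a" "a + 1 / real n \<le> T"
  shows "((\<lambda>t. real n * bump (real n * (t - a)) / bump_mass) has_integral 1) {0..T}"
proof -
  have D: "((\<lambda>x. step (real n * (x - a))) has_field_derivative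
     bump (real n * (x - a)) / bump_mass * real n) (at x)" for x
    by (rule DERIV_chain2[OF step_deriv]) (auto intro!: derivative_eq_intros)
  have T: "0 \<le> T" using a n by (smt (verit) divide_nonneg_nonneg of_nat_0_le_iff)
  have "((\<lambda>x. bump (real n * (x - a)) / bump_mass * real n) has_integral
      (step (real n * (T - a)) - step (real n * (0 - a)))) {0..T}"
    by (rule fundamental_theorem_of_calculus[OF T])
      (use D in \<open>auto simp: has_real_derivative_iff_has_vector_derivative[symmetric] intro: DERIV_subset\<close>)
  moreover have "1 \<le> real n * (T - a)" using a(2) n by (simp add: field_simps)
  ultimately show ?thesis using a(1) by (simp add: step_1 step_0 mult.commute)
qed

lemma kernel_continuous: "continuous_on S (\<lambda>t. real n * bump (real n * (t - a)) / bump_mass)"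
  by (intro continuous_intros continuous_on_compose2[OF smooth_continuous[OF smooth_bump, of UNIV]]) (use bump_mass_pos in auto)

lemma kernel_approx:
  fixes \<phi> :: "real \<Rightarrow> real"
  assumes \<phi>: "continuous_on {0..T} \<phi>" and n: "n > 0" and a: "0 \<le> a" "a + 1 / real n \<le> T"
    and e: "\<And>t. a \<le> t \<Longrightarrow> t \<le> a + 1 / real n \<Longrightarrow> \<bar>\<phi> t - c\<bar> \<le> e"
  shows "\<bar>(LINT t|L\<^sub>T T. \<phi> t * (real n * bump (real n * (t - a)) / bump_mass)) - c\<bar> \<le> e"
proof -
  let ?k = "\<lambda>t. real n * bump (real n * (t - a)) / bump_mass"
  have k0: "?k t \<ge> 0" for t using bump_nonneg bump_mass_pos by (simp add: less_imp_le)
  have k: "integrable (L\<^sub>T T) ?k" by (intro continuous_integrable_time kernel_continuous)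
  have ki: "(LINT t|L\<^sub>T T. ?k t) = 1"
    unfolding lebesgue_on_Icc(2)[OF k] by (rule integral_unique[OF kernel_integral[OF n a]])
  have pk: "integrable (L\<^sub>T T) (\<lambda>t. \<phi> t * ?k t)"
    by (intro continuous_integrable_time continuous_on_mult \<phi> kernel_continuous)
  have eq: "(LINT t|L\<^sub>T T. \<phi> t * ?k t) - c = (LINT t|L\<^sub>T T. \<phi> t * ?k t - c * ?k t)"
    unfolding Bochner_Integration.integral_diff[OF pk integrable_mult_right[OF k]]
    by (simp only: integral_mult_right_zero ki mult_1_right)
  have "\<bar>(LINT t|L\<^sub>T T. \<phi> t * ?k t) - c\<bar> \<le> (LINT t|L\<^sub>T T. \<bar>\<phi> t * ?k t - c * ?k t\<bar>)"
    unfolding eq by (rule integral_abs_bound)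
  also have "\<dots> \<le> (LINT t|L\<^sub>T T. e * ?k t)"
  proof (rule integral_mono)
    fix t
    have "\<bar>\<phi> t * ?k t - c * ?k t\<bar> = \<bar>\<phi> t - c\<bar> * ?k t"
      unfolding left_diff_distrib[symmetric] abs_mult using k0[of t] by (simp only: abs_of_nonneg)
    also have "\<dots> \<le> e * ?k t"
    proof (cases "?k t = 0")
      case False
      then have b: "bump (real n * (t - a)) \<noteq> 0" by auto
      then have "0 < real n * (t - a)" "real n * (t - a) < 1" using bump_0 by (meson not_le)+
      then have "a \<le> t" "t \<le> a + 1 / real n" using n by (auto simp: field_simps zero_less_mult_iff)
      from e[OF this] show ?thesis by (rule mult_right_mono[OF _ k0])
    next
      case True
      then show ?thesis by (simp only: mult_zero_right order_refl)
    qed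
    finally show "\<bar>\<phi> t * ?k t - c * ?k t\<bar> \<le> e * ?k t" .
  qed (intro integrable_abs Bochner_Integration.integrable_diff pk integrable_mult_right k)+
  also have "\<dots> = e" by (simp only: integral_mult_right_zero ki mult_1_right)
  finally show ?thesis .
qed

lemma kernel_tendsto:
  fixes \<phi> :: "real \<Rightarrow> real"
  assumes \<phi>: "continuous_on {0..T} \<phi>" and c: "0 < c" "c < T" and a: "\<And>n. \<bar>a n - c\<bar> \<le> 1 / real n"
  shows "(\<lambda>n. LINT t|L\<^sub>T T. \<phi> t * (real n * bump (real n * (t - a n)) / bump_mass)) \<longlonglongrightarrow> \<phi> c"
proof (rule LIMSEQ_I)
  fix e :: real assume e: "e > 0"
  have "continuous (at c within {0..T}) \<phi>" using \<phi> c by (auto simp: continuous_on_eq_continuous_within)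
  then obtain d where d: "d > 0" "\<And>t. t \<in> {0..T} \<Longrightarrow> \<bar>t - c\<bar> < d \<Longrightarrow> \<bar>\<phi> t - \<phi> c\<bar> < e/2"
    unfolding continuous_within_eps_delta dist_real_def using e half_gt_zero[OF e] by meson
  define m where "m = Min {d, c, T - c}"
  have m: "m > 0" "m \<le> d" "m \<le> c" "m \<le> T - c" using d c by (auto simp: m_def)
  obtain N :: nat where N: "2 / m < real N" using reals_Archimedean2 by blast
  have "norm ((LINT t|L\<^sub>T T. \<phi> t * (real n * bump (real n * (t - a n)) / bump_mass)) - \<phi> c) < e" if n: "n \<ge> N" for n
  proof -
    have nN: "2 / m < real n" using N n by (meson less_le_trans of_nat_mono)
    have n0: "n > 0" using nN m(1) by (intro gr0I) (simp add: divide_less_0_iff)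
    have "2 / real n < m" using nN m(1) n0 by (simp add: field_simps)
    then have *: "1 / real n < m / 2" by simp
    have an: "\<bar>a n - c\<bar> < m / 2" using a[of n] * by linarith
    have "\<bar>(LINT t|L\<^sub>T T. \<phi> t * (real n * bump (real n * (t - a n)) / bump_mass)) - \<phi> c\<bar> \<le> e/2"
    proof (rule kernel_approx[OF \<phi> n0])
      show "0 \<le> a n" "a n + 1 / real n \<le> T" using an * m by linarith+
      fix t assume t: "a n \<le> t" "t \<le> a n + 1 / real n"
      then have "\<bar>t - c\<bar> < m" using an * by linarith
      then show "\<bar>\<phi> t - \<phi> c\<bar> \<le> e/2" using m d(2)[of t] by fastforce
    qed
    then show ?thesis using e by simp
  qed
  then show "\<exists>N. \<forall>n\<ge>N. norm ((LINT t|L\<^sub>T T. \<phi> t * (real n * bump (real n * (t - a n)) / bump_mass)) - \<phi> c) < e"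
    by blast
qed

lemma distributional_derivative_increment:
  fixes \<phi> g :: "real \<Rightarrow> real"
  assumes \<phi>: "continuous_on {0..T} \<phi>" and g: "integrable (L\<^sub>T T) g"
    and weak: "\<And>\<psi>. \<psi> \<in> test_funs {0<..<T} \<Longrightarrow> (LINT t|L\<^sub>T T. \<phi> t * deriv \<psi> t) = - (LINT t|L\<^sub>T T. g t * \<psi> t)"
    and sr: "0 < s" "s < r" "r < T"
  shows "\<phi> r - \<phi> s = integral {s..r} g"
proof -
  let ?K = "\<lambda>a n t. real n * bump (real n * (t - a)) / bump_mass"
  have plateau: "deriv (plateau s r n) t = ?K s n t - ?K (r - 1 / real n) n t" if "n > 0" for n t
  proof -
    have "real n * (t - (r - 1 / real n)) = real n * (t - r) + 1" using that by (simp add: field_simps)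
    then show ?thesis using DERIV_imp_deriv[OF plateau_deriv[of s r n t]] by (simp add: diff_divide_distrib)
  qed
  have ev: "\<forall>\<^sub>F n in sequentially. (LINT t|L\<^sub>T T. \<phi> t * ?K s n t) - (LINT t|L\<^sub>T T. \<phi> t * ?K (r - 1 / real n) n t)
      = - (LINT t|L\<^sub>T T. g t * plateau s r n t)"
  proof -
    obtain N :: nat where N: "2 / (r - s) < real N" using reals_Archimedean2 by blast
    have "(LINT t|L\<^sub>T T. \<phi> t * ?K s n t) - (LINT t|L\<^sub>T T. \<phi> t * ?K (r - 1 / real n) n t)
      = - (LINT t|L\<^sub>T T. g t * plateau s r n t)" if n: "n \<ge> N" for n
    proof -
      have nN: "2 / (r - s) < real n" using N n by (meson less_le_trans of_nat_mono)
      have n0: "n > 0" using nN sr by (intro gr0I) (simp add: divide_less_0_iff)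
      have n2: "real n * (r - s) \<ge> 2" using nN sr by (simp add: field_simps)
      have "plateau s r n \<in> test_funs {0<..<T}"
        by (rule test_funsI[of _ "{s..r}"]) (use sr plateau_support[OF n2] in \<open>auto intro: smooth_plateau\<close>)
      from weak[OF this] have "- (LINT t|L\<^sub>T T. g t * plateau s r n t) = (LINT t|L\<^sub>T T. \<phi> t * ?K s n t - \<phi> t * ?K (r - 1 / real n) n t)"
        by (simp add: plateau[OF n0] right_diff_distrib)
      also have "\<dots> = (LINT t|L\<^sub>T T. \<phi> t * ?K s n t) - (LINT t|L\<^sub>T T. \<phi> t * ?K (r - 1 / real n) n t)"
        by (intro Bochner_Integration.integral_diff continuous_integrable_time continuous_on_mult \<phi> kernel_continuous)
      finally show ?thesis by simp
    qed
    then show ?thesis by (auto simp: eventually_sequentially)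
  qed
  have L: "(\<lambda>n. (LINT t|L\<^sub>T T. \<phi> t * ?K s n t) - (LINT t|L\<^sub>T T. \<phi> t * ?K (r - 1 / real n) n t)) \<longlonglongrightarrow> \<phi> s - \<phi> r"
    by (intro tendsto_diff kernel_tendsto \<phi>) (use sr in auto)
  have gm: "g \<in> borel_measurable (L\<^sub>T T)" using g by auto
  have cm: "f \<in> borel_measurable (L\<^sub>T T)" if "f \<in> borel_measurable borel" for f :: "real \<Rightarrow> real"
    using that by (intro measurable_restrict_space1 measurable_completion) simp
  have pm: "plateau s r n \<in> borel_measurable (L\<^sub>T T)" for n
    by (intro cm borel_measurable_continuous_onI smooth_continuous smooth_plateau)
  have im: "(indicator {s<..<r} :: real \<Rightarrow> real) \<in> borel_measurable (L\<^sub>T T)"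
    by (rule cm[OF borel_measurable_indicator]) simp
  have "(\<lambda>n. LINT t|L\<^sub>T T. g t * plateau s r n t) \<longlonglongrightarrow> (LINT t|L\<^sub>T T. g t * indicator {s<..<r} t)"
  proof (rule integral_dominated_convergence[where w = "\<lambda>t. \<bar>g t\<bar>"])
    show "(\<lambda>t. g t * indicator {s<..<r} t) \<in> borel_measurable (L\<^sub>T T)" "(\<lambda>t. g t * plateau s r n t) \<in> borel_measurable (L\<^sub>T T)" for n
      by (rule borel_measurable_times[OF gm im], rule borel_measurable_times[OF gm pm])
    show "AE t in L\<^sub>T T. (\<lambda>n. g t * plateau s r n t) \<longlonglongrightarrow> g t * indicator {s<..<r} t"
      by (intro AE_I2 tendsto_mult_left plateau_tendsto sr)
    show "AE t in L\<^sub>T T. norm (g t * plateau s r n t) \<le> \<bar>g t\<bar>" for n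
      by (intro AE_I2) (simp add: abs_mult mult_left_le plateau_bound)
  qed (use g in auto)
  also have "(LINT t|L\<^sub>T T. g t * indicator {s<..<r} t) = integral {0..T} (\<lambda>t. g t * indicator {s<..<r} t)"
  proof (rule lebesgue_on_Icc(2))
    show "integrable (L\<^sub>T T) (\<lambda>t. g t * indicator {s<..<r} t)"
      using g by (rule Bochner_Integration.integrable_bound) (use borel_measurable_times[OF gm im] in \<open>auto simp: indicator_def\<close>)
  qed
  also have "\<dots> = integral {0..T} (\<lambda>t. if t \<in> {s..r} then g t else 0)"
    by (rule integral_spike[of "{s, r}"]) (auto simp: indicator_def)
  also have "\<dots> = integral {s..r} g"
  proof (rule integral_unique)
    have "g integrable_on {s..r}"
      by (rule integrable_subinterval_real[OF lebesgue_on_Icc(1)[OF g]]) (use sr in auto)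
    then show "((\<lambda>t. if t \<in> {s..r} then g t else 0) has_integral integral {s..r} g) {0..T}"
      using sr by (subst has_integral_restrict) (auto intro: integrable_integral)
  qed
  finally have R: "(\<lambda>n. - (LINT t|L\<^sub>T T. g t * plateau s r n t)) \<longlonglongrightarrow> - integral {s..r} g"
    by (rule tendsto_minus)
  have "\<phi> s - \<phi> r = - integral {s..r} g"
    by (rule LIMSEQ_unique[OF Lim_transform_eventually[OF L ev] R])
  then show ?thesis by simp
qed

section \<open>Approximation of functions of time\<close>

lemma indicator_continuous_approx:
  assumes E: "E \<in> sets lebesgue" and e: "e > 0"
  obtains c :: "real \<Rightarrow> real" where "continuous_on UNIV c"
    "integrable (L\<^sub>T T) (\<lambda>t. (indicator E t - c t)\<^sup>2)" "(LINT t|L\<^sub>T T. (indicator E t - c t)\<^sup>2) < e"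
proof -
  have e2: "e/2 > 0" using e by simp
  obtain O' where O: "open O'" "E \<subseteq> O'" "O' - E \<in> lmeasurable" "emeasure lebesgue (O' - E) < ennreal (e/2)"
    using sets_lebesgue_outer_open[OF E e2] by blast
  obtain K where K: "closed K" "K \<subseteq> E" "E - K \<in> lmeasurable" "emeasure lebesgue (E - K) < ennreal (e/2)"
    using sets_lebesgue_inner_closed[OF E e2] by blast
  have cO: "closed (- O')" using O(1) by (rule closed_Compl)
  have "K \<inter> - O' = {}" using K(2) O(2) by blast
  then obtain c :: "real \<Rightarrow> real" where c: "continuous_on UNIV c" "\<And>x. c x \<in> closed_segment 1 0"
      "\<And>x. x \<in> K \<Longrightarrow> c x = 1" "\<And>x. x \<in> - O' \<Longrightarrow> c x = 0"
    using Urysohn[OF K(1) cO, of 1 0] by blast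
  have c01: "0 \<le> c x" "c x \<le> 1" for x using c(2)[of x] by (auto simp: closed_segment_eq_real_ivl)
  let ?D = "(O' - E) \<union> (E - K)"
  have D: "?D \<in> lmeasurable" using O(3) K(3) by (rule fmeasurable.Un)
  have "measure lebesgue ?D \<le> measure lebesgue (O' - E) + measure lebesgue (E - K)"
    using O(3) K(3) by (intro measure_Un_le) auto
  moreover have "measure lebesgue (O' - E) < e/2" "measure lebesgue (E - K) < e/2"
    using O(3,4) K(3,4) e by (auto simp: emeasure_eq_measure2 ennreal_less_iff)
  ultimately have mD: "measure lebesgue ?D < e" by linarith
  have le: "(indicator E t - c t)\<^sup>2 \<le> indicator ?D t" for t
  proof (cases "t \<in> ?D")
    case True
    have "\<bar>indicator E t - c t\<bar> \<le> 1" using c01[of t] by (auto simp: indicator_def)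
    then have "(indicator E t - c t)\<^sup>2 \<le> 1" by (simp add: abs_square_le_1)
    then show ?thesis using True by simp
  next
    case False
    then have "t \<in> K \<or> t \<notin> O'" by blast
    then show ?thesis using c(3)[of t] c(4)[of t] K(2) O(2) by (auto simp: indicator_def)
  qed
  have iD: "integrable lebesgue (indicator ?D :: real \<Rightarrow> real)"
    using D by (simp add: lmeasurable_iff_integrable)
  have iDT: "integrable (L\<^sub>T T) (indicator ?D :: real \<Rightarrow> real)"
    using integrable_mult_indicator[OF _ iD, of "{0..T}"] by (simp add: integrable_restrict_space)
  have m: "(\<lambda>t. (indicator E t - c t)\<^sup>2) \<in> borel_measurable (L\<^sub>T T)"
  proof -
    have "c \<in> borel_measurable borel" using c(1) by (rule borel_measurable_continuous_onI)
    then have "c \<in> borel_measurable lebesgue" by (intro measurable_completion) simp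
    moreover have "(indicator E :: real \<Rightarrow> real) \<in> borel_measurable lebesgue" using E by simp
    ultimately have "(\<lambda>t. (indicator E t - c t)\<^sup>2) \<in> borel_measurable lebesgue" by measurable
    then show ?thesis by (rule measurable_restrict_space1)
  qed
  have i: "integrable (L\<^sub>T T) (\<lambda>t. (indicator E t - c t)\<^sup>2)"
    by (rule Bochner_Integration.integrable_bound[OF iDT m]) (use le in auto)
  have "(LINT t|L\<^sub>T T. (indicator E t - c t)\<^sup>2) \<le> (LINT t|L\<^sub>T T. indicator ?D t)"
    by (rule integral_mono[OF i iDT le])
  also have "\<dots> \<le> (LINT t|lebesgue. indicator ?D t)"
  proof -
    have "integrable lebesgue (\<lambda>t. indicator {0..T} t *\<^sub>R (indicator ?D t :: real))"
      by (rule integrable_mult_indicator[OF _ iD]) simp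
    then have "(LINT t|lebesgue. indicator {0..T} t *\<^sub>R (indicator ?D t :: real)) \<le> (LINT t|lebesgue. indicator ?D t)"
      by (rule integral_mono[OF _ iD]) (simp add: indicator_def)
    then show ?thesis by (subst integral_restrict_space) auto
  qed
  also have "\<dots> = measure lebesgue ?D" using D by simp
  finally have "(LINT t|L\<^sub>T T. (indicator E t - c t)\<^sup>2) < e" using mD by linarith
  with c(1) i show ?thesis by (rule that)
qed

lemma grid_point:
  fixes \<phi> :: "real \<Rightarrow> real"
  assumes T: "T > 0" and N: "N > 0" and \<phi>: "integrable (L\<^sub>T T) \<phi>" and less: "(LINT t|L\<^sub>T T. \<phi> t) < \<delta>"
    and P: "AE t in L\<^sub>T T. P t"
  defines "h \<equiv> T / real N"
  obtains s where "0 < s" "s < h" "\<forall>i<N. P (s + real i * h)" "h * (\<Sum>i<N. \<phi> (s + real i * h)) < \<delta>"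
proof -
  note found = that
  have h: "h > 0" "real N * h = T" using T N by (auto simp: h_def)
  have int: "\<phi> integrable_on {0..T}" "(LINT t|L\<^sub>T T. \<phi> t) = integral {0..T} \<phi>"
    using lebesgue_on_Icc[OF \<phi>] by auto
  have sub: "\<phi> integrable_on {real i * h..real i * h + h}" if "i < N" for i
  proof (rule integrable_subinterval_real[OF int(1)])
    have "real i * h + h = real (Suc i) * h" by (simp add: algebra_simps)
    also have "\<dots> \<le> real N * h" using that h by (intro mult_right_mono) auto
    finally show "{real i * h..real i * h + h} \<subseteq> {0..T}" using h by auto
  qed
  have shift: "(\<lambda>s. \<phi> (s + real i * h)) integrable_on {0..h}"
    "integral {0..h} (\<lambda>s. \<phi> (s + real i * h)) = integral {real i * h..real i * h + h} \<phi>" if "i < N" for i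
    using sub[OF that] integrable_on_shift_Icc_real[of \<phi> "real i * h" 0 h] integral_shift_Icc_real[of 0 h \<phi> "real i * h"]
    by (simp_all add: o_def add.commute)
  have sum: "integral {0..real m * h} \<phi> = (\<Sum>i<m. integral {0..h} (\<lambda>s. \<phi> (s + real i * h)))" if "m \<le> N" for m
    using that
  proof (induction m)
    case (Suc m)
    have le: "real (Suc m) * h \<le> T" using Suc.prems h by (metis mult_right_mono of_nat_mono less_imp_le)
    have "integral {0..real m * h} \<phi> + integral {real m * h..real (Suc m) * h} \<phi> = integral {0..real (Suc m) * h} \<phi>"
      by (rule Henstock_Kurzweil_Integration.integral_combine)
        (use h le in \<open>auto intro: integrable_subinterval_real[OF int(1)] simp: algebra_simps\<close>)
    then show ?case using Suc shift(2)[of m] by (simp add: algebra_simps)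
  qed simp
  define \<Phi> where "\<Phi> s = (\<Sum>i<N. \<phi> (s + real i * h))" for s
  have \<Phi>: "\<Phi> integrable_on {0..h}" "integral {0..h} \<Phi> = integral {0..T} \<phi>"
  proof -
    show "\<Phi> integrable_on {0..h}" unfolding \<Phi>_def by (intro integrable_sum shift) auto
    have "integral {0..h} \<Phi> = (\<Sum>i<N. integral {0..h} (\<lambda>s. \<phi> (s + real i * h)))"
      unfolding \<Phi>_def by (rule integral_sum) (auto intro: shift)
    then show "integral {0..h} \<Phi> = integral {0..T} \<phi>" using sum[of N] h by simp
  qed
  obtain Z where Z: "negligible Z" "\<forall>t\<in>{0..T} - Z. P t" using AE_negligible[OF P] by blast
  define B where "B = (\<Union>i<N. (+) (- real i * h) ` Z) \<union> {0, h}"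
  have tr: "negligible ((+) (- real i * h) ` Z)" for i by (rule negligible_translation[OF Z(1)])
  have "negligible (\<Union>i<N. (+) (- real i * h) ` Z)"
    by (rule negligible_Union) (use tr in blast)+
  then have B: "negligible B" unfolding B_def by (intro negligible_Un) auto
  have good: "P (s + real i * h)" if "s \<in> {0..h} - B" "i < N" for s i
  proof -
    have "s + real i * h \<notin> Z"
    proof
      assume "s + real i * h \<in> Z"
      then have "s \<in> (+) (- real i * h) ` Z" by (intro image_eqI[where x = "s + real i * h"]) auto
      then show False using that by (auto simp: B_def)
    qed
    moreover have "real (Suc i) * h \<le> T" using that(2) h by (metis Suc_leI mult_right_mono of_nat_mono less_imp_le)
    then have "s + real i * h \<in> {0..T}" using that h by (auto simp: algebra_simps)
    ultimately show ?thesis using Z(2) by blast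
  qed
  show ?thesis
  proof (rule ccontr)
    assume "\<not> thesis"
    then have bad: "\<delta> / h \<le> \<Phi> s" if "s \<in> {0..h} - B" for s
    proof -
      have "0 < s" "s < h" using that by (auto simp: B_def)
      moreover have "\<forall>i<N. P (s + real i * h)" using good[OF that] by blast
      ultimately have "\<not> h * \<Phi> s < \<delta>"
        using found[of s] \<open>\<not> thesis\<close> unfolding \<Phi>_def by (intro notI) simp
      then show ?thesis using h(1) by (simp add: pos_divide_le_eq mult.commute)
    qed
    have I2: "((\<lambda>s. if s \<in> B then \<delta> / h else \<Phi> s) has_integral integral {0..h} \<Phi>) {0..h}"
      by (rule has_integral_spike[OF B _ integrable_integral[OF \<Phi>(1)]]) auto
    have I1: "((\<lambda>s. \<delta> / h) has_integral (h - 0) * (\<delta> / h)) {0..h}"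
      using has_integral_const_real[of "\<delta> / h" 0 h] h by simp
    have "(h - 0) * (\<delta> / h) \<le> integral {0..h} \<Phi>"
      by (rule has_integral_le[OF I1 I2]) (use bad in auto)
    then show False using less int(2) \<Phi>(2) h by simp
  qed
qed

context planar_domain
begin

lemma cont_in_time_H: "w \<in> cont_in_time T (\<H> \<Omega>) (H_norm \<Omega>) \<Longrightarrow> t \<in> {0..T} \<Longrightarrow> w t \<in> \<H> \<Omega>"
  by (simp add: cont_in_time_def)

lemma cont_in_time_Lspace: "w \<in> cont_in_time T (\<H> \<Omega>) (H_norm \<Omega>) \<Longrightarrow> t \<in> {0..T} \<Longrightarrow> w t \<in> Lspace \<Omega> 2"
  by (intro H_Lspace cont_in_time_H)

lemma cont_in_time_const: "v \<in> \<H> \<Omega> \<Longrightarrow> (\<lambda>t. v) \<in> cont_in_time T (\<H> \<Omega>) (H_norm \<Omega>)"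
  by (simp add: cont_in_time_def Lnorm_2)

lemma cont_in_time_diff:
  assumes w: "w \<in> cont_in_time T (\<H> \<Omega>) (H_norm \<Omega>)" and p: "p \<in> cont_in_time T (\<H> \<Omega>) (H_norm \<Omega>)"
  shows "(\<lambda>t x. w t x - p t x) \<in> cont_in_time T (\<H> \<Omega>) (H_norm \<Omega>)"
  unfolding cont_in_time_def
proof (intro CollectI ballI conjI)
  fix t assume t: "t \<in> {0..T}"
  show "(\<lambda>x. w t x - p t x) \<in> \<H> \<Omega>" by (intro H_diff cont_in_time_H[OF w t] cont_in_time_H[OF p t])
  have lim: "((\<lambda>s. H_norm \<Omega> (\<lambda>x. w s x - w t x) + H_norm \<Omega> (\<lambda>x. p s x - p t x)) \<longlongrightarrow> 0) (at t within {0..T})"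
    using tendsto_add[of "\<lambda>s. H_norm \<Omega> (\<lambda>x. w s x - w t x)" 0 _ "\<lambda>s. H_norm \<Omega> (\<lambda>x. p s x - p t x)" 0] w p t
    by (simp add: cont_in_time_def)
  show "((\<lambda>s. H_norm \<Omega> (\<lambda>x. w s x - p s x - (w t x - p t x))) \<longlongrightarrow> 0) (at t within {0..T})"
  proof (rule Lim_null_comparison[OF _ lim])
    show "\<forall>\<^sub>F s in at t within {0..T}. norm (H_norm \<Omega> (\<lambda>x. w s x - p s x - (w t x - p t x)))
        \<le> H_norm \<Omega> (\<lambda>x. w s x - w t x) + H_norm \<Omega> (\<lambda>x. p s x - p t x)"
      unfolding eventually_at_filter
    proof (intro always_eventually allI impI)
      fix s assume s: "s \<in> {0..T}"
      have "H_norm \<Omega> (\<lambda>x. (w s x - w t x) + (p t x - p s x)) \<le> H_norm \<Omega> (\<lambda>x. w s x - w t x) + H_norm \<Omega> (\<lambda>x. p t x - p s x)"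
        by (intro Lnorm2_triangle Lspace2_diff cont_in_time_Lspace[OF w] cont_in_time_Lspace[OF p] s t)
      moreover have "(\<lambda>x. (w s x - w t x) + (p t x - p s x)) = (\<lambda>x. w s x - p s x - (w t x - p t x))" by auto
      ultimately show "norm (H_norm \<Omega> (\<lambda>x. w s x - p s x - (w t x - p t x)))
        \<le> H_norm \<Omega> (\<lambda>x. w s x - w t x) + H_norm \<Omega> (\<lambda>x. p s x - p t x)"
        using Lnorm2_minus_commute[of \<Omega> "p t" "p s"] Lnorm_nonneg[of \<Omega> 2 "\<lambda>x. w s x - p s x - (w t x - p t x)"]
        by simp
    qed
  qed
qed

lemma continuous_on_pairing:
  assumes w: "w \<in> cont_in_time T (\<H> \<Omega>) (H_norm \<Omega>)" and p: "p \<in> cont_in_time T (\<H> \<Omega>) (H_norm \<Omega>)"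
  shows "continuous_on {0..T} (\<lambda>t. pairing \<Omega> (w t) (p t))"
  unfolding continuous_on_def
proof
  fix t assume t: "t \<in> {0..T}"
  let ?a = "\<lambda>s. H_norm \<Omega> (\<lambda>x. w s x - w t x)" and ?b = "\<lambda>s. H_norm \<Omega> (\<lambda>x. p s x - p t x)"
  have a: "(?a \<longlongrightarrow> 0) (at t within {0..T})" and b: "(?b \<longlongrightarrow> 0) (at t within {0..T})"
    using w p t by (auto simp: cont_in_time_def)
  have "((\<lambda>s. ?a s * (?b s + H_norm \<Omega> (p t)) + H_norm \<Omega> (w t) * ?b s) \<longlongrightarrow> 0 * (0 + H_norm \<Omega> (p t)) + H_norm \<Omega> (w t) * 0) (at t within {0..T})"
    by (intro tendsto_intros a b)
  then have lim: "((\<lambda>s. ?a s * (?b s + H_norm \<Omega> (p t)) + H_norm \<Omega> (w t) * ?b s) \<longlongrightarrow> 0) (at t within {0..T})" by simp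
  show "((\<lambda>s. pairing \<Omega> (w s) (p s)) \<longlongrightarrow> pairing \<Omega> (w t) (p t)) (at t within {0..T})"
  proof (rule LIM_zero_cancel[OF Lim_null_comparison[OF _ lim]])
    show "\<forall>\<^sub>F s in at t within {0..T}. norm (pairing \<Omega> (w s) (p s) - pairing \<Omega> (w t) (p t))
        \<le> ?a s * (?b s + H_norm \<Omega> (p t)) + H_norm \<Omega> (w t) * ?b s"
      unfolding eventually_at_filter
    proof (intro always_eventually allI impI)
      fix s assume s: "s \<in> {0..T}"
      note L = cont_in_time_Lspace[OF w s] cont_in_time_Lspace[OF w t] cont_in_time_Lspace[OF p s] cont_in_time_Lspace[OF p t]
      have "pairing \<Omega> (w s) (p s) - pairing \<Omega> (w t) (p t)
        = pairing \<Omega> (\<lambda>x. w s x - w t x) (p s) + pairing \<Omega> (w t) (\<lambda>x. p s x - p t x)"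
        using L by (simp add: pairing_diff_left pairing_diff_right)
      moreover have "\<bar>pairing \<Omega> (\<lambda>x. w s x - w t x) (p s)\<bar> \<le> ?a s * H_norm \<Omega> (p s)"
        by (intro pairing_Cauchy_Schwarz Lspace2_diff L)
      moreover have "?a s * H_norm \<Omega> (p s) \<le> ?a s * (?b s + H_norm \<Omega> (p t))"
        using Lnorm2_triangle[OF Lspace2_diff[OF L(3,4)] L(4)] by (intro mult_left_mono Lnorm_nonneg) simp
      moreover have "\<bar>pairing \<Omega> (w t) (\<lambda>x. p s x - p t x)\<bar> \<le> H_norm \<Omega> (w t) * ?b s"
        by (intro pairing_Cauchy_Schwarz Lspace2_diff L)
      ultimately show "norm (pairing \<Omega> (w s) (p s) - pairing \<Omega> (w t) (p t))
        \<le> ?a s * (?b s + H_norm \<Omega> (p t)) + H_norm \<Omega> (w t) * ?b s"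
        unfolding real_norm_def by linarith
    qed
  qed
qed

lemma H_norm_bounded_in_time:
  assumes w: "w \<in> cont_in_time T (\<H> \<Omega>) (H_norm \<Omega>)"
  obtains M where "M \<ge> 0" "\<forall>t\<in>{0..T}. H_norm \<Omega> (w t) \<le> M"
proof -
  have "bounded ((\<lambda>t. pairing \<Omega> (w t) (w t)) ` {0..T})"
    by (intro compact_imp_bounded compact_continuous_image continuous_on_pairing w compact_Icc)
  then obtain B where B: "\<forall>t\<in>{0..T}. \<bar>pairing \<Omega> (w t) (w t)\<bar> \<le> B" by (auto simp: bounded_iff)
  have "H_norm \<Omega> (w t) \<le> sqrt \<bar>B\<bar>" if "t \<in> {0..T}" for t
  proof (rule real_le_rsqrt)
    show "H_norm \<Omega> (w t) ^ 2 \<le> \<bar>B\<bar>" using B[rule_format, OF that] by (simp add: pairing_self)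
  qed
  then show ?thesis using that[of "sqrt \<bar>B\<bar>"] by simp
qed

lemma V_norm_reverse_triangle:
  assumes "u \<in> H1 \<Omega>" "v \<in> H1 \<Omega>"
  shows "\<bar>V_norm \<Omega> u - V_norm \<Omega> v\<bar> \<le> V_norm \<Omega> (\<lambda>x. u x - v x)"
  using V_norm_add[OF H1_diff[OF assms] assms(2)] V_norm_add[OF H1_diff[OF assms(2,1)] assms(1)]
    V_norm_minus_commute[OF assms] by simp

definition V_continuous :: "real \<Rightarrow> (real \<Rightarrow> field) \<Rightarrow> bool" where
  "V_continuous T q \<longleftrightarrow> (\<forall>t. q t \<in> \<V> \<Omega>) \<and>
    (\<forall>e>0. \<exists>d>0. \<forall>s\<in>{0..T}. \<forall>t\<in>{0..T}. \<bar>s - t\<bar> < d \<longrightarrow> V_norm \<Omega> (\<lambda>x. q s x - q t x) < e)"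

lemma V_continuous_strongly_measurable:
  assumes q: "V_continuous T q" and T: "T > 0"
  shows "strongly_measurable T (\<V> \<Omega>) (V_norm \<Omega>) q"
proof -
  define k where "k n t = \<lfloor>real n * t\<rfloor>" for n and t :: real
  define s where "s n t = q (real_of_int (k n t) / real n)" for n t
  have kb: "k n ` {0..T} \<subseteq> {0..\<lfloor>real n * T\<rfloor>}" for n
    by (auto simp: k_def intro!: floor_mono mult_left_mono)
  have ks: "{t \<in> {0..T}. k n t = y} \<in> sets lebesgue" for n y
  proof -
    have "k n \<in> borel \<rightarrow>\<^sub>M count_space UNIV" unfolding k_def by measurable
    then have "k n -` {y} \<inter> space borel \<in> sets borel" by (rule measurable_sets) simp
    then have "(k n -` {y} \<inter> {0..T}) \<in> sets borel" by simp
    moreover have "k n -` {y} \<inter> {0..T} = {t \<in> {0..T}. k n t = y}" by auto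
    ultimately show ?thesis by simp
  qed
  have "simple_in_time T (k n)" for n
    unfolding simple_in_time_def using ks finite_subset[OF kb] by auto
  from simple_in_time_comp[OF this this, of "\<lambda>a b. q (real_of_int a / real _)"]
  have simple: "simple_in_time T (s n)" for n unfolding s_def by blast
  have lim: "(\<lambda>n. V_norm \<Omega> (\<lambda>x. s n t x - q t x)) \<longlonglongrightarrow> 0" if t: "t \<in> {0..T}" for t
  proof (rule LIMSEQ_I)
    fix e :: real assume "e > 0"
    then obtain d where d: "d > 0" "\<forall>s\<in>{0..T}. \<forall>t\<in>{0..T}. \<bar>s - t\<bar> < d \<longrightarrow> V_norm \<Omega> (\<lambda>x. q s x - q t x) < e"
      using q by (auto simp: V_continuous_def)
    obtain N :: nat where N: "1 / d < real N" using reals_Archimedean2 by blast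
    have "norm (V_norm \<Omega> (\<lambda>x. s n t x - q t x) - 0) < e" if n: "n \<ge> N" for n
    proof -
      have nN: "1 / d < real n" using N n by (meson less_le_trans of_nat_mono)
      have n0: "real n > 0" using nN d(1) by (meson divide_pos_pos less_trans zero_less_one)
      have "real_of_int (k n t) \<le> real n * t" "real n * t < real_of_int (k n t) + 1"
        by (auto simp: k_def)
      then have 1: "real_of_int (k n t) / real n \<le> t" "t < real_of_int (k n t) / real n + 1 / real n"
        using n0 by (auto simp: field_simps)
      moreover have "1 / real n < d" using nN n0 d(1) by (simp add: field_simps)
      moreover have "k n t \<ge> 0" using t by (simp add: k_def)
      ultimately have "real_of_int (k n t) / real n \<in> {0..T}" "\<bar>real_of_int (k n t) / real n - t\<bar> < d"
        using t n0 by auto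
      then show ?thesis using d(2) t V_norm_nonneg by (simp add: s_def)
    qed
    then show "\<exists>N. \<forall>n\<ge>N. norm (V_norm \<Omega> (\<lambda>x. s n t x - q t x) - 0) < e" by blast
  qed
  have "AE t in L\<^sub>T T. (\<lambda>n. V_norm \<Omega> (\<lambda>x. s n t x - q t x)) \<longlonglongrightarrow> 0"
    by (rule AE_I2) (use lim in simp)
  moreover have "\<forall>n. finite (s n ` {0..T}) \<and> s n ` {0..T} \<subseteq> \<V> \<Omega> \<and> (\<forall>y. {t \<in> {0..T}. s n t = y} \<in> sets lebesgue)"
    using simple q by (auto simp: simple_in_time_def V_continuous_def s_def)
  ultimately show ?thesis unfolding strongly_measurable_def by blast
qed

lemma V_norm_diff_measurable:
  assumes u: "strongly_measurable T (\<V> \<Omega>) (V_norm \<Omega>) u" "AE t in L\<^sub>T T. u t \<in> \<V> \<Omega>"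
    and v: "strongly_measurable T (\<V> \<Omega>) (V_norm \<Omega>) v" "AE t in L\<^sub>T T. v t \<in> \<V> \<Omega>"
  shows "(\<lambda>t. V_norm \<Omega> (\<lambda>x. u t x - v t x)) \<in> borel_measurable (L\<^sub>T T)"
proof (rule strongly_measurable_apply2[where \<Phi> = "\<lambda>a b. V_norm \<Omega> (\<lambda>x. a x - b x)", OF u v])
  fix a b :: field and an bn :: "nat \<Rightarrow> field"
  assume V: "a \<in> \<V> \<Omega>" "b \<in> \<V> \<Omega>" "\<And>n. an n \<in> \<V> \<Omega>" "\<And>n. bn n \<in> \<V> \<Omega>"
    and l: "(\<lambda>n. V_norm \<Omega> (\<lambda>x. an n x - a x)) \<longlonglongrightarrow> 0" "(\<lambda>n. V_norm \<Omega> (\<lambda>x. bn n x - b x)) \<longlonglongrightarrow> 0"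
  have bound: "\<bar>V_norm \<Omega> (\<lambda>x. an n x - bn n x) - V_norm \<Omega> (\<lambda>x. a x - b x)\<bar>
      \<le> V_norm \<Omega> (\<lambda>x. an n x - a x) + V_norm \<Omega> (\<lambda>x. bn n x - b x)" for n
  proof -
    have "\<bar>V_norm \<Omega> (\<lambda>x. an n x - bn n x) - V_norm \<Omega> (\<lambda>x. a x - b x)\<bar>
      \<le> V_norm \<Omega> (\<lambda>x. (an n x - bn n x) - (a x - b x))"
      by (intro V_norm_reverse_triangle H1_diff V_H1 V)
    also have "(\<lambda>x. (an n x - bn n x) - (a x - b x)) = (\<lambda>x. (an n x - a x) - (bn n x - b x))" by auto
    also have "V_norm \<Omega> \<dots> \<le> V_norm \<Omega> (\<lambda>x. an n x - a x) + V_norm \<Omega> (\<lambda>x. bn n x - b x)"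
      by (intro V_norm_diff_le V_diff V)
    finally show ?thesis .
  qed
  have "(\<lambda>n. V_norm \<Omega> (\<lambda>x. an n x - a x) + V_norm \<Omega> (\<lambda>x. bn n x - b x)) \<longlonglongrightarrow> 0"
    using tendsto_add[OF l] by simp
  then show "(\<lambda>n. V_norm \<Omega> (\<lambda>x. an n x - bn n x)) \<longlonglongrightarrow> V_norm \<Omega> (\<lambda>x. a x - b x)"
    by (rule tendsto_null_bound[rotated]) (rule bound)
qed

lemma V_norm_measurable:
  assumes u: "strongly_measurable T (\<V> \<Omega>) (V_norm \<Omega>) u" "AE t in L\<^sub>T T. u t \<in> \<V> \<Omega>"
  shows "(\<lambda>t. V_norm \<Omega> (u t)) \<in> borel_measurable (L\<^sub>T T)"
  using V_norm_diff_measurable[OF u strongly_measurable_const[where v = "\<lambda>x. 0"]] V_0 V_norm_0 by simp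

lemma
  assumes "finite Y" "\<And>y. y \<in> Y \<Longrightarrow> y \<in> \<V> \<Omega>"
  shows V_sum: "(\<lambda>x. \<Sum>y\<in>Y. c y *\<^sub>R y x) \<in> \<V> \<Omega>"
    and V_norm_sum: "V_norm \<Omega> (\<lambda>x. \<Sum>y\<in>Y. c y *\<^sub>R y x) \<le> (\<Sum>y\<in>Y. \<bar>c y\<bar> * V_norm \<Omega> y)"
proof -
  have "(\<lambda>x. \<Sum>y\<in>Y. c y *\<^sub>R y x) \<in> \<V> \<Omega> \<and> V_norm \<Omega> (\<lambda>x. \<Sum>y\<in>Y. c y *\<^sub>R y x) \<le> (\<Sum>y\<in>Y. \<bar>c y\<bar> * V_norm \<Omega> y)"
    using assms
  proof (induction Y rule: finite_induct)
    case empty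
    then show ?case using V_0 V_norm_0 by simp
  next
    case (insert y Y)
    have y: "(\<lambda>x. c y *\<^sub>R y x) \<in> \<V> \<Omega>" using insert by (intro V_scale) simp
    have Y: "(\<lambda>x. \<Sum>y\<in>Y. c y *\<^sub>R y x) \<in> \<V> \<Omega>"
      "V_norm \<Omega> (\<lambda>x. \<Sum>y\<in>Y. c y *\<^sub>R y x) \<le> (\<Sum>y\<in>Y. \<bar>c y\<bar> * V_norm \<Omega> y)"
      using insert by auto
    have "V_norm \<Omega> (\<lambda>x. c y *\<^sub>R y x + (\<Sum>y\<in>Y. c y *\<^sub>R y x)) \<le> \<bar>c y\<bar> * V_norm \<Omega> y + (\<Sum>y\<in>Y. \<bar>c y\<bar> * V_norm \<Omega> y)"
      using V_norm_add[OF V_H1[OF y] V_H1[OF Y(1)]] V_norm_scale[OF V_H1, of y "c y"] insert.prems Y(2) by simp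
    then show ?case using insert(1,2) V_add[OF y Y(1)] by simp
  qed
  then show "(\<lambda>x. \<Sum>y\<in>Y. c y *\<^sub>R y x) \<in> \<V> \<Omega>"
    "V_norm \<Omega> (\<lambda>x. \<Sum>y\<in>Y. c y *\<^sub>R y x) \<le> (\<Sum>y\<in>Y. \<bar>c y\<bar> * V_norm \<Omega> y)" by auto
qed

lemma V_continuous_sum:
  assumes Y: "finite Y" "\<And>y. y \<in> Y \<Longrightarrow> y \<in> \<V> \<Omega>" and c: "\<And>y. y \<in> Y \<Longrightarrow> continuous_on UNIV (c y)"
  shows "V_continuous T (\<lambda>t x. \<Sum>y\<in>Y. c y t *\<^sub>R y x)"
  unfolding V_continuous_def
proof (intro conjI allI impI)
  show "(\<lambda>x. \<Sum>y\<in>Y. c y t *\<^sub>R y x) \<in> \<V> \<Omega>" for t by (rule V_sum[OF Y])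
  fix e :: real assume e: "e > 0"
  define F where "F z = (\<Sum>y\<in>Y. \<bar>c y (fst z) - c y (snd z)\<bar> * V_norm \<Omega> y)" for z
  have cc: "continuous_on UNIV (\<lambda>z. c y (fst z))" "continuous_on UNIV (\<lambda>z. c y (snd z))" if "y \<in> Y" for y
    by (auto intro!: continuous_on_compose2[OF c[OF that]] continuous_intros)
  have "continuous_on UNIV F" unfolding F_def by (intro continuous_intros cc)
  then have "uniformly_continuous_on ({0..T} \<times> {0..T}) F"
    by (intro compact_uniformly_continuous compact_Times compact_Icc) (auto intro: continuous_on_subset)
  then obtain d where d: "d > 0" "\<And>z z'. z \<in> {0..T} \<times> {0..T} \<Longrightarrow> z' \<in> {0..T} \<times> {0..T} \<Longrightarrow> dist z' z < d \<Longrightarrow> dist (F z') (F z) < e"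
    unfolding uniformly_continuous_on_def using e by meson
  have "V_norm \<Omega> (\<lambda>x. (\<Sum>y\<in>Y. c y s *\<^sub>R y x) - (\<Sum>y\<in>Y. c y t *\<^sub>R y x)) < e"
    if st: "s \<in> {0..T}" "t \<in> {0..T}" "\<bar>s - t\<bar> < d" for s t
  proof -
    have "dist (F (s, t)) (F (t, t)) < e"
      by (rule d(2)) (use st in \<open>auto simp: dist_Pair_Pair dist_real_def\<close>)
    then have "F (s, t) < e" by (simp add: F_def dist_real_def)
    moreover have "(\<lambda>x. (\<Sum>y\<in>Y. c y s *\<^sub>R y x) - (\<Sum>y\<in>Y. c y t *\<^sub>R y x)) = (\<lambda>x. \<Sum>y\<in>Y. (c y s - c y t) *\<^sub>R y x)"
      by (simp add: sum_subtractf scaleR_left_diff_distrib)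
    ultimately show ?thesis using V_norm_sum[OF Y, of "\<lambda>y. c y s - c y t"] by (simp add: F_def)
  qed
  with d(1) show "\<exists>d>0. \<forall>s\<in>{0..T}. \<forall>t\<in>{0..T}. \<bar>s - t\<bar> < d \<longrightarrow>
     V_norm \<Omega> (\<lambda>x. (\<Sum>y\<in>Y. c y s *\<^sub>R y x) - (\<Sum>y\<in>Y. c y t *\<^sub>R y x)) < e" by blast
qed

lemma V_continuous_dense:
  assumes u: "u \<in> bochner_L 2 T (\<V> \<Omega>) (V_norm \<Omega>)" and T: "T > 0" and \<delta>: "\<delta> > 0"
  obtains q where "V_continuous T q" "integrable (L\<^sub>T T) (\<lambda>t. V_norm \<Omega> (\<lambda>x. u t x - q t x) ^ 2)"
    "(LINT t|L\<^sub>T T. V_norm \<Omega> (\<lambda>x. u t x - q t x) ^ 2) < \<delta>"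
proof -
  note us = bochner_L_D(1,2)[OF u]
  have ui: "integrable (L\<^sub>T T) (\<lambda>t. V_norm \<Omega> (u t) ^ 2)" by (rule bochner_L2_integrable[OF u V_norm_nonneg])
  have one: "integrable (L\<^sub>T T) (\<lambda>t. 1::real)" using finite_measure.integrable_const[OF time_measure(1)] .
  have I: "AE t in L\<^sub>T T. t \<in> {0..T}" by (rule AE_I2) simp
  have um: "(\<lambda>t. V_norm \<Omega> (u t)) \<in> borel_measurable (L\<^sub>T T)" by (rule V_norm_measurable[OF us])
  obtain s where "\<forall>n::nat. simple_in_time T (s n)" "\<forall>n. \<forall>t\<in>{0..T}. s n t \<in> \<V> \<Omega>"
    "AE t in L\<^sub>T T. (\<lambda>n. V_norm \<Omega> (\<lambda>x. s n t x - u t x)) \<longlonglongrightarrow> 0" using us(1) by (rule strongly_measurableE)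
  note s = this(1)[rule_format] this(2)[rule_format] this(3)
  have sv: "V_norm \<Omega> (s n t) \<le> V_norm \<Omega> (\<lambda>x. s n t x - u t x) + V_norm \<Omega> (u t)" if "t \<in> {0..T}" "u t \<in> \<V> \<Omega>" for n t
    using V_norm_add[OF H1_diff[OF V_H1[OF s(2)[OF that(1), of n]] V_H1[OF that(2)]] V_H1[OF that(2)]] by simp
  have sm: "(\<lambda>t. V_norm \<Omega> (s n t)) \<in> borel_measurable (L\<^sub>T T)" for n
    using simple_in_time_measurable[OF simple_in_time_comp[OF s(1) s(1), of "\<lambda>a b. V_norm \<Omega> a" n n]] .
  have ssm: "strongly_measurable T (\<V> \<Omega>) (V_norm \<Omega>) (s n)" for n
    unfolding strongly_measurable_def using s(1)[of n] s(2) V_norm_0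
    by (intro exI[of _ "\<lambda>m. s n"]) (auto simp: simple_in_time_def)
  have sAE: "AE t in L\<^sub>T T. s n t \<in> \<V> \<Omega>" for n by (rule AE_I2) (simp add: s(2))
  define A where "A n = {t \<in> {0..T}. V_norm \<Omega> (s n t) \<le> V_norm \<Omega> (u t) + 1}" for n
  have A: "A n \<in> sets lebesgue" for n
  proof -
    have "{t \<in> space (L\<^sub>T T). V_norm \<Omega> (s n t) \<le> V_norm \<Omega> (u t) + 1} \<in> sets (L\<^sub>T T)"
      using sm um by (intro borel_measurable_le borel_measurable_add) auto
    then show ?thesis by (simp add: A_def sets_restrict_space_iff)
  qed
  define P where "P n t = (\<lambda>x. (if t \<in> A n then 1 else 0::real) *\<^sub>R s n t x)" for n t
  define g where "g n t = (if t \<in> A n then V_norm \<Omega> (\<lambda>x. u t x - s n t x) else V_norm \<Omega> (u t))" for n t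
  have gP: "V_norm \<Omega> (\<lambda>x. u t x - P n t x) = g n t" for n t by (simp add: g_def P_def)
  have gm: "g n \<in> borel_measurable (L\<^sub>T T)" for n
    unfolding g_def
    by (rule measurable_If_set[OF V_norm_diff_measurable[OF us ssm sAE] um])
      (use A[of n] in \<open>auto simp: A_def sets_restrict_space_iff\<close>)
  have gle: "AE t in L\<^sub>T T. \<bar>g n t\<bar> ^ 2 \<le> 8 * V_norm \<Omega> (u t) ^ 2 + 2" for n
    using I us(2)
  proof eventually_elim
    case (elim t)
    have "g n t \<le> 2 * V_norm \<Omega> (u t) + 1"
      using V_norm_diff_le[OF elim(2) s(2)[OF elim(1), of n]] V_norm_nonneg[of "u t"] by (auto simp: g_def A_def)
    moreover have "g n t \<ge> 0" by (simp add: g_def V_norm_nonneg)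
    ultimately have "\<bar>g n t\<bar> ^ 2 \<le> (2 * V_norm \<Omega> (u t) + 1) ^ 2" by (intro power_mono) auto
    also have "\<dots> \<le> 2 * ((2 * V_norm \<Omega> (u t))\<^sup>2 + 1\<^sup>2)" by (rule square_sum_le)
    finally show ?case by (simp add: power_mult_distrib)
  qed
  have glim: "AE t in L\<^sub>T T. (\<lambda>n. g n t ^ 2) \<longlonglongrightarrow> 0"
    using I us(2) s(3)
  proof eventually_elim
    case (elim t)
    have "\<forall>\<^sub>F n in sequentially. V_norm \<Omega> (\<lambda>x. s n t x - u t x) < 1" using order_tendstoD(2)[OF elim(3)] by simp
    then have "\<forall>\<^sub>F n in sequentially. V_norm \<Omega> (\<lambda>x. s n t x - u t x) = g n t"
    proof eventually_elim
      case (elim n)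
      have "t \<in> A n" using sv[OF \<open>t \<in> {0..T}\<close> \<open>u t \<in> \<V> \<Omega>\<close>, of n] elim \<open>t \<in> {0..T}\<close> by (simp add: A_def)
      then show ?case
        using V_norm_minus_commute[OF V_H1[OF s(2)[OF \<open>t \<in> {0..T}\<close>, of n]] V_H1[OF \<open>u t \<in> \<V> \<Omega>\<close>]] by (simp add: g_def)
    qed
    from Lim_transform_eventually[OF elim(3) this] have "(\<lambda>n. g n t) \<longlonglongrightarrow> 0" .
    from tendsto_power[OF this, of 2] show ?case by simp
  qed
  have dom: "integrable (L\<^sub>T T) (\<lambda>t. 8 * V_norm \<Omega> (u t) ^ 2 + 2)" using ui one by auto
  have "(\<lambda>n. LINT t|L\<^sub>T T. g n t ^ 2) \<longlonglongrightarrow> (LINT t|L\<^sub>T T. 0)"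
    by (rule integral_dominated_convergence[where w = "\<lambda>t. 8 * V_norm \<Omega> (u t) ^ 2 + 2"])
      (use dom glim gle borel_measurable_power[OF gm] in auto)
  then have "\<forall>\<^sub>F n in sequentially. (LINT t|L\<^sub>T T. g n t ^ 2) < \<delta> / 4" using order_tendstoD(2)[of _ 0 _ "\<delta>/4"] \<delta> by simp
  then obtain n where n: "(LINT t|L\<^sub>T T. g n t ^ 2) < \<delta> / 4" using eventually_happens'[OF sequentially_bot] by blast
  have gi: "integrable (L\<^sub>T T) (\<lambda>t. g n t ^ 2)"
    by (rule integrable_bound_AE[OF dom borel_measurable_power[OF gm]]) (use gle[of n] in simp)
  define Y where "Y = s n ` {0..T}"
  have Y: "finite Y" "\<And>y. y \<in> Y \<Longrightarrow> y \<in> \<V> \<Omega>" using s(1)[of n] s(2) by (auto simp: Y_def simple_in_time_def)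
  define E where "E y = A n \<inter> {t \<in> {0..T}. s n t = y}" for y
  have E: "E y \<in> sets lebesgue" for y using A s(1)[of n] by (auto simp: E_def simple_in_time_def)
  define K where "K = real (card Y) * (\<Sum>y\<in>Y. V_norm \<Omega> y ^ 2) + 1"
  have K: "K > 0" unfolding K_def by (intro add_nonneg_pos mult_nonneg_nonneg sum_nonneg) auto
  have \<delta>K: "\<delta> / (4 * K) > 0" using \<delta> K by simp
  have "\<exists>c. continuous_on UNIV c \<and> integrable (L\<^sub>T T) (\<lambda>t. (indicator (E y) t - c t)\<^sup>2) \<and>
      (LINT t|L\<^sub>T T. (indicator (E y) t - c t)\<^sup>2) < \<delta> / (4 * K)" for y
    by (rule indicator_continuous_approx[OF E[of y] \<delta>K]) (intro exI conjI)
  from choice[OF allI[OF this]] obtain c where c': "\<forall>y. continuous_on UNIV (c y) \<and>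
      integrable (L\<^sub>T T) (\<lambda>t. (indicator (E y) t - c y t)\<^sup>2) \<and> (LINT t|L\<^sub>T T. (indicator (E y) t - c y t)\<^sup>2) < \<delta> / (4 * K)" ..
  have c: "continuous_on UNIV (c y)" "integrable (L\<^sub>T T) (\<lambda>t. (indicator (E y) t - c y t)\<^sup>2)"
      "(LINT t|L\<^sub>T T. (indicator (E y) t - c y t)\<^sup>2) < \<delta> / (4 * K)" for y using c' by auto
  define q where "q t = (\<lambda>x. \<Sum>y\<in>Y. c y t *\<^sub>R y x)" for t
  have q: "V_continuous T q" unfolding q_def by (rule V_continuous_sum[OF Y c(1)])
  have qV: "q t \<in> \<V> \<Omega>" for t unfolding q_def by (rule V_sum[OF Y])
  define b where "b t = real (card Y) * (\<Sum>y\<in>Y. V_norm \<Omega> y ^ 2 * (indicator (E y) t - c y t)\<^sup>2)" for t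
  have bi: "integrable (L\<^sub>T T) b" unfolding b_def by (intro integrable_mult_right Bochner_Integration.integrable_sum c(2))
  have "(LINT t|L\<^sub>T T. b t) = real (card Y) * (\<Sum>y\<in>Y. V_norm \<Omega> y ^ 2 * (LINT t|L\<^sub>T T. (indicator (E y) t - c y t)\<^sup>2))"
    unfolding b_def by (simp add: Bochner_Integration.integral_sum[OF integrable_mult_right[OF c(2)]])
  also have "\<dots> \<le> real (card Y) * (\<Sum>y\<in>Y. V_norm \<Omega> y ^ 2 * (\<delta> / (4 * K)))"
    using c(3) by (intro mult_left_mono sum_mono) (auto intro: less_imp_le)
  also have "\<dots> = (K - 1) * (\<delta> / (4 * K))"
  proof -
    have KS: "real (card Y) * (\<Sum>y\<in>Y. V_norm \<Omega> y ^ 2) = K - 1" by (simp add: K_def)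
    show ?thesis by (simp only: sum_distrib_right[symmetric] mult.assoc[symmetric] KS)
  qed
  also have "\<dots> \<le> K * (\<delta> / (4 * K))" using K \<delta> by (intro mult_right_mono) auto
  also have "\<dots> = \<delta> / 4" using K by simp
  finally have b4: "(LINT t|L\<^sub>T T. b t) \<le> \<delta> / 4" .
  have le: "AE t in L\<^sub>T T. \<bar>V_norm \<Omega> (\<lambda>x. u t x - q t x) ^ 2\<bar> \<le> 2 * (g n t ^ 2 + b t)"
    using I us(2)
  proof eventually_elim
    case (elim t)
    have PV: "P n t \<in> \<V> \<Omega>" unfolding P_def by (intro V_scale s(2) elim)
    have "P n t x = (\<Sum>y\<in>Y. indicator (E y) t *\<^sub>R y x)" for x
    proof -
      have "(\<Sum>y\<in>Y. indicator (E y) t *\<^sub>R y x) = (\<Sum>y\<in>Y. if y = s n t then (if t \<in> A n then 1 else 0) *\<^sub>R y x else 0)"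
        by (rule sum.cong) (use elim(1) in \<open>auto simp: E_def indicator_def\<close>)
      also have "\<dots> = P n t x" using Y(1) elim(1) by (simp add: P_def Y_def)
      finally show ?thesis by simp
    qed
    then have diff: "(\<lambda>x. P n t x - q t x) = (\<lambda>x. \<Sum>y\<in>Y. (indicator (E y) t - c y t) *\<^sub>R y x)"
      by (simp add: q_def sum_subtractf scaleR_left_diff_distrib)
    have "V_norm \<Omega> (\<lambda>x. P n t x - q t x) \<le> (\<Sum>y\<in>Y. \<bar>indicator (E y) t - c y t\<bar> * V_norm \<Omega> y)"
      unfolding diff by (rule V_norm_sum[OF Y])
    then have "V_norm \<Omega> (\<lambda>x. P n t x - q t x) ^ 2 \<le> (\<Sum>y\<in>Y. \<bar>indicator (E y) t - c y t\<bar> * V_norm \<Omega> y) ^ 2"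
      by (intro power_mono V_norm_nonneg)
    also have "\<dots> \<le> real (card Y) * (\<Sum>y\<in>Y. (\<bar>indicator (E y) t - c y t\<bar> * V_norm \<Omega> y)\<^sup>2)"
      using sum_squared_le_sum_of_squares[of "\<lambda>y. \<bar>indicator (E y) t - c y t\<bar> * V_norm \<Omega> y" Y] by (simp only: mult.commute)
    also have "\<dots> = b t" by (simp add: b_def power_mult_distrib mult.commute)
    finally have 1: "V_norm \<Omega> (\<lambda>x. P n t x - q t x) ^ 2 \<le> b t" .
    have "V_norm \<Omega> (\<lambda>x. u t x - q t x) \<le> g n t + V_norm \<Omega> (\<lambda>x. P n t x - q t x)"
      unfolding gP[symmetric] by (intro V_norm_diff_triangle V_H1 elim PV qV)
    then have "V_norm \<Omega> (\<lambda>x. u t x - q t x) ^ 2 \<le> (g n t + V_norm \<Omega> (\<lambda>x. P n t x - q t x)) ^ 2"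
      by (intro power_mono V_norm_nonneg)
    also have "\<dots> \<le> 2 * (g n t ^ 2 + V_norm \<Omega> (\<lambda>x. P n t x - q t x) ^ 2)" by (rule square_sum_le)
    also have "\<dots> \<le> 2 * (g n t ^ 2 + b t)" using 1 by simp
    finally show ?case by simp
  qed
  have qAE: "AE t in L\<^sub>T T. q t \<in> \<V> \<Omega>" by (rule AE_I2) (rule qV)
  have i2: "integrable (L\<^sub>T T) (\<lambda>t. 2 * (g n t ^ 2 + b t))" using gi bi by auto
  have i: "integrable (L\<^sub>T T) (\<lambda>t. V_norm \<Omega> (\<lambda>x. u t x - q t x) ^ 2)"
    by (rule integrable_bound_AE[OF i2 borel_measurable_power[OF V_norm_diff_measurable[OF us V_continuous_strongly_measurable[OF q T] qAE]] le])
  have "(LINT t|L\<^sub>T T. V_norm \<Omega> (\<lambda>x. u t x - q t x) ^ 2) \<le> (LINT t|L\<^sub>T T. 2 * (g n t ^ 2 + b t))"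
    by (rule integral_mono_AE[OF i i2]) (use le in auto)
  also have "\<dots> < \<delta>" using gi bi n b4 by simp
  finally show ?thesis by (rule that[OF q i])
qed

end

section \<open>Integration by parts in time\<close>

lemma HK_abs_bound_AE:
  fixes G R :: "real \<Rightarrow> real"
  assumes "G integrable_on {a..b}" "R integrable_on {a..b}" "negligible N"
    and le: "\<And>t. t \<in> {a..b} - N \<Longrightarrow> \<bar>G t\<bar> \<le> R t"
  shows "\<bar>integral {a..b} G\<bar> \<le> integral {a..b} R"
proof -
  let ?G = "\<lambda>t. if t \<in> N then 0 else G t" and ?R = "\<lambda>t. if t \<in> N then 0 else R t"
  have "?G integrable_on {a..b}" "?R integrable_on {a..b}"
    using integrable_spike[OF assms(1,3), of ?G] integrable_spike[OF assms(2,3), of ?R] by auto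
  then have "norm (integral {a..b} ?G) \<le> integral {a..b} ?R"
    by (rule integral_norm_bound_integral) (use le in auto)
  moreover have "integral {a..b} G = integral {a..b} ?G" "integral {a..b} R = integral {a..b} ?R"
    by (rule integral_spike[OF assms(3)]; simp)+
  ultimately show ?thesis by simp
qed

lemma square_sum3_le: "(x + y + z)\<^sup>2 \<le> 3 * (x\<^sup>2 + y\<^sup>2 + z\<^sup>2)" for x y z :: real
  using sum_squares_bound[of x y] sum_squares_bound[of x z] sum_squares_bound[of y z]
  by (simp add: power2_eq_square algebra_simps)

context planar_domain
begin

text \<open>A substitute for \<open>g \<in> (L\<^sup>2(0,T;\<V>) \<inter> L\<^sup>4(0,T;L\<^sup>4))'\<close> that avoids Hoelder exponents: by
  Ladyzhenskaya's inequality the last factor controls the fourth power of the \<open>L\<^sup>4\<close> norm.\<close>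

definition dual_bound :: "real \<Rightarrow> (real \<Rightarrow> functional) \<Rightarrow> bool" where
  "dual_bound T g \<longleftrightarrow> (\<exists>k. integrable (L\<^sub>T T) k \<and> (\<forall>t. k t \<ge> 0) \<and>
     (\<forall>e>0. \<exists>C\<ge>0. AE t in L\<^sub>T T. \<forall>v\<in>\<V> \<Omega>. \<bar>g t v\<bar> \<le> e * k t + C * ((1 + H_norm \<Omega> v ^ 2) * V_norm \<Omega> v ^ 2)))"

lemma dual_pairing_integrable:
  assumes g: "g \<in> bochner_L (4/3) T (V_dual \<Omega>) (V_dual_norm \<Omega>)" and b: "dual_bound T g"
    and v: "v \<in> bochner_L 2 T (\<V> \<Omega>) (V_norm \<Omega>)" "v \<in> cont_in_time T (\<H> \<Omega>) (H_norm \<Omega>)"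
  shows "integrable (L\<^sub>T T) (\<lambda>t. g t (v t))"
proof -
  obtain M where M: "M \<ge> 0" "\<forall>t\<in>{0..T}. H_norm \<Omega> (v t) \<le> M" using H_norm_bounded_in_time[OF v(2)] .
  obtain k where k: "integrable (L\<^sub>T T) k"
    "\<forall>e>0. \<exists>C\<ge>0. AE t in L\<^sub>T T. \<forall>v\<in>\<V> \<Omega>. \<bar>g t v\<bar> \<le> e * k t + C * ((1 + H_norm \<Omega> v ^ 2) * V_norm \<Omega> v ^ 2)"
    using b unfolding dual_bound_def by blast
  obtain C where C: "C \<ge> 0" "AE t in L\<^sub>T T. \<forall>v\<in>\<V> \<Omega>. \<bar>g t v\<bar> \<le> 1 * k t + C * ((1 + H_norm \<Omega> v ^ 2) * V_norm \<Omega> v ^ 2)"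
    using k(2)[rule_format, of 1] by auto
  have I: "AE t in L\<^sub>T T. t \<in> {0..T}" by (rule AE_I2) simp
  show ?thesis
  proof (rule integrable_bound_AE)
    show "integrable (L\<^sub>T T) (\<lambda>t. k t + C * ((1 + M ^ 2) * V_norm \<Omega> (v t) ^ 2))"
      by (intro Bochner_Integration.integrable_add k integrable_mult_right bochner_L2_integrable[OF v(1)] V_norm_nonneg)
    show "(\<lambda>t. g t (v t)) \<in> borel_measurable (L\<^sub>T T)"
      by (rule dual_pairing_measurable[OF bochner_L_D(1,2)[OF g] bochner_L_D(1,2)[OF v(1)]])
    show "AE t in L\<^sub>T T. \<bar>g t (v t)\<bar> \<le> k t + C * ((1 + M ^ 2) * V_norm \<Omega> (v t) ^ 2)"
      using C(2) I bochner_L_D(2)[OF v(1)]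
    proof eventually_elim
      case (elim t)
      have "\<bar>g t (v t)\<bar> \<le> k t + C * ((1 + H_norm \<Omega> (v t) ^ 2) * V_norm \<Omega> (v t) ^ 2)" using elim by simp
      also have "\<dots> \<le> k t + C * ((1 + M ^ 2) * V_norm \<Omega> (v t) ^ 2)"
        using M C(1) elim(2) by (intro add_left_mono mult_left_mono mult_right_mono power_mono) (auto simp: Lnorm_nonneg)
      finally show ?case .
    qed
  qed
qed

lemma
  assumes g: "g \<in> bochner_L (4/3) T (V_dual \<Omega>) (V_dual_norm \<Omega>)" and v: "v \<in> \<V> \<Omega>"
  shows dual_apply_integrable: "integrable (L\<^sub>T T) (\<lambda>t. g t v)"
    and pairing_increment: "\<lbrakk>w \<in> cont_in_time T (\<H> \<Omega>) (H_norm \<Omega>); is_time_deriv \<Omega> T w g; 0 < s; s < r; r < T\<rbrakk> \<Longrightarrow>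
      pairing \<Omega> (w r) v - pairing \<Omega> (w s) v = integral {s..r} (\<lambda>t. g t v)"
proof -
  have one: "integrable (L\<^sub>T T) (\<lambda>t. 1::real)" using finite_measure.integrable_const[OF time_measure(1)] .
  show i: "integrable (L\<^sub>T T) (\<lambda>t. g t v)"
  proof (rule integrable_bound_AE)
    show "integrable (L\<^sub>T T) (\<lambda>t. (1 + V_dual_norm \<Omega> (g t) powr (4/3)) * V_norm \<Omega> v)"
      by (intro integrable_mult_left Bochner_Integration.integrable_add one bochner_L_D(3)[OF g])
    show "(\<lambda>t. g t v) \<in> borel_measurable (L\<^sub>T T)"
      by (rule dual_pairing_measurable[OF bochner_L_D(1,2)[OF g] strongly_measurable_const]) (use v V_norm_0 in auto)
    show "AE t in L\<^sub>T T. \<bar>g t v\<bar> \<le> (1 + V_dual_norm \<Omega> (g t) powr (4/3)) * V_norm \<Omega> v"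
      using bochner_L_D(2)[OF g]
    proof eventually_elim
      case (elim t)
      have "V_dual_norm \<Omega> (g t) \<le> 1 + V_dual_norm \<Omega> (g t) powr (4/3)"
      proof (cases "V_dual_norm \<Omega> (g t) \<le> 1")
        case False
        then have "V_dual_norm \<Omega> (g t) powr 1 \<le> V_dual_norm \<Omega> (g t) powr (4/3)" by (intro powr_mono) auto
        then show ?thesis using False by simp
      qed (simp add: add_increasing2)
      then show ?case
        using V_dual_norm_bound[OF elim v] by (meson V_norm_nonneg mult_right_mono order_trans)
    qed
  qed
  assume w: "w \<in> cont_in_time T (\<H> \<Omega>) (H_norm \<Omega>)" and d: "is_time_deriv \<Omega> T w g" and sr: "0 < s" "s < r" "r < T"
  show "pairing \<Omega> (w r) v - pairing \<Omega> (w s) v = integral {s..r} (\<lambda>t. g t v)"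
  proof (rule distributional_derivative_increment[OF continuous_on_pairing[OF w cont_in_time_const[OF V_H[OF v]]] i _ sr])
    fix \<psi> :: "real \<Rightarrow> real" assume "\<psi> \<in> test_funs {0<..<T}"
    then show "(LINT t|L\<^sub>T T. pairing \<Omega> (w t) v * deriv \<psi> t) = - (LINT t|L\<^sub>T T. g t v * \<psi> t)"
      using d v unfolding is_time_deriv_def by blast
  qed
qed

text \<open>Riemann sums: on a grid \<open>t\<^sub>i\<close> the increments of \<open>(w, p)\<close> telescope into the integrals of
  \<open>g\<^sub>w(t)(p(t\<^sub>i\<^sub>+\<^sub>1)) + g\<^sub>p(t)(w(t\<^sub>i))\<close>.  A suitable translate of the grid makes the piecewise constant
  functions close to \<open>p\<close> and \<open>w\<close> in \<open>L\<^sup>2(0,T;\<V>)\<close>.\<close>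

lemma integration_by_parts_approx:
  assumes T: "T > 0"
    and w: "w \<in> cont_in_time T (\<H> \<Omega>) (H_norm \<Omega>)" "w \<in> bochner_L 2 T (\<V> \<Omega>) (V_norm \<Omega>)"
    and p: "p \<in> cont_in_time T (\<H> \<Omega>) (H_norm \<Omega>)" "p \<in> bochner_L 2 T (\<V> \<Omega>) (V_norm \<Omega>)"
    and gw: "gw \<in> bochner_L (4/3) T (V_dual \<Omega>) (V_dual_norm \<Omega>)" "is_time_deriv \<Omega> T w gw" "dual_bound T gw"
    and gp: "gp \<in> bochner_L (4/3) T (V_dual \<Omega>) (V_dual_norm \<Omega>)" "is_time_deriv \<Omega> T p gp" "dual_bound T gp"
    and e0: "e0 > 0" and h0: "h0 > 0"
  shows "\<exists>a b. 0 < a \<and> a < h0 \<and> a \<le> b \<and> T - h0 < b \<and> b < T \<and>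
    \<bar>pairing \<Omega> (w b) (p b) - pairing \<Omega> (w a) (p a) - integral {a..b} (\<lambda>t. gw t (p t) + gp t (w t))\<bar> \<le> e0"
proof -
  let ?F = "\<lambda>t. gw t (p t) + gp t (w t)"
  let ?\<Psi> = "\<lambda>t. pairing \<Omega> (w t) (p t)"
  have Fi: "integrable (L\<^sub>T T) (\<lambda>t. gw t (p t))" "integrable (L\<^sub>T T) (\<lambda>t. gp t (w t))"
    by (rule dual_pairing_integrable[OF gw(1,3) p(2,1)], rule dual_pairing_integrable[OF gp(1,3) w(2,1)])
  have Fint: "?F integrable_on {0..T}" by (intro lebesgue_on_Icc(1) Bochner_Integration.integrable_add Fi)
  obtain M1 where M1: "M1 \<ge> 0" "\<forall>t\<in>{0..T}. H_norm \<Omega> (w t) \<le> M1" using H_norm_bounded_in_time[OF w(1)] .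
  obtain M2 where M2: "M2 \<ge> 0" "\<forall>t\<in>{0..T}. H_norm \<Omega> (p t) \<le> M2" using H_norm_bounded_in_time[OF p(1)] .
  define M where "M = M1 + M2"
  have M: "\<And>t. t \<in> {0..T} \<Longrightarrow> H_norm \<Omega> (w t) \<le> M" "\<And>t. t \<in> {0..T} \<Longrightarrow> H_norm \<Omega> (p t) \<le> M"
    using M1 M2 by (auto simp: M_def intro: add_increasing add_increasing2)
  define L where "L = 1 + (2 * M) ^ 2"
  have L: "L \<ge> 0" by (simp add: L_def)
  have HL: "1 + H_norm \<Omega> (\<lambda>x. y s x - y t x) ^ 2 \<le> L"
    if y: "y \<in> cont_in_time T (\<H> \<Omega>) (H_norm \<Omega>)" "\<And>t. t \<in> {0..T} \<Longrightarrow> H_norm \<Omega> (y t) \<le> M" and st: "s \<in> {0..T}" "t \<in> {0..T}" for y s t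
  proof -
    have "H_norm \<Omega> (\<lambda>x. y s x - y t x) \<le> H_norm \<Omega> (y s) + H_norm \<Omega> (y t)"
      using Lnorm2_triangle[OF cont_in_time_Lspace[OF y(1) st(1)] Lspace_scale[OF cont_in_time_Lspace[OF y(1) st(2)], of "-1"]]
        Lnorm_scale[of \<Omega> "-1" "y t"] by simp
    also have "\<dots> \<le> 2 * M" using y(2)[OF st(1)] y(2)[OF st(2)] by simp
    finally show ?thesis unfolding L_def by (intro add_left_mono power_mono Lnorm_nonneg)
  qed
  obtain k1 where k1: "integrable (L\<^sub>T T) k1" "\<forall>t. k1 t \<ge> 0"
    "\<forall>e>0. \<exists>C\<ge>0. AE t in L\<^sub>T T. \<forall>v\<in>\<V> \<Omega>. \<bar>gw t v\<bar> \<le> e * k1 t + C * ((1 + H_norm \<Omega> v ^ 2) * V_norm \<Omega> v ^ 2)"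
    using gw(3) unfolding dual_bound_def by blast
  obtain k2 where k2: "integrable (L\<^sub>T T) k2" "\<forall>t. k2 t \<ge> 0"
    "\<forall>e>0. \<exists>C\<ge>0. AE t in L\<^sub>T T. \<forall>v\<in>\<V> \<Omega>. \<bar>gp t v\<bar> \<le> e * k2 t + C * ((1 + H_norm \<Omega> v ^ 2) * V_norm \<Omega> v ^ 2)"
    using gp(3) unfolding dual_bound_def by blast
  define k where "k t = k1 t + k2 t" for t
  have ki: "integrable (L\<^sub>T T) k" unfolding k_def using k1 k2 by auto
  have k0: "k t \<ge> 0" for t using k1(2) k2(2) by (simp add: k_def)
  define K where "K = (LINT t|L\<^sub>T T. k t)"
  have K: "K \<ge> 0" unfolding K_def using k0 by (intro integral_nonneg_AE) auto
  define \<epsilon> where "\<epsilon> = e0 / (2 * (K + 1))"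
  have \<epsilon>: "\<epsilon> > 0" "\<epsilon> * K \<le> e0 / 2" using e0 K by (auto simp: \<epsilon>_def field_simps)
  obtain C1 where C1: "C1 \<ge> 0" "AE t in L\<^sub>T T. \<forall>v\<in>\<V> \<Omega>. \<bar>gw t v\<bar> \<le> \<epsilon> * k1 t + C1 * ((1 + H_norm \<Omega> v ^ 2) * V_norm \<Omega> v ^ 2)"
    using k1(3) \<epsilon>(1) by blast
  obtain C2 where C2: "C2 \<ge> 0" "AE t in L\<^sub>T T. \<forall>v\<in>\<V> \<Omega>. \<bar>gp t v\<bar> \<le> \<epsilon> * k2 t + C2 * ((1 + H_norm \<Omega> v ^ 2) * V_norm \<Omega> v ^ 2)"
    using k2(3) \<epsilon>(1) by blast
  define C where "C = C1 + C2"
  define D where "D = 3 * C * L"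
  have C: "C \<ge> 0" "C1 \<le> C" "C2 \<le> C" using C1 C2 by (auto simp: C_def)
  have D: "D \<ge> 0" using C L by (simp add: D_def)
  define \<delta> where "\<delta> = e0 / (12 * (D + 1))"
  have \<delta>: "\<delta> > 0" "3 * (D * \<delta>) \<le> e0 / 4" using e0 D by (auto simp: \<delta>_def field_simps)
  define \<eta> where "\<eta> = sqrt (e0 / (8 * (D + 1) * T))"
  have pos: "e0 / (8 * (D + 1) * T) > 0" using e0 D T by (intro divide_pos_pos mult_pos_pos) auto
  have \<eta>: "\<eta> > 0" "2 * (D * (T * \<eta>\<^sup>2)) \<le> e0 / 4"
  proof -
    show "\<eta> > 0" unfolding \<eta>_def using pos by simp
    have "\<eta>\<^sup>2 = e0 / (8 * (D + 1) * T)" unfolding \<eta>_def using pos by simp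
    then have "T * \<eta>\<^sup>2 = e0 / (8 * (D + 1))" using T by simp
    moreover have "2 * (D * (e0 / (8 * E))) = D / E * (e0 / 4)" for E by simp
    ultimately have "2 * (D * (T * \<eta>\<^sup>2)) = (D / (D + 1)) * (e0 / 4)" by (simp only:)
    also have "\<dots> \<le> 1 * (e0 / 4)" using D e0 by (intro mult_right_mono) auto
    finally show "2 * (D * (T * \<eta>\<^sup>2)) \<le> e0 / 4" by simp
  qed
  obtain q where q: "V_continuous T q" "integrable (L\<^sub>T T) (\<lambda>t. V_norm \<Omega> (\<lambda>x. p t x - q t x) ^ 2)"
    "(LINT t|L\<^sub>T T. V_norm \<Omega> (\<lambda>x. p t x - q t x) ^ 2) < \<delta> / 2"
    using V_continuous_dense[OF p(2) T half_gt_zero[OF \<delta>(1)]] .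
  obtain r where r: "V_continuous T r" "integrable (L\<^sub>T T) (\<lambda>t. V_norm \<Omega> (\<lambda>x. w t x - r t x) ^ 2)"
    "(LINT t|L\<^sub>T T. V_norm \<Omega> (\<lambda>x. w t x - r t x) ^ 2) < \<delta> / 2"
    using V_continuous_dense[OF w(2) T half_gt_zero[OF \<delta>(1)]] .
  define \<phi> where "\<phi> t = V_norm \<Omega> (\<lambda>x. p t x - q t x) ^ 2 + V_norm \<Omega> (\<lambda>x. w t x - r t x) ^ 2" for t
  have \<phi>i: "integrable (L\<^sub>T T) \<phi>" unfolding \<phi>_def using q r by auto
  have \<phi>0: "\<phi> t \<ge> 0" for t by (simp add: \<phi>_def)
  have \<phi>\<delta>: "(LINT t|L\<^sub>T T. \<phi> t) < \<delta>" unfolding \<phi>_def using q r by simp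
  obtain d1 where d1: "d1 > 0" "\<forall>s\<in>{0..T}. \<forall>t\<in>{0..T}. \<bar>s - t\<bar> < d1 \<longrightarrow> V_norm \<Omega> (\<lambda>x. q s x - q t x) < \<eta>"
    using q(1) \<eta>(1) unfolding V_continuous_def by blast
  obtain d2 where d2: "d2 > 0" "\<forall>s\<in>{0..T}. \<forall>t\<in>{0..T}. \<bar>s - t\<bar> < d2 \<longrightarrow> V_norm \<Omega> (\<lambda>x. r s x - r t x) < \<eta>"
    using r(1) \<eta>(1) unfolding V_continuous_def by blast
  have qV: "q t \<in> \<V> \<Omega>" and rV: "r t \<in> \<V> \<Omega>" for t using q(1) r(1) by (auto simp: V_continuous_def)
  define m0 where "m0 = Min {d1, d2, h0}"
  have m0: "m0 > 0" "m0 \<le> d1" "m0 \<le> d2" "m0 \<le> h0" using d1 d2 h0 by (auto simp: m0_def)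
  obtain N :: nat where N: "T / m0 < real N" using reals_Archimedean2 by blast
  have N0: "N > 0" using N T m0 by (intro gr0I) (simp add: divide_less_0_iff)
  define h where "h = T / real N"
  have h: "h > 0" "real N * h = T" "h < m0" using T N0 N m0 by (auto simp: h_def field_simps)
  have AEV: "AE t in L\<^sub>T T. w t \<in> \<V> \<Omega> \<and> p t \<in> \<V> \<Omega>"
    using bochner_L_D(2)[OF w(2)] bochner_L_D(2)[OF p(2)] by eventually_elim simp
  obtain s where s: "0 < s" "s < h" "\<forall>i<N. w (s + real i * h) \<in> \<V> \<Omega> \<and> p (s + real i * h) \<in> \<V> \<Omega>"
    "h * (\<Sum>i<N. \<phi> (s + real i * h)) < \<delta>"
    using grid_point[OF T N0 \<phi>i \<phi>\<delta> AEV] unfolding h_def by blast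
  define t where "t i = s + real i * h" for i
  have tb: "0 < t i" "t i < T" if "i < N" for i
  proof -
    show "0 < t i" using s h by (simp add: t_def add_pos_nonneg)
    have "real (Suc i) * h \<le> real N * h" using that h(1) by (intro mult_right_mono) auto
    then show "t i < T" using s(2) h(2) by (simp add: t_def algebra_simps)
  qed
  have tS: "t (Suc i) = t i + h" for i by (simp add: t_def algebra_simps)
  have tV: "w (t i) \<in> \<V> \<Omega>" "p (t i) \<in> \<V> \<Omega>" if "i < N" for i using s(3) that by (auto simp: t_def)
  have "AE \<tau> in L\<^sub>T T. (w \<tau> \<in> \<V> \<Omega> \<and> p \<tau> \<in> \<V> \<Omega>) \<and> gw \<tau> \<in> V_dual \<Omega> \<and> gp \<tau> \<in> V_dual \<Omega> \<and>
      (\<forall>v\<in>\<V> \<Omega>. \<bar>gw \<tau> v\<bar> \<le> \<epsilon> * k1 \<tau> + C1 * ((1 + H_norm \<Omega> v ^ 2) * V_norm \<Omega> v ^ 2)) \<and>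
      (\<forall>v\<in>\<V> \<Omega>. \<bar>gp \<tau> v\<bar> \<le> \<epsilon> * k2 \<tau> + C2 * ((1 + H_norm \<Omega> v ^ 2) * V_norm \<Omega> v ^ 2))"
    using AEV bochner_L_D(2)[OF gw(1)] bochner_L_D(2)[OF gp(1)] C1(2) C2(2) by eventually_elim blast
  then obtain Z where Z: "negligible Z" and Z': "\<forall>\<tau>\<in>{0..T} - Z. (w \<tau> \<in> \<V> \<Omega> \<and> p \<tau> \<in> \<V> \<Omega>) \<and> gw \<tau> \<in> V_dual \<Omega> \<and> gp \<tau> \<in> V_dual \<Omega> \<and>
      (\<forall>v\<in>\<V> \<Omega>. \<bar>gw \<tau> v\<bar> \<le> \<epsilon> * k1 \<tau> + C1 * ((1 + H_norm \<Omega> v ^ 2) * V_norm \<Omega> v ^ 2)) \<and>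
      (\<forall>v\<in>\<V> \<Omega>. \<bar>gp \<tau> v\<bar> \<le> \<epsilon> * k2 \<tau> + C2 * ((1 + H_norm \<Omega> v ^ 2) * V_norm \<Omega> v ^ 2))"
    by (rule AE_negligible)
  define R where "R \<tau> = \<epsilon> * k \<tau> + D * \<phi> \<tau>" for \<tau>
  have Ri: "integrable (L\<^sub>T T) R" unfolding R_def using ki \<phi>i by auto
  have R0: "R \<tau> \<ge> 0" for \<tau> using k0 \<phi>0 \<epsilon>(1) D by (simp add: R_def)
  have Rint: "R integrable_on {0..T}" by (rule lebesgue_on_Icc(1)[OF Ri])
  define S where "S i = D * (\<phi> (t (Suc i)) + \<phi> (t i) + 2 * \<eta>\<^sup>2)" for i
  have interval: "\<bar>?\<Psi> (t (Suc i)) - ?\<Psi> (t i) - integral {t i..t (Suc i)} ?F\<bar> \<le> integral {t i..t (Suc i)} R + h * S i"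
    if i: "Suc i < N" for i
  proof -
    define a b where "a = t i" and "b = t (Suc i)"
    have ab: "0 < a" "a < b" "b < T" "b = a + h" using tb[of i] tb[of "Suc i"] i tS h(1) by (auto simp: a_def b_def)
    have aV: "w a \<in> \<V> \<Omega>" "p a \<in> \<V> \<Omega>" "w b \<in> \<V> \<Omega>" "p b \<in> \<V> \<Omega>" using tV[of i] tV[of "Suc i"] i by (auto simp: a_def b_def)
    have sub: "f integrable_on {a..b}" if "f integrable_on {0..T}" for f :: "real \<Rightarrow> real"
      by (rule integrable_subinterval_real[OF that]) (use ab in auto)
    have inc1: "pairing \<Omega> (w b) (p b) - pairing \<Omega> (w a) (p b) = integral {a..b} (\<lambda>\<tau>. gw \<tau> (p b))"
      by (rule pairing_increment[OF gw(1) aV(4) w(1) gw(2) ab(1,2,3)])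
    have inc2: "pairing \<Omega> (p b) (w a) - pairing \<Omega> (p a) (w a) = integral {a..b} (\<lambda>\<tau>. gp \<tau> (w a))"
      by (rule pairing_increment[OF gp(1) aV(1) p(1) gp(2) ab(1,2,3)])
    have i1: "(\<lambda>\<tau>. gw \<tau> (p b)) integrable_on {a..b}" by (intro sub lebesgue_on_Icc(1) dual_apply_integrable[OF gw(1)] aV)
    have i2: "(\<lambda>\<tau>. gp \<tau> (w a)) integrable_on {a..b}" by (intro sub lebesgue_on_Icc(1) dual_apply_integrable[OF gp(1)] aV)
    let ?G = "\<lambda>\<tau>. (gw \<tau> (p b) + gp \<tau> (w a)) - ?F \<tau>"
    have eq: "?\<Psi> b - ?\<Psi> a - integral {a..b} ?F = integral {a..b} ?G"
    proof -
      have "integral {a..b} ?G = integral {a..b} (\<lambda>\<tau>. gw \<tau> (p b)) + integral {a..b} (\<lambda>\<tau>. gp \<tau> (w a)) - integral {a..b} ?F"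
        using i1 i2 sub[OF Fint] by (simp add: Henstock_Kurzweil_Integration.integral_diff Henstock_Kurzweil_Integration.integral_add integrable_add)
      then show ?thesis using inc1 inc2 by (simp add: pairing_commute[of \<Omega> "p b" "w a"] pairing_commute[of \<Omega> "p a" "w a"])
    qed
    have "\<bar>integral {a..b} ?G\<bar> \<le> integral {a..b} (\<lambda>\<tau>. R \<tau> + S i)"
    proof (rule HK_abs_bound_AE[OF _ _ Z])
      show "?G integrable_on {a..b}" by (intro integrable_diff integrable_add i1 i2 sub[OF Fint])
      show "(\<lambda>\<tau>. R \<tau> + S i) integrable_on {a..b}" by (intro integrable_add sub[OF Rint]) auto
      fix \<tau> assume \<tau>: "\<tau> \<in> {a..b} - Z"
      then have \<tau>T: "\<tau> \<in> {0..T}" "a \<in> {0..T}" "b \<in> {0..T}" using ab by auto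
      have \<tau>V: "w \<tau> \<in> \<V> \<Omega>" "p \<tau> \<in> \<V> \<Omega>" "gw \<tau> \<in> V_dual \<Omega>" "gp \<tau> \<in> V_dual \<Omega>" using Z' \<tau> \<tau>T by auto
      have near: "\<bar>b - \<tau>\<bar> < d1" "\<bar>a - \<tau>\<bar> < d2" using \<tau> ab h m0 by auto
      let ?P = "\<lambda>x. p b x - p \<tau> x" and ?W = "\<lambda>x. w a x - w \<tau> x"
      have PW: "?P \<in> \<V> \<Omega>" "?W \<in> \<V> \<Omega>" by (intro V_diff aV \<tau>V)+
      have sq: "V_norm \<Omega> (\<lambda>x. y s x - y \<tau> x) ^ 2 \<le> 3 * (V_norm \<Omega> (\<lambda>x. y s x - z s x) ^ 2 + \<eta>\<^sup>2 + V_norm \<Omega> (\<lambda>x. y \<tau> x - z \<tau> x) ^ 2)"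
        if "y s \<in> \<V> \<Omega>" "y \<tau> \<in> \<V> \<Omega>" "z s \<in> \<V> \<Omega>" "z \<tau> \<in> \<V> \<Omega>" "V_norm \<Omega> (\<lambda>x. z s x - z \<tau> x) < \<eta>" for y z :: "real \<Rightarrow> field" and s
      proof -
        have "V_norm \<Omega> (\<lambda>x. y s x - y \<tau> x) \<le> V_norm \<Omega> (\<lambda>x. y s x - z s x) + \<eta> + V_norm \<Omega> (\<lambda>x. y \<tau> x - z \<tau> x)"
          using V_norm_diff_triangle[OF V_H1[OF that(1)] V_H1[OF that(3)] V_H1[OF that(2)]]
            V_norm_diff_triangle[OF V_H1[OF that(3)] V_H1[OF that(4)] V_H1[OF that(2)]]
            V_norm_minus_commute[OF V_H1[OF that(4)] V_H1[OF that(2)]] that(5) by simp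
        then have "V_norm \<Omega> (\<lambda>x. y s x - y \<tau> x) ^ 2 \<le> (V_norm \<Omega> (\<lambda>x. y s x - z s x) + \<eta> + V_norm \<Omega> (\<lambda>x. y \<tau> x - z \<tau> x)) ^ 2"
          by (intro power_mono V_norm_nonneg)
        also have "\<dots> \<le> 3 * (V_norm \<Omega> (\<lambda>x. y s x - z s x) ^ 2 + \<eta>\<^sup>2 + V_norm \<Omega> (\<lambda>x. y \<tau> x - z \<tau> x) ^ 2)"
          by (rule square_sum3_le)
        finally show ?thesis .
      qed
      have X: "V_norm \<Omega> ?P ^ 2 \<le> 3 * (V_norm \<Omega> (\<lambda>x. p b x - q b x) ^ 2 + \<eta>\<^sup>2 + V_norm \<Omega> (\<lambda>x. p \<tau> x - q \<tau> x) ^ 2)"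
        by (rule sq) (use aV \<tau>V qV d1(2) near(1) \<tau>T in auto)
      have Y: "V_norm \<Omega> ?W ^ 2 \<le> 3 * (V_norm \<Omega> (\<lambda>x. w a x - r a x) ^ 2 + \<eta>\<^sup>2 + V_norm \<Omega> (\<lambda>x. w \<tau> x - r \<tau> x) ^ 2)"
        by (rule sq) (use aV \<tau>V rV d2(2) near(2) \<tau>T in auto)
      have lin: "x + y \<le> 3 * (f + (A + B + 2 * e'))"
        if "x \<le> 3 * (a' + e' + c')" "y \<le> 3 * (b' + e' + d')" "a' \<le> A" "b' \<le> B" "f = c' + d'"
        for x y f A B e' a' b' c' d' :: real
      proof -
        have "x + y \<le> 3 * (a' + e' + c') + 3 * (b' + e' + d')" by (rule add_mono[OF that(1,2)])
        also have "\<dots> = 3 * (f + (a' + b' + 2 * e'))" using that(5) by (simp add: algebra_simps)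
        also have "\<dots> \<le> 3 * (f + (A + B + 2 * e'))" using that(3,4) by (intro mult_left_mono add_left_mono add_right_mono add_mono) auto
        finally show ?thesis .
      qed
      have XY: "V_norm \<Omega> ?P ^ 2 + V_norm \<Omega> ?W ^ 2 \<le> 3 * (\<phi> \<tau> + (\<phi> b + \<phi> a + 2 * \<eta>\<^sup>2))"
        by (rule lin[OF X Y]) (simp_all add: \<phi>_def)
      have "\<bar>gw \<tau> ?P\<bar> \<le> \<epsilon> * k1 \<tau> + C1 * ((1 + H_norm \<Omega> ?P ^ 2) * V_norm \<Omega> ?P ^ 2)" using Z' \<tau> \<tau>T PW by auto
      also have "\<dots> \<le> \<epsilon> * k1 \<tau> + C * (L * V_norm \<Omega> ?P ^ 2)"
        using HL[OF p(1) M(2) \<tau>T(3,1)] C C1 L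
        by (intro add_left_mono mult_mono mult_nonneg_nonneg) auto
      finally have 1: "\<bar>gw \<tau> ?P\<bar> \<le> \<epsilon> * k1 \<tau> + C * (L * V_norm \<Omega> ?P ^ 2)" .
      have "\<bar>gp \<tau> ?W\<bar> \<le> \<epsilon> * k2 \<tau> + C2 * ((1 + H_norm \<Omega> ?W ^ 2) * V_norm \<Omega> ?W ^ 2)" using Z' \<tau> \<tau>T PW by auto
      also have "\<dots> \<le> \<epsilon> * k2 \<tau> + C * (L * V_norm \<Omega> ?W ^ 2)"
        using HL[OF w(1) M(1) \<tau>T(2,1)] C C2 L
        by (intro add_left_mono mult_mono mult_nonneg_nonneg) auto
      finally have 2: "\<bar>gp \<tau> ?W\<bar> \<le> \<epsilon> * k2 \<tau> + C * (L * V_norm \<Omega> ?W ^ 2)" .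
      have "?G \<tau> = gw \<tau> ?P + gp \<tau> ?W"
        using V_dual_minus[OF \<tau>V(3) aV(4) \<tau>V(2)] V_dual_minus[OF \<tau>V(4) aV(1) \<tau>V(1)] by simp
      then have "\<bar>?G \<tau>\<bar> \<le> \<epsilon> * k \<tau> + C * L * (V_norm \<Omega> ?P ^ 2 + V_norm \<Omega> ?W ^ 2)"
        using 1 2 by (simp add: k_def algebra_simps)
      also have "\<dots> \<le> \<epsilon> * k \<tau> + C * L * (3 * (\<phi> \<tau> + (\<phi> b + \<phi> a + 2 * \<eta>\<^sup>2)))"
        using XY C L by (intro add_left_mono mult_left_mono) auto
      also have "\<dots> = R \<tau> + S i" by (simp add: R_def S_def D_def a_def b_def algebra_simps)
      finally show "\<bar>?G \<tau>\<bar> \<le> R \<tau> + S i" .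
    qed
    also have "\<dots> = integral {a..b} R + h * S i"
      using Henstock_Kurzweil_Integration.integral_add[OF sub[OF Rint] integrable_const_ivl[of "S i" a b]] ab by simp
    finally show ?thesis using eq by (simp only: a_def b_def)
  qed
  have telescope: "\<bar>?\<Psi> (t m) - ?\<Psi> (t 0) - integral {t 0..t m} ?F\<bar> \<le> integral {t 0..t m} R + h * (\<Sum>i<m. S i)"
    if "m < N" for m
    using that
  proof (induction m)
    case (Suc m)
    have le: "t 0 \<le> t m" "t m \<le> t (Suc m)" using h(1) by (auto simp: t_def)
    have comb: "integral {t 0..t (Suc m)} f = integral {t 0..t m} f + integral {t m..t (Suc m)} f"
      if "f integrable_on {0..T}" for f :: "real \<Rightarrow> real"
    proof -
      have "{t 0..t (Suc m)} \<subseteq> {0..T}" using tb(1)[OF N0] tb(2)[OF Suc.prems] by auto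
      from Henstock_Kurzweil_Integration.integral_combine[OF le integrable_subinterval_real[OF that this]]
      show ?thesis by simp
    qed
    show ?case using Suc.IH interval[OF Suc.prems] Suc.prems comb[OF Fint] comb[OF Rint] by (simp add: algebra_simps)
  qed simp
  define m where "m = N - 1"
  have m: "m < N" "Suc m = N" using N0 by (auto simp: m_def)
  have "integral {t 0..t m} R \<le> integral {0..T} R"
    using tb[of 0] tb[OF m(1)] N0 R0
    by (intro integral_subset_le integrable_subinterval_real[OF Rint] Rint) auto
  also have "\<dots> = \<epsilon> * K + D * (LINT t|L\<^sub>T T. \<phi> t)"
    unfolding lebesgue_on_Icc(2)[OF Ri, symmetric] R_def K_def using ki \<phi>i by simp
  also have "\<dots> \<le> e0 / 2 + D * \<delta>" using \<epsilon>(2) \<phi>\<delta> D by (intro add_mono mult_left_mono) auto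
  finally have r1: "integral {t 0..t m} R \<le> e0 / 2 + D * \<delta>" .
  have "h * (\<Sum>i<m. S i) = D * (h * (\<Sum>i<m. \<phi> (t (Suc i))) + h * (\<Sum>i<m. \<phi> (t i)) + 2 * (real m * h) * \<eta>\<^sup>2)"
    by (simp add: S_def sum.distrib sum_distrib_left[symmetric] algebra_simps)
  also have "\<dots> \<le> D * (\<delta> + \<delta> + 2 * T * \<eta>\<^sup>2)"
  proof (intro mult_left_mono add_mono mult_right_mono D)
    have "(\<Sum>i<m. \<phi> (t (Suc i))) \<le> (\<Sum>i<N. \<phi> (t i))"
      unfolding m(2)[symmetric] sum.lessThan_Suc_shift using \<phi>0 by simp
    then have "h * (\<Sum>i<m. \<phi> (t (Suc i))) \<le> h * (\<Sum>i<N. \<phi> (t i))" using h(1) by simp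
    then show "h * (\<Sum>i<m. \<phi> (t (Suc i))) \<le> \<delta>" using s(4) by (simp add: t_def)
    have "(\<Sum>i<m. \<phi> (t i)) \<le> (\<Sum>i<N. \<phi> (t i))" unfolding m(2)[symmetric] using \<phi>0 by simp
    then have "h * (\<Sum>i<m. \<phi> (t i)) \<le> h * (\<Sum>i<N. \<phi> (t i))" using h(1) by simp
    then show "h * (\<Sum>i<m. \<phi> (t i)) \<le> \<delta>" using s(4) by (simp add: t_def)
    have "real m * h \<le> real N * h" using m h(1) by (intro mult_right_mono) auto
    then show "real m * h \<le> T" using h(2) by simp
  qed auto
  finally have r2: "h * (\<Sum>i<m. S i) \<le> D * (\<delta> + \<delta> + 2 * T * \<eta>\<^sup>2)" .
  have "D * (\<delta> + \<delta> + 2 * T * \<eta>\<^sup>2) = 2 * (D * \<delta>) + 2 * (D * (T * \<eta>\<^sup>2))" by (simp add: algebra_simps)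
  then have bound: "\<bar>?\<Psi> (t m) - ?\<Psi> (t 0) - integral {t 0..t m} ?F\<bar> \<le> e0"
    using telescope[OF m(1)] r1 r2 \<delta>(2) \<eta>(2) by linarith
  have "t m + h > T" using m s(1) h(2) by (metis add.commute add_less_cancel_left less_add_same_cancel1 t_def tS)
  then have "T - h0 < t m" using h(3) m0(4) by linarith
  moreover have "t 0 < h0" "t 0 \<le> t m" using s h m0 by (auto simp: t_def)
  ultimately show ?thesis using bound tb[OF m(1)] tb(1)[OF N0] by blast
qed

lemma
  assumes T: "T > 0"
    and w: "w \<in> cont_in_time T (\<H> \<Omega>) (H_norm \<Omega>)" "w \<in> bochner_L 2 T (\<V> \<Omega>) (V_norm \<Omega>)"
    and p: "p \<in> cont_in_time T (\<H> \<Omega>) (H_norm \<Omega>)" "p \<in> bochner_L 2 T (\<V> \<Omega>) (V_norm \<Omega>)"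
    and gw: "gw \<in> bochner_L (4/3) T (V_dual \<Omega>) (V_dual_norm \<Omega>)" "is_time_deriv \<Omega> T w gw" "dual_bound T gw"
    and gp: "gp \<in> bochner_L (4/3) T (V_dual \<Omega>) (V_dual_norm \<Omega>)" "is_time_deriv \<Omega> T p gp" "dual_bound T gp"
  shows integration_by_parts: "(LINT t|L\<^sub>T T. gw t (p t) + gp t (w t)) = pairing \<Omega> (w T) (p T) - pairing \<Omega> (w 0) (p 0)"
proof -
  let ?F = "\<lambda>t. gw t (p t) + gp t (w t)"
  let ?\<Psi> = "\<lambda>t. pairing \<Omega> (w t) (p t)"
  let ?J = "\<lambda>t. integral {0..t} ?F"
  have Fi: "integrable (L\<^sub>T T) ?F"
    by (intro Bochner_Integration.integrable_add dual_pairing_integrable[OF gw(1,3) p(2,1)] dual_pairing_integrable[OF gp(1,3) w(2,1)])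
  have Fint: "?F integrable_on {0..T}" by (rule lebesgue_on_Icc(1)[OF Fi])
  have contJ: "continuous_on {0..T} ?J" by (rule indefinite_integral_continuous_1[OF Fint])
  have cont\<Psi>: "continuous_on {0..T} ?\<Psi>" by (rule continuous_on_pairing[OF w(1) p(1)])
  define X where "X t = ?\<Psi> t - ?J t" for t
  have contX: "continuous_on {0..T} X" unfolding X_def by (intro continuous_on_diff contJ cont\<Psi>)
  have "\<bar>X T - X 0\<bar> \<le> e" if e: "e > 0" for e
  proof -
    have e3: "e / 3 > 0" using e by simp
    obtain d1 where d1: "d1 > 0" "\<forall>t\<in>{0..T}. dist t 0 < d1 \<longrightarrow> dist (X t) (X 0) < e / 3"
      using contX e3 T unfolding continuous_on_iff by (metis atLeastAtMost_iff order_refl less_imp_le)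
    obtain d2 where d2: "d2 > 0" "\<forall>t\<in>{0..T}. dist t T < d2 \<longrightarrow> dist (X t) (X T) < e / 3"
      using contX e3 T unfolding continuous_on_iff by (metis atLeastAtMost_iff order_refl less_imp_le)
    define h0 where "h0 = min d1 d2"
    have h0: "h0 > 0" "h0 \<le> d1" "h0 \<le> d2" using d1 d2 by (auto simp: h0_def)
    obtain a b where ab: "0 < a" "a < h0" "a \<le> b" "T - h0 < b" "b < T"
      and le: "\<bar>?\<Psi> b - ?\<Psi> a - integral {a..b} ?F\<bar> \<le> e / 3"
      using integration_by_parts_approx[OF T w p gw gp e3 h0(1)] by blast
    have "integral {0..a} ?F + integral {a..b} ?F = integral {0..b} ?F"
      by (rule Henstock_Kurzweil_Integration.integral_combine)
        (use ab in \<open>auto intro: integrable_subinterval_real[OF Fint]\<close>)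
    then have "X b - X a = ?\<Psi> b - ?\<Psi> a - integral {a..b} ?F" unfolding X_def by linarith
    then have "\<bar>X b - X a\<bar> \<le> e / 3" using le by simp
    moreover have "\<bar>X a - X 0\<bar> < e / 3" using d1(2)[rule_format, of a] ab h0 by (simp add: dist_real_def)
    moreover have "\<bar>X b - X T\<bar> < e / 3" using d2(2)[rule_format, of b] ab h0 by (simp add: dist_real_def)
    ultimately show ?thesis by linarith
  qed
  then have "\<bar>X T - X 0\<bar> \<le> 0" using dense_ge[of 0 "\<bar>X T - X 0\<bar>"] by blast
  then have "?J T = ?\<Psi> T - ?\<Psi> 0" by (simp add: X_def)
  then show ?thesis using lebesgue_on_Icc(2)[OF Fi] by simp
qed

end

section \<open>Estimates for the nonlinear terms\<close>

lemma norm_matrix_vector_le: "norm ((A::real^2^2) *v x) \<le> norm A * norm x"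
proof -
  have "norm (A *v x) = L2_set (\<lambda>i. norm (A $ i \<bullet> x)) UNIV"
    by (simp add: norm_vec_def matrix_vector_mul_component)
  also have "\<dots> \<le> L2_set (\<lambda>i. norm (A $ i) * norm x) UNIV"
    by (rule L2_set_mono) (auto simp: Cauchy_Schwarz_ineq2)
  also have "\<dots> = norm A * norm x"
    by (simp add: L2_set_left_distrib norm_vec_def)
  finally show ?thesis .
qed

definition cub :: "field \<Rightarrow> field \<Rightarrow> field \<Rightarrow> field" where
  "cub a b c = (\<lambda>x. (a x \<bullet> b x) *\<^sub>R c x)"

context planar_domain
begin

definition lad :: "field \<Rightarrow> real" where
  "lad u = sqrt (sqrt 8 * (H_norm \<Omega> u * V_norm \<Omega> u))"

lemma lad_nonneg: "lad u \<ge> 0"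
  by (simp add: lad_def Lnorm_nonneg V_norm_nonneg)

lemma lad_square: "lad u ^ 2 = sqrt 8 * (H_norm \<Omega> u * V_norm \<Omega> u)"
  by (simp add: lad_def Lnorm_nonneg V_norm_nonneg)

lemma lad_power4: "lad u ^ 4 = 8 * (H_norm \<Omega> u ^ 2 * V_norm \<Omega> u ^ 2)"
proof -
  have "lad u ^ 4 = (lad u ^ 2) ^ 2" by simp
  also have "\<dots> = (sqrt 8)\<^sup>2 * (H_norm \<Omega> u ^ 2 * V_norm \<Omega> u ^ 2)" by (simp only: lad_square power_mult_distrib)
  finally show ?thesis by simp
qed

lemma lad_le_V_norm:
  assumes "u \<in> \<V> \<Omega>"
  shows "lad u \<le> sqrt (sqrt 8 * sqrt area) * V_norm \<Omega> u"
proof -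
  have "lad u \<le> sqrt (sqrt 8 * ((sqrt area * V_norm \<Omega> u) * V_norm \<Omega> u))"
    unfolding lad_def by (intro real_sqrt_le_mono mult_left_mono mult_right_mono poincare assms V_norm_nonneg) simp
  also have "\<dots> = sqrt (sqrt 8 * sqrt area) * V_norm \<Omega> u"
    by (simp add: real_sqrt_mult V_norm_nonneg mult.assoc[symmetric])
  finally show ?thesis .
qed

lemma
  assumes u: "u \<in> \<V> \<Omega>" and v: "v \<in> \<V> \<Omega>"
  shows integrable_product_square: "integrable L\<Omega> (\<lambda>x. (norm (u x) * norm (v x))\<^sup>2)"
    and L2_product_bound: "sqrt (LINT x|L\<Omega>. (norm (u x) * norm (v x))\<^sup>2) \<le> lad u * lad v"
proof -
  have m [measurable]: "u \<in> borel_measurable L\<Omega>" "v \<in> borel_measurable L\<Omega>"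
    using V_Lspace[OF u] V_Lspace[OF v] by (auto dest: Lspace_measurable)
  have i: "integrable L\<Omega> (\<lambda>x. ((norm (u x))\<^sup>2)\<^sup>2)" "integrable L\<Omega> (\<lambda>x. ((norm (v x))\<^sup>2)\<^sup>2)"
    using Lspace_integrable[OF V_L4[OF u]] Lspace_integrable[OF V_L4[OF v]] by simp_all
  show "integrable L\<Omega> (\<lambda>x. (norm (u x) * norm (v x))\<^sup>2)"
    using integrable_mult_square[OF _ _ i] by (simp add: power_mult_distrib)
  have "(LINT x|L\<Omega>. (norm (u x) * norm (v x))\<^sup>2) \<le> sqrt (LINT x|L\<Omega>. ((norm (u x))\<^sup>2)\<^sup>2) * sqrt (LINT x|L\<Omega>. ((norm (v x))\<^sup>2)\<^sup>2)"
    using Cauchy_Schwarz_integral_abs[OF _ _ i] by (simp add: power_mult_distrib)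
  also have "\<dots> = sqrt (Lnorm \<Omega> 4 u ^ 4) * sqrt (Lnorm \<Omega> 4 v ^ 4)" by (simp add: Lnorm_power)
  also have "\<dots> \<le> sqrt (lad u ^ 4) * sqrt (lad v ^ 4)"
    unfolding lad_power4
    by (intro mult_mono real_sqrt_le_mono ladyzhenskaya u v) (auto intro!: real_sqrt_ge_zero mult_nonneg_nonneg simp: Lnorm_nonneg)
  also have "\<dots> = (lad u * lad v) ^ 2"
  proof -
    have "sqrt (lad y ^ 4) = lad y ^ 2" for y
      by (rule real_sqrt_unique) (simp_all add: lad_nonneg)
    then show ?thesis by (simp add: power_mult_distrib)
  qed
  finally have "(LINT x|L\<Omega>. (norm (u x) * norm (v x))\<^sup>2) \<le> (lad u * lad v) ^ 2" .
  then show "sqrt (LINT x|L\<Omega>. (norm (u x) * norm (v x))\<^sup>2) \<le> lad u * lad v"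
    by (intro real_le_lsqrt) (auto simp: lad_nonneg)
qed

lemma
  assumes G: "G \<in> Lspace \<Omega> 2" and u: "u \<in> \<V> \<Omega>" and v: "v \<in> \<V> \<Omega>"
  shows trilinear_integrable: "integrable L\<Omega> (\<lambda>x. (G x *v u x) \<bullet> v x)"
    and trilinear_bound: "\<bar>LINT x|L\<Omega>. (G x *v u x) \<bullet> v x\<bar> \<le> Lnorm \<Omega> 2 G * (lad u * lad v)"
proof -
  have m [measurable]: "u \<in> borel_measurable L\<Omega>" "v \<in> borel_measurable L\<Omega>" "G \<in> borel_measurable L\<Omega>"
    using V_Lspace[OF u] V_Lspace[OF v] G by (auto dest: Lspace_measurable)
  have Gm: "(\<lambda>x. (G x *v u x) \<bullet> v x) \<in> borel_measurable L\<Omega>"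
  proof -
    have c [measurable]: "(\<lambda>x. G x $ i $ j) \<in> borel_measurable L\<Omega>" "(\<lambda>x. u x $ i) \<in> borel_measurable L\<Omega>"
      "(\<lambda>x. v x $ i) \<in> borel_measurable L\<Omega>" for i j
      by (rule Lspace_measurable[OF Lspace_component[OF Lspace_component[OF G]]],
          rule Lspace_measurable[OF Lspace_component[OF V_Lspace[OF u]]],
          rule Lspace_measurable[OF Lspace_component[OF V_Lspace[OF v]]])
    show ?thesis unfolding inner_vec_def matrix_vector_mult_def vec_lambda_beta inner_real_def by measurable
  qed
  have i: "integrable L\<Omega> (\<lambda>x. (norm (G x))\<^sup>2)" using Lspace_integrable[OF G] by simp
  have i1: "integrable L\<Omega> (\<lambda>x. norm (G x) * (norm (u x) * norm (v x)))"
    by (rule integrable_mult_square[OF _ _ i integrable_product_square[OF u v]]) measurable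
  have le: "\<bar>(G x *v u x) \<bullet> v x\<bar> \<le> norm (G x) * (norm (u x) * norm (v x))" for x
  proof -
    have "\<bar>(G x *v u x) \<bullet> v x\<bar> \<le> norm (G x *v u x) * norm (v x)" by (rule Cauchy_Schwarz_ineq2)
    also have "\<dots> \<le> (norm (G x) * norm (u x)) * norm (v x)" by (intro mult_right_mono norm_matrix_vector_le) simp
    finally show ?thesis by (simp add: mult.assoc)
  qed
  show i2: "integrable L\<Omega> (\<lambda>x. (G x *v u x) \<bullet> v x)"
    by (rule integrable_bound_AE[OF i1 Gm]) (use le in auto)
  have "\<bar>LINT x|L\<Omega>. (G x *v u x) \<bullet> v x\<bar> \<le> (LINT x|L\<Omega>. \<bar>norm (G x) * (norm (u x) * norm (v x))\<bar>)"
    by (rule order_trans[OF integral_abs_bound integral_mono[OF integrable_abs[OF i2] integrable_abs[OF i1]]])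
      (simp add: le)
  also have "\<dots> \<le> sqrt (LINT x|L\<Omega>. (norm (G x))\<^sup>2) * sqrt (LINT x|L\<Omega>. (norm (u x) * norm (v x))\<^sup>2)"
    by (rule Cauchy_Schwarz_integral_abs[OF _ _ i integrable_product_square[OF u v]]) measurable
  also have "\<dots> \<le> Lnorm \<Omega> 2 G * (lad u * lad v)"
    unfolding Lnorm_2 by (intro mult_left_mono L2_product_bound u v) simp
  finally show "\<bar>LINT x|L\<Omega>. (G x *v u x) \<bullet> v x\<bar> \<le> Lnorm \<Omega> 2 G * (lad u * lad v)" .
qed

lemma B_op_integrable:
  "u \<in> \<V> \<Omega> \<Longrightarrow> v \<in> \<V> \<Omega> \<Longrightarrow> w \<in> \<V> \<Omega> \<Longrightarrow> integrable L\<Omega> (\<lambda>x. (grad \<Omega> v x *v u x) \<bullet> w x)"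
  by (intro trilinear_integrable grad_Lspace V_H1)

lemma B_op_bound:
  "u \<in> \<V> \<Omega> \<Longrightarrow> v \<in> \<V> \<Omega> \<Longrightarrow> w \<in> \<V> \<Omega> \<Longrightarrow> \<bar>B_op \<Omega> u v w\<bar> \<le> V_norm \<Omega> v * (lad u * lad w)"
  unfolding B_op_def pairing_def V_norm_def by (intro trilinear_bound grad_Lspace V_H1)

lemma B_op_diff1:
  assumes "u \<in> \<V> \<Omega>" "u' \<in> \<V> \<Omega>" "v \<in> \<V> \<Omega>" "w \<in> \<V> \<Omega>"
  shows "B_op \<Omega> (\<lambda>x. u x - u' x) v w = B_op \<Omega> u v w - B_op \<Omega> u' v w"
  using B_op_integrable[OF assms(1,3,4)] B_op_integrable[OF assms(2,3,4)]
  by (simp add: B_op_def pairing_def matrix_vector_mult_diff_distrib inner_diff_left)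

lemma B_op_diff2:
  assumes "u \<in> \<V> \<Omega>" "v \<in> \<V> \<Omega>" "v' \<in> \<V> \<Omega>" "w \<in> \<V> \<Omega>"
  shows "B_op \<Omega> u (\<lambda>x. v x - v' x) w = B_op \<Omega> u v w - B_op \<Omega> u v' w"
proof -
  note i = B_op_integrable[OF assms(1,2,4)] B_op_integrable[OF assms(1,3,4)]
  have "B_op \<Omega> u (\<lambda>x. v x - v' x) w = (LINT x|L\<Omega>. (grad \<Omega> v x *v u x) \<bullet> w x - (grad \<Omega> v' x *v u x) \<bullet> w x)"
    unfolding B_op_def pairing_def
  proof (rule integral_cong_AE)
    show "(\<lambda>x. (grad \<Omega> (\<lambda>x. v x - v' x) x *v u x) \<bullet> w x) \<in> borel_measurable L\<Omega>"
      using B_op_integrable[OF assms(1) V_diff[OF assms(2,3)] assms(4)] by auto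
    show "(\<lambda>x. (grad \<Omega> v x *v u x) \<bullet> w x - (grad \<Omega> v' x *v u x) \<bullet> w x) \<in> borel_measurable L\<Omega>"
      using i by auto
    show "AE x in L\<Omega>. (grad \<Omega> (\<lambda>x. v x - v' x) x *v u x) \<bullet> w x = (grad \<Omega> v x *v u x) \<bullet> w x - (grad \<Omega> v' x *v u x) \<bullet> w x"
      using grad_diff[OF V_H1[OF assms(2)] V_H1[OF assms(3)]]
      by eventually_elim (simp add: matrix_vector_mult_diff_rdistrib inner_diff_left)
  qed
  then show ?thesis using i by (simp add: B_op_def pairing_def)
qed

lemma B_op_diff3:
  assumes "u \<in> \<V> \<Omega>" "v \<in> \<V> \<Omega>" "w \<in> \<V> \<Omega>" "w' \<in> \<V> \<Omega>"
  shows "B_op \<Omega> u v (\<lambda>x. w x - w' x) = B_op \<Omega> u v w - B_op \<Omega> u v w'"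
  using B_op_integrable[OF assms(1,2,3)] B_op_integrable[OF assms(1,2,4)]
  by (simp add: B_op_def pairing_def inner_diff_right)

lemma cub_Lspace:
  assumes "a \<in> \<V> \<Omega>" "b \<in> \<V> \<Omega>" "c \<in> \<V> \<Omega>"
  shows "cub a b c \<in> Lspace \<Omega> 2"
proof -
  have m [measurable]: "a \<in> borel_measurable L\<Omega>" "b \<in> borel_measurable L\<Omega>" "c \<in> borel_measurable L\<Omega>"
    using V_Lspace[OF assms(1)] V_Lspace[OF assms(2)] V_Lspace[OF assms(3)] by (auto dest: Lspace_measurable)
  have "cub a b c \<in> borel_measurable L\<Omega>" unfolding cub_def by measurable
  moreover have "integrable L\<Omega> (\<lambda>x. norm (cub a b c x) ^ 2)"
  proof (rule integrable_bound_AE)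
    show "integrable L\<Omega> (\<lambda>x. norm (a x) ^ 6 + norm (b x) ^ 6 + norm (c x) ^ 6)"
      by (intro Bochner_Integration.integrable_add Lspace_integrable V_L6 assms)
    show "(\<lambda>x. norm (cub a b c x) ^ 2) \<in> borel_measurable L\<Omega>" using calculation by measurable
    have le: "(r * s * t) ^ 2 \<le> r ^ 6 + s ^ 6 + t ^ 6" if "r \<ge> 0" "s \<ge> 0" "t \<ge> 0" for r s t :: real
    proof -
      define m where "m = max r (max s t)"
      have "r * s * t \<le> m * m * m" using that by (intro mult_mono) (auto simp: m_def)
      then have "(r * s * t) ^ 2 \<le> (m * m * m) ^ 2" using that by (intro power_mono) auto
      also have "\<dots> = m ^ 6" by (simp add: power2_eq_square numeral_eq_Suc)
      also have "\<dots> \<le> r ^ 6 + s ^ 6 + t ^ 6"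
        using that unfolding m_def by (auto simp: max_def)
      finally show ?thesis .
    qed
    show "AE x in L\<Omega>. \<bar>norm (cub a b c x) ^ 2\<bar> \<le> norm (a x) ^ 6 + norm (b x) ^ 6 + norm (c x) ^ 6"
    proof (rule AE_I2)
      fix x
      have "norm (cub a b c x) \<le> norm (a x) * norm (b x) * norm (c x)"
        unfolding cub_def by (simp add: mult_right_mono Cauchy_Schwarz_ineq2)
      then have "norm (cub a b c x) ^ 2 \<le> (norm (a x) * norm (b x) * norm (c x)) ^ 2" by (intro power_mono) auto
      also have "\<dots> \<le> norm (a x) ^ 6 + norm (b x) ^ 6 + norm (c x) ^ 6" by (rule le) auto
      finally show "\<bar>norm (cub a b c x) ^ 2\<bar> \<le> norm (a x) ^ 6 + norm (b x) ^ 6 + norm (c x) ^ 6" by simp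
    qed
  qed
  ultimately show ?thesis by (simp add: Lspace_def)
qed

lemma cub_bound:
  assumes "a \<in> \<V> \<Omega>" "b \<in> \<V> \<Omega>" "c \<in> \<V> \<Omega>" "v \<in> \<V> \<Omega>"
  shows "\<bar>pairing \<Omega> (cub a b c) v\<bar> \<le> (lad a * lad b) * (lad c * lad v)"
proof -
  have m [measurable]: "a \<in> borel_measurable L\<Omega>" "b \<in> borel_measurable L\<Omega>" "c \<in> borel_measurable L\<Omega>" "v \<in> borel_measurable L\<Omega>"
    using assms[THEN V_Lspace] by (auto dest: Lspace_measurable)
  note i = integrable_product_square[OF assms(1,2)] integrable_product_square[OF assms(3,4)]
  have i1: "integrable L\<Omega> (\<lambda>x. (norm (a x) * norm (b x)) * (norm (c x) * norm (v x)))"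
    by (rule integrable_mult_square[OF _ _ i]) measurable
  have i2: "integrable L\<Omega> (\<lambda>x. cub a b c x \<bullet> v x)"
    by (rule pairing_integrable[OF cub_Lspace[OF assms(1,2,3)] V_Lspace[OF assms(4)]])
  have le: "\<bar>cub a b c x \<bullet> v x\<bar> \<le> (norm (a x) * norm (b x)) * (norm (c x) * norm (v x))" for x
    unfolding cub_def inner_scaleR_left abs_mult by (intro mult_mono Cauchy_Schwarz_ineq2) auto
  have "\<bar>pairing \<Omega> (cub a b c) v\<bar> \<le> (LINT x|L\<Omega>. \<bar>(norm (a x) * norm (b x)) * (norm (c x) * norm (v x))\<bar>)"
    unfolding pairing_def
    by (rule order_trans[OF integral_abs_bound integral_mono[OF integrable_abs[OF i2] integrable_abs[OF i1]]])
      (simp add: le)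
  also have "\<dots> \<le> sqrt (LINT x|L\<Omega>. (norm (a x) * norm (b x))\<^sup>2) * sqrt (LINT x|L\<Omega>. (norm (c x) * norm (v x))\<^sup>2)"
    by (rule Cauchy_Schwarz_integral_abs[OF _ _ i]) measurable
  also have "\<dots> \<le> (lad a * lad b) * (lad c * lad v)"
    by (intro mult_mono L2_product_bound assms) (auto intro!: mult_nonneg_nonneg lad_nonneg)
  finally show ?thesis .
qed

lemma C_op_eq: "C_op \<Omega> u = helmholtz \<Omega> (cub u u u)"
  by (simp add: C_op_def cub_def power2_norm_eq_inner)

lemma C'_op_eq: "C'_op \<Omega> u v = helmholtz \<Omega> (\<lambda>x. cub u u v x + 2 *\<^sub>R cub u v u x)"
  by (simp add: C'_op_def cub_def power2_norm_eq_inner)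

lemma pairing_C_op:
  "u \<in> \<V> \<Omega> \<Longrightarrow> v \<in> \<V> \<Omega> \<Longrightarrow> pairing \<Omega> (C_op \<Omega> u) v = pairing \<Omega> (cub u u u) v"
  unfolding C_op_eq by (intro pairing_helmholtz cub_Lspace V_H)

lemma pairing_C'_op:
  "u \<in> \<V> \<Omega> \<Longrightarrow> p \<in> \<V> \<Omega> \<Longrightarrow> v \<in> \<V> \<Omega> \<Longrightarrow>
    pairing \<Omega> (C'_op \<Omega> u p) v = pairing \<Omega> (cub u u p) v + 2 * pairing \<Omega> (cub u p u) v"
  unfolding C'_op_eq
  by (simp add: pairing_helmholtz[OF Lspace2_add[OF cub_Lspace Lspace_scale[OF cub_Lspace]] V_H]
      pairing_add_left[OF cub_Lspace Lspace_scale[OF cub_Lspace] V_Lspace] pairing_scale_left)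

text \<open>The Taylor expansion of the cubic \<open>\<C>\<close>; as \<open>\<C>'(u)\<close> is symmetric, it may act on \<open>p\<close>.\<close>

lemma C_op_expansion:
  assumes V: "u \<in> \<V> \<Omega>" "z \<in> \<V> \<Omega>" "p \<in> \<V> \<Omega>" and w: "w = (\<lambda>x. z x - u x)"
  shows "pairing \<Omega> (C_op \<Omega> z) p - pairing \<Omega> (C_op \<Omega> u) p
    = pairing \<Omega> (C'_op \<Omega> u p) w
      + pairing \<Omega> (\<lambda>x. (2 * (u x \<bullet> w x)) *\<^sub>R w x + (norm (w x))\<^sup>2 *\<^sub>R (w x + u x)) p"
proof -
  have wV: "w \<in> \<V> \<Omega>" unfolding w by (intro V_diff V)
  let ?Q = "\<lambda>x. (2 * (u x \<bullet> w x)) *\<^sub>R w x + (norm (w x))\<^sup>2 *\<^sub>R (w x + u x)"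
  have Q: "?Q = (\<lambda>x. 2 *\<^sub>R cub u w w x + (cub w w w x + cub w w u x))"
    by (simp add: cub_def power2_norm_eq_inner scaleR_add_right)
  have QL: "?Q \<in> Lspace \<Omega> 2" unfolding Q by (intro Lspace2_add Lspace_scale cub_Lspace V wV)
  let ?R = "\<lambda>x. cub u u p x + 2 *\<^sub>R cub u p u x"
  have RL: "?R \<in> Lspace \<Omega> 2" by (intro Lspace2_add Lspace_scale cub_Lspace V wV)
  have i: "integrable L\<Omega> (\<lambda>x. cub z z z x \<bullet> p x)" "integrable L\<Omega> (\<lambda>x. cub u u u x \<bullet> p x)"
    "integrable L\<Omega> (\<lambda>x. ?Q x \<bullet> p x)" "integrable L\<Omega> (\<lambda>x. ?R x \<bullet> w x)"
    by (intro pairing_integrable cub_Lspace V_Lspace V wV QL RL)+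
  have pw: "cub z z z x \<bullet> p x - cub u u u x \<bullet> p x = ?R x \<bullet> w x + ?Q x \<bullet> p x" for x
  proof -
    have z: "z x = u x + w x" by (simp add: w)
    have zz: "z x \<bullet> z x = u x \<bullet> u x + 2 * (u x \<bullet> w x) + w x \<bullet> w x" "z x \<bullet> p x = u x \<bullet> p x + w x \<bullet> p x"
      unfolding z by (simp_all add: inner_add_left inner_add_right inner_commute)
    show ?thesis
      unfolding cub_def power2_norm_eq_inner inner_add_left inner_scaleR_left inner_scaleR_right zz
        inner_commute[of "p x" "w x"]
      by (simp only: ring_distribs) (simp add: mult_ac)
  qed
  have "pairing \<Omega> (C_op \<Omega> z) p - pairing \<Omega> (C_op \<Omega> u) p = pairing \<Omega> (cub z z z) p - pairing \<Omega> (cub u u u) p"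
    by (simp only: pairing_C_op[OF V(2,3)] pairing_C_op[OF V(1,3)])
  also have "\<dots> = (LINT x|L\<Omega>. cub z z z x \<bullet> p x - cub u u u x \<bullet> p x)"
    unfolding pairing_def using i by simp
  also have "\<dots> = (LINT x|L\<Omega>. ?R x \<bullet> w x) + (LINT x|L\<Omega>. ?Q x \<bullet> p x)"
    unfolding pw using i by simp
  also have "(LINT x|L\<Omega>. ?R x \<bullet> w x) = pairing \<Omega> (C'_op \<Omega> u p) w"
    using pairing_helmholtz[OF RL V_H[OF wV]] by (simp only: C'_op_eq pairing_def)
  finally show ?thesis by (simp add: pairing_def)
qed

lemma B_op_expansion:
  assumes V: "u \<in> \<V> \<Omega>" "z \<in> \<V> \<Omega>" "p \<in> \<V> \<Omega>" and w: "w = (\<lambda>x. z x - u x)"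
  shows "B_op \<Omega> z z p - B_op \<Omega> u u p = B'_adj \<Omega> u p w + B_op \<Omega> w w p"
  unfolding B'_adj_def w using V by (simp add: B_op_diff1 B_op_diff2 V_diff)

lemma A_op_bound: "u \<in> \<V> \<Omega> \<Longrightarrow> v \<in> \<V> \<Omega> \<Longrightarrow> \<bar>A_op \<Omega> u v\<bar> \<le> V_norm \<Omega> u * V_norm \<Omega> v"
  unfolding A_op_def V_norm_def by (intro pairing_Cauchy_Schwarz grad_Lspace V_H1)

lemma A_op_commute: "A_op \<Omega> u v = A_op \<Omega> v u"
  by (simp add: A_op_def pairing_commute)

lemma A_op_diff:
  assumes "u \<in> \<V> \<Omega>" "v \<in> \<V> \<Omega>" "q \<in> \<V> \<Omega>"
  shows "A_op \<Omega> (\<lambda>x. u x - v x) q = A_op \<Omega> u q - A_op \<Omega> v q"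
proof -
  note G = grad_Lspace[OF V_H1[OF assms(1)]] grad_Lspace[OF V_H1[OF assms(2)]] grad_Lspace[OF V_H1[OF assms(3)]]
  have "A_op \<Omega> (\<lambda>x. u x - v x) q = pairing \<Omega> (\<lambda>x. grad \<Omega> u x - grad \<Omega> v x) (grad \<Omega> q)"
    unfolding A_op_def
    by (rule pairing_cong_AE) (use G Lspace2_diff[OF G(1,2)] grad_Lspace[OF V_H1[OF V_diff[OF assms(1,2)]]]
        grad_diff[OF V_H1[OF assms(1)] V_H1[OF assms(2)]] in \<open>auto dest: Lspace_measurable\<close>)
  also have "\<dots> = A_op \<Omega> u q - A_op \<Omega> v q" unfolding A_op_def by (rule pairing_diff_left[OF G])
  finally show ?thesis .
qed

lemma V_norm_diff_square:
  assumes "u \<in> \<V> \<Omega>" "v \<in> \<V> \<Omega>"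
  shows "V_norm \<Omega> (\<lambda>x. u x - v x) ^ 2 = V_norm \<Omega> u ^ 2 - 2 * A_op \<Omega> u v + V_norm \<Omega> v ^ 2"
proof -
  note G = grad_Lspace[OF V_H1[OF assms(1)]] grad_Lspace[OF V_H1[OF assms(2)]]
  have "V_norm \<Omega> (\<lambda>x. u x - v x) = Lnorm \<Omega> 2 (\<lambda>x. grad \<Omega> u x - grad \<Omega> v x)"
    unfolding V_norm_def
    by (rule Lnorm_cong_AE) (use Lspace2_diff[OF G] grad_Lspace[OF V_H1[OF V_diff[OF assms]]]
        grad_diff[OF V_H1[OF assms(1)] V_H1[OF assms(2)]] in \<open>auto dest: Lspace_measurable\<close>)
  then show ?thesis unfolding A_op_def V_norm_def by (simp only: Lnorm2_diff_square[OF G])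
qed

lemma dual_boundI:
  assumes int: "integrable (L\<^sub>T T) (\<lambda>t. a t ^ 2)" "integrable (L\<^sub>T T) (\<lambda>t. c t ^ 2)" "integrable (L\<^sub>T T) (\<lambda>t. b t ^ 4)"
    and le: "AE t in L\<^sub>T T. \<forall>v\<in>\<V> \<Omega>. \<bar>g t v\<bar> \<le> a t * V_norm \<Omega> v + c t * (b t * lad v)"
  shows "dual_bound T g"
  unfolding dual_bound_def
proof (intro exI[of _ "\<lambda>t. a t ^ 2 + c t ^ 2 + b t ^ 4"] conjI allI impI)
  let ?k = "\<lambda>t. a t ^ 2 + c t ^ 2 + b t ^ 4"
  show "integrable (L\<^sub>T T) ?k" using int by auto
  show "?k t \<ge> 0" for t by simp
  fix e :: real assume e: "e > 0"
  have young: "x * y \<le> e * x\<^sup>2 + (1 / e) * y\<^sup>2" for x y :: real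
  proof -
    have "0 \<le> (e * x - y)\<^sup>2 + (e * x)\<^sup>2 + y\<^sup>2" by simp
    then have "e * (x * y) \<le> e * (e * x\<^sup>2) + y\<^sup>2" by (simp add: power2_eq_square algebra_simps)
    then have "e * (x * y) \<le> e * (e * x\<^sup>2 + (1 / e) * y\<^sup>2)" using e by (simp add: distrib_left)
    then show ?thesis using e by simp
  qed
  let ?C = "1 / e + 8 / e ^ 3"
  show "\<exists>C\<ge>0. AE t in L\<^sub>T T. \<forall>v\<in>\<V> \<Omega>. \<bar>g t v\<bar> \<le> e * ?k t + C * ((1 + H_norm \<Omega> v ^ 2) * V_norm \<Omega> v ^ 2)"
  proof (intro exI[of _ ?C] conjI)
    show "?C \<ge> 0" using e by simp
    have main: "\<bar>g t v\<bar> \<le> e * ?k t + ?C * ((1 + H_norm \<Omega> v ^ 2) * V_norm \<Omega> v ^ 2)"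
      if t: "\<forall>v\<in>\<V> \<Omega>. \<bar>g t v\<bar> \<le> a t * V_norm \<Omega> v + c t * (b t * lad v)" and v: "v \<in> \<V> \<Omega>" for t v
    proof -
      let ?V = "V_norm \<Omega> v" and ?H = "H_norm \<Omega> v"
      have "(b t)\<^sup>2 * ((1 / e) * (lad v)\<^sup>2) \<le> e * ((b t)\<^sup>2)\<^sup>2 + (1 / e) * ((1 / e) * (lad v)\<^sup>2)\<^sup>2" by (rule young)
      then have "(1 / e) * (b t * lad v)\<^sup>2 \<le> e * b t ^ 4 + 1 / e ^ 3 * lad v ^ 4"
        using e by (simp add: power_mult_distrib power_divide mult_ac power3_eq_cube power2_eq_square numeral_eq_Suc)
      then have "\<bar>g t v\<bar> \<le> e * ?k t + (1 / e) * ?V\<^sup>2 + 1 / e ^ 3 * lad v ^ 4"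
        using t[rule_format, OF v] young[of "a t" ?V] young[of "c t" "b t * lad v"] by (simp add: distrib_left)
      also have "\<dots> \<le> e * ?k t + ?C * ((1 + ?H\<^sup>2) * ?V\<^sup>2)"
      proof -
        have "0 \<le> 1 / e * (?H\<^sup>2 * ?V\<^sup>2)" "0 \<le> 8 / e ^ 3 * ?V\<^sup>2" using e by auto
        then show ?thesis unfolding lad_power4 by (simp add: algebra_simps)
      qed
      finally show ?thesis .
    qed
    show "AE t in L\<^sub>T T. \<forall>v\<in>\<V> \<Omega>. \<bar>g t v\<bar> \<le> e * ?k t + ?C * ((1 + H_norm \<Omega> v ^ 2) * V_norm \<Omega> v ^ 2)"
      using le by (rule AE_mp) (intro AE_I2 impI ballI, rule main)
  qed
qed

end

section \<open>The control operator\<close>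

lemma riesz_representation:
  fixes F :: "'u::{real_inner,polish_space} \<Rightarrow> real"
  assumes F: "bounded_linear F"
  shows "\<exists>!a. \<forall>b. a \<bullet> b = F b"
proof -
  interpret F: bounded_linear F by (rule F)
  define J where "J a = 1/2 * (norm a)\<^sup>2 - F a" for a
  obtain K where K: "\<And>a. norm (F a) \<le> norm a * K" using F.bounded by blast
  have lower: "J a \<ge> - (K\<^sup>2 / 2)" for a
  proof -
    have "0 \<le> (norm a - K)\<^sup>2" by simp
    moreover have "F a \<le> norm a * K" using K[of a] by simp
    ultimately show ?thesis by (simp add: J_def power2_eq_square algebra_simps)
  qed
  define m where "m = (INF a. J a)"
  have bdd: "bdd_below (range J)" by (rule bdd_belowI2) (rule lower)
  have m: "m \<le> J a" for a unfolding m_def by (rule cINF_lower[OF bdd]) simp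
  have "\<exists>a. J a < m + inverse (real (Suc n))" for n
    using cINF_less_iff[of UNIV J "m + inverse (real (Suc n))"] bdd by (auto simp: m_def)
  then obtain a where a: "\<And>n. J (a n) < m + inverse (real (Suc n))" by metis
  have par: "(norm (a i - a j))\<^sup>2 \<le> 4 * (inverse (real (Suc i)) + inverse (real (Suc j)))" for i j
  proof -
    have "J (a i) + J (a j) - 2 * J ((1/2) *\<^sub>R (a i + a j)) = 1/4 * (norm (a i - a j))\<^sup>2"
      unfolding J_def F.scaleR F.add power2_norm_eq_inner
      by (simp add: inner_add_left inner_add_right inner_diff_left inner_diff_right inner_commute[of "a j" "a i"] field_simps)
    then show ?thesis using a[of i] a[of j] m[of "(1/2) *\<^sub>R (a i + a j)"] by simp
  qed
  have "Cauchy a"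
  proof (rule metric_CauchyI)
    fix e :: real assume e: "e > 0"
    then have "e\<^sup>2 / 8 > 0" by simp
    then obtain N where N: "inverse (real (Suc N)) < e\<^sup>2 / 8" using reals_Archimedean by blast
    have le: "inverse (real (Suc i)) < e\<^sup>2 / 8" if "i \<ge> N" for i
    proof -
      have "inverse (real (Suc i)) \<le> inverse (real (Suc N))" using that by (intro le_imp_inverse_le) auto
      with N show ?thesis by linarith
    qed
    have "dist (a i) (a j) < e" if "i \<ge> N" "j \<ge> N" for i j
    proof (rule power2_less_imp_less)
      show "(dist (a i) (a j))\<^sup>2 < e\<^sup>2" 
      proof -
        have "4 * (inverse (real (Suc i)) + inverse (real (Suc j))) < 4 * (e\<^sup>2 / 8 + e\<^sup>2 / 8)"
          by (intro mult_strict_left_mono add_strict_mono le that) simp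
        then show ?thesis unfolding dist_norm using order_le_less_trans[OF par[of i j]] by simp
      qed
    qed (use e in simp)
    then show "\<exists>N. \<forall>i\<ge>N. \<forall>j\<ge>N. dist (a i) (a j) < e" by blast
  qed
  then obtain l where l: "a \<longlonglongrightarrow> l" using Cauchy_convergent convergent_def by blast
  have "(\<lambda>n. J (a n)) \<longlonglongrightarrow> J l" unfolding J_def by (intro tendsto_intros F.tendsto l)
  moreover have "(\<lambda>n. m + inverse (real (Suc n))) \<longlonglongrightarrow> m + 0" by (intro tendsto_add tendsto_const LIMSEQ_inverse_real_of_nat)
  ultimately have "J l \<le> m + 0" by (rule LIMSEQ_le) (use a in \<open>auto intro: less_imp_le\<close>)
  then have min: "J l \<le> J x" for x using m[of x] by simp
  have ex: "l \<bullet> b = F b" for b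
  proof -
    define c where "c = l \<bullet> b - F b"
    define n where "n = (norm b)\<^sup>2"
    define t where "t = c / (n + 1)"
    have n0: "n \<ge> 0" by (simp add: n_def)
    have "J (l - t *\<^sub>R b) = J l - t * c + t\<^sup>2 * n / 2"
      unfolding J_def F.diff F.scaleR power2_norm_eq_inner c_def n_def
      by (simp add: inner_diff_left inner_diff_right inner_commute[of b l] power2_eq_square algebra_simps)
    then have "t * c \<le> t\<^sup>2 * n / 2" using min[of "l - t *\<^sub>R b"] by simp
    moreover have tc: "c = t * (n + 1)" using n0 by (simp add: t_def)
    ultimately have "t\<^sup>2 * (n + 2) \<le> 0" by (simp add: power2_eq_square algebra_simps)
    then have "t = 0" using n0 by (simp add: mult_le_0_iff)
    then show ?thesis using tc by (simp add: c_def)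
  qed
  show ?thesis
  proof (rule ex1I[of _ l])
    show "\<forall>b. l \<bullet> b = F b" using ex by blast
    fix a assume "\<forall>b. a \<bullet> b = F b"
    then have "(a - l) \<bullet> (a - l) = 0" using ex by (simp add: inner_diff_left)
    then show "a = l" by simp
  qed
qed

context planar_domain
begin

lemma control_operator_bound:
  assumes D: "control_operator \<Omega> D"
  obtains K where "K \<ge> 0" "\<forall>a. \<forall>v\<in>\<V> \<Omega>. \<bar>D a v\<bar> \<le> K * norm a * V_norm \<Omega> v"
proof -
  obtain K where K: "\<And>a. V_dual_norm \<Omega> (D a) \<le> K * norm a" using D by (auto simp: control_operator_def)
  have "\<bar>D a v\<bar> \<le> \<bar>K\<bar> * norm a * V_norm \<Omega> v" if v: "v \<in> \<V> \<Omega>" for a v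
  proof -
    have "D a \<in> V_dual \<Omega>" using D by (simp add: control_operator_def)
    from V_dual_norm_bound[OF this v] have "\<bar>D a v\<bar> \<le> V_dual_norm \<Omega> (D a) * V_norm \<Omega> v" .
    also have "\<dots> \<le> (\<bar>K\<bar> * norm a) * V_norm \<Omega> v"
      by (intro mult_right_mono V_norm_nonneg order_trans[OF K]) (auto intro: mult_right_mono)
    finally show ?thesis .
  qed
  then show ?thesis using that[of "\<bar>K\<bar>"] by simp
qed

lemma control_adj_inner:
  fixes D :: "'u::{real_inner,polish_space} \<Rightarrow> functional"
  assumes D: "control_operator \<Omega> D" and v: "v \<in> \<V> \<Omega>"
  shows "control_adj D v \<bullet> b = D b v"
proof -
  obtain K where K: "K \<ge> 0" "\<forall>a. \<forall>v\<in>\<V> \<Omega>. \<bar>D a v\<bar> \<le> K * norm a * V_norm \<Omega> v" using control_operator_bound[OF D] .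
  have "bounded_linear (\<lambda>b. D b v)"
  proof (rule bounded_linear_intro)
    show "D (x + y) v = D x v + D y v" "D (r *\<^sub>R x) v = r *\<^sub>R D x v" for x y r
      using D v by (auto simp: control_operator_def)
    show "norm (D x v) \<le> norm x * (K * V_norm \<Omega> v)" for x
      using K(2) v by (simp add: mult_ac)
  qed
  from theI'[OF riesz_representation[OF this]] show ?thesis by (simp add: control_adj_def)
qed

lemma control_operator_diff:
  fixes D :: "'u::{real_inner,polish_space} \<Rightarrow> functional"
  assumes D: "control_operator \<Omega> D" and v: "v \<in> \<V> \<Omega>"
  shows "D (a - b) v = D a v - D b v"
  using control_adj_inner[OF assms, of "a - b"] control_adj_inner[OF assms, of a] control_adj_inner[OF assms, of b]
  by (simp add: inner_diff_right)

section \<open>Square integrable functions of time\<close>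

definition sqint :: "real \<Rightarrow> (real \<Rightarrow> real) \<Rightarrow> bool" where
  "sqint T f \<longleftrightarrow> f \<in> borel_measurable (L\<^sub>T T) \<and> integrable (L\<^sub>T T) (\<lambda>t. (f t)\<^sup>2)"

lemma sqint_add: "sqint T f \<Longrightarrow> sqint T g \<Longrightarrow> sqint T (\<lambda>t. f t + g t)"
  using integrable_square_add[of f "L\<^sub>T T" g] by (auto simp: sqint_def)

lemma sqint_cmult: "sqint T f \<Longrightarrow> sqint T (\<lambda>t. c * f t)"
  by (auto simp: sqint_def power_mult_distrib)

lemma sqint_bound:
  assumes "sqint T f" "g \<in> borel_measurable (L\<^sub>T T)" "AE t in L\<^sub>T T. \<bar>g t\<bar> \<le> f t"
  shows "sqint T g"
proof -
  have "integrable (L\<^sub>T T) (\<lambda>t. (g t)\<^sup>2)"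
  proof (rule integrable_bound_AE)
    show "integrable (L\<^sub>T T) (\<lambda>t. (f t)\<^sup>2)" using assms(1) by (simp add: sqint_def)
    show "(\<lambda>t. (g t)\<^sup>2) \<in> borel_measurable (L\<^sub>T T)" using assms(2) by measurable
    show "AE t in L\<^sub>T T. \<bar>(g t)\<^sup>2\<bar> \<le> (f t)\<^sup>2"
      using assms(3)
    proof eventually_elim
      case (elim t)
      have "\<bar>g t\<bar>\<^sup>2 \<le> (f t)\<^sup>2" by (rule power_mono[OF elim]) simp
      then show ?case by simp
    qed
  qed
  then show ?thesis using assms(2) by (simp add: sqint_def)
qed

lemma sqint_product: "sqint T f \<Longrightarrow> sqint T g \<Longrightarrow> integrable (L\<^sub>T T) (\<lambda>t. f t * g t)"
  by (rule integrable_mult_square) (auto simp: sqint_def)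

lemma sqint_V_norm:
  assumes "y \<in> bochner_L 2 T (\<V> \<Omega>) (V_norm \<Omega>)"
  shows "sqint T (\<lambda>t. V_norm \<Omega> (y t))"
  using V_norm_measurable[OF bochner_L_D(1,2)[OF assms]] bochner_L2_integrable[OF assms V_norm_nonneg]
  by (simp add: sqint_def)

lemma H_norm_eq_pairing: "H_norm \<Omega> u = sqrt (pairing \<Omega> u u)"
  by (simp add: pairing_self Lnorm_nonneg)

lemma sqint_H_norm:
  assumes "y \<in> cont_in_time T (\<H> \<Omega>) (H_norm \<Omega>)"
  shows "sqint T (\<lambda>t. H_norm \<Omega> (y t))"
proof -
  have c: "continuous_on {0..T} (\<lambda>t. H_norm \<Omega> (y t))"
    unfolding H_norm_eq_pairing by (intro continuous_on_real_sqrt continuous_on_pairing assms)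
  have "integrable (L\<^sub>T T) (\<lambda>t. H_norm \<Omega> (y t))" by (rule continuous_integrable_time[OF c])
  moreover have "integrable (L\<^sub>T T) (\<lambda>t. H_norm \<Omega> (y t) ^ 2)" by (intro continuous_integrable_time continuous_on_power c)
  ultimately show ?thesis by (auto simp: sqint_def)
qed

lemma
  assumes "y \<in> bochner_L 2 T (\<V> \<Omega>) (V_norm \<Omega>)" "y \<in> cont_in_time T (\<H> \<Omega>) (H_norm \<Omega>)"
  shows lad_measurable: "(\<lambda>t. lad (y t)) \<in> borel_measurable (L\<^sub>T T)"
    and sqint_lad_square: "sqint T (\<lambda>t. lad (y t) ^ 2)"
proof -
  have m [measurable]: "(\<lambda>t. V_norm \<Omega> (y t)) \<in> borel_measurable (L\<^sub>T T)" "(\<lambda>t. H_norm \<Omega> (y t)) \<in> borel_measurable (L\<^sub>T T)"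
    using sqint_V_norm[OF assms(1)] sqint_H_norm[OF assms(2)] by (auto simp: sqint_def)
  show l [measurable]: "(\<lambda>t. lad (y t)) \<in> borel_measurable (L\<^sub>T T)" unfolding lad_def by measurable
  obtain M where M: "M \<ge> 0" "\<forall>t\<in>{0..T}. H_norm \<Omega> (y t) \<le> M" using H_norm_bounded_in_time[OF assms(2)] .
  show "sqint T (\<lambda>t. lad (y t) ^ 2)"
  proof (rule sqint_bound[OF sqint_cmult[OF sqint_V_norm[OF assms(1)], of "sqrt 8 * M"]])
    show "AE t in L\<^sub>T T. \<bar>lad (y t) ^ 2\<bar> \<le> sqrt 8 * M * V_norm \<Omega> (y t)"
    proof (rule AE_I2)
      fix t assume "t \<in> space (L\<^sub>T T)"
      then have "H_norm \<Omega> (y t) * V_norm \<Omega> (y t) \<le> M * V_norm \<Omega> (y t)" using M by (intro mult_right_mono V_norm_nonneg) auto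
      then show "\<bar>lad (y t) ^ 2\<bar> \<le> sqrt 8 * M * V_norm \<Omega> (y t)"
        unfolding lad_square by (simp add: Lnorm_nonneg V_norm_nonneg mult.assoc)
    qed
  qed measurable
qed

lemma lad_sum:
  assumes y: "y \<in> bochner_L 2 T (\<V> \<Omega>) (V_norm \<Omega>)" "y \<in> cont_in_time T (\<H> \<Omega>) (H_norm \<Omega>)"
    and z: "z \<in> bochner_L 2 T (\<V> \<Omega>) (V_norm \<Omega>)" "z \<in> cont_in_time T (\<H> \<Omega>) (H_norm \<Omega>)"
  shows "sqint T (\<lambda>t. (lad (y t) + lad (z t))\<^sup>2)" and "integrable (L\<^sub>T T) (\<lambda>t. (lad (y t) + lad (z t)) ^ 4)"
    and "sqint T (\<lambda>t. lad (y t) * lad (z t))"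
proof -
  note [measurable] = lad_measurable[OF y] lad_measurable[OF z]
  show s: "sqint T (\<lambda>t. (lad (y t) + lad (z t))\<^sup>2)"
    by (rule sqint_bound[OF sqint_cmult[OF sqint_add[OF sqint_lad_square[OF y] sqint_lad_square[OF z]], of 2]])
      (use square_sum_le[of "lad (y _)" "lad (z _)"] in \<open>auto intro!: AE_I2\<close>)
  then show "integrable (L\<^sub>T T) (\<lambda>t. (lad (y t) + lad (z t)) ^ 4)" by (simp add: sqint_def)
  show "sqint T (\<lambda>t. lad (y t) * lad (z t))"
  proof (rule sqint_bound[OF s])
    show "AE t in L\<^sub>T T. \<bar>lad (y t) * lad (z t)\<bar> \<le> (lad (y t) + lad (z t))\<^sup>2"
    proof (rule AE_I2)
      fix t
      show "\<bar>lad (y t) * lad (z t)\<bar> \<le> (lad (y t) + lad (z t))\<^sup>2"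
        using lad_nonneg[of "y t"] lad_nonneg[of "z t"] by (simp add: power2_eq_square algebra_simps)
    qed
  qed measurable
qed

lemma integrable_AE_eq:
  fixes f g :: "real \<Rightarrow> real"
  assumes f: "integrable (L\<^sub>T T) f" and eq: "AE t in L\<^sub>T T. f t = g t"
  shows "integrable (L\<^sub>T T) g" "(LINT t|L\<^sub>T T. f t) = (LINT t|L\<^sub>T T. g t)"
proof -
  have m: "g \<in> borel_measurable (L\<^sub>T T)"
    using f by (intro borel_measurable_lebesgue_on_AE[OF _ time_measure(2) eq]) auto
  show "integrable (L\<^sub>T T) g" using integrable_cong_AE[OF _ m eq] f by auto
  show "(LINT t|L\<^sub>T T. f t) = (LINT t|L\<^sub>T T. g t)" by (rule integral_cong_AE[OF _ m eq]) (use f in auto)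
qed

section \<open>Differences of solutions\<close>

lemma bochner_V_diff:
  assumes y: "y \<in> bochner_L 2 T (\<V> \<Omega>) (V_norm \<Omega>)" and z: "z \<in> bochner_L 2 T (\<V> \<Omega>) (V_norm \<Omega>)"
  shows "(\<lambda>t x. y t x - z t x) \<in> bochner_L 2 T (\<V> \<Omega>) (V_norm \<Omega>)"
proof -
  have s: "strongly_measurable T (\<V> \<Omega>) (V_norm \<Omega>) (\<lambda>t x. y t x - z t x)"
    by (rule strongly_measurable_diff[OF bochner_L_D(1,2)[OF y] bochner_L_D(1,2)[OF z]])
      (auto intro: V_diff V_norm_diff_le V_norm_nonneg)
  have AE: "AE t in L\<^sub>T T. (\<lambda>x. y t x - z t x) \<in> \<V> \<Omega>"
    using bochner_L_D(2)[OF y] bochner_L_D(2)[OF z] by eventually_elim (rule V_diff)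
  have "sqint T (\<lambda>t. V_norm \<Omega> (\<lambda>x. y t x - z t x))"
  proof (rule sqint_bound[OF sqint_add[OF sqint_V_norm[OF y] sqint_V_norm[OF z]] V_norm_measurable[OF s AE]])
    show "AE t in L\<^sub>T T. \<bar>V_norm \<Omega> (\<lambda>x. y t x - z t x)\<bar> \<le> V_norm \<Omega> (y t) + V_norm \<Omega> (z t)"
      using bochner_L_D(2)[OF y] bochner_L_D(2)[OF z]
      by eventually_elim (simp add: V_norm_nonneg V_norm_diff_le)
  qed
  then show ?thesis using s AE by (simp add: bochner_L_def sqint_def V_norm_nonneg)
qed

lemma V_dual_norm_diff_le:
  assumes F: "F \<in> V_dual \<Omega>" and G: "G \<in> V_dual \<Omega>"
  shows "V_dual_norm \<Omega> (\<lambda>v. F v - G v) \<le> V_dual_norm \<Omega> F + V_dual_norm \<Omega> G"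
proof (rule V_dual_norm_le)
  fix v assume v: "v \<in> \<V> \<Omega>"
  show "\<bar>F v - G v\<bar> \<le> (V_dual_norm \<Omega> F + V_dual_norm \<Omega> G) * V_norm \<Omega> v"
    using V_dual_norm_bound[OF F v] V_dual_norm_bound[OF G v] by (simp add: distrib_right)
qed (simp add: V_dual_norm_nonneg F G)

lemma V_dual_norm_measurable:
  assumes g: "strongly_measurable T (V_dual \<Omega>) (V_dual_norm \<Omega>) g" "AE t in L\<^sub>T T. g t \<in> V_dual \<Omega>"
  shows "(\<lambda>t. V_dual_norm \<Omega> (g t)) \<in> borel_measurable (L\<^sub>T T)"
proof (rule strongly_measurable_apply2[where \<Phi> = "\<lambda>a b. V_dual_norm \<Omega> a", OF g g])
  fix F :: functional and Fn :: "nat \<Rightarrow> functional"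
  assume F: "F \<in> V_dual \<Omega>" and Fn: "\<And>n. Fn n \<in> V_dual \<Omega>" and l: "(\<lambda>n. V_dual_norm \<Omega> (\<lambda>x. Fn n x - F x)) \<longlonglongrightarrow> 0"
  have le: "V_dual_norm \<Omega> A \<le> V_dual_norm \<Omega> B + V_dual_norm \<Omega> E"
    if "B \<in> V_dual \<Omega>" "E \<in> V_dual \<Omega>" "\<And>v. \<bar>A v\<bar> \<le> \<bar>B v\<bar> + \<bar>E v\<bar>" for A B E
  proof (rule V_dual_norm_le)
    fix v assume v: "v \<in> \<V> \<Omega>"
    show "\<bar>A v\<bar> \<le> (V_dual_norm \<Omega> B + V_dual_norm \<Omega> E) * V_norm \<Omega> v"
      using V_dual_norm_bound[OF that(1) v] V_dual_norm_bound[OF that(2) v] that(3)[of v] by (simp add: distrib_right)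
  qed (simp add: V_dual_norm_nonneg that)
  have b: "\<bar>V_dual_norm \<Omega> (Fn n) - V_dual_norm \<Omega> F\<bar> \<le> V_dual_norm \<Omega> (\<lambda>x. Fn n x - F x)" for n
  proof -
    have "V_dual_norm \<Omega> (Fn n) \<le> V_dual_norm \<Omega> F + V_dual_norm \<Omega> (\<lambda>x. Fn n x - F x)"
      by (rule le[where B = F and E = "\<lambda>x. Fn n x - F x", OF F V_dual_diff[OF Fn F]]) linarith
    moreover have "V_dual_norm \<Omega> F \<le> V_dual_norm \<Omega> (Fn n) + V_dual_norm \<Omega> (\<lambda>x. Fn n x - F x)"
      by (rule le[where B = "Fn n" and E = "\<lambda>x. Fn n x - F x", OF Fn V_dual_diff[OF Fn F]]) linarith
    ultimately show ?thesis by linarith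
  qed
  show "(\<lambda>n. V_dual_norm \<Omega> (Fn n)) \<longlonglongrightarrow> V_dual_norm \<Omega> F"
    by (rule tendsto_null_bound[where a = "\<lambda>n. V_dual_norm \<Omega> (Fn n)", OF b l])
qed

lemma bochner_V_dual_diff:
  assumes g: "g \<in> bochner_L (4/3) T (V_dual \<Omega>) (V_dual_norm \<Omega>)" and k: "k \<in> bochner_L (4/3) T (V_dual \<Omega>) (V_dual_norm \<Omega>)"
  shows "(\<lambda>t v. g t v - k t v) \<in> bochner_L (4/3) T (V_dual \<Omega>) (V_dual_norm \<Omega>)"
proof -
  have s: "strongly_measurable T (V_dual \<Omega>) (V_dual_norm \<Omega>) (\<lambda>t x. g t x - k t x)"
    by (rule strongly_measurable_diff[OF bochner_L_D(1,2)[OF g] bochner_L_D(1,2)[OF k]])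
      (auto intro: V_dual_diff V_dual_norm_diff_le V_dual_norm_nonneg)
  have AE: "AE t in L\<^sub>T T. (\<lambda>x. g t x - k t x) \<in> V_dual \<Omega>"
    using bochner_L_D(2)[OF g] bochner_L_D(2)[OF k] by eventually_elim (rule V_dual_diff)
  have "integrable (L\<^sub>T T) (\<lambda>t. V_dual_norm \<Omega> (\<lambda>v. g t v - k t v) powr (4/3))"
  proof (rule integrable_bound_AE)
    show "integrable (L\<^sub>T T) (\<lambda>t. 2 powr (4/3) * (V_dual_norm \<Omega> (g t) powr (4/3) + V_dual_norm \<Omega> (k t) powr (4/3)))"
      by (intro integrable_mult_right Bochner_Integration.integrable_add bochner_L_D(3)[OF g] bochner_L_D(3)[OF k])
    show "(\<lambda>t. V_dual_norm \<Omega> (\<lambda>v. g t v - k t v) powr (4/3)) \<in> borel_measurable (L\<^sub>T T)"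
      using V_dual_norm_measurable[OF s AE] by measurable
    show "AE t in L\<^sub>T T. \<bar>V_dual_norm \<Omega> (\<lambda>v. g t v - k t v) powr (4/3)\<bar>
        \<le> 2 powr (4/3) * (V_dual_norm \<Omega> (g t) powr (4/3) + V_dual_norm \<Omega> (k t) powr (4/3))"
      using bochner_L_D(2)[OF g] bochner_L_D(2)[OF k]
    proof eventually_elim
      case (elim t)
      let ?x = "V_dual_norm \<Omega> (g t)" and ?y = "V_dual_norm \<Omega> (k t)"
      have n: "?x \<ge> 0" "?y \<ge> 0" by (intro V_dual_norm_nonneg elim)+
      have "V_dual_norm \<Omega> (\<lambda>v. g t v - k t v) powr (4/3) \<le> (2 * max ?x ?y) powr (4/3)"
        using V_dual_norm_diff_le[OF elim] V_dual_norm_nonneg[OF V_dual_diff[OF elim]] by (intro powr_mono2) auto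
      also have "\<dots> = 2 powr (4/3) * (max ?x ?y) powr (4/3)" by (rule powr_mult)
      also have "\<dots> \<le> 2 powr (4/3) * (?x powr (4/3) + ?y powr (4/3))"
        by (intro mult_left_mono) (auto simp: max_def)
      finally show ?case by simp
    qed
  qed
  with s AE show ?thesis by (simp add: bochner_L_def)
qed

lemma time_deriv_diff:
  assumes y: "y \<in> cont_in_time T (\<H> \<Omega>) (H_norm \<Omega>)" "is_time_deriv \<Omega> T y g" "g \<in> bochner_L (4/3) T (V_dual \<Omega>) (V_dual_norm \<Omega>)"
    and z: "z \<in> cont_in_time T (\<H> \<Omega>) (H_norm \<Omega>)" "is_time_deriv \<Omega> T z k" "k \<in> bochner_L (4/3) T (V_dual \<Omega>) (V_dual_norm \<Omega>)"
  shows "is_time_deriv \<Omega> T (\<lambda>t x. y t x - z t x) (\<lambda>t v. g t v - k t v)"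
  unfolding is_time_deriv_def
proof (intro ballI)
  fix \<psi> :: "real \<Rightarrow> real" and v assume \<psi>: "\<psi> \<in> test_funs {0<..<T}" and v: "v \<in> \<V> \<Omega>"
  have sm: "smooth \<psi>" using \<psi> by (rule test_funs_smooth)
  have "deriv \<psi> t = frechet_derivative \<psi> (at t) 1" for t
  proof -
    have D: "(\<psi> has_derivative frechet_derivative \<psi> (at t)) (at t)" by (rule smooth_has_derivative[OF sm])
    define c where "c = frechet_derivative \<psi> (at t) 1"
    have "frechet_derivative \<psi> (at t) v = c * v" for v
      using linear_cmul[OF has_derivative_linear[OF D], of v 1] by (simp add: c_def)
    then have "frechet_derivative \<psi> (at t) = (\<lambda>v. c * v)" by (rule ext)
    then have "(\<psi> has_field_derivative c) (at t)"
      using D unfolding has_field_derivative_def by simp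
    then show ?thesis unfolding c_def by (rule DERIV_imp_deriv)
  qed
  then have cd: "continuous_on {0..T} (deriv \<psi>)"
    using smooth_continuous[OF smooth_frechet_derivative[OF sm, of 1], of "{0..T}"] by presburger
  have i1: "integrable (L\<^sub>T T) (\<lambda>t. pairing \<Omega> (a t) v * deriv \<psi> t)" if "a \<in> cont_in_time T (\<H> \<Omega>) (H_norm \<Omega>)" for a
    by (intro continuous_integrable_time continuous_on_mult cd continuous_on_pairing[OF that cont_in_time_const[OF V_H[OF v]]])
  have i2: "integrable (L\<^sub>T T) (\<lambda>t. a t v * \<psi> t)" if a: "a \<in> bochner_L (4/3) T (V_dual \<Omega>) (V_dual_norm \<Omega>)" for a
  proof -
    have "bounded (\<psi> ` {0..T})" by (intro compact_imp_bounded compact_continuous_image smooth_continuous sm compact_Icc)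
    then obtain B where B: "\<forall>t\<in>{0..T}. \<bar>\<psi> t\<bar> \<le> B" by (auto simp: bounded_iff)
    have i: "integrable (L\<^sub>T T) (\<lambda>t. a t v)" by (rule dual_apply_integrable[OF a v])
    show ?thesis
    proof (rule integrable_bound_AE)
      show "integrable (L\<^sub>T T) (\<lambda>t. \<bar>a t v\<bar> * B)" using i by auto
      have "\<psi> \<in> borel_measurable (L\<^sub>T T)"
        using continuous_integrable_time[OF smooth_continuous[OF sm]] by (rule borel_measurable_integrable)
      then show "(\<lambda>t. a t v * \<psi> t) \<in> borel_measurable (L\<^sub>T T)"
        using borel_measurable_integrable[OF i] by (rule borel_measurable_times[rotated])
      show "AE t in L\<^sub>T T. \<bar>a t v * \<psi> t\<bar> \<le> \<bar>a t v\<bar> * B"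
        by (rule AE_I2) (use B in \<open>simp add: abs_mult mult_left_mono\<close>)
    qed
  qed
  have "(LINT t|L\<^sub>T T. pairing \<Omega> (\<lambda>x. y t x - z t x) v * deriv \<psi> t)
      = (LINT t|L\<^sub>T T. pairing \<Omega> (y t) v * deriv \<psi> t - pairing \<Omega> (z t) v * deriv \<psi> t)"
  proof (rule Bochner_Integration.integral_cong)
    fix t assume "t \<in> space (L\<^sub>T T)"
    then have t: "t \<in> {0..T}" by simp
    show "pairing \<Omega> (\<lambda>x. y t x - z t x) v * deriv \<psi> t = pairing \<Omega> (y t) v * deriv \<psi> t - pairing \<Omega> (z t) v * deriv \<psi> t"
      unfolding pairing_diff_left[OF cont_in_time_Lspace[OF y(1) t] cont_in_time_Lspace[OF z(1) t] V_Lspace[OF v]]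
      by (rule left_diff_distrib)
  qed simp
  also have "\<dots> = (LINT t|L\<^sub>T T. pairing \<Omega> (y t) v * deriv \<psi> t) - (LINT t|L\<^sub>T T. pairing \<Omega> (z t) v * deriv \<psi> t)"
    by (rule Bochner_Integration.integral_diff[OF i1[OF y(1)] i1[OF z(1)]])
  also have "\<dots> = - (LINT t|L\<^sub>T T. g t v * \<psi> t) - - (LINT t|L\<^sub>T T. k t v * \<psi> t)"
    using y(2) z(2) \<psi> v by (simp add: is_time_deriv_def)
  also have "\<dots> = - (LINT t|L\<^sub>T T. g t v * \<psi> t - k t v * \<psi> t)"
    by (simp add: Bochner_Integration.integral_diff[OF i2[OF y(3)] i2[OF z(3)]])
  also have "\<dots> = - (LINT t|L\<^sub>T T. (g t v - k t v) * \<psi> t)" by (simp add: left_diff_distrib)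
  finally show "(LINT t|L\<^sub>T T. pairing \<Omega> (\<lambda>x. y t x - z t x) v * deriv \<psi> t) = - (LINT t|L\<^sub>T T. (g t v - k t v) * \<psi> t)" .
qed

lemma H_norm_diff_measurable:
  assumes u: "strongly_measurable T (\<H> \<Omega>) (H_norm \<Omega>) u" "AE t in L\<^sub>T T. u t \<in> \<H> \<Omega>"
    and v: "strongly_measurable T (\<H> \<Omega>) (H_norm \<Omega>) v" "AE t in L\<^sub>T T. v t \<in> \<H> \<Omega>"
  shows "(\<lambda>t. H_norm \<Omega> (\<lambda>x. u t x - v t x)) \<in> borel_measurable (L\<^sub>T T)"
proof (rule strongly_measurable_apply2[where \<Phi> = "\<lambda>a b. H_norm \<Omega> (\<lambda>x. a x - b x)", OF u v])
  fix a b :: field and an bn :: "nat \<Rightarrow> field"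
  assume H: "a \<in> \<H> \<Omega>" "b \<in> \<H> \<Omega>" "\<And>n. an n \<in> \<H> \<Omega>" "\<And>n. bn n \<in> \<H> \<Omega>"
    and l: "(\<lambda>n. H_norm \<Omega> (\<lambda>x. an n x - a x)) \<longlonglongrightarrow> 0" "(\<lambda>n. H_norm \<Omega> (\<lambda>x. bn n x - b x)) \<longlonglongrightarrow> 0"
  note L = H_Lspace[OF H(1)] H_Lspace[OF H(2)] H_Lspace[OF H(3)] H_Lspace[OF H(4)]
  have bound: "\<bar>H_norm \<Omega> (\<lambda>x. an n x - bn n x) - H_norm \<Omega> (\<lambda>x. a x - b x)\<bar>
      \<le> H_norm \<Omega> (\<lambda>x. an n x - a x) + H_norm \<Omega> (\<lambda>x. bn n x - b x)" for n
  proof -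
    have 1: "H_norm \<Omega> (\<lambda>x. an n x - bn n x) \<le> H_norm \<Omega> (\<lambda>x. an n x - a x) + (H_norm \<Omega> (\<lambda>x. a x - b x) + H_norm \<Omega> (\<lambda>x. b x - bn n x))"
      using Lnorm2_diff_triangle[OF L(3)[of n] L(1) L(4)[of n]] Lnorm2_diff_triangle[OF L(1,2) L(4)[of n]] by linarith
    have 2: "H_norm \<Omega> (\<lambda>x. a x - b x) \<le> H_norm \<Omega> (\<lambda>x. a x - an n x) + (H_norm \<Omega> (\<lambda>x. an n x - bn n x) + H_norm \<Omega> (\<lambda>x. bn n x - b x))"
      using Lnorm2_diff_triangle[OF L(1) L(3)[of n] L(2)] Lnorm2_diff_triangle[OF L(3)[of n] L(4)[of n] L(2)] by linarith
    show ?thesis using 1 2 Lnorm2_minus_commute[of \<Omega> "an n" a] Lnorm2_minus_commute[of \<Omega> "bn n" b] by linarith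
  qed
  have "(\<lambda>n. H_norm \<Omega> (\<lambda>x. an n x - a x) + H_norm \<Omega> (\<lambda>x. bn n x - b x)) \<longlonglongrightarrow> 0"
    using tendsto_add[OF l] by simp
  then show "(\<lambda>n. H_norm \<Omega> (\<lambda>x. an n x - bn n x)) \<longlonglongrightarrow> H_norm \<Omega> (\<lambda>x. a x - b x)"
    by (rule tendsto_null_bound[rotated]) (rule bound)
qed

lemma sqint_H_norm_diff:
  assumes y: "y \<in> bochner_Linf T (\<H> \<Omega>) (H_norm \<Omega>)" "y \<in> cont_in_time T (\<H> \<Omega>) (H_norm \<Omega>)"
    and v: "v \<in> bochner_L 2 T (\<H> \<Omega>) (H_norm \<Omega>)"
  shows "sqint T (\<lambda>t. H_norm \<Omega> (\<lambda>x. y t x - v t x))"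
proof -
  have ys: "strongly_measurable T (\<H> \<Omega>) (H_norm \<Omega>) y" "AE t in L\<^sub>T T. y t \<in> \<H> \<Omega>"
    using y(1) by (auto simp: bochner_Linf_def)
  note vs = bochner_L_D(1,2)[OF v]
  have m: "(\<lambda>t. H_norm \<Omega> (\<lambda>x. y t x - v t x)) \<in> borel_measurable (L\<^sub>T T)" by (rule H_norm_diff_measurable[OF ys vs])
  have "integrable (L\<^sub>T T) (\<lambda>t. H_norm \<Omega> (\<lambda>x. y t x - v t x) ^ 2)"
  proof (rule integrable_bound_AE)
    show "integrable (L\<^sub>T T) (\<lambda>t. 2 * (H_norm \<Omega> (y t) ^ 2 + H_norm \<Omega> (v t) ^ 2))"
      using sqint_H_norm[OF y(2)] bochner_L2_integrable[OF v Lnorm_nonneg] by (auto simp: sqint_def)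
    show "(\<lambda>t. H_norm \<Omega> (\<lambda>x. y t x - v t x) ^ 2) \<in> borel_measurable (L\<^sub>T T)" using m by measurable
    show "AE t in L\<^sub>T T. \<bar>H_norm \<Omega> (\<lambda>x. y t x - v t x) ^ 2\<bar> \<le> 2 * (H_norm \<Omega> (y t) ^ 2 + H_norm \<Omega> (v t) ^ 2)"
      using ys(2) vs(2)
    proof eventually_elim
      case (elim t)
      have "H_norm \<Omega> (\<lambda>x. y t x - v t x) \<le> H_norm \<Omega> (y t) + H_norm \<Omega> (v t)"
        using Lnorm2_triangle[OF H_Lspace[OF elim(1)] Lspace_scale[OF H_Lspace[OF elim(2)], of "-1"]] Lnorm_scale[of \<Omega> "-1" "v t"] by simp
      then have "H_norm \<Omega> (\<lambda>x. y t x - v t x) ^ 2 \<le> (H_norm \<Omega> (y t) + H_norm \<Omega> (v t)) ^ 2"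
        by (intro power_mono Lnorm_nonneg)
      also have "\<dots> \<le> 2 * (H_norm \<Omega> (y t) ^ 2 + H_norm \<Omega> (v t) ^ 2)" by (rule square_sum_le)
      finally show ?case by simp
    qed
  qed
  with m show ?thesis by (simp add: sqint_def)
qed


lemma controls_sqint: "U \<in> controls_L2 T \<Longrightarrow> sqint T (\<lambda>t. norm (U t))"
  by (auto simp: controls_L2_def sqint_def)

lemma state_difference_dual_bound:
  fixes D :: "'u::{real_inner,polish_space} \<Rightarrow> functional"
  assumes D: "control_operator \<Omega> D" and pos: "\<mu> > 0" "\<alpha> > 0" "\<beta> > 0"
    and u: "u \<in> bochner_L 2 T (\<V> \<Omega>) (V_norm \<Omega>)" "u \<in> cont_in_time T (\<H> \<Omega>) (H_norm \<Omega>)"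
    and z: "z \<in> bochner_L 2 T (\<V> \<Omega>) (V_norm \<Omega>)" "z \<in> cont_in_time T (\<H> \<Omega>) (H_norm \<Omega>)"
    and U: "U \<in> controls_L2 T" and W: "W \<in> controls_L2 T"
    and eqs: "AE t in L\<^sub>T T. \<forall>v\<in>\<V> \<Omega>.
           gu t v + \<mu> * A_op \<Omega> (u t) v + B_op \<Omega> (u t) (u t) v
             + \<alpha> * pairing \<Omega> (u t) v + \<beta> * pairing \<Omega> (C_op \<Omega> (u t)) v = f t v + D (U t) v"
      "AE t in L\<^sub>T T. \<forall>v\<in>\<V> \<Omega>.
           gz t v + \<mu> * A_op \<Omega> (z t) v + B_op \<Omega> (z t) (z t) v
             + \<alpha> * pairing \<Omega> (z t) v + \<beta> * pairing \<Omega> (C_op \<Omega> (z t)) v = f t v + D (W t) v"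
  shows "dual_bound T (\<lambda>t v. gz t v - gu t v)"
proof -
  obtain K where K: "K \<ge> 0" "\<forall>a. \<forall>v\<in>\<V> \<Omega>. \<bar>D a v\<bar> \<le> K * norm a * V_norm \<Omega> v" using control_operator_bound[OF D] .
  define a where "a t = K * (norm (W t) + norm (U t)) + \<mu> * (V_norm \<Omega> (z t) + V_norm \<Omega> (u t))
     + (\<alpha> * sqrt area) * (H_norm \<Omega> (z t) + H_norm \<Omega> (u t))" for t
  define b where "b t = lad (z t) + lad (u t)" for t
  define c where "c t = (V_norm \<Omega> (z t) + V_norm \<Omega> (u t)) + \<beta> * (b t)\<^sup>2" for t
  have "sqint T a" unfolding a_def
    by (intro sqint_add sqint_cmult controls_sqint sqint_V_norm sqint_H_norm u z U W)
  moreover have "sqint T c" unfolding c_def b_def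
    by (intro sqint_add sqint_cmult sqint_V_norm lad_sum u z)
  moreover have "integrable (L\<^sub>T T) (\<lambda>t. b t ^ 4)" unfolding b_def by (rule lad_sum[OF z u])
  moreover have "AE t in L\<^sub>T T. \<forall>v\<in>\<V> \<Omega>. \<bar>gz t v - gu t v\<bar> \<le> a t * V_norm \<Omega> v + c t * (b t * lad v)"
    using eqs bochner_L_D(2)[OF u(1)] bochner_L_D(2)[OF z(1)]
  proof eventually_elim
    case (elim t)
    show ?case
    proof
      fix v assume v: "v \<in> \<V> \<Omega>"
      note V = elim(3,4) v
      let ?lz = "lad (z t)" and ?lu = "lad (u t)" and ?lv = "lad v" and ?Vz = "V_norm \<Omega> (z t)" and ?Vu = "V_norm \<Omega> (u t)" and ?Vv = "V_norm \<Omega> v"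
      have nn: "0 \<le> ?lz" "0 \<le> ?lu" "0 \<le> ?lv" "0 \<le> ?Vz" "0 \<le> ?Vu" "0 \<le> ?Vv" by (simp_all add: lad_nonneg V_norm_nonneg)
      have 1: "\<bar>D (W t) v - D (U t) v\<bar> \<le> K * (norm (W t) + norm (U t)) * ?Vv"
        using K(2)[rule_format, of v "W t"] K(2)[rule_format, of v "U t"] v by (simp add: algebra_simps)
      have 2: "\<bar>\<mu> * (A_op \<Omega> (z t) v - A_op \<Omega> (u t) v)\<bar> \<le> \<mu> * (?Vz + ?Vu) * ?Vv"
      proof -
        have "\<bar>A_op \<Omega> (z t) v - A_op \<Omega> (u t) v\<bar> \<le> (?Vz + ?Vu) * ?Vv"
          using A_op_bound[OF V(2,3)] A_op_bound[OF V(1,3)] by (simp add: distrib_right)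
        then show ?thesis using pos by (simp add: abs_mult mult.assoc)
      qed
      have 3: "\<bar>B_op \<Omega> (z t) (z t) v - B_op \<Omega> (u t) (u t) v\<bar> \<le> (?Vz + ?Vu) * (b t * ?lv)"
      proof -
        have "\<bar>B_op \<Omega> (z t) (z t) v\<bar> \<le> ?Vz * (b t * ?lv)"
          using B_op_bound[OF V(2,2,3)] by (rule order_trans) (intro mult_left_mono mult_right_mono, auto simp: b_def nn)
        moreover have "\<bar>B_op \<Omega> (u t) (u t) v\<bar> \<le> ?Vu * (b t * ?lv)"
          using B_op_bound[OF V(1,1,3)] by (rule order_trans) (intro mult_left_mono mult_right_mono, auto simp: b_def nn)
        ultimately show ?thesis by (simp add: distrib_right)
      qed
      have 4: "\<bar>\<alpha> * (pairing \<Omega> (z t) v - pairing \<Omega> (u t) v)\<bar> \<le> (\<alpha> * sqrt area) * (H_norm \<Omega> (z t) + H_norm \<Omega> (u t)) * ?Vv"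
      proof -
        have "\<bar>pairing \<Omega> y v\<bar> \<le> H_norm \<Omega> y * (sqrt area * ?Vv)" if "y \<in> \<V> \<Omega>" for y
          using pairing_Cauchy_Schwarz[OF V_Lspace[OF that] V_Lspace[OF v]] mult_left_mono[OF poincare[OF v] Lnorm_nonneg[of \<Omega> 2 y]] by linarith
        from this[OF V(2)] this[OF V(1)]
        have "\<bar>pairing \<Omega> (z t) v - pairing \<Omega> (u t) v\<bar> \<le> (H_norm \<Omega> (z t) + H_norm \<Omega> (u t)) * (sqrt area * ?Vv)"
          by (simp add: distrib_right)
        then have "\<alpha> * \<bar>pairing \<Omega> (z t) v - pairing \<Omega> (u t) v\<bar> \<le> \<alpha> * ((H_norm \<Omega> (z t) + H_norm \<Omega> (u t)) * (sqrt area * ?Vv))"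
          using pos by (intro mult_left_mono) auto
        then show ?thesis using pos by (simp add: abs_mult mult_ac)
      qed
      have 5: "\<bar>\<beta> * (pairing \<Omega> (C_op \<Omega> (z t)) v - pairing \<Omega> (C_op \<Omega> (u t)) v)\<bar> \<le> \<beta> * (b t)\<^sup>2 * (b t * ?lv)"
      proof -
        have "\<bar>pairing \<Omega> (C_op \<Omega> (z t)) v - pairing \<Omega> (C_op \<Omega> (u t)) v\<bar> \<le> ?lz * ?lz * (?lz * ?lv) + ?lu * ?lu * (?lu * ?lv)"
          unfolding pairing_C_op[OF V(2,3)] pairing_C_op[OF V(1,3)]
          using cub_bound[OF V(2,2,2,3)] cub_bound[OF V(1,1,1,3)] by linarith
        also have "\<dots> \<le> (b t)\<^sup>2 * (?lz * ?lv) + (b t)\<^sup>2 * (?lu * ?lv)"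
          by (intro add_mono mult_right_mono) (auto simp: b_def power2_eq_square nn intro!: mult_mono)
        also have "\<dots> = (b t)\<^sup>2 * (b t * ?lv)" by (simp add: b_def algebra_simps)
        finally show ?thesis using pos by (simp add: abs_mult mult.assoc)
      qed
      have "gz t v - gu t v = (D (W t) v - D (U t) v) - \<mu> * (A_op \<Omega> (z t) v - A_op \<Omega> (u t) v)
          - (B_op \<Omega> (z t) (z t) v - B_op \<Omega> (u t) (u t) v) - \<alpha> * (pairing \<Omega> (z t) v - pairing \<Omega> (u t) v)
          - \<beta> * (pairing \<Omega> (C_op \<Omega> (z t)) v - pairing \<Omega> (C_op \<Omega> (u t)) v)"
        using elim(1)[rule_format, OF v] elim(2)[rule_format, OF v] by (simp add: algebra_simps)
      then have "\<bar>gz t v - gu t v\<bar> \<le> K * (norm (W t) + norm (U t)) * ?Vv + \<mu> * (?Vz + ?Vu) * ?Vv + (?Vz + ?Vu) * (b t * ?lv)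
          + (\<alpha> * sqrt area) * (H_norm \<Omega> (z t) + H_norm \<Omega> (u t)) * ?Vv + \<beta> * (b t)\<^sup>2 * (b t * ?lv)"
        using 1 2 3 4 5 by linarith
      also have "\<dots> = a t * ?Vv + c t * (b t * ?lv)" by (simp add: a_def c_def distrib_right)
      finally show "\<bar>gz t v - gu t v\<bar> \<le> a t * ?Vv + c t * (b t * ?lv)" .
    qed
  qed
  ultimately show ?thesis by (intro dual_boundI) (auto simp: sqint_def)
qed

lemma adjoint_dual_bound:
  assumes pos: "\<mu> > 0" "\<alpha> > 0" "\<beta> > 0"
    and u: "u \<in> bochner_L 2 T (\<V> \<Omega>) (V_norm \<Omega>)" "u \<in> cont_in_time T (\<H> \<Omega>) (H_norm \<Omega>)"
    and p: "p \<in> bochner_L 2 T (\<V> \<Omega>) (V_norm \<Omega>)" "p \<in> cont_in_time T (\<H> \<Omega>) (H_norm \<Omega>)"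
    and ud: "sqint T (\<lambda>t. H_norm \<Omega> (\<lambda>x. u t x - ud t x))" "AE t in L\<^sub>T T. ud t \<in> \<H> \<Omega>"
    and eq: "AE t in L\<^sub>T T. \<forall>q\<in>\<V> \<Omega>.
           - g t q + \<mu> * A_op \<Omega> (p t) q + B'_adj \<Omega> (u t) (p t) q
             + \<alpha> * pairing \<Omega> (p t) q + \<beta> * pairing \<Omega> (C'_op \<Omega> (u t) (p t)) q
           = pairing \<Omega> (\<lambda>x. u t x - ud t x) q + A_op \<Omega> (u t) q"
  shows "dual_bound T g"
proof -
  define a where "a t = \<mu> * V_norm \<Omega> (p t) + lad (u t) * lad (p t) + (\<alpha> * sqrt area) * H_norm \<Omega> (p t)
     + sqrt area * H_norm \<Omega> (\<lambda>x. u t x - ud t x) + V_norm \<Omega> (u t)" for t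
  define b where "b t = lad (u t) + lad (p t)" for t
  define c where "c t = V_norm \<Omega> (u t) + (3 * \<beta>) * (b t)\<^sup>2" for t
  have "sqint T a" unfolding a_def
    by (intro sqint_add sqint_cmult sqint_V_norm sqint_H_norm lad_sum u p ud)
  moreover have "sqint T c" unfolding c_def b_def
    by (intro sqint_add sqint_cmult sqint_V_norm lad_sum u p)
  moreover have "integrable (L\<^sub>T T) (\<lambda>t. b t ^ 4)" unfolding b_def by (rule lad_sum[OF u p])
  moreover have "AE t in L\<^sub>T T. \<forall>v\<in>\<V> \<Omega>. \<bar>g t v\<bar> \<le> a t * V_norm \<Omega> v + c t * (b t * lad v)"
    using eq bochner_L_D(2)[OF u(1)] bochner_L_D(2)[OF p(1)] ud(2)
  proof eventually_elim
    case (elim t)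
    show ?case
    proof
      fix v assume v: "v \<in> \<V> \<Omega>"
      note V = elim(2,3) v
      let ?lp = "lad (p t)" and ?lu = "lad (u t)" and ?lv = "lad v" and ?Vp = "V_norm \<Omega> (p t)" and ?Vu = "V_norm \<Omega> (u t)" and ?Vv = "V_norm \<Omega> v"
      have nn: "0 \<le> ?lp" "0 \<le> ?lu" "0 \<le> ?lv" "0 \<le> ?Vp" "0 \<le> ?Vu" "0 \<le> ?Vv" by (simp_all add: lad_nonneg V_norm_nonneg)
      have pair: "\<bar>pairing \<Omega> y v\<bar> \<le> H_norm \<Omega> y * (sqrt area * ?Vv)" if "y \<in> Lspace \<Omega> 2" for y
        using pairing_Cauchy_Schwarz[OF that V_Lspace[OF v]] mult_left_mono[OF poincare[OF v] Lnorm_nonneg[of \<Omega> 2 y]] by linarith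
      have 1: "\<bar>\<mu> * A_op \<Omega> (p t) v\<bar> \<le> \<mu> * ?Vp * ?Vv" using A_op_bound[OF V(2,3)] pos by (simp add: abs_mult mult.assoc)
      have 2: "\<bar>B_op \<Omega> (u t) v (p t)\<bar> \<le> ?lu * ?lp * ?Vv" using B_op_bound[OF V(1,3,2)] by (simp add: mult_ac)
      have 3: "\<bar>B_op \<Omega> v (u t) (p t)\<bar> \<le> ?Vu * (b t * ?lv)"
        using B_op_bound[OF V(3,1,2)]
      proof (rule order_trans)
        have "?lv * ?lp \<le> b t * ?lv" using nn by (simp add: b_def algebra_simps)
        then show "?Vu * (?lv * ?lp) \<le> ?Vu * (b t * ?lv)" using nn by (intro mult_left_mono) auto
      qed
      have 4: "\<bar>\<alpha> * pairing \<Omega> (p t) v\<bar> \<le> (\<alpha> * sqrt area) * H_norm \<Omega> (p t) * ?Vv"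
      proof -
        have "\<alpha> * \<bar>pairing \<Omega> (p t) v\<bar> \<le> \<alpha> * (H_norm \<Omega> (p t) * (sqrt area * ?Vv))"
          using pos pair[OF V_Lspace[OF V(2)]] by (intro mult_left_mono) auto
        then show ?thesis using pos by (simp add: abs_mult mult_ac)
      qed
      have 5: "\<bar>\<beta> * pairing \<Omega> (C'_op \<Omega> (u t) (p t)) v\<bar> \<le> (3 * \<beta>) * (b t)\<^sup>2 * (b t * ?lv)"
      proof -
        have "\<bar>pairing \<Omega> (C'_op \<Omega> (u t) (p t)) v\<bar> \<le> ?lu * ?lu * (?lp * ?lv) + 2 * (?lu * ?lp * (?lu * ?lv))"
          unfolding pairing_C'_op[OF V]
          using cub_bound[OF V(1,1,2,3)] cub_bound[OF V(1,2,1,3)] by linarith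
        also have "\<dots> \<le> (b t)\<^sup>2 * (b t * ?lv) + 2 * ((b t)\<^sup>2 * (b t * ?lv))"
        proof (intro add_mono mult_left_mono)
          have b: "?lu \<le> b t" "?lp \<le> b t" "0 \<le> b t" using nn by (auto simp: b_def)
          show "?lu * ?lu * (?lp * ?lv) \<le> (b t)\<^sup>2 * (b t * ?lv)" "?lu * ?lp * (?lu * ?lv) \<le> (b t)\<^sup>2 * (b t * ?lv)"
            unfolding power2_eq_square using b nn by (auto intro!: mult_mono)
        qed simp
        also have "\<dots> = 3 * ((b t)\<^sup>2 * (b t * ?lv))" by simp
        finally have "\<beta> * \<bar>pairing \<Omega> (C'_op \<Omega> (u t) (p t)) v\<bar> \<le> \<beta> * (3 * ((b t)\<^sup>2 * (b t * ?lv)))"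
          using pos by (intro mult_left_mono) auto
        then show ?thesis using pos by (simp add: abs_mult mult_ac)
      qed
      have 6: "\<bar>pairing \<Omega> (\<lambda>x. u t x - ud t x) v\<bar> \<le> sqrt area * H_norm \<Omega> (\<lambda>x. u t x - ud t x) * ?Vv"
        using pair[OF Lspace2_diff[OF V_Lspace[OF V(1)] H_Lspace[OF elim(4)]]] by (simp add: mult_ac)
      have 7: "\<bar>A_op \<Omega> (u t) v\<bar> \<le> ?Vu * ?Vv" by (rule A_op_bound[OF V(1,3)])
      have "g t v = \<mu> * A_op \<Omega> (p t) v + B_op \<Omega> (u t) v (p t) + B_op \<Omega> v (u t) (p t) + \<alpha> * pairing \<Omega> (p t) v
          + \<beta> * pairing \<Omega> (C'_op \<Omega> (u t) (p t)) v - pairing \<Omega> (\<lambda>x. u t x - ud t x) v - A_op \<Omega> (u t) v"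
        using elim(1)[rule_format, OF v] by (simp add: B'_adj_def)
      then have "\<bar>g t v\<bar> \<le> \<mu> * ?Vp * ?Vv + ?lu * ?lp * ?Vv + ?Vu * (b t * ?lv) + (\<alpha> * sqrt area) * H_norm \<Omega> (p t) * ?Vv
          + (3 * \<beta>) * (b t)\<^sup>2 * (b t * ?lv) + sqrt area * H_norm \<Omega> (\<lambda>x. u t x - ud t x) * ?Vv + ?Vu * ?Vv"
        using 1 2 3 4 5 6 7 by linarith
      also have "\<dots> = a t * ?Vv + c t * (b t * ?lv)" by (simp add: a_def c_def distrib_right)
      finally show "\<bar>g t v\<bar> \<le> a t * ?Vv + c t * (b t * ?lv)" .
    qed
  qed
  ultimately show ?thesis by (intro dual_boundI) (auto simp: sqint_def)
qed

lemma B_op_continuous: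
  assumes a: "a \<in> \<V> \<Omega>" and b: "b \<in> \<V> \<Omega>" and an: "\<And>n::nat. an n \<in> \<V> \<Omega>" and bn: "\<And>n. bn n \<in> \<V> \<Omega>"
    and la: "(\<lambda>n. V_norm \<Omega> (\<lambda>x. an n x - a x)) \<longlonglongrightarrow> 0" and lb: "(\<lambda>n. V_norm \<Omega> (\<lambda>x. bn n x - b x)) \<longlonglongrightarrow> 0"
  shows "(\<lambda>n. B_op \<Omega> (an n) (an n) (bn n)) \<longlonglongrightarrow> B_op \<Omega> a a b"
proof -
  define S where "S = sqrt (sqrt 8 * sqrt area)"
  have S: "S \<ge> 0" by (simp add: S_def area_nonneg)
  have bound: "\<bar>B_op \<Omega> u v w\<bar> \<le> S\<^sup>2 * (V_norm \<Omega> u * V_norm \<Omega> v * V_norm \<Omega> w)"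
    if "u \<in> \<V> \<Omega>" "v \<in> \<V> \<Omega>" "w \<in> \<V> \<Omega>" for u v w
  proof -
    have "\<bar>B_op \<Omega> u v w\<bar> \<le> V_norm \<Omega> v * (lad u * lad w)" by (rule B_op_bound[OF that])
    also have "\<dots> \<le> V_norm \<Omega> v * ((S * V_norm \<Omega> u) * (S * V_norm \<Omega> w))"
      using lad_le_V_norm[OF that(1)] lad_le_V_norm[OF that(3)] S unfolding S_def[symmetric]
      by (intro mult_left_mono mult_mono) (auto simp: V_norm_nonneg lad_nonneg)
    finally show ?thesis by (simp add: power2_eq_square mult_ac)
  qed
  let ?A = "\<lambda>n. V_norm \<Omega> (\<lambda>x. an n x - a x)" and ?B = "\<lambda>n. V_norm \<Omega> (\<lambda>x. bn n x - b x)"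
  have an_le: "V_norm \<Omega> (an n) \<le> ?A n + V_norm \<Omega> a" and bn_le: "V_norm \<Omega> (bn n) \<le> ?B n + V_norm \<Omega> b" for n
    using V_norm_add[OF H1_diff[OF V_H1[OF an] V_H1[OF a]] V_H1[OF a], of n]
      V_norm_add[OF H1_diff[OF V_H1[OF bn] V_H1[OF b]] V_H1[OF b], of n] by simp_all
  let ?E = "\<lambda>n. S\<^sup>2 * (?A n * (?A n + V_norm \<Omega> a) * (?B n + V_norm \<Omega> b))
      + S\<^sup>2 * (V_norm \<Omega> a * ?A n * (?B n + V_norm \<Omega> b)) + S\<^sup>2 * (V_norm \<Omega> a * V_norm \<Omega> a * ?B n)"
  have le: "\<bar>B_op \<Omega> (an n) (an n) (bn n) - B_op \<Omega> a a b\<bar> \<le> ?E n" for n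
  proof -
    let ?a = "\<lambda>x. an n x - a x" and ?b = "\<lambda>x. bn n x - b x"
    have V: "?a \<in> \<V> \<Omega>" "?b \<in> \<V> \<Omega>" by (intro V_diff an a bn b)+
    have "B_op \<Omega> (an n) (an n) (bn n) - B_op \<Omega> a a b = B_op \<Omega> ?a (an n) (bn n) + B_op \<Omega> a ?a (bn n) + B_op \<Omega> a a ?b"
      using a b an bn by (simp add: B_op_diff1 B_op_diff2 B_op_diff3)
    moreover have "\<bar>B_op \<Omega> ?a (an n) (bn n)\<bar> \<le> S\<^sup>2 * (?A n * (?A n + V_norm \<Omega> a) * (?B n + V_norm \<Omega> b))"
      using bound[OF V(1) an bn, of n n]
      by (rule order_trans) (intro mult_left_mono mult_mono an_le bn_le order_refl mult_nonneg_nonneg add_nonneg_nonneg V_norm_nonneg zero_le_power2)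
    moreover have "\<bar>B_op \<Omega> a ?a (bn n)\<bar> \<le> S\<^sup>2 * (V_norm \<Omega> a * ?A n * (?B n + V_norm \<Omega> b))"
      using bound[OF a V(1) bn, of n]
      by (rule order_trans) (intro mult_left_mono bn_le mult_nonneg_nonneg V_norm_nonneg zero_le_power2)
    moreover have "\<bar>B_op \<Omega> a a ?b\<bar> \<le> S\<^sup>2 * (V_norm \<Omega> a * V_norm \<Omega> a * ?B n)" by (rule bound[OF a a V(2)])
    ultimately show ?thesis by linarith
  qed
  have "?E \<longlonglongrightarrow> S\<^sup>2 * (0 * (0 + V_norm \<Omega> a) * (0 + V_norm \<Omega> b))
      + S\<^sup>2 * (V_norm \<Omega> a * 0 * (0 + V_norm \<Omega> b)) + S\<^sup>2 * (V_norm \<Omega> a * V_norm \<Omega> a * 0)"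
    by (intro tendsto_intros la lb)
  then have lim: "?E \<longlonglongrightarrow> 0" by (simp only: mult_zero_left mult_zero_right add_0_left)
  show ?thesis by (rule tendsto_null_bound[OF le lim])
qed

lemma B_op_time_integrable:
  assumes w: "w \<in> bochner_L 2 T (\<V> \<Omega>) (V_norm \<Omega>)" "w \<in> cont_in_time T (\<H> \<Omega>) (H_norm \<Omega>)"
    and p: "p \<in> bochner_L 2 T (\<V> \<Omega>) (V_norm \<Omega>)" "p \<in> cont_in_time T (\<H> \<Omega>) (H_norm \<Omega>)"
  shows "integrable (L\<^sub>T T) (\<lambda>t. B_op \<Omega> (w t) (w t) (p t))"
proof (rule integrable_bound_AE)
  show "integrable (L\<^sub>T T) (\<lambda>t. V_norm \<Omega> (w t) * (lad (w t) * lad (p t)))"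
    by (intro sqint_product sqint_V_norm lad_sum(3) w p)
  show "(\<lambda>t. B_op \<Omega> (w t) (w t) (p t)) \<in> borel_measurable (L\<^sub>T T)"
    by (rule strongly_measurable_apply2[where \<Phi> = "\<lambda>a b. B_op \<Omega> a a b", OF bochner_L_D(1,2)[OF w(1)] bochner_L_D(1,2)[OF p(1)]])
      (rule B_op_continuous)
  show "AE t in L\<^sub>T T. \<bar>B_op \<Omega> (w t) (w t) (p t)\<bar> \<le> V_norm \<Omega> (w t) * (lad (w t) * lad (p t))"
    using bochner_L_D(2)[OF w(1)] bochner_L_D(2)[OF p(1)] by eventually_elim (rule B_op_bound)
qed

lemma initial_pairing_unique:
  assumes y: "y \<in> cont_in_time T (\<H> \<Omega>) (H_norm \<Omega>)" and T: "T > 0"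
    and lim: "\<forall>v\<in>\<V> \<Omega>. ((\<lambda>t. pairing \<Omega> (y t) v) \<longlongrightarrow> pairing \<Omega> u0 v) (at_right 0)" and v: "v \<in> \<V> \<Omega>"
  shows "pairing \<Omega> (y 0) v = pairing \<Omega> u0 v"
proof -
  have "continuous_on {0..T} (\<lambda>t. pairing \<Omega> (y t) v)"
    by (rule continuous_on_pairing[OF y cont_in_time_const[OF V_H[OF v]]])
  then have "((\<lambda>t. pairing \<Omega> (y t) v) \<longlongrightarrow> pairing \<Omega> (y 0) v) (at 0 within {0..T})"
    using T by (auto simp: continuous_on_def)
  then have "((\<lambda>t. pairing \<Omega> (y t) v) \<longlongrightarrow> pairing \<Omega> (y 0) v) (at_right 0)"
    using T by (simp add: at_within_Icc_at_right)
  then show ?thesis using lim v tendsto_unique[OF trivial_limit_at_right_real] by blast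
qed

lemma pairing_eq_0_if_V:
  assumes u: "u \<in> Lspace \<Omega> 2" and zero: "\<And>v. v \<in> \<V> \<Omega> \<Longrightarrow> pairing \<Omega> u v = 0" and h: "h \<in> \<H> \<Omega>"
  shows "pairing \<Omega> u h = 0"
proof -
  have "\<bar>pairing \<Omega> u h\<bar> \<le> e" if e: "e > 0" for e
  proof -
    have e': "e / (Lnorm \<Omega> 2 u + 1) > 0" using e Lnorm_nonneg[of \<Omega> 2 u] by simp
    obtain \<phi> where \<phi>: "\<phi> \<in> div_free_tests \<Omega>" "H_norm \<Omega> (\<lambda>x. h x - \<phi> x) < e / (Lnorm \<Omega> 2 u + 1)"
      using closure_inD[OF h[unfolded \<H>_def] e'] by blast
    have \<phi>L: "\<phi> \<in> Lspace \<Omega> 2" by (rule div_free_tests_Lspace[OF \<phi>(1)])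
    have "pairing \<Omega> u h = pairing \<Omega> u (\<lambda>x. h x - \<phi> x)"
      using pairing_diff_right[OF H_Lspace[OF h] \<phi>L u] zero[of \<phi>] \<phi>(1) div_free_tests_V by auto
    also have "\<bar>\<dots>\<bar> \<le> Lnorm \<Omega> 2 u * H_norm \<Omega> (\<lambda>x. h x - \<phi> x)"
      by (rule pairing_Cauchy_Schwarz[OF u Lspace2_diff[OF H_Lspace[OF h] \<phi>L]])
    also have "\<dots> \<le> Lnorm \<Omega> 2 u * (e / (Lnorm \<Omega> 2 u + 1))" using \<phi>(2) by (intro mult_left_mono Lnorm_nonneg) auto
    also have "\<dots> \<le> e" using e Lnorm_nonneg[of \<Omega> 2 u] by (simp add: field_simps)
    finally show ?thesis .
  qed
  then have "\<bar>pairing \<Omega> u h\<bar> \<le> 0" using dense_ge[of 0 "\<bar>pairing \<Omega> u h\<bar>"] by blast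
  then show ?thesis by simp
qed


lemma H_norm_diff_expand:
  assumes "z \<in> Lspace \<Omega> 2" "u \<in> Lspace \<Omega> 2" "d \<in> Lspace \<Omega> 2"
  shows "H_norm \<Omega> (\<lambda>x. z x - d x) ^ 2 = H_norm \<Omega> (\<lambda>x. u x - d x) ^ 2
    + 2 * pairing \<Omega> (\<lambda>x. u x - d x) (\<lambda>x. z x - u x) + H_norm \<Omega> (\<lambda>x. z x - u x) ^ 2"
proof -
  have "(\<lambda>x. z x - d x) = (\<lambda>x. (u x - d x) + (z x - u x))" by auto
  then show ?thesis using Lnorm2_add_square[OF Lspace2_diff[OF assms(2,3)] Lspace2_diff[OF assms(1,2)]] by metis
qed

lemma V_norm_expand:
  assumes "z \<in> \<V> \<Omega>" "u \<in> \<V> \<Omega>"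
  shows "V_norm \<Omega> z ^ 2 = V_norm \<Omega> u ^ 2 + 2 * A_op \<Omega> u (\<lambda>x. z x - u x) + V_norm \<Omega> (\<lambda>x. z x - u x) ^ 2"
proof -
  have "A_op \<Omega> u (\<lambda>x. z x - u x) = A_op \<Omega> z u - A_op \<Omega> u u"
    using A_op_diff[OF assms assms(2)] A_op_commute[of u "\<lambda>x. z x - u x"] by simp
  moreover have "A_op \<Omega> u u = V_norm \<Omega> u ^ 2" by (simp add: V_norm_def A_op_def pairing_self)
  ultimately show ?thesis using V_norm_diff_square[OF assms] by simp
qed

lemma sufficient_optimality:
  fixes D :: "'u::{real_inner,polish_space} \<Rightarrow> functional"
  assumes T: "T > 0" and pos: "\<mu> > 0" "\<alpha> > 0" "\<beta> > 0"
    and D: "control_operator \<Omega> D"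
    and ud: "u\<^sub>d \<in> bochner_L 2 T (\<H> \<Omega>) (H_norm \<Omega>)"
    and uf: "u\<^sub>f \<in> \<H> \<Omega>"
    and feasible: "(us, Us) \<in> admissible \<Omega> T \<mu> \<alpha> \<beta> D u0 f"
    and adjoint: "adjoint_solution \<Omega> T \<mu> \<alpha> \<beta> u\<^sub>d u\<^sub>f us p"
    and first_order: "AE t in L\<^sub>T T. Us t = - control_adj D (p t)"
    and second_order:
      "\<And>u U. (u, U) \<in> admissible_differences (admissible \<Omega> T \<mu> \<alpha> \<beta> D u0 f) us Us \<Longrightarrow>
         1/2 * (LINT t|L\<^sub>T T. H_norm \<Omega> (u t) ^ 2 + Lnorm \<Omega> 2 (grad \<Omega> (u t)) ^ 2 + (norm (U t))\<^sup>2)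
         + 1/2 * H_norm \<Omega> (u T) ^ 2
         - (LINT t|L\<^sub>T T. B_op \<Omega> (u t) (u t) (p t))
         - \<beta> * (LINT t|L\<^sub>T T. pairing \<Omega> (\<lambda>x. (2 * (us t x \<bullet> u t x)) *\<^sub>R u t x
                            + (norm (u t x))\<^sup>2 *\<^sub>R (u t x + us t x)) (p t)) \<ge> 0"
    and zW: "(z, W) \<in> admissible \<Omega> T \<mu> \<alpha> \<beta> D u0 f"
  shows "cost \<Omega> T u\<^sub>d u\<^sub>f us Us \<le> cost \<Omega> T u\<^sub>d u\<^sub>f z W"
proof -
  have Us: "Us \<in> controls_L2 T" and W: "W \<in> controls_L2 T"
    and uC: "us \<in> cont_in_time T (\<H> \<Omega>) (H_norm \<Omega>)" and zC: "z \<in> cont_in_time T (\<H> \<Omega>) (H_norm \<Omega>)"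
    and wu: "weak_solution \<Omega> T \<mu> \<alpha> \<beta> D u0 f Us us" and wz: "weak_solution \<Omega> T \<mu> \<alpha> \<beta> D u0 f W z"
    using feasible zW by (auto simp: admissible_def)
  have ui: "us \<in> bochner_Linf T (\<H> \<Omega>) (H_norm \<Omega>)" and zi: "z \<in> bochner_Linf T (\<H> \<Omega>) (H_norm \<Omega>)"
    and uV: "us \<in> bochner_L 2 T (\<V> \<Omega>) (V_norm \<Omega>)" and zV: "z \<in> bochner_L 2 T (\<V> \<Omega>) (V_norm \<Omega>)"
    and u_init: "\<forall>v\<in>\<V> \<Omega>. ((\<lambda>t. pairing \<Omega> (us t) v) \<longlongrightarrow> pairing \<Omega> u0 v) (at_right 0)"
    and z_init: "\<forall>v\<in>\<V> \<Omega>. ((\<lambda>t. pairing \<Omega> (z t) v) \<longlongrightarrow> pairing \<Omega> u0 v) (at_right 0)"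
    using wu wz unfolding weak_solution_def by blast+
  obtain gu where gu: "gu \<in> bochner_L (4/3) T (V_dual \<Omega>) (V_dual_norm \<Omega>)" "is_time_deriv \<Omega> T us gu"
    and gu_eq: "AE t in L\<^sub>T T. \<forall>v\<in>\<V> \<Omega>. gu t v + \<mu> * A_op \<Omega> (us t) v + B_op \<Omega> (us t) (us t) v
             + \<alpha> * pairing \<Omega> (us t) v + \<beta> * pairing \<Omega> (C_op \<Omega> (us t)) v = f t v + D (Us t) v"
    using wu unfolding weak_solution_def by blast
  obtain gz where gz: "gz \<in> bochner_L (4/3) T (V_dual \<Omega>) (V_dual_norm \<Omega>)" "is_time_deriv \<Omega> T z gz"
    and gz_eq: "AE t in L\<^sub>T T. \<forall>v\<in>\<V> \<Omega>. gz t v + \<mu> * A_op \<Omega> (z t) v + B_op \<Omega> (z t) (z t) v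
             + \<alpha> * pairing \<Omega> (z t) v + \<beta> * pairing \<Omega> (C_op \<Omega> (z t)) v = f t v + D (W t) v"
    using wz unfolding weak_solution_def by blast
  have pC: "p \<in> cont_in_time T (\<H> \<Omega>) (H_norm \<Omega>)" and pV: "p \<in> bochner_L 2 T (\<V> \<Omega>) (V_norm \<Omega>)"
    and pT: "AE x in L\<Omega>. p T x = us T x - u\<^sub>f x"
    using adjoint unfolding adjoint_solution_def by blast+
  obtain gp where gp: "gp \<in> bochner_L (4/3) T (V_dual \<Omega>) (V_dual_norm \<Omega>)" "is_time_deriv \<Omega> T p gp"
    and gp_eq: "AE t in L\<^sub>T T. \<forall>q\<in>\<V> \<Omega>. - gp t q + \<mu> * A_op \<Omega> (p t) q + B'_adj \<Omega> (us t) (p t) q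
             + \<alpha> * pairing \<Omega> (p t) q + \<beta> * pairing \<Omega> (C'_op \<Omega> (us t) (p t)) q
           = pairing \<Omega> (\<lambda>x. us t x - u\<^sub>d t x) q + A_op \<Omega> (us t) q"
    using adjoint unfolding adjoint_solution_def by blast
  define w where "w = (\<lambda>t x. z t x - us t x)"
  define \<delta> where "\<delta> = (\<lambda>t. W t - Us t)"
  define gw where "gw = (\<lambda>t v. gz t v - gu t v)"
  have w_eq: "w t = (\<lambda>x. z t x - us t x)" for t by (simp add: w_def)
  have wC: "w \<in> cont_in_time T (\<H> \<Omega>) (H_norm \<Omega>)" unfolding w_def by (rule cont_in_time_diff[OF zC uC])
  have wV: "w \<in> bochner_L 2 T (\<V> \<Omega>) (V_norm \<Omega>)" unfolding w_def by (rule bochner_V_diff[OF zV uV])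
  have gw: "gw \<in> bochner_L (4/3) T (V_dual \<Omega>) (V_dual_norm \<Omega>)" "is_time_deriv \<Omega> T w gw" "dual_bound T gw"
    unfolding gw_def w_def
    by (rule bochner_V_dual_diff[OF gz(1) gu(1)], rule time_deriv_diff[OF zC gz(2,1) uC gu(2,1)],
        rule state_difference_dual_bound[OF D pos uV uC zV zC Us W gu_eq gz_eq])
  have udL: "AE t in L\<^sub>T T. u\<^sub>d t \<in> \<H> \<Omega>" by (rule bochner_L_D(2)[OF ud])
  have sq_ud: "sqint T (\<lambda>t. H_norm \<Omega> (\<lambda>x. us t x - u\<^sub>d t x))" "sqint T (\<lambda>t. H_norm \<Omega> (\<lambda>x. z t x - u\<^sub>d t x))"
    by (rule sqint_H_norm_diff[OF ui uC ud], rule sqint_H_norm_diff[OF zi zC ud])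
  have gp_bound: "dual_bound T gp" by (rule adjoint_dual_bound[OF pos uV uC pV pC sq_ud(1) udL gp_eq])
  define Pt where "Pt t = pairing \<Omega> (\<lambda>x. us t x - u\<^sub>d t x) (w t)" for t
  define At where "At t = A_op \<Omega> (us t) (w t)" for t
  define Ut where "Ut t = Us t \<bullet> \<delta> t" for t
  define Bt where "Bt t = B_op \<Omega> (w t) (w t) (p t)" for t
  define Qt where "Qt t = pairing \<Omega> (\<lambda>x. (2 * (us t x \<bullet> w t x)) *\<^sub>R w t x + (norm (w t x))\<^sup>2 *\<^sub>R (w t x + us t x)) (p t)" for t
  define Ft where "Ft t = gw t (p t) + gp t (w t)" for t
  have key: "AE t in L\<^sub>T T. (- Ft t - Ut t - Pt t - At t - Bt t) / \<beta> = Qt t"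
    using gu_eq gz_eq gp_eq first_order bochner_L_D(2)[OF uV] bochner_L_D(2)[OF zV] bochner_L_D(2)[OF pV]
  proof eventually_elim
    case (elim t)
    note V = elim(5,6,7)
    have wtV: "w t \<in> \<V> \<Omega>" unfolding w_eq by (rule V_diff[OF V(2,1)])
    have "D (W t) (p t) - D (Us t) (p t) = - Ut t"
      using control_operator_diff[OF D V(3), of "W t" "Us t"] control_adj_inner[OF D V(3), of "\<delta> t"] elim(4)
      by (simp add: Ut_def \<delta>_def)
    moreover have "A_op \<Omega> (z t) (p t) - A_op \<Omega> (us t) (p t) = A_op \<Omega> (p t) (w t)"
      using A_op_diff[OF V(2,1,3)] A_op_commute[of "p t" "w t"] by (simp add: w_eq)
    moreover have "pairing \<Omega> (z t) (p t) - pairing \<Omega> (us t) (p t) = pairing \<Omega> (p t) (w t)"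
      using pairing_diff_left[OF V_Lspace[OF V(2)] V_Lspace[OF V(1)] V_Lspace[OF V(3)]] pairing_commute[of \<Omega> "p t" "w t"]
      by (simp add: w_eq)
    moreover have "B_op \<Omega> (z t) (z t) (p t) - B_op \<Omega> (us t) (us t) (p t) = B'_adj \<Omega> (us t) (p t) (w t) + Bt t"
      unfolding Bt_def by (rule B_op_expansion[OF V w_eq])
    moreover have "pairing \<Omega> (C_op \<Omega> (z t)) (p t) - pairing \<Omega> (C_op \<Omega> (us t)) (p t) = pairing \<Omega> (C'_op \<Omega> (us t) (p t)) (w t) + Qt t"
      unfolding Qt_def by (rule C_op_expansion[OF V w_eq])
    moreover have "gz t (p t) - gu t (p t) = (D (W t) (p t) - D (Us t) (p t)) - \<mu> * (A_op \<Omega> (z t) (p t) - A_op \<Omega> (us t) (p t))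
        - (B_op \<Omega> (z t) (z t) (p t) - B_op \<Omega> (us t) (us t) (p t)) - \<alpha> * (pairing \<Omega> (z t) (p t) - pairing \<Omega> (us t) (p t))
        - \<beta> * (pairing \<Omega> (C_op \<Omega> (z t)) (p t) - pairing \<Omega> (C_op \<Omega> (us t)) (p t))"
      using elim(1)[rule_format, OF V(3)] elim(2)[rule_format, OF V(3)] by (simp add: algebra_simps)
    moreover have "gp t (w t) = \<mu> * A_op \<Omega> (p t) (w t) + B'_adj \<Omega> (us t) (p t) (w t) + \<alpha> * pairing \<Omega> (p t) (w t)
        + \<beta> * pairing \<Omega> (C'_op \<Omega> (us t) (p t)) (w t) - Pt t - At t"
      using elim(3)[rule_format, OF wtV] by (simp add: Pt_def At_def)
    ultimately have "Ft t = - Ut t - Pt t - At t - Bt t - \<beta> * Qt t"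
      by (simp add: Ft_def gw_def distrib_left)
    then show ?case using pos by (simp add: field_simps)
  qed
  have I: "AE t in L\<^sub>T T. t \<in> {0..T}" by (rule AE_I2) simp
  have iF: "integrable (L\<^sub>T T) Ft" unfolding Ft_def
    by (intro Bochner_Integration.integrable_add dual_pairing_integrable[OF gw(1,3) pV pC] dual_pairing_integrable[OF gp(1) gp_bound wV wC])
  have iB: "integrable (L\<^sub>T T) Bt" unfolding Bt_def by (rule B_op_time_integrable[OF wV wC pV pC])
  have Hz: "integrable (L\<^sub>T T) (\<lambda>t. H_norm \<Omega> (\<lambda>x. z t x - u\<^sub>d t x) ^ 2)"
    and Hu: "integrable (L\<^sub>T T) (\<lambda>t. H_norm \<Omega> (\<lambda>x. us t x - u\<^sub>d t x) ^ 2)"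
    and Hw: "integrable (L\<^sub>T T) (\<lambda>t. H_norm \<Omega> (w t) ^ 2)"
    using sq_ud sqint_H_norm[OF wC] by (auto simp: sqint_def)
  have Vz: "integrable (L\<^sub>T T) (\<lambda>t. V_norm \<Omega> (z t) ^ 2)" and Vu: "integrable (L\<^sub>T T) (\<lambda>t. V_norm \<Omega> (us t) ^ 2)"
    and Vw: "integrable (L\<^sub>T T) (\<lambda>t. V_norm \<Omega> (w t) ^ 2)"
    using sqint_V_norm[OF zV] sqint_V_norm[OF uV] sqint_V_norm[OF wV] by (auto simp: sqint_def)
  have Nz: "integrable (L\<^sub>T T) (\<lambda>t. (norm (W t))\<^sup>2)" and Nu: "integrable (L\<^sub>T T) (\<lambda>t. (norm (Us t))\<^sup>2)"
    using W Us by (auto simp: controls_L2_def)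
  have Nw: "integrable (L\<^sub>T T) (\<lambda>t. (norm (\<delta> t))\<^sup>2)"
  proof -
    have "sqint T (\<lambda>t. norm (\<delta> t))"
    proof (rule sqint_bound[OF sqint_add[OF controls_sqint[OF W] controls_sqint[OF Us]]])
      have "W \<in> borel_measurable (L\<^sub>T T)" "Us \<in> borel_measurable (L\<^sub>T T)" using W Us by (auto simp: controls_L2_def)
      then show "(\<lambda>t. norm (\<delta> t)) \<in> borel_measurable (L\<^sub>T T)" unfolding \<delta>_def by measurable
    qed (simp add: \<delta>_def norm_triangle_ineq4)
    then show ?thesis by (simp add: sqint_def)
  qed
  have eP: "AE t in L\<^sub>T T. (H_norm \<Omega> (\<lambda>x. z t x - u\<^sub>d t x) ^ 2 - H_norm \<Omega> (\<lambda>x. us t x - u\<^sub>d t x) ^ 2 - H_norm \<Omega> (w t) ^ 2) / 2 = Pt t"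
    using I udL
  proof eventually_elim
    case (elim t)
    then show ?case
      using H_norm_diff_expand[OF cont_in_time_Lspace[OF zC elim(1)] cont_in_time_Lspace[OF uC elim(1)] H_Lspace[OF elim(2)]]
      by (simp add: Pt_def w_eq)
  qed
  have eA: "AE t in L\<^sub>T T. (V_norm \<Omega> (z t) ^ 2 - V_norm \<Omega> (us t) ^ 2 - V_norm \<Omega> (w t) ^ 2) / 2 = At t"
    using bochner_L_D(2)[OF zV] bochner_L_D(2)[OF uV]
  proof eventually_elim
    case (elim t)
    then show ?case using V_norm_expand[OF elim] by (simp add: At_def w_eq)
  qed
  have eU: "AE t in L\<^sub>T T. ((norm (W t))\<^sup>2 - (norm (Us t))\<^sup>2 - (norm (\<delta> t))\<^sup>2) / 2 = Ut t"
    by (rule AE_I2) (simp add: Ut_def \<delta>_def power2_norm_eq_inner inner_diff_left inner_diff_right inner_commute)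
  have "integrable (L\<^sub>T T) (\<lambda>t. (H_norm \<Omega> (\<lambda>x. z t x - u\<^sub>d t x) ^ 2 - H_norm \<Omega> (\<lambda>x. us t x - u\<^sub>d t x) ^ 2 - H_norm \<Omega> (w t) ^ 2) / 2)"
    using Hz Hu Hw by auto
  from integrable_AE_eq[OF this eP] have iP: "integrable (L\<^sub>T T) Pt"
    and sP: "(LINT t|L\<^sub>T T. Pt t) = ((LINT t|L\<^sub>T T. H_norm \<Omega> (\<lambda>x. z t x - u\<^sub>d t x) ^ 2)
      - (LINT t|L\<^sub>T T. H_norm \<Omega> (\<lambda>x. us t x - u\<^sub>d t x) ^ 2) - (LINT t|L\<^sub>T T. H_norm \<Omega> (w t) ^ 2)) / 2"
    using Hz Hu Hw by simp_all
  have "integrable (L\<^sub>T T) (\<lambda>t. (V_norm \<Omega> (z t) ^ 2 - V_norm \<Omega> (us t) ^ 2 - V_norm \<Omega> (w t) ^ 2) / 2)"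
    using Vz Vu Vw by auto
  from integrable_AE_eq[OF this eA] have iA: "integrable (L\<^sub>T T) At"
    and sA: "(LINT t|L\<^sub>T T. At t) = ((LINT t|L\<^sub>T T. V_norm \<Omega> (z t) ^ 2)
      - (LINT t|L\<^sub>T T. V_norm \<Omega> (us t) ^ 2) - (LINT t|L\<^sub>T T. V_norm \<Omega> (w t) ^ 2)) / 2"
    using Vz Vu Vw by simp_all
  have "integrable (L\<^sub>T T) (\<lambda>t. ((norm (W t))\<^sup>2 - (norm (Us t))\<^sup>2 - (norm (\<delta> t))\<^sup>2) / 2)"
    using Nz Nu Nw by auto
  from integrable_AE_eq[OF this eU] have iU: "integrable (L\<^sub>T T) Ut"
    and sU: "(LINT t|L\<^sub>T T. Ut t) = ((LINT t|L\<^sub>T T. (norm (W t))\<^sup>2)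
      - (LINT t|L\<^sub>T T. (norm (Us t))\<^sup>2) - (LINT t|L\<^sub>T T. (norm (\<delta> t))\<^sup>2)) / 2"
    using Nz Nu Nw by simp_all
  have "integrable (L\<^sub>T T) (\<lambda>t. (- Ft t - Ut t - Pt t - At t - Bt t) / \<beta>)"
    using iF iU iP iA iB by auto
  from integrable_AE_eq(2)[OF this key]
  have sQ: "\<beta> * (LINT t|L\<^sub>T T. Qt t) = - (LINT t|L\<^sub>T T. Ft t) - (LINT t|L\<^sub>T T. Ut t) - (LINT t|L\<^sub>T T. Pt t)
      - (LINT t|L\<^sub>T T. At t) - (LINT t|L\<^sub>T T. Bt t)"
    using pos iF iU iP iA iB by (simp add: field_simps)
  have 0: "0 \<in> {0..T}" and TT: "T \<in> {0..T}" using T by auto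
  have init: "pairing \<Omega> (w 0) (p 0) = 0"
  proof (rule pairing_eq_0_if_V[OF cont_in_time_Lspace[OF wC 0] _ cont_in_time_H[OF pC 0]])
    fix v assume v: "v \<in> \<V> \<Omega>"
    show "pairing \<Omega> (w 0) v = 0"
      unfolding w_eq pairing_diff_left[OF cont_in_time_Lspace[OF zC 0] cont_in_time_Lspace[OF uC 0] V_Lspace[OF v]]
        initial_pairing_unique[OF zC T z_init v] initial_pairing_unique[OF uC T u_init v] by simp
  qed
  have sF: "(LINT t|L\<^sub>T T. Ft t) = pairing \<Omega> (w T) (p T)"
    using integration_by_parts[OF T wC wV pC pV gw gp gp_bound] init by (simp add: Ft_def)
  have final: "H_norm \<Omega> (\<lambda>x. z T x - u\<^sub>f x) ^ 2 = H_norm \<Omega> (\<lambda>x. us T x - u\<^sub>f x) ^ 2 + 2 * pairing \<Omega> (w T) (p T) + H_norm \<Omega> (w T) ^ 2"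
  proof -
    note L = cont_in_time_Lspace[OF zC TT] cont_in_time_Lspace[OF uC TT] H_Lspace[OF uf]
    have "pairing \<Omega> (w T) (p T) = pairing \<Omega> (w T) (\<lambda>x. us T x - u\<^sub>f x)"
      by (rule pairing_cong_AE)
        (use pT in \<open>auto intro: Lspace_measurable[OF cont_in_time_Lspace[OF wC TT]] Lspace_measurable[OF cont_in_time_Lspace[OF pC TT]]
          Lspace_measurable[OF Lspace2_diff[OF L(2,3)]]\<close>)
    then show ?thesis
      using H_norm_diff_expand[OF L] pairing_commute[of \<Omega> "w T" "\<lambda>x. us T x - u\<^sub>f x"] by (simp add: w_eq)
  qed
  have "(w, \<delta>) \<in> admissible_differences (admissible \<Omega> T \<mu> \<alpha> \<beta> D u0 f) us Us"
    using zW unfolding admissible_differences_def w_def \<delta>_def by blast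
  from second_order[OF this]
  have so: "1/2 * (LINT t|L\<^sub>T T. H_norm \<Omega> (w t) ^ 2 + V_norm \<Omega> (w t) ^ 2 + (norm (\<delta> t))\<^sup>2) + 1/2 * H_norm \<Omega> (w T) ^ 2
      - (LINT t|L\<^sub>T T. Bt t) - \<beta> * (LINT t|L\<^sub>T T. Qt t) \<ge> 0"
    by (simp add: Bt_def Qt_def V_norm_def)
  have "(LINT t|L\<^sub>T T. H_norm \<Omega> (w t) ^ 2 + V_norm \<Omega> (w t) ^ 2 + (norm (\<delta> t))\<^sup>2)
      = (LINT t|L\<^sub>T T. H_norm \<Omega> (w t) ^ 2) + (LINT t|L\<^sub>T T. V_norm \<Omega> (w t) ^ 2) + (LINT t|L\<^sub>T T. (norm (\<delta> t))\<^sup>2)"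
    using Hw Vw Nw by simp
  with so have so': "1/2 * ((LINT t|L\<^sub>T T. H_norm \<Omega> (w t) ^ 2) + (LINT t|L\<^sub>T T. V_norm \<Omega> (w t) ^ 2) + (LINT t|L\<^sub>T T. (norm (\<delta> t))\<^sup>2))
      + 1/2 * H_norm \<Omega> (w T) ^ 2 - (LINT t|L\<^sub>T T. Bt t) - \<beta> * (LINT t|L\<^sub>T T. Qt t) \<ge> 0" by simp
  have cost: "cost \<Omega> T u\<^sub>d u\<^sub>f y Y = 1/2 * (LINT t|L\<^sub>T T. H_norm \<Omega> (\<lambda>x. y t x - u\<^sub>d t x) ^ 2) + 1/2 * (LINT t|L\<^sub>T T. V_norm \<Omega> (y t) ^ 2)
      + 1/2 * (LINT t|L\<^sub>T T. (norm (Y t))\<^sup>2) + 1/2 * H_norm \<Omega> (\<lambda>x. y T x - u\<^sub>f x) ^ 2" for y and Y :: "real \<Rightarrow> 'u"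
    by (simp add: cost_def V_norm_def control_cost_def)
  show ?thesis
    using so' sQ sF sP sA sU final unfolding cost by argo
qed

end

theorem theorem5p3:
  fixes \<Omega> :: "(real^2) set"
    and T \<mu> \<alpha> \<beta> :: real
    and D :: "'u::{real_inner,polish_space} \<Rightarrow> functional"
    and u0 u\<^sub>f :: field
    and f :: "real \<Rightarrow> functional"
    and u\<^sub>d us p :: "real \<Rightarrow> field"
    and Us :: "real \<Rightarrow> 'u"
  assumes domain: "smooth_bounded_domain \<Omega>"
    and pos: "T > 0" "\<mu> > 0" "\<alpha> > 0" "\<beta> > 0"
    and control_op: "control_operator \<Omega> D"
    and u0: "u0 \<in> \<H> \<Omega>"
    and f: "f \<in> bochner_L 2 T (V_dual \<Omega>) (V_dual_norm \<Omega>)"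
    and ud: "u\<^sub>d \<in> bochner_L 2 T (\<H> \<Omega>) (H_norm \<Omega>)"
    and uf: "u\<^sub>f \<in> \<H> \<Omega>"
    and feasible: "(us, Us) \<in> admissible \<Omega> T \<mu> \<alpha> \<beta> D u0 f"
    and adjoint: "adjoint_solution \<Omega> T \<mu> \<alpha> \<beta> u\<^sub>d u\<^sub>f us p"
    and first_order: "AE t in lebesgue_on {0..T}. Us t = - control_adj D (p t)"
    and second_order:
      "\<And>u U. (u, U) \<in> admissible_differences (admissible \<Omega> T \<mu> \<alpha> \<beta> D u0 f) us Us \<Longrightarrow>
         1/2 * (LINT t|lebesgue_on {0..T}.
             H_norm \<Omega> (u t) ^ 2 + Lnorm \<Omega> 2 (grad \<Omega> (u t)) ^ 2 + (norm (U t))\<^sup>2)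
         + 1/2 * H_norm \<Omega> (u T) ^ 2
         - (LINT t|lebesgue_on {0..T}. B_op \<Omega> (u t) (u t) (p t))
         - \<beta> * (LINT t|lebesgue_on {0..T}.
             pairing \<Omega> (\<lambda>x. (2 * (us t x \<bullet> u t x)) *\<^sub>R u t x
                            + (norm (u t x))\<^sup>2 *\<^sub>R (u t x + us t x)) (p t))
         \<ge> 0"
  shows "optimal_pair (admissible \<Omega> T \<mu> \<alpha> \<beta> D u0 f) (cost \<Omega> T u\<^sub>d u\<^sub>f) us Us"
proof -
  interpret planar_domain \<Omega>
    by unfold_locales (use domain in \<open>simp_all add: smooth_bounded_domain_def\<close>)
  have "cost \<Omega> T u\<^sub>d u\<^sub>f us Us \<le> cost \<Omega> T u\<^sub>d u\<^sub>f z W" if "(z, W) \<in> admissible \<Omega> T \<mu> \<alpha> \<beta> D u0 f" for z W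
    by (rule sufficient_optimality[OF pos control_op ud uf feasible adjoint first_order second_order that])
  with feasible show ?thesis by (auto simp: optimal_pair_def)
qed

end
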